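(* Let $M=S^{n_1}\times\cdots\times S^{n_k}\times\mathbf R^l$ be a Riemannian product of round spheres and Euclidean space, or let $M$ be the base of a Riemannian submersion whose total space is such a product. Equip $M$ with the cost $c=\tfrac12\operatorname{dist}^2$ and let $h$ be the induced pseudo-Riemannian metric on $N=M\times M\setminus\text{cut-locus}$. Then: (i) $M$ is non-negatively cross-curved: $\operatorname{cross}_{(x,\bar x)}(p,\bar p)\ge0$ for all $(x,\bar x)\in N$ and all $p\oplus\bar p\in T_{(x,\bar x)}N$. (ii) For each $h$-geodesic of the form $t\in[0,1]\mapsto(x,\bar x(t))\in N$ and each $y\in M$, the function $f_t(y):=-c(y,\bar x(t))+c(x,\bar x(t))$ satisfies $$f_t(y)\le(1-t)f_0(y)+tf_1(y)\qquad\text{for }0\le t\le1,$$ and hence $f_t(y)\le\max\{f_0(y),f_1(y)\}$ for $0\le t\le1$.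
   Context: Here $\text{cut-locus}$ denotes the set of pairs $(x,\bar x)$ with $\bar x$ in the cut locus of $x$; $c$ is smooth on the open set $N$. $D$, $\bar D$ denote differentials in the first and second variable. The pseudo-Riemannian metric on $N$ is $$h=\begin{pmatrix}0&-\frac12\bar DDc\\-\frac12 D\bar Dc&0\end{pmatrix},\qquad\text{i.e. } h(p\oplus\bar p,p\oplus\bar p)=-c_{i\bar j}\,p^i\bar p^{\bar j},$$ with subscripts denoting partial derivatives in local coordinates $x^i$ (first variable) and $x^{\bar j}$ (second variable). The cross-curvature is $\operatorname{cross}_{(x,\bar x)}(p,\bar p)=R_h((p\oplus0)\wedge(0\oplus\bar p),(p\oplus0)\wedge(0\oplus\bar p))$, with $R_h$ the Riemann curvature operator of $h$, with sign and normalization such that $$\operatorname{cross}_{(x,\bar x)}(p,\bar p)=2\left(-c_{ij\bar k\bar l}+c_{ij\bar a}\,c^{\bar a b}\,c_{b\bar k\bar l}\right)p^ip^j\bar p^{\bar k}\bar p^{\bar l},$$ $(c^{\bar a b})$ being the inverse of $(c_{b\bar a})$. For this cost, the $h$-geodesics $(x,\bar x(t))$ in $N$ with fixed first coordinate are the curves $\bar x(t)=\exp_x(p+tq)$ with $p,q\in T_xM$ and $p+tq$ in the open region of $T_xM$ bounded by the tangential cut locus. A Riemannian submersion is a surjective smooth map $\pi:\tilde M\to M$ such that each $d\pi_x$ is surjective and restricts to an isometry from $(\ker d\pi_x)^\perp$ onto $T_{\pi(x)}M$. *)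

theory Defs
  imports "HOL-Analysis.Analysis"
begin

section \<open>Calculus on open subsets of Euclidean spaces\<close>

primrec C_k_on :: "nat \<Rightarrow> 'a::euclidean_space set \<Rightarrow> ('a \<Rightarrow> 'b::real_normed_vector) \<Rightarrow> bool" where
  "C_k_on 0 S f \<longleftrightarrow> continuous_on S f"
| "C_k_on (Suc k) S f \<longleftrightarrow>
     f differentiable_on S \<and> (\<forall>v. C_k_on k S (\<lambda>z. frechet_derivative f (at z) v))"

text \<open>Only meant for open \<open>S\<close>.\<close>
definition smooth_on :: "'a::euclidean_space set \<Rightarrow> ('a \<Rightarrow> 'b::real_normed_vector) \<Rightarrow> bool" where
  "smooth_on S f \<longleftrightarrow> (\<forall>k. C_k_on k S f)"

section \<open>Pseudo-Riemannian metrics in coordinates\<close>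

text \<open>A (possibly indefinite) metric tensor in a coordinate domain is a function \<open>G\<close> with
  \<open>G z u v\<close> the value at the point \<open>z\<close> on the vectors \<open>u\<close>, \<open>v\<close>. The vector
  \<open>christoffel G z u v\<close> is \<open>\<Gamma>(u,v)\<close> at \<open>z\<close>; it is well defined where \<open>G\<close> is differentiable
  and nondegenerate.\<close>

type_synonym 'v tensor_field = "'v \<Rightarrow> 'v \<Rightarrow> 'v \<Rightarrow> real"

definition christoffel :: "'v::euclidean_space tensor_field \<Rightarrow> 'v \<Rightarrow> 'v \<Rightarrow> 'v \<Rightarrow> 'v" where
  "christoffel G z u v = (THE w. \<forall>y. G z w y =
     (frechet_derivative (\<lambda>z'. G z' v y) (at z) u
    + frechet_derivative (\<lambda>z'. G z' u y) (at z) v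
    - frechet_derivative (\<lambda>z'. G z' u v) (at z) y) / 2)"

text \<open>The curvature tensor \<open>R(u,v)w = \<nabla>\<^sub>u\<nabla>\<^sub>v w - \<nabla>\<^sub>v\<nabla>\<^sub>u w\<close> for constant coordinate fields.\<close>
definition curvature_tensor ::
  "'v::euclidean_space tensor_field \<Rightarrow> 'v \<Rightarrow> 'v \<Rightarrow> 'v \<Rightarrow> 'v \<Rightarrow> 'v" where
  "curvature_tensor G z u v w =
     frechet_derivative (\<lambda>z'. christoffel G z' v w) (at z) u
   - frechet_derivative (\<lambda>z'. christoffel G z' u w) (at z) v
   + christoffel G z u (christoffel G z v w)
   - christoffel G z v (christoffel G z u w)"

definition wedge :: "'v::euclidean_space \<Rightarrow> 'v \<Rightarrow> 'v \<Rightarrow> 'v \<Rightarrow> real" where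
  "wedge P Q a b = (P \<bullet> a) * (Q \<bullet> b) - (P \<bullet> b) * (Q \<bullet> a)"

text \<open>The curvature operator on bivectors, as the full contraction
  \<open>R\<^sub>a\<^sub>b\<^sub>c\<^sub>d \<omega>\<^sup>a\<^sup>b \<eta>\<^sup>c\<^sup>d\<close>, with the sign for which \<open>R\<^sub>a\<^sub>b\<^sub>a\<^sub>b\<close> is positive on round spheres.
  Since \<open>P \<and> Q = P \<otimes> Q - Q \<otimes> P\<close>, its value on \<open>(P \<and> Q, P \<and> Q)\<close> is four times
  \<open>G(R(P,Q)Q, P)\<close>. For the metric \<open>h\<close> of a cost below, this is the normalization in which
  the cross-curvature equals
  \<open>2 (- c\<^sub>i\<^sub>j\<^sub>k\<^sub>l + c\<^sub>i\<^sub>j\<^sub>a c\<^sup>a\<^sup>b c\<^sub>b\<^sub>k\<^sub>l) p\<^sup>i p\<^sup>j q\<^sup>k q\<^sup>l\<close>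
  (\<open>i, j, b\<close> referring to the first variable of \<open>c\<close>, \<open>k, l, a\<close> to the second).\<close>
definition curvature_operator ::
  "'v::euclidean_space tensor_field \<Rightarrow> 'v \<Rightarrow> ('v \<Rightarrow> 'v \<Rightarrow> real) \<Rightarrow> ('v \<Rightarrow> 'v \<Rightarrow> real) \<Rightarrow> real" where
  "curvature_operator G z \<omega> \<eta> =
     (\<Sum>a\<in>Basis. \<Sum>b\<in>Basis. \<Sum>c\<in>Basis. \<Sum>d\<in>Basis.
        G z (curvature_tensor G z a b d) c * \<omega> a b * \<eta> c d)"

text \<open>The curve \<open>\<xi>\<close>, defined on the interval \<open>J\<close>, is twice differentiable at the time \<open>t\<close> and
  satisfies \<open>\<xi>'' + \<Gamma>(\<xi>', \<xi>') = 0\<close> there (one-sided derivatives at endpoints of \<open>J\<close>).\<close>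
definition geodesic_equation_at ::
  "'v::euclidean_space tensor_field \<Rightarrow> real set \<Rightarrow> (real \<Rightarrow> 'v) \<Rightarrow> real \<Rightarrow> bool" where
  "geodesic_equation_at G J \<xi> t \<longleftrightarrow>
     (\<exists>w. (\<forall>\<^sub>F s in nhds t. s \<in> J \<longrightarrow> (\<xi> has_vector_derivative w s) (at s within J)) \<and>
          (w has_vector_derivative - christoffel G (\<xi> t) (w t) (w t)) (at t within J))"

section \<open>Riemannian manifolds\<close>

text \<open>A chart is a pair of its domain and its coordinate map (irrelevant outside the domain).
  The dimension of a manifold is that of the model space \<open>'e\<close>. A tensor on the manifold is
  given by its coordinate expressions in the charts of the atlas.\<close>

type_synonym ('m, 'e) chart = "'m set \<times> ('m \<Rightarrow> 'e)"

abbreviation chart_image :: "('m, 'e) chart \<Rightarrow> 'e set" where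
  "chart_image a \<equiv> snd a ` fst a"

abbreviation chart_inv :: "('m, 'e) chart \<Rightarrow> 'e \<Rightarrow> 'm" where
  "chart_inv a \<equiv> inv_into (fst a) (snd a)"

record ('m, 'e) riemannian =
  man_top :: "'m topology"
  atlas :: "('m, 'e) chart set"
  metric :: "('m, 'e) chart \<Rightarrow> 'e tensor_field"

definition smooth_manifold :: "('m, 'e::euclidean_space, 'z) riemannian_scheme \<Rightarrow> bool" where
  "smooth_manifold M \<longleftrightarrow>
     Hausdorff_space (man_top M) \<and> second_countable (man_top M) \<and>
     topspace (man_top M) = (\<Union>a\<in>atlas M. fst a) \<and>
     (\<forall>a\<in>atlas M. openin (man_top M) (fst a) \<and> open (chart_image a) \<and>
        homeomorphic_map (subtopology (man_top M) (fst a)) (top_of_set (chart_image a)) (snd a)) \<and>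
     (\<forall>a\<in>atlas M. \<forall>b\<in>atlas M. smooth_on (snd a ` (fst a \<inter> fst b)) (snd b \<circ> chart_inv a))"

definition riemannian_manifold :: "('m, 'e::euclidean_space, 'z) riemannian_scheme \<Rightarrow> bool" where
  "riemannian_manifold M \<longleftrightarrow> smooth_manifold M \<and>
     (\<forall>a\<in>atlas M.
        (\<forall>z\<in>chart_image a. bilinear (metric M a z) \<and>
           (\<forall>u v. metric M a z u v = metric M a z v u) \<and>
           (\<forall>u. u \<noteq> 0 \<longrightarrow> 0 < metric M a z u u)) \<and>
        (\<forall>u v. smooth_on (chart_image a) (\<lambda>z. metric M a z u v))) \<and>
     (\<forall>a\<in>atlas M. \<forall>b\<in>atlas M. \<forall>x\<in>fst a \<inter> fst b. \<forall>u v.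
        metric M a (snd a x) u v =
        metric M b (snd b x) (frechet_derivative (snd b \<circ> chart_inv a) (at (snd a x)) u)
                             (frechet_derivative (snd b \<circ> chart_inv a) (at (snd a x)) v))"

text \<open>The length of the velocity at time \<open>t\<close> of a curve on \<open>J\<close>; where the curve is
  differentiable, the choice of the chart is immaterial.\<close>
definition speed ::
  "('m, 'e::euclidean_space, 'z) riemannian_scheme \<Rightarrow> real set \<Rightarrow> (real \<Rightarrow> 'm) \<Rightarrow> real \<Rightarrow> real" where
  "speed M J \<gamma> t =
     (let a = (SOME a. a \<in> atlas M \<and> \<gamma> t \<in> fst a);
          v = vector_derivative (snd a \<circ> \<gamma>) (at t within J)
      in sqrt (metric M a (snd a (\<gamma> t)) v v))"

text \<open>The library's piecewise \<open>C\<^sup>1\<close> functions may have unbounded derivatives near the exceptional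
  points, so integrability of the speed has to be required.\<close>
definition rectifiable_curve ::
  "('m, 'e::euclidean_space, 'z) riemannian_scheme \<Rightarrow> (real \<Rightarrow> 'm) \<Rightarrow> bool" where
  "rectifiable_curve M \<gamma> \<longleftrightarrow>
     continuous_map (top_of_set {0..1}) (man_top M) \<gamma> \<and>
     (\<forall>a\<in>atlas M. \<forall>s t. 0 \<le> s \<and> s \<le> t \<and> t \<le> 1 \<and> \<gamma> ` {s..t} \<subseteq> fst a
        \<longrightarrow> (snd a \<circ> \<gamma>) piecewise_C1_differentiable_on {s..t}) \<and>
     speed M {0..1} \<gamma> integrable_on {0..1}"

definition riem_dist ::
  "('m, 'e::euclidean_space, 'z) riemannian_scheme \<Rightarrow> 'm \<Rightarrow> 'm \<Rightarrow> real" where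
  "riem_dist M x y =
     Inf {integral {0..1} (speed M {0..1} \<gamma>) | \<gamma>. rectifiable_curve M \<gamma> \<and> \<gamma> 0 = x \<and> \<gamma> 1 = y}"

definition unit_speed_geodesic_ray ::
  "('m, 'e::euclidean_space, 'z) riemannian_scheme \<Rightarrow> (real \<Rightarrow> 'm) \<Rightarrow> bool" where
  "unit_speed_geodesic_ray M \<gamma> \<longleftrightarrow>
     continuous_map (top_of_set {0..}) (man_top M) \<gamma> \<and>
     (\<forall>t\<ge>0. speed M {0..} \<gamma> t = 1 \<and>
        (\<forall>a\<in>atlas M. \<gamma> t \<in> fst a \<longrightarrow> geodesic_equation_at (metric M a) {0..} (snd a \<circ> \<gamma>) t))"

text \<open>The points where some geodesic issuing from \<open>x\<close> stops being minimizing. Rays defined on all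
  of \<open>{0..}\<close> suffice, as the manifolds of interest are complete.\<close>
definition cut_locus ::
  "('m, 'e::euclidean_space, 'z) riemannian_scheme \<Rightarrow> 'm \<Rightarrow> 'm set" where
  "cut_locus M x = {y. \<exists>\<gamma> T. unit_speed_geodesic_ray M \<gamma> \<and> \<gamma> 0 = x \<and> 0 < T \<and> \<gamma> T = y \<and>
     (\<forall>t\<in>{0..T}. riem_dist M x (\<gamma> t) = t) \<and> (\<forall>t>T. riem_dist M x (\<gamma> t) < t)}"

definition riemannian_submersion ::
  "('p, 'd::euclidean_space, 'y) riemannian_scheme \<Rightarrow> ('m, 'e::euclidean_space, 'z) riemannian_scheme
    \<Rightarrow> ('p \<Rightarrow> 'm) \<Rightarrow> bool" where
  "riemannian_submersion P M \<pi> \<longleftrightarrow>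
     continuous_map (man_top P) (man_top M) \<pi> \<and>
     \<pi> ` topspace (man_top P) = topspace (man_top M) \<and>
     (\<forall>a\<in>atlas P. \<forall>b\<in>atlas M.
        smooth_on (snd a ` {x\<in>fst a. \<pi> x \<in> fst b}) (snd b \<circ> \<pi> \<circ> chart_inv a) \<and>
        (\<forall>x\<in>fst a. \<pi> x \<in> fst b \<longrightarrow>
           (let D = frechet_derivative (snd b \<circ> \<pi> \<circ> chart_inv a) (at (snd a x));
                H = {u. \<forall>w. D w = 0 \<longrightarrow> metric P a (snd a x) u w = 0}
            in surj D \<and> bij_betw D H UNIV \<and>
               (\<forall>u\<in>H. \<forall>v\<in>H. metric M b (snd b (\<pi> x)) (D u) (D v) = metric P a (snd a x) u v))))"

section \<open>Products of round spheres and a Euclidean space\<close>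

text \<open>A smooth submanifold \<open>S\<close> of a Euclidean space, of dimension \<open>DIM('d)\<close>, with the induced
  metric and the atlas of all inverses of smooth parametrizations.\<close>
definition submanifold :: "'p::euclidean_space set \<Rightarrow> ('p, 'd::euclidean_space) riemannian" where
  "submanifold S =
     \<lparr> man_top = top_of_set S,
       atlas = {a. openin (top_of_set S) (fst a) \<and> open (chart_image a) \<and>
                   homeomorphism (fst a) (chart_image a) (snd a) (chart_inv a) \<and>
                   smooth_on (chart_image a) (chart_inv a) \<and>
                   (\<forall>z\<in>chart_image a. inj (frechet_derivative (chart_inv a) (at z)))},
       metric = (\<lambda>a z u v. frechet_derivative (chart_inv a) (at z) u
                         \<bullet> frechet_derivative (chart_inv a) (at z) v) \<rparr>"

text \<open>The coordinates of \<open>real ^ 'i\<close> are distributed into blocks by \<open>B\<close>. For \<open>j < k\<close>, the \<open>j\<close>-th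
  block ranges over the sphere of radius \<open>r j\<close>; the coordinates in all other blocks are free.
  As an orthogonal product, this set carries the Riemannian product metric.\<close>
definition spheres_times_euclidean ::
  "('i::finite \<Rightarrow> nat) \<Rightarrow> nat \<Rightarrow> (nat \<Rightarrow> real) \<Rightarrow> (real ^ 'i) set" where
  "spheres_times_euclidean B k r = {x. \<forall>j<k. (\<Sum>i | B i = j. (x $ i)\<^sup>2) = (r j)\<^sup>2}"

section \<open>The squared distance cost and its cross-curvature\<close>

definition cost :: "('m, 'e::euclidean_space, 'z) riemannian_scheme \<Rightarrow> 'm \<Rightarrow> 'm \<Rightarrow> real" where
  "cost M x y = (riem_dist M x y)\<^sup>2 / 2"

definition off_cut_locus :: "('m, 'e::euclidean_space, 'z) riemannian_scheme \<Rightarrow> ('m \<times> 'm) set" where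
  "off_cut_locus M =
     {(x, y). x \<in> topspace (man_top M) \<and> y \<in> topspace (man_top M) \<and> y \<notin> cut_locus M x}"

text \<open>The metric \<open>h\<close> in the coordinates given by a chart \<open>a\<close> for the first and a chart \<open>b\<close> for the
  second variable, obtained by polarization from
  \<open>h(p \<oplus> q, p \<oplus> q) = - c\<^sub>i\<^sub>j p\<^sup>i q\<^sup>j\<close>, with \<open>c\<^sub>i\<^sub>j\<close> the mixed second derivatives of the cost.\<close>
definition cost_metric ::
  "('m, 'e::euclidean_space, 'z) riemannian_scheme \<Rightarrow> ('m, 'e) chart \<Rightarrow> ('m, 'e) chart
    \<Rightarrow> ('e \<times> 'e) tensor_field" where
  "cost_metric M a b = (\<lambda>(z, z') (p, q) (p', q').
     let mixed = (\<lambda>u v. frechet_derivative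
           (\<lambda>w. frechet_derivative (\<lambda>w'. cost M (chart_inv a w) (chart_inv b w')) (at z') v) (at z) u)
     in - (mixed p q' + mixed p' q) / 2)"

text \<open>The tangent vectors are given by their coordinates \<open>p\<close> and \<open>q\<close> in the charts \<open>a\<close> and \<open>b\<close>.\<close>
definition cross_curvature ::
  "('m, 'e::euclidean_space, 'z) riemannian_scheme \<Rightarrow> ('m, 'e) chart \<Rightarrow> ('m, 'e) chart
    \<Rightarrow> 'm \<Rightarrow> 'm \<Rightarrow> 'e \<Rightarrow> 'e \<Rightarrow> real" where
  "cross_curvature M a b x y p q =
     curvature_operator (cost_metric M a b) (snd a x, snd b y)
       (wedge (p, 0) (0, q)) (wedge (p, 0) (0, q))"

definition nonneg_cross_curved :: "('m, 'e::euclidean_space, 'z) riemannian_scheme \<Rightarrow> bool" where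
  "nonneg_cross_curved M \<longleftrightarrow>
     (\<forall>(x, y)\<in>off_cut_locus M. \<forall>a\<in>atlas M. \<forall>b\<in>atlas M. x \<in> fst a \<and> y \<in> fst b \<longrightarrow>
        (\<forall>p q. 0 \<le> cross_curvature M a b x y p q))"

text \<open>The curve \<open>t \<mapsto> (x, \<eta> t)\<close> on \<open>{0..1}\<close> is a geodesic of \<open>h\<close>.\<close>
definition vertical_cost_geodesic ::
  "('m, 'e::euclidean_space, 'z) riemannian_scheme \<Rightarrow> 'm \<Rightarrow> (real \<Rightarrow> 'm) \<Rightarrow> bool" where
  "vertical_cost_geodesic M x \<eta> \<longleftrightarrow>
     continuous_map (top_of_set {0..1}) (man_top M) \<eta> \<and>
     (\<forall>t\<in>{0..1}. (x, \<eta> t) \<in> off_cut_locus M \<and>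
        (\<forall>a\<in>atlas M. \<forall>b\<in>atlas M. x \<in> fst a \<and> \<eta> t \<in> fst b \<longrightarrow>
           geodesic_equation_at (cost_metric M a b) {0..1} (\<lambda>s. (snd a x, snd b (\<eta> s))) t))"

definition sliding_mountain ::
  "('m, 'e::euclidean_space, 'z) riemannian_scheme \<Rightarrow> 'm \<Rightarrow> (real \<Rightarrow> 'm) \<Rightarrow> real \<Rightarrow> 'm \<Rightarrow> real" where
  "sliding_mountain M x \<eta> t y = - cost M y (\<eta> t) + cost M x (\<eta> t)"

definition time_convex_sliding_mountain ::
  "('m, 'e::euclidean_space, 'z) riemannian_scheme \<Rightarrow> bool" where
  "time_convex_sliding_mountain M \<longleftrightarrow>
     (\<forall>x \<eta>. vertical_cost_geodesic M x \<eta> \<longrightarrow>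
       (\<forall>y\<in>topspace (man_top M). \<forall>t\<in>{0..1}. let f = sliding_mountain M x \<eta> in
          f t y \<le> (1 - t) * f 0 y + t * f 1 y \<and>
          f t y \<le> max (f 0 y) (f 1 y)))"

end

theory Submission
  imports Defs
begin

text \<open>On a product of spheres and a Euclidean space, \<open>v \<mapsto> |v|\<^sup>2 - d(y, exp\<^sub>p v)\<^sup>2\<close> is convex on the whole
  tangent space at \<open>p\<close>: on each sphere, curves of rotations \<open>t \<mapsto> exp(tA) exp(-tA\<^sub>0) exp(tC) y\<close> ending
  at \<open>exp\<^sub>p v\<close> have an energy that is affine in \<open>v\<close> up to a square. Curves in the base of a Riemannian
  submersion lift without gaining length, so distances in the base are distances between fibres and
  the convexity descends to horizontal vectors. Based at the other end point \<open>y\<close> of a minimizer that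
  can be extended, it makes the minimizers ending near \<open>y\<close> depend on their end points in a Lipschitz
  way, which excludes conjugate points. Hence off the cut locus the cost is smooth, with differential
  \<open>- g(u, \<cdot>)\<close> in its first variable, where \<open>u\<close> is the initial velocity of the minimizer. Along a
  vertical geodesic of \<open>h\<close> this differential is affine in time, hence so is \<open>u\<close>, and convexity gives
  the second claim. The cross-curvature is, up to the factor \<open>-2\<close>, the second time derivative, along
  such a geodesic, of the second derivative of the cost at \<open>x\<close>, and the second claim gives its sign.\<close>

text \<open>All geometry of \<open>M\<close> is read off upstairs, in \<open>real ^ 'i\<close>:
  functions on the product are extended to an open set by the radial retraction \<open>ret\<close>,
  geodesics are the explicit curves \<open>pexp p (t *R v)\<close>, and a point of \<open>M\<close>
  is handled through a point of its fibre. The price is that one vector of \<open>M\<close> has a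
  lift at every point of the fibre, and the projected geodesics have to be shown to agree. This,
  like the horizontality of minimizers and its persistence along geodesics, is drawn from
  minimization: distances have explicit upper bounds touching them, differentiable at the point of
  contact, and a sum of two such bounds that has a minimum has differential 0. The same device gives
  uniqueness of minimizers and the gradient of the cost. Against conjugate points, convexity is used
  as follows: a convex function squeezed between two quadratics with the same linear part has
  subgradients that are Lipschitz at the point, and here the subgradients encode the velocities with
  which minimizers arrive. The product itself is the base of its identity submersion, so that only
  bases are treated.\<close>

abbreviation "FD \<equiv> frechet_derivative"

notation scaleR (infixr "*R" 75)

notation inner (infix "*." 70)

section \<open>Smooth maps between Euclidean spaces\<close>

lemma has_derivative_cong_open:
 assumes "open V" "x : V" "!!y. y : V ==> f y = g y"
 shows "(f has_derivative f') (at x) \<longleftrightarrow> (g has_derivative f') (at x)"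
proof
 show "(g has_derivative f') (at x)" if "(f has_derivative f') (at x)"
  by (rule has_derivative_transform_within_open[OF that assms(1,2)]) (rule assms(3))
 show "(f has_derivative f') (at x)" if "(g has_derivative f') (at x)"
  by (rule has_derivative_transform_within_open[OF that assms(1,2)]) (rule assms(3)[symmetric])
qed

lemma FD_cong:
 assumes "open V" "x : V" "!!y. y : V ==> f y = g y"
 shows "FD f (at x) = FD g (at x)" unfolding frechet_derivative_def using has_derivative_cong_open[OF assms] by simp

lemma has_derivative_imp_Lipschitz_at:
 assumes "(f has_derivative L) (at x)"
 obtains K e where "0 < K" "0 < e" "!!y. norm (y - x) < e ==> norm (f y - f x) <= K * norm (y - x)"
proof -
 obtain C where C: "0 < C" "!!v. norm (L v) <= norm v * C"
  using bounded_linear.pos_bounded[OF has_derivative_bounded_linear[OF assms]] by blast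
 obtain e where e: "0 < e" "!!y. norm (y - x) < e ==> norm (f y - f x - L (y - x)) <= 1 * norm (y - x)"
  using assms[unfolded has_derivative_at_alt] by (meson zero_less_one)
 show ?thesis
 proof (rule that[of "C + 1" e])
  fix y assume y: "norm (y - x) < e"
  have "norm (f y - f x) <= norm (f y - f x - L (y - x)) + norm (L (y - x))"
   using norm_triangle_ineq[of "f y - f x - L (y - x)" "L (y - x)"] by simp
  thus "norm (f y - f x) <= (C + 1) * norm (y - x)" using e(2)[OF y] C(2)[of "y - x"] by (simp add: algebra_simps)
 qed (use C e in auto)
qed

text \<open>Differentiation respects the sums and multiples that express linearity in
  \<open>u\<close>. Linearity is assumed on the open set \<open>V\<close> only, hence the transfer
  through \<open>has_derivative_cong_open\<close>. It yields linearity of the derivatives of metrics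
  and Christoffel symbols in their vector arguments.\<close>

lemma linear_FD_parameter:
 fixes f :: "'u::real_vector => 'a::real_normed_vector => 'b::real_normed_vector"
 assumes V: "open V" "x : V" and f: "!!u. f u differentiable at x" and lin: "!!y. y : V ==> linear (%u. f u y)"
 shows "linear (%u. FD (f u) (at x) v)"
proof (rule linearI)
 note df = frechet_derivative_works[THEN iffD1, OF f]
 fix u u' s
 have "(f (u + u') has_derivative (%v. FD (f u) (at x) v + FD (f u') (at x) v)) (at x)"
  using has_derivative_cong_open[OF V, of "f (u + u')" "%y. f u y + f u' y"] linear_add[OF lin] has_derivative_add[OF df df] by simp
 from frechet_derivative_at[OF this]
 show "FD (f (u + u')) (at x) v = FD (f u) (at x) v + FD (f u') (at x) v" by metis
 have "(f (s *R u) has_derivative (%v. s *R FD (f u) (at x) v)) (at x)"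
  using has_derivative_cong_open[OF V, of "f (s *R u)" "%y. s *R f u y"] linear_cmul[OF lin] has_derivative_scaleR_right[OF df] by simp
 from frechet_derivative_at[OF this]
 show "FD (f (s *R u)) (at x) v = s *R FD (f u) (at x) v" by metis
qed

text \<open>At a zero of \<open>ph\<close>, the product rule asks only for continuity of the other
  factor, because \<open>ph z *R (b z - b x)\<close> is a Lipschitz term times a term tending to 0.
  The derivative of an inverse thereby follows from its continuity.\<close>

lemma has_derivative_scaleR_vanishing:
 fixes ph :: "'a::real_normed_vector => real"
 assumes d: "(ph has_derivative ph') (at x)" and 0: "ph x = 0" and b: "isCont b x"
 shows "((%z. ph z *R b z) has_derivative (%h. ph' h *R b x)) (at x)"
proof -
 obtain K e where K: "0 < K" "0 < e" "!!y. norm (y - x) < e ==> norm (ph y - ph x) <= K * norm (y - x)"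
  by (rule has_derivative_imp_Lipschitz_at[OF d]) (rule that)
 have "((%z. ph z *R (b z - b x)) has_derivative (%h. 0)) (at x)" unfolding has_derivative_at_alt
 proof (intro conjI allI impI bounded_linear_zero)
  fix ep :: real assume "0 < ep"
  hence "0 < ep / K" using K by simp
  then obtain e' where e': "0 < e'" "!!y. dist y x < e' ==> dist (b y) (b x) < ep / K"
   using b unfolding continuous_at_eps_delta by blast
  have "norm (ph y *R (b y - b x)) <= ep * norm (y - x)" if y: "norm (y - x) < min e e'" for y
  proof -
   have "\<bar>ph y\<bar> * norm (b y - b x) <= (K * norm (y - x)) * (ep / K)"
    using K(3)[of y] e'(2)[of y] y 0 K(1) by (intro mult_mono) (auto simp: dist_norm)
   thus ?thesis using K(1) by (simp add: mult.commute)
  qed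
  thus "EX d>0. ALL y. norm (y - x) < d --> norm (ph y *R (b y - b x) - ph x *R (b x - b x) - 0) <= ep * norm (y - x)"
   using K(2) e'(1) by (intro exI[of _ "min e e'"]) simp
 qed
 from has_derivative_add[OF has_derivative_scaleR_left[OF d, of "b x"] this] show ?thesis by (simp flip: scaleR_add_right)
qed

lemma differentiable_on_open_iff:
 "open S ==> f differentiable_on S \<longleftrightarrow> (ALL x:S. f differentiable at x)"
 by (rule differentiable_on_eq_differentiable_at)

lemma C_k_on_cong:
 assumes "open S" "!!x. x : S ==> f x = g x"
 shows "C_k_on k S f \<longleftrightarrow> C_k_on k S g"
proof -
 have "C_k_on k S g" if "!!x. x : S ==> f x = g x" "C_k_on k S f" for f g :: "'a => 'b" using that
 proof (induction k arbitrary: f g)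
  case 0
  thus ?case using continuous_on_cong[of S S f g] by auto
 next
  case (Suc k)
  have d: "f differentiable at x" if "x : S" for x
   using Suc.prems(2) that \<open>open S\<close> by (simp add: differentiable_on_open_iff)
  have eq: "FD f (at x) = FD g (at x)" if "x : S" for x
   using frechet_derivative_transform_within_open[OF d[OF that] \<open>open S\<close> that] Suc.prems(1) by auto
  have "g differentiable at x" if "x : S" for x using d[OF that] Suc.prems(1) that \<open>open S\<close>
   by (metis differentiable_def has_derivative_transform_within_open)
  hence "g differentiable_on S" by (simp add: \<open>open S\<close> differentiable_on_open_iff)
  moreover have "C_k_on k S (%z. FD g (at z) v)" for v using Suc.IH[of "%z. FD f (at z) v" "%z. FD g (at z) v"]
    Suc.prems(2) eq by auto
  ultimately show ?case by simp
 qed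
 thus ?thesis using assms(2) by metis
qed

lemma C_k_on_subset:
 "C_k_on k S f ==> T \<subseteq> S ==> C_k_on k T f"
 by (induction k arbitrary: f) (auto intro: continuous_on_subset differentiable_on_subset)

lemma C_k_on_Suc: "C_k_on (Suc k) S f ==> C_k_on k S f"
 by (induction k arbitrary: f) (auto intro: differentiable_imp_continuous_on)

lemma C_k_on_local:
 assumes "!!x. x : S ==> EX T. open T & x : T & C_k_on k T f" "open S"
 shows "C_k_on k S f" using assms(1)
proof (induction k arbitrary: f)
 case 0
 hence "continuous (at x) f" if "x : S" for x using that by (metis C_k_on.simps(1) continuous_on_eq_continuous_at)
 thus ?case by (simp add: continuous_at_imp_continuous_on)
next
 case (Suc k)
 have "f differentiable at x" if "x : S" for x using Suc.prems[OF that] by (auto simp: differentiable_on_open_iff)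
 moreover have "C_k_on k S (%z. FD f (at z) v)" for v using Suc.prems by (intro Suc.IH) auto
 ultimately show ?case by (simp add: \<open>open S\<close> differentiable_on_open_iff)
qed

lemma smooth_on_cong:
 "open S ==> (!!x. x : S ==> f x = g x) ==> smooth_on S f \<longleftrightarrow> smooth_on S g"
 unfolding smooth_on_def using C_k_on_cong by blast

lemma smooth_on_subset: "smooth_on S f ==> T \<subseteq> S ==> smooth_on T f"
 unfolding smooth_on_def using C_k_on_subset by blast

lemma smooth_on_local:
 assumes "open S" "!!x. x : S ==> EX T. open T & x : T & smooth_on T f"
 shows "smooth_on S f" unfolding smooth_on_def using C_k_on_local assms smooth_on_def by metis

lemma smooth_on_cont: "smooth_on S f ==> continuous_on S f" unfolding smooth_on_def using C_k_on.simps(1) by blast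

lemma smooth_on_diffable:
 "smooth_on S f ==> open S ==> x : S ==> f differentiable at x"
 unfolding smooth_on_def using C_k_on.simps(2) differentiable_on_open_iff by blast

lemma smooth_on_deriv:
 "smooth_on S f ==> open S ==> x : S ==> (f has_derivative FD f (at x)) (at x)"
 using smooth_on_diffable frechet_derivative_works by blast

lemma smooth_on_FD:
 "smooth_on S f ==> smooth_on S (%z. FD f (at z) v)" unfolding smooth_on_def using C_k_on.simps(2) by blast

section \<open>Closure properties of the differentiability classes\<close>

lemma C_k_on_SucI:
 assumes "open S" "!!x. x : S ==> (f has_derivative f' x) (at x)"
  "!!v. C_k_on k S (%x. f' x v)" shows "C_k_on (Suc k) S f"
proof -
 have eq: "FD f (at x) = f' x" if "x : S" for x using assms(2)[OF that] by (metis frechet_derivative_at)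
 have "f differentiable_on S" using assms differentiable_on_open_iff differentiable_def by blast
 moreover have "C_k_on k S (%z. FD f (at z) v)" for v
  using assms(3) C_k_on_cong[OF assms(1), of "%z. FD f (at z) v" "%x. f' x v"] eq by auto
 ultimately show ?thesis by simp
qed

lemma C_k_on_has_derivative:
 "C_k_on (Suc k) S f ==> open S ==> x : S ==> (f has_derivative FD f (at x)) (at x)"
 using C_k_on.simps(2) differentiable_on_open_iff frechet_derivative_works by blast

lemma C_k_on_const: "open S ==> C_k_on k S (%x. c)"
proof (induction k arbitrary: c)
 case (Suc k)
 thus ?case by (intro C_k_on_SucI[where f' = "%x v. 0"]) auto
qed auto

lemma C_k_on_bounded_linear:
 assumes "bounded_linear L" "open S" "C_k_on k S f"
 shows "C_k_on k S (%x. L (f x))" using assms(3)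
proof (induction k arbitrary: f)
 case 0
 thus ?case using bounded_linear.continuous_on[OF assms(1)] by auto
next
 case (Suc k)
 show ?case using Suc.IH Suc.prems by (intro C_k_on_SucI[where f' = "%x v. L (FD f (at x) v)"] assms(2)
    bounded_linear.has_derivative[OF assms(1)] C_k_on_has_derivative[OF Suc.prems assms(2)]) auto
qed

lemma C_k_on_add:
 assumes "open S" "C_k_on k S f" "C_k_on k S g"
 shows "C_k_on k S (%x. f x + g x)" using assms(2,3)
proof (induction k arbitrary: f g)
 case 0
 thus ?case by (auto intro: continuous_intros)
next
 case (Suc k)
 note d = C_k_on_has_derivative[OF Suc.prems(1) assms(1)] C_k_on_has_derivative[OF Suc.prems(2) assms(1)]
 show ?case using Suc.IH Suc.prems by (intro C_k_on_SucI[where f' = "%x v. FD f (at x) v + FD g (at x) v"]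
    assms(1) has_derivative_add d) auto
qed

lemma C_k_on_sum:
 assumes "open S" "!!i. i : I ==> C_k_on k S (f i)"
 shows "C_k_on k S (%x. \<Sum>i\<in>I. f i x)"
proof (cases "finite I")
 case True
 thus ?thesis using assms(2) by (induction I rule: finite_induct) (auto simp: C_k_on_const assms(1) C_k_on_add)
qed (simp add: C_k_on_const assms(1))

lemma C_k_on_bilinear:
 assumes "bounded_bilinear B" "open S" "C_k_on k S f" "C_k_on k S g"
 shows "C_k_on k S (%x. B (f x) (g x))" using assms(3,4)
proof (induction k arbitrary: f g)
 case 0
 thus ?case using bounded_bilinear.continuous_on[OF assms(1)] by auto
next
 case (Suc k)
 have "C_k_on k S f" "C_k_on k S g" using Suc.prems C_k_on_Suc by auto
 thus ?case
  using Suc.IH Suc.prems C_k_on_has_derivative[OF Suc.prems(1) assms(2)] C_k_on_has_derivative[OF Suc.prems(2) assms(2)]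
  by (intro C_k_on_SucI[where f' = "%x v. B (f x) (FD g (at x) v)
     + B (FD f (at x) v) (g x)"] assms(2)
    bounded_bilinear.FDERIV[OF assms(1)] C_k_on_add) auto
qed

lemma linear_basis_expansion:
 fixes v :: "'a::euclidean_space"
 assumes "linear L"
 shows "L v = (\<Sum>e\<in>Basis. (v *. e) *R L e)"
 by (metis (no_types, lifting) assms euclidean_representation linear_cmul linear_sum sum.cong)

text \<open>After expanding the derivative of the composite over \<open>Basis\<close>, the induction
  hypothesis is applied to the partial derivatives of \<open>g\<close> along the same
  \<open>f\<close>; hence only \<open>g\<close> is generalized.\<close>

lemma C_k_on_compose:
 fixes f :: "'a::euclidean_space => 'b::euclidean_space" and g :: "'b => 'c::real_normed_vector"
 assumes "open S" "open T" "f ` S \<subseteq> T" "C_k_on k S f" "C_k_on k T g"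
 shows "C_k_on k S (%x. g (f x))" using assms(4,5)
proof (induction k arbitrary: g)
 case 0
 hence "continuous_on S f" "continuous_on T g" by auto
 thus ?case using continuous_on_compose2[of T g S f] assms(3) by simp
next
 case (Suc k)
 let ?f' = "%x v. \<Sum>e\<in>Basis. (FD f (at x) v *. e) *R FD g (at (f x)) e"
 have fk: "C_k_on k S f" using Suc.prems C_k_on_Suc by auto
 show ?case
 proof (rule C_k_on_SucI[where f' = ?f'])
  fix x assume x: "x : S"
  have "f x : T" using x assms(3) by auto
  note dg = C_k_on_has_derivative[OF Suc.prems(2) assms(2) this]
  have "((%x. g (f x)) has_derivative (%v. FD g (at (f x)) (FD f (at x) v))) (at x)"
   using has_derivative_compose[OF C_k_on_has_derivative[OF Suc.prems(1) assms(1) x] dg] .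
  moreover have "(%v. FD g (at (f x)) (FD f (at x) v)) = ?f' x"
   by (rule ext) (rule linear_basis_expansion[OF has_derivative_linear[OF dg]])
  ultimately show "((%x. g (f x)) has_derivative ?f' x) (at x)" by (simp only:)
 next
  fix v
  have "C_k_on k S (%x. FD f (at x) v)" using Suc.prems by auto
  moreover have "C_k_on k S (%x. FD g (at (f x)) e)" for e using Suc.IH[OF fk, of "%z. FD g (at z) e"] Suc.prems(2) by auto
  ultimately show "C_k_on k S (%x. ?f' x v)" by (intro C_k_on_sum assms(1) C_k_on_bilinear[OF bounded_bilinear_scaleR]
     C_k_on_bounded_linear[OF bounded_linear_inner_left])
 qed (rule assms)
qed

named_theorems smooth_intros

lemma smooth_on_const [smooth_intros]: "open S ==> smooth_on S (%x. c)" by (simp add: smooth_on_def C_k_on_const)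

lemma smooth_on_bounded_linear:
 "bounded_linear L ==> open S ==> smooth_on S f ==> smooth_on S (%x. L (f x))"
 by (simp add: smooth_on_def C_k_on_bounded_linear)

lemma smooth_on_add [smooth_intros]:
 "open S ==> smooth_on S f ==> smooth_on S g ==> smooth_on S (%x. f x + g x)" by (simp add: smooth_on_def C_k_on_add)

lemma smooth_on_sum [smooth_intros]:
 "open S ==> (!!i. i : I ==> smooth_on S (f i)) ==> smooth_on S (%x. \<Sum>i\<in>I. f i x)"
 by (simp add: smooth_on_def C_k_on_sum)

lemma smooth_on_bilinear:
 "bounded_bilinear B ==> open S ==> smooth_on S f ==> smooth_on S g ==> smooth_on S (%x. B (f x) (g x))"
 by (simp add: smooth_on_def C_k_on_bilinear)

lemma smooth_on_compose:
 fixes f :: "'a::euclidean_space => 'b::euclidean_space" and g :: "'b => 'c::real_normed_vector"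
 assumes "open S" "open T" "f ` S \<subseteq> T" "smooth_on S f" "smooth_on T g"
 shows "smooth_on S (%x. g (f x))" using assms(4,5) C_k_on_compose[OF assms(1-3)] unfolding smooth_on_def by blast

lemmas smooth_on_scaleR [smooth_intros] = smooth_on_bilinear[OF bounded_bilinear_scaleR]
lemmas smooth_on_mult [smooth_intros] = smooth_on_bilinear[OF bounded_bilinear_mult]
lemmas smooth_on_inner [smooth_intros] = smooth_on_bilinear[OF bounded_bilinear_inner]
lemmas smooth_on_fst [smooth_intros] = smooth_on_bounded_linear[OF bounded_linear_fst]
lemmas smooth_on_snd [smooth_intros] = smooth_on_bounded_linear[OF bounded_linear_snd]
lemmas smooth_on_minus [smooth_intros] = smooth_on_bounded_linear[OF bounded_linear_minus[OF bounded_linear_ident]]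

lemma smooth_on_diff [smooth_intros]:
 "open S ==> smooth_on S f ==> smooth_on S g ==> smooth_on S (%x. f x - g x)"
 using smooth_on_add[OF _ _ smooth_on_minus, of S f g] by simp

lemma smooth_on_id [smooth_intros]: "open S ==> smooth_on S (%x. x)"
proof -
 assume "open S"
 have "C_k_on k S (%x. x)" for k
 proof (cases k)
  case (Suc n)
  thus ?thesis using C_k_on_SucI[OF \<open>open S\<close>, of "%x. x" "%x v. v" n] C_k_on_const \<open>open S\<close>
   by auto
 qed auto
 thus ?thesis by (simp add: smooth_on_def)
qed

lemma smooth_on_Pair [smooth_intros]:
 assumes "open S" "smooth_on S f" "smooth_on S g"
 shows "smooth_on S (%x. (f x, g x))"
proof -
 have "bounded_linear (%a. (a, 0::'c))" "bounded_linear (%b. (0::'b, b))"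
  by (auto intro!: bounded_linear_Pair bounded_linear_ident bounded_linear_zero)
 hence "smooth_on S (%x. (f x, 0) + (0, g x))"
  using smooth_on_add[OF assms(1) smooth_on_bounded_linear[OF _ assms(1,2)] smooth_on_bounded_linear[OF _ assms(1,3)]]
  by blast
 thus ?thesis by simp
qed

lemma smooth_on_FD_apply:
 fixes g :: "'b::euclidean_space => 'c::real_normed_vector"
 assumes "open S" "open T" "smooth_on T g" "smooth_on S ph" "ph ` S \<subseteq> T" "smooth_on S ps"
 shows "smooth_on S (%x. FD g (at (ph x)) (ps x))"
proof -
 have "smooth_on S (%x. \<Sum>e\<in>Basis. (ps x *. e) *R FD g (at (ph x)) e)"
  using smooth_on_compose[OF assms(1,2,5,4) smooth_on_FD[OF assms(3)]] assms(1,6) by (intro smooth_intros)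
 moreover have "FD g (at (ph x)) (ps x) = (\<Sum>e\<in>Basis. (ps x *. e) *R FD g (at (ph x)) e)"
  if "x : S" for x using that assms smooth_on_deriv[OF assms(3,2), of "ph x"]
  by (intro linear_basis_expansion has_derivative_linear) auto
 ultimately show ?thesis using smooth_on_cong[OF assms(1), of "%x. FD g (at (ph x)) (ps x)"
   "%x. \<Sum>e\<in>Basis. (ps x *. e) *R FD g (at (ph x)) e"] by simp
qed

text \<open>Directional derivatives of members of \<open>F\<close> are again in \<open>F\<close>, so
  the induction on \<open>k\<close> can run through the whole family at once. It serves for power
  series, whose derivatives are power series.\<close>

lemma smooth_on_coinduct:
 assumes "open S" "f : F"
  and "!!f. f : F ==> EX f'. (ALL x:S. (f has_derivative f' x) (at x)) & (ALL v. (%x. f' x v) : F)"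
 shows "smooth_on S f"
proof -
 have "C_k_on k S f" if "f : F" for k f using that
 proof (induction k arbitrary: f)
  case 0
  from assms(3)[OF 0] show ?case by (metis C_k_on.simps(1) continuous_at_imp_continuous_on has_derivative_continuous)
 next
  case (Suc k)
  from assms(3)[OF Suc.prems] obtain f' where "!!x. x : S ==> (f has_derivative f' x) (at x)" "!!v. (%x. f' x v) : F"
   by blast
  thus ?case using Suc.IH by (intro C_k_on_SucI assms(1)) auto
 qed
 thus ?thesis using assms(2) by (simp add: smooth_on_def)
qed

lemma smooth_on_inverse_real: "smooth_on (- {0}) (inverse :: real => real)"
proof -
 have o: "open (- {0::real})" by auto
 have "C_k_on k (- {0}) (inverse :: real => real)" for k
 proof (induction k)
  case 0
  thus ?case by (auto intro: continuous_intros)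
 next
  case (Suc k)
  show ?case
  proof (rule C_k_on_SucI[OF o, where f' = "%x v. - (inverse x * v * inverse x)"])
   show "C_k_on k (- {0}) (%x. - (inverse x * v * inverse x))" for v :: real
    by (intro C_k_on_bounded_linear[OF bounded_linear_minus[OF bounded_linear_ident]]
      C_k_on_bilinear[OF bounded_bilinear_mult] Suc o C_k_on_const)
  qed (auto intro: has_derivative_inverse')
 qed
 thus ?thesis by (simp add: smooth_on_def)
qed

lemma smooth_on_inverse [smooth_intros]:
 fixes f :: "'a::euclidean_space => real"
 assumes "open S" "smooth_on S f" "!!x. x : S ==> f x ~= 0"
 shows "smooth_on S (%x. inverse (f x))"
 by (rule smooth_on_compose[OF assms(1) _ _ assms(2) smooth_on_inverse_real]) (use assms in auto)

lemma smooth_on_divide [smooth_intros]: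
 fixes f :: "'a::euclidean_space => real"
 assumes "open S" "smooth_on S f" "smooth_on S g" "!!x. x : S ==> g x ~= 0"
 shows "smooth_on S (%x. f x / g x)" unfolding divide_inverse using assms by (intro smooth_intros) auto

lemma real_deriv_iff:
 "(f has_real_derivative d) (at x) \<longleftrightarrow> (f has_derivative (%v. v * d)) (at x)"
 by (simp add: has_field_derivative_def mult_commute_abs)

lemma smooth_on_sqrt_real: "smooth_on {0<..} sqrt"
proof -
 have o: "open {0::real<..}" by auto
 have "C_k_on k {0<..} sqrt" for k
 proof (induction k)
  case 0
  thus ?case by (auto intro: continuous_intros)
 next
  case (Suc k)
  show ?case
  proof (rule C_k_on_SucI[OF o, where f' = "%x v. v * (inverse (sqrt x) / 2)"])
   show "(sqrt has_derivative (%v. v * (inverse (sqrt x) / 2))) (at x)" if "x : {0<..}" for x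
    using DERIV_real_sqrt[of x] that unfolding real_deriv_iff by simp
   have "C_k_on k {0<..} (%x. inverse (sqrt x))" using smooth_on_inverse_real
    by (intro C_k_on_compose[OF o _ _ Suc, of "-{0}" inverse]) (auto simp: smooth_on_def)
   thus "C_k_on k {0<..} (%x. v * (inverse (sqrt x) / 2))" for v :: real unfolding divide_inverse
    by (rule C_k_on_bilinear[OF bounded_bilinear_mult o C_k_on_const[OF o]
       C_k_on_bilinear[OF bounded_bilinear_mult o _ C_k_on_const[OF o]]])
  qed
 qed
 thus ?thesis by (simp add: smooth_on_def)
qed

lemma smooth_on_sqrt [smooth_intros]:
 fixes f :: "'a::euclidean_space => real"
 assumes "open S" "smooth_on S f" "!!x. x : S ==> 0 < f x"
 shows "smooth_on S (%x. sqrt (f x))"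
 by (rule smooth_on_compose[OF assms(1) _ _ assms(2) smooth_on_sqrt_real]) (use assms in auto)

lemma smooth_on_componentwise:
 fixes f :: "'a::euclidean_space => 'b::euclidean_space"
 assumes "open S" "!!e. e : Basis ==> smooth_on S (%x. f x *. e)"
 shows "smooth_on S f"
proof -
 have "smooth_on S (%x. \<Sum>e\<in>Basis. (f x *. e) *R e)"
  using assms by (intro smooth_on_sum smooth_on_scaleR smooth_on_const) auto
 thus ?thesis by (simp add: euclidean_representation)
qed

lemma smooth_on_vec_nth [smooth_intros]:
 "open S ==> smooth_on S f ==> smooth_on S (%x. f x $ i)" by (rule smooth_on_bounded_linear[OF bounded_linear_vec_nth])

lemma smooth_on_vec:
 fixes f :: "'i::finite => 'a::euclidean_space => real"
 assumes "open S" "!!i. smooth_on S (f i)"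
 shows "smooth_on S (%x. \<chi> i. f i x)"
 by (rule smooth_on_componentwise) (use assms in \<open>auto simp: Basis_vec_def inner_axis\<close>)

lemma FD_slice:
 fixes f :: "'a::euclidean_space \<times> 'b::euclidean_space => 'c::real_normed_vector"
 assumes V: "open V" "(z, z') : V" and f: "smooth_on V f"
 shows "((%w. f (w, z')) has_derivative (%v. FD f (at (z, z')) (v, 0))) (at z)"
  and "((%w. f (z, w)) has_derivative (%v. FD f (at (z, z')) (0, v))) (at z')"
proof -
 note df = smooth_on_deriv[OF f V]
 have 1: "((%w. (w, z')) has_derivative (%v. (v, 0))) (at z)" by (intro has_derivative_Pair has_derivative_const has_derivative_ident)
 show "((%w. f (w, z')) has_derivative (%v. FD f (at (z, z')) (v, 0))) (at z)" by (rule has_derivative_compose[OF 1 df])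
 have 2: "((%w. (z, w)) has_derivative (%v. (0, v))) (at z')" by (intro has_derivative_Pair has_derivative_const has_derivative_ident)
 show "((%w. f (z, w)) has_derivative (%v. FD f (at (z, z')) (0, v))) (at z')" by (rule has_derivative_compose[OF 2 df])
qed

subsection \<open>Inverses\<close>

lemma linear_norm_le_sum_Basis:
 fixes L :: "'a::euclidean_space => 'b::real_normed_vector"
 assumes "linear L"
 shows "norm (L v) <= (\<Sum>e\<in>Basis. norm (L e)) * norm v"
proof -
 have "norm (L v) <= (\<Sum>e\<in>Basis. norm ((v *. e) *R L e))" by (subst linear_basis_expansion[OF assms]) (rule norm_sum)
 also have "\<dots> <= (\<Sum>e\<in>Basis. norm (L e) * norm v)"
  by (rule sum_mono) (simp add: Basis_le_norm mult_left_mono mult.commute[of _ "norm (L _)"])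
 finally show ?thesis by (simp add: sum_distrib_right)
qed

lemma linear_inv_of_bij:
 fixes L :: "'a::euclidean_space => 'a"
 assumes "linear L" "bij L"
 shows "linear (inv L)" using assms by (metis bij_betw_def inj_linear_imp_inv_linear)

text \<open>With \<open>w = inv (A x) v0\<close> fixed, \<open>inv (A z) v - w\<close> is sent by
  \<open>A z\<close> to \<open>v - A z w\<close>, which tends to 0. The map \<open>A x\<close> is
  bounded below by \<open>c\<close>, and the sum \<open>ep\<close> over basis vectors keeps
  \<open>A z\<close> within \<open>c / 2\<close> of it, so solutions are controlled by right-hand
  sides.\<close>

lemma tendsto_inverse_family:
 fixes A :: "'b::t2_space => 'a::euclidean_space => 'a"
 assumes lin: "!!z. z : S ==> linear (A z)" and bij: "!!z. z : S ==> bij (A z)"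
  and S: "open S" "x : S" and cont: "!!v. continuous_on S (%z. A z v)"
  and v: "(v \<longlongrightarrow> v0) F" and z: "((z :: 'c => 'b) \<longlongrightarrow> x) F"
 shows "((%i. inv (A (z i)) (v i)) \<longlongrightarrow> inv (A x) v0) F"
proof -
 obtain c where c: "c > 0" "!!u. c * norm u <= norm (A x u)"
  using linear_inj_bounded_below_pos[OF lin bij_is_inj[OF bij]] S(2) by metis
 define w where "w = inv (A x) v0"
 have Aw: "A x w = v0" unfolding w_def using bij[OF S(2)] by (simp add: bij_is_surj surj_f_inv_f)
 define ep where "ep = (%i. \<Sum>e\<in>Basis. norm (A (z i) e - A x e))"
 have At: "((%i. A (z i) u) \<longlongrightarrow> A x u) F" for u
  using cont[of u] S isCont_tendsto_compose[OF _ z, where g="%z. A z u"] by (simp add: continuous_on_eq_continuous_at)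
 have "(ep \<longlongrightarrow> (\<Sum>e\<in>Basis. norm (A x e - A x e))) F" unfolding ep_def by (intro tendsto_intros At)
 hence "(ep \<longlongrightarrow> 0) F" by simp
 hence ev: "eventually (%i. ep i < c / 2) F" using c(1) by (intro order_tendstoD) auto
 have evS: "eventually (%i. z i : S) F" using z S by (rule topological_tendstoD)
 have evle: "eventually (%i. dist (inv (A (z i)) (v i)) w <= (2 / c) * norm (v i - A (z i) w)) F" using ev evS
 proof eventually_elim
  case (elim i)
  define u where "u = inv (A (z i)) (v i) - w"
  have Au: "A (z i) u = v i - A (z i) w" unfolding u_def using linear_diff[OF lin[OF elim(2)]] bij[OF elim(2)]
   by (simp add: bij_is_surj surj_f_inv_f)
  have l: "linear (%u. A (z i) u - A x u)" using lin elim(2) S(2) linear_compose_sub by blast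
  have "c * norm u <= norm (A x u)" by (rule c)
  also have "\<dots> <= norm (A (z i) u) + norm (A (z i) u - A x u)"
   by (metis norm_minus_commute norm_triangle_sub add.commute)
  also have "norm (A (z i) u - A x u) <= ep i * norm u" using linear_norm_le_sum_Basis[OF l, of u] by (simp add: ep_def)
  also have "ep i * norm u <= c / 2 * norm u" using elim(1) by (intro mult_right_mono) auto
  finally have "c / 2 * norm u <= norm (v i - A (z i) w)" using Au by simp
  hence "norm u <= (2 / c) * norm (v i - A (z i) w)" using c(1) by (simp add: field_simps)
  thus ?case by (simp add: dist_norm u_def)
 qed
 have "((%i. (2 / c) * norm (v i - A (z i) w)) \<longlongrightarrow> (2 / c) * norm (v0 - A x w)) F"
  by (intro tendsto_intros At v)
 hence "((%i. (2 / c) * norm (v i - A (z i) w)) \<longlongrightarrow> 0) F" by (simp add: Aw)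
 note nul = this
 have ev0: "eventually (%i. 0 <= dist (inv (A (z i)) (v i)) w) F" by simp
 have "((%i. dist (inv (A (z i)) (v i)) w) \<longlongrightarrow> 0) F"
  by (rule tendsto_sandwich[OF ev0 evle tendsto_const nul])
 thus ?thesis unfolding w_def by (rule iffD2[OF tendsto_dist_iff])
qed

text \<open>The identity \<open>inv (A z) v = w - inv (A z) (A z w - v)\<close> with
  \<open>w = inv (A x) v\<close> isolates a factor \<open>A z w - v\<close> that vanishes at
  \<open>x\<close>; then \<open>has_derivative_scaleR_vanishing\<close> applies to each coordinate
  of this factor.\<close>

lemma has_derivative_inverse_family:
 fixes A :: "'b::euclidean_space => 'a::euclidean_space => 'a"
 assumes lin: "!!z. z : S ==> linear (A z)" and bij: "!!z. z : S ==> bij (A z)"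
  and S: "open S" "x : S"
  and der: "!!v z. z : S ==> ((%z. A z v) has_derivative A' z v) (at z)"
 shows "((%z. inv (A z) v) has_derivative (%h. - inv (A x) (A' x (inv (A x) v) h))) (at x)"
proof -
 define w where "w = inv (A x) v"
 have c: "continuous_on S (%z. A z v)" for v using der by (meson continuous_at_imp_continuous_on has_derivative_continuous)
 have w: "A x w = v" unfolding w_def using bij[OF S(2)] by (simp add: bij_is_surj surj_f_inv_f)
 have ex: "inv (A z) u = (\<Sum>e\<in>Basis. (u *. e) *R inv (A z) e)" if "z : S" for z u
  by (rule linear_basis_expansion[OF linear_inv_of_bij[OF lin[OF that] bij[OF that]]])
 have "isCont (%z. inv (A z) e) x" for e
  unfolding isCont_def by (rule tendsto_inverse_family[OF lin bij S c]) (auto intro: tendsto_intros)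
 moreover have "((%z. (A z w - v) *. e) has_derivative (%h. A' x w h *. e)) (at x)" for e
  using has_derivative_inner_left[OF has_derivative_diff[OF der[OF S(2), of w] has_derivative_const[of v]], of e] by simp
 ultimately have "((%z. \<Sum>e\<in>Basis. ((A z w - v) *. e) *R inv (A z) e) has_derivative
   (%h. \<Sum>e\<in>Basis. (A' x w h *. e) *R inv (A x) e)) (at x)"
  by (intro has_derivative_sum has_derivative_scaleR_vanishing) (simp_all add: w)
 hence "((%z. w - (\<Sum>e\<in>Basis. ((A z w - v) *. e) *R inv (A z) e)) has_derivative (%h. - inv (A x) (A' x w h))) (at x)"
  unfolding ex[OF S(2), symmetric] by (rule has_derivative_eq_rhs[OF has_derivative_diff[OF has_derivative_const]]) simp
 moreover have "w - (\<Sum>e\<in>Basis. ((A z w - v) *. e) *R inv (A z) e) = inv (A z) v" if z: "z : S" for z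
  unfolding ex[OF z, of "A z w - v", symmetric] linear_diff[OF linear_inv_of_bij[OF lin[OF z] bij[OF z]]]
  using bij[OF z] by (simp add: bij_is_inj inv_f_f)
 ultimately show ?thesis unfolding w_def[symmetric] by (rule has_derivative_transform_within_open[OF _ S])
qed

text \<open>The derivative is again built from the inverse family and from derivatives of
  \<open>A\<close>, so regularity climbs one order at a time.\<close>

lemma C_k_on_inverse_family:
 fixes A :: "'b::euclidean_space => 'a::euclidean_space => 'a"
 assumes lin: "!!z. z : S ==> linear (A z)" and bij: "!!z. z : S ==> bij (A z)"
  and S: "open S" and A: "!!v. C_k_on k S (%z. A z v)"
 shows "C_k_on k S (%z. inv (A z) v)" using A
proof (induction k arbitrary: v)
 case 0
 have c: "continuous_on S (%z. A z v)" for v using 0 by auto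
 have "isCont (%z. inv (A z) v) x" if "x : S" for x
  unfolding isCont_def by (rule tendsto_inverse_family[OF lin bij S that c]) (auto intro: tendsto_intros)
 thus ?case by (simp add: continuous_at_imp_continuous_on)
next
 case (Suc k)
 let ?A' = "%z v. FD (%z. A z v) (at z)"
 have Ak: "C_k_on k S (%z. A z v)" for v using Suc.prems C_k_on_Suc by blast
 have IH: "C_k_on k S (%z. inv (A z) v)" for v using Suc.IH Ak by auto
 have d: "((%z. A z v) has_derivative ?A' z v) (at z)" if "z : S" for v z using C_k_on_has_derivative[OF Suc.prems S that] .
 have lA': "linear (%v. ?A' z v h)" if z: "z : S" for z h using linear_FD_parameter[OF S z differentiableI[OF d[OF z]] lin] .
 show ?case
 proof (rule C_k_on_SucI[OF S])
  show "((%z. inv (A z) v) has_derivative (%h. - inv (A x) (?A' x (inv (A x) v) h))) (at x)" if "x : S" for x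
   by (rule has_derivative_inverse_family[OF lin bij S that d])
 next
  fix h
  have *: "C_k_on k S (%x. inv (A x) (r x))" if "C_k_on k S r" for r :: "'b => 'a"
  proof -
   have "C_k_on k S (%x. \<Sum>e\<in>Basis. (r x *. e) *R inv (A x) e)"
    by (intro C_k_on_sum S C_k_on_bilinear[OF bounded_bilinear_scaleR]
     C_k_on_bounded_linear[OF bounded_linear_inner_left] IH that)
   moreover have "inv (A x) (r x) = (\<Sum>e\<in>Basis. (r x *. e) *R inv (A x) e)" if "x : S" for x
    by (rule linear_basis_expansion[OF linear_inv_of_bij[OF lin[OF that] bij[OF that]]])
   ultimately show ?thesis
    using C_k_on_cong[OF S, of "%x. inv (A x) (r x)" "%x. \<Sum>e\<in>Basis. (r x *. e) *R inv (A x) e"] by blast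
  qed
  have "C_k_on k S (%x. \<Sum>e\<in>Basis. (inv (A x) v *. e) *R ?A' x e h)" using Suc.prems
   by (intro C_k_on_sum S C_k_on_bilinear[OF bounded_bilinear_scaleR]
     C_k_on_bounded_linear[OF bounded_linear_inner_left] IH) auto
  moreover have "?A' x (inv (A x) v) h = (\<Sum>e\<in>Basis. (inv (A x) v *. e) *R ?A' x e h)" if "x : S" for x
   by (rule linear_basis_expansion[OF lA'[OF that]])
  ultimately have "C_k_on k S (%x. ?A' x (inv (A x) v) h)"
   using C_k_on_cong[OF S, of "%x. ?A' x (inv (A x) v) h" "%x. \<Sum>e\<in>Basis. (inv (A x) v *. e) *R ?A' x e h"] by blast
  from C_k_on_bounded_linear[OF bounded_linear_minus[OF bounded_linear_ident] S *[OF this]]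
  show "C_k_on k S (%x. - inv (A x) (?A' x (inv (A x) v) h))" .
 qed
qed

lemma smooth_on_inverse_family:
 fixes A :: "'b::euclidean_space => 'a::euclidean_space => 'a"
 assumes lin: "!!z. z : S ==> linear (A z)" and bij: "!!z. z : S ==> bij (A z)"
  and S: "open S" and A: "!!v. smooth_on S (%z. A z v)" and r: "smooth_on S r"
 shows "smooth_on S (%z. inv (A z) (r z))"
proof -
 have s: "smooth_on S (%z. inv (A z) v)" for v
  using A C_k_on_inverse_family[of S A, OF lin bij S] unfolding smooth_on_def by blast
 have "smooth_on S (%x. \<Sum>e\<in>Basis. (r x *. e) *R inv (A x) e)"
  by (intro smooth_on_sum smooth_on_scaleR smooth_on_inner smooth_on_const S r s)
 moreover have "inv (A x) (r x) = (\<Sum>e\<in>Basis. (r x *. e) *R inv (A x) e)" if "x : S" for x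
  by (rule linear_basis_expansion[OF linear_inv_of_bij[OF lin[OF that] bij[OF that]]])
 ultimately show ?thesis
  using smooth_on_cong[OF S, of "%x. inv (A x) (r x)" "%x. \<Sum>e\<in>Basis. (r x *. e) *R inv (A x) e"] by blast
qed

text \<open>The continuously differentiable version is bootstrapped: the derivative of the inverse
  at \<open>y\<close> is \<open>inv (FD f (at (g y)))\<close>, so if \<open>g\<close> is of class
  \<open>k\<close>, so is its derivative. Invertibility on all of \<open>U\<close> is recorded
  because later coordinates use it at every point.\<close>

theorem smooth_inverse_function:
 fixes f :: "'a::euclidean_space => 'a"
 assumes S: "open S" "x0 : S" and f: "smooth_on S f" and inj: "inj (FD f (at x0))"
 obtains U V g where "open U" "U \<subseteq> S" "x0 : U" "open V" "f x0 : V" "homeomorphism U V f g"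
  "smooth_on V g" "!!x. x : U ==> bij (FD f (at x))"
proof -
 define f' where "f' = (%x. Blinfun (FD f (at x)))"
 have d: "(f has_derivative FD f (at x)) (at x)" if "x : S" for x using smooth_on_deriv[OF f S(1) that] .
 have f': "blinfun_apply (f' x) = FD f (at x)" if "x : S" for x
  unfolding f'_def using d[OF that] has_derivative_bounded_linear bounded_linear_Blinfun_apply by blast
 have lin0: "linear (FD f (at x0))" using d[OF S(2)] has_derivative_linear by blast
 hence bij0: "bij (FD f (at x0))" using inj by (simp add: bij_def linear_injective_imp_surjective)
 define invf where "invf = Blinfun (inv (FD f (at x0)))"
 have invf: "blinfun_apply invf = inv (FD f (at x0))"
  unfolding invf_def using linear_inv_of_bij[OF lin0 bij0] linear_linear bounded_linear_Blinfun_apply by blast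
 have "continuous_on S f'"
 proof (rule continuous_on_blinfun_componentwise)
  fix i :: 'a
  have "continuous_on S (%x. FD f (at x) i)" using smooth_on_FD[OF f] smooth_on_cont by blast
  thus "continuous_on S (%x. blinfun_apply (f' x) i)"
   using f' continuous_on_cong[OF refl, of S "%x. blinfun_apply (f' x) i" "%x. FD f (at x) i"] by simp
 qed
 moreover have "invf o\<^sub>L f' x0 = id_blinfun" by (rule blinfun_eqI) (simp add: invf f' S inj inv_f_f)
 moreover have "(f has_derivative blinfun_apply (f' x)) (at x)" if "x : S" for x using d f' that by simp
 ultimately obtain U V g g' where *: "open U" "U \<subseteq> S" "x0 : U" "open V" "f x0 : V" "homeomorphism U V f g"
  "!!y. y : V ==> (g has_derivative (g' y)) (at y)"
  "!!y. y : V ==> g' y = inv (blinfun_apply (f'(g y)))"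
  "!!y. y : V ==> bij (blinfun_apply (f'(g y)))" using inverse_function_theorem[OF S(1) _ _ S(2)] by blast
 have gU: "g y : U" if "y : V" for y using *(6) that by (auto simp: homeomorphism_def)
 have bij: "bij (FD f (at x))" if "x : U" for x
  using *(2,6) *(9)[of "f x"] that f' by (metis (no_types, lifting) homeomorphism_apply1 homeomorphism_image1 imageI subsetD)
 have gS: "g y : S" if "y : V" for y using gU[OF that] *(2) by blast
 have lin: "linear (FD f (at (g y)))" if "y : V" for y using d[OF gS[OF that]] has_derivative_linear by blast
 have "C_k_on k V g" for k
 proof (induction k)
  case 0
  thus ?case using *(6) by (auto simp: homeomorphism_def)
 next
  case (Suc k)
  show ?case
  proof (rule C_k_on_SucI[OF *(4)])
   show "(g has_derivative inv (FD f (at (g y)))) (at y)" if "y : V" for y using *(7,8)[OF that] f'[OF gS[OF that]] by simp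
   have "C_k_on k V (%y. FD f (at (g y)) v)" for v by (rule C_k_on_compose[OF *(4) S(1) _ Suc])
     (use gS smooth_on_FD[OF f] in \<open>auto simp: smooth_on_def\<close>)
   thus "C_k_on k V (%y. inv (FD f (at (g y))) v)" for v by (intro C_k_on_inverse_family[OF lin bij[OF gU] *(4)]) auto
  qed
 qed
 hence "smooth_on V g" by (simp add: smooth_on_def)
 with * bij show ?thesis using that by blast
qed

subsection \<open>Symmetry of second derivatives\<close>

lemma deriv_along_line:
 assumes "(f has_derivative f') (at (p + t *R v))"
 shows "((%t. f (p + t *R v)) has_vector_derivative f' v) (at t)"
proof -
 have "((%t. p + t *R v) has_derivative (%k. k *R v)) (at t)" by (auto intro!: derivative_eq_intros)
 from has_derivative_compose[where f="%t. p + t *R v", OF this assms]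
 show ?thesis using linear_cmul[OF has_derivative_linear[OF assms]] by (simp add: has_vector_derivative_def)
qed

text \<open>Two applications of the mean value theorem turn the second difference into
  \<open>h^2\<close> times a mixed derivative at a nearby point. The second difference is symmetric
  in \<open>u\<close> and \<open>v\<close>; this is how \<open>FD_commute_real\<close> obtains
  symmetry of the limit.\<close>

lemma second_difference_quotient_tendsto:
 fixes f :: "'a::euclidean_space => real"
 assumes S: "open S" "x : S" and f: "smooth_on S f"
 shows "((%h. (f (x + h *R u + h *R v) - f (x + h *R u) - f (x + h *R v) + f x) / h\<^sup>2)
   \<longlongrightarrow> FD (%z. FD f (at z) u) (at x) v) (at_right 0)"
proof -
 let ?D = "%z. FD f (at z) u"
 let ?D2 = "%z. FD ?D (at z) v"
 obtain e where e: "e > 0" "ball x e \<subseteq> S" using S open_contains_ball by blast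
 define d where "d = e / (norm u + norm v + 1)"
 have d: "d > 0" unfolding d_def using e by (simp add: add_nonneg_pos)
 have inS: "x + s *R u + t *R v : S" if "0 <= s" "s <= h" "0 <= t" "t <= h" "h < d" for s t h
 proof -
  have "norm (s *R u + t *R v) <= s * norm u + t * norm v" using that by (metis abs_of_nonneg norm_scaleR norm_triangle_ineq)
  also have "\<dots> <= h * norm u + h * norm v" using that by (intro add_mono mult_right_mono) auto
  also have "\<dots> <= h * (norm u + norm v + 1)" using that by (simp add: algebra_simps)
  also have "\<dots> < d * (norm u + norm v + 1)" using that by (intro mult_strict_right_mono) (auto simp: add_nonneg_pos)
  also have "\<dots> = e" by (simp add: d_def add_nonneg_eq_0_iff)
  finally have "dist x (x + s *R u + t *R v) < e" by (simp add: dist_norm algebra_simps norm_minus_commute[of 0])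
    (metis (no_types, lifting) add.commute minus_add_distrib norm_minus_cancel uminus_add_conv_diff)
  thus ?thesis using e by auto
 qed
 have "EX s t. 0 <= s & s <= h & 0 <= t & t <= h &
   (f (x + h *R u + h *R v) - f (x + h *R u) - f (x + h *R v) + f x) / h\<^sup>2 = ?D2 (x + s *R u + t *R v)"
  if h: "0 < h" "h < d" for h
 proof -
  define ph where "ph = (%s. f (x + s *R u + h *R v) - f (x + s *R u + 0 *R v))"
  have "EX s. 0 < s & s < h & ph h - ph 0 = (h - 0) * (?D (x + s *R u + h *R v) - ?D (x + s *R u + 0 *R v))"
  proof (rule MVT2[OF h(1)])
   fix s assume s: "0 <= s" "s <= h"
   have *: "((%s. f (x + s *R u + t *R v)) has_real_derivative ?D (x + s *R u + t *R v)) (at s)"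
    if "0 <= t" "t <= h" for t
   proof -
    have "x + s *R u + t *R v = (x + t *R v) + s *R u" for s by simp
    note eq = this
    show ?thesis unfolding eq using deriv_along_line[where f=f and p="x + t *R v" and t=s and v=u]
      smooth_on_deriv[OF f S(1) inS[OF s that h(2)], unfolded eq]
     by (simp only: has_real_derivative_iff_has_vector_derivative)
   qed
   show "(ph has_real_derivative (?D (x + s *R u + h *R v) - ?D (x + s *R u + 0 *R v))) (at s)"
    unfolding ph_def using h by (intro DERIV_diff *) auto
  qed
  then obtain s where s: "0 < s" "s < h"
   "ph h - ph 0 = h * (?D (x + s *R u + h *R v) - ?D (x + s *R u + 0 *R v))" by auto
  have "EX t. 0 < t & t < h & ?D (x + s *R u + h *R v) - ?D (x + s *R u + 0 *R v) = (h - 0) * ?D2 (x + s *R u + t *R v)"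
  proof (rule MVT2[OF h(1)])
   fix t assume t: "0 <= t" "t <= h"
   have sh: "0 <= s" "s <= h" using s by auto
   show "((%t. ?D (x + s *R u + t *R v)) has_real_derivative ?D2 (x + s *R u + t *R v)) (at t)"
    using deriv_along_line[where f="?D", OF
      smooth_on_deriv[OF smooth_on_FD[OF f] S(1) inS[OF sh t h(2)]]]
    by (simp add: has_real_derivative_iff_has_vector_derivative)
  qed
  then obtain t where t: "0 < t" "t < h"
   "?D (x + s *R u + h *R v) - ?D (x + s *R u + 0 *R v) = h * ?D2 (x + s *R u + t *R v)" by auto
  have "ph h - ph 0 = h\<^sup>2 * ?D2 (x + s *R u + t *R v)" using s(3) t(3) by (simp add: power2_eq_square)
  moreover have "ph h - ph 0 = f (x + h *R u + h *R v) - f (x + h *R u) - f (x + h *R v) + f x" by (simp add: ph_def)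
  ultimately show ?thesis using s t h by (intro exI[of _ s] exI[of _ t]) auto
 qed
 then obtain s t where st: "!!h. 0 < h ==> h < d ==> 0 <= s h & s h <= h & 0 <= t h & t h <= h &
   (f (x + h *R u + h *R v) - f (x + h *R u) - f (x + h *R v) + f x) / h\<^sup>2 = ?D2 (x + s h *R u + t h *R v)" by metis
 have evd: "eventually (%h. 0 < h & h < d) (at_right (0::real))" using d by (auto simp: eventually_at_right_field)
 have id0: "((%h. h) \<longlongrightarrow> (0::real)) (at_right 0)" by (rule tendsto_ident_at)
 have "(s \<longlongrightarrow> 0) (at_right 0)" "(t \<longlongrightarrow> 0) (at_right 0)"
  by (rule tendsto_sandwich[OF _ _ tendsto_const id0]; use evd st in \<open>auto elim!: eventually_mono\<close>)+
 hence "((%h. x + s h *R u + t h *R v) \<longlongrightarrow> x + 0 *R u + 0 *R v) (at_right 0)" by (intro tendsto_intros)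
 moreover have "isCont ?D2 x" using smooth_on_cont[OF smooth_on_FD[OF smooth_on_FD[OF f]]]
   S continuous_on_eq_continuous_at by blast
 ultimately have "((%h. ?D2 (x + s h *R u + t h *R v)) \<longlongrightarrow> ?D2 x) (at_right 0)"
  by (auto intro: isCont_tendsto_compose)
 thus ?thesis by (rule Lim_transform_eventually) (use evd st in \<open>auto elim!: eventually_mono\<close>)
qed

lemma FD_commute_real:
 fixes f :: "'a::euclidean_space => real"
 assumes S: "open S" "x : S" and f: "smooth_on S f"
 shows "FD (%z. FD f (at z) u) (at x) v
    = FD (%z. FD f (at z) v) (at x) u"
proof -
 have "(%h. (f (x + h *R v + h *R u) - f (x + h *R v) - f (x + h *R u) + f x) / h\<^sup>2)
   = (%h. (f (x + h *R u + h *R v) - f (x + h *R u) - f (x + h *R v) + f x) / h\<^sup>2)" by (simp add: algebra_simps)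
 thus ?thesis using tendsto_unique[OF trivial_limit_at_right_real second_difference_quotient_tendsto[OF assms, of u v]]
   second_difference_quotient_tendsto[OF assms, of v u] by simp
qed

lemma FD_inner_left:
 assumes "f differentiable at x"
 shows "FD (%z. f z *. e) (at x) v = FD f (at x) v *. e"
proof -
 have "((%z. f z *. e) has_derivative (%v. FD f (at x) v *. e)) (at x)"
  using assms by (intro has_derivative_inner_left) (simp add: frechet_derivative_works)
 thus ?thesis by (metis frechet_derivative_at)
qed

lemma FD_commute:
 fixes f :: "'a::euclidean_space => 'b::euclidean_space"
 assumes S: "open S" "x : S" and f: "smooth_on S f"
 shows "FD (%z. FD f (at z) u) (at x) v
    = FD (%z. FD f (at z) v) (at x) u"
proof (rule euclidean_eqI)
 fix e :: 'b
 have sm: "smooth_on S (%z. f z *. e)" by (intro smooth_intros S f)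
 have "FD (%z. FD f (at z) u) (at x) v *. e
   = FD (%z. FD (%z. f z *. e) (at z) u) (at x) v" for u v
 proof -
  have "FD (%z. FD f (at z) u) (at x) v *. e
   = FD (%z. FD f (at z) u *. e) (at x) v" using smooth_on_diffable[OF smooth_on_FD[OF f] S] by (subst FD_inner_left) auto
  also have "(%z. FD f (at z) u *. e) differentiable at x"
   using smooth_on_diffable[OF smooth_on_inner[OF S(1) smooth_on_FD[OF f] smooth_on_const[OF S(1)]] S] .
  from frechet_derivative_transform_within_open[OF this S, of "%z. FD (%z. f z *. e) (at z) u"]
  have "FD (%z. FD f (at z) u *. e) (at x)
    = FD (%z. FD (%z. f z *. e) (at z) u) (at x)" using FD_inner_left[OF smooth_on_diffable[OF f S(1)]] by auto
  finally show ?thesis .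
 qed
 thus "FD (%z. FD f (at z) u) (at x) v *. e
    = FD (%z. FD f (at z) v) (at x) u *. e" using FD_commute_real[OF S sm] by simp
qed

subsection \<open>The functions \<open>cos \<surd>s\<close> and \<open>sin \<surd>s / \<surd>s\<close>\<close>

text \<open>The class \<open>F\<close> admits a constant factor \<open>k\<close> in order to absorb
  the direction \<open>v\<close> of the derivative; it is then closed under directional
  derivatives.\<close>

lemma smooth_on_power_series:
 fixes c :: "nat => real"
 assumes "!!x. summable (%n. c n * x ^ n)"
 shows "smooth_on UNIV (%x. \<Sum>n. c n * x ^ n)"
proof -
 define F where "F = {%x::real. k * (\<Sum>n. c n * x ^ n) | k c. ALL x. summable (%n. c n * x ^ n)}"
 have "(%x. \<Sum>n. c n * x ^ n) : F" unfolding F_def using assms by (auto intro!: exI[of _ 1] exI[of _ c])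
 thus ?thesis
 proof (rule smooth_on_coinduct[rotated])
  fix f assume "f : F"
  then obtain k c where f: "f = (%x. k * (\<Sum>n. c n * x ^ n))" and s: "!!x. summable (%n. c n * x ^ n)"
   unfolding F_def by auto
  let ?f' = "%x v. k * v * (\<Sum>n. diffs c n * x ^ n)"
  have "(f has_derivative ?f' x) (at x)" for x
  proof -
   have "(f has_real_derivative (k * (\<Sum>n. diffs c n * x ^ n))) (at x)"
    unfolding f by (intro DERIV_cmult termdiffs_strong_converges_everywhere s)
   thus ?thesis by (simp add: real_deriv_iff ac_simps)
  qed
  moreover have "(%x. ?f' x v) : F" for v unfolding F_def using termdiff_converges_all[OF s] by blast
  ultimately show "EX f'. (ALL x:UNIV. (f has_derivative f' x) (at x)) & (ALL v. (%x. f' x v) : F)"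
   by (intro exI[of _ ?f'] conjI ballI allI)
 qed auto
qed

text \<open>The entire function with \<open>cos_sqrt (x^2) = cos x\<close>. Evaluated at squared
  norms, it and \<open>sinc_sqrt\<close> make the exponential map of a sphere smooth also at the
  zero vector, where the norm is not differentiable.\<close>

definition cos_sqrt :: "real => real" where
 "cos_sqrt s = (\<Sum>n. (- 1) ^ n / fact (2 * n) * s ^ n)"

definition sinc_sqrt :: "real => real" where
 "sinc_sqrt s = (\<Sum>n. (- 1) ^ n / fact (2 * n + 1) * s ^ n)"

text \<open>Every real, negative ones included, is smaller in absolute value than some square, here
  \<open>(|s| + 1)^2\<close>, and a power series converges strictly inside any radius where it
  converges.\<close>

lemma summable_all_of_squares:
 fixes c :: "nat => real"
 assumes "!!x. summable (%n. c n * (x\<^sup>2) ^ n)"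
 shows "summable (%n. c n * s ^ n)"
proof (rule powser_inside[of c "(\<bar>s\<bar> + 1)\<^sup>2"])
 have "\<bar>s\<bar> < 1 + 2 * \<bar>s\<bar> + \<bar>s\<bar>\<^sup>2"
  using zero_le_power2[of "\<bar>s\<bar>"] abs_ge_zero[of s] by linarith
 hence "\<bar>s\<bar> < (\<bar>s\<bar> + 1)\<^sup>2" by (simp add: power2_eq_square algebra_simps)
 thus "norm s < norm ((\<bar>s\<bar> + 1)\<^sup>2)" by simp
qed (rule assms)

lemma cos_sqrt_sums: fixes x :: real shows "(%n. (- 1) ^ n / fact (2 * n) * (x\<^sup>2) ^ n) sums cos x"
 using cos_paired[of x] by (simp add: power_mult)

lemma sinc_sqrt_sums: fixes x :: real shows "x ~= 0 ==> (%n. (- 1) ^ n / fact (2 * n + 1) * (x\<^sup>2) ^ n) sums (sin x / x)"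
 using sums_divide[OF sin_paired[of x], of x] by (simp add: power_mult)

lemma cos_sqrt_square [simp]: "cos_sqrt (x\<^sup>2) = cos x" unfolding cos_sqrt_def using cos_sqrt_sums sums_unique by metis

lemma sinc_sqrt_0 [simp]: "sinc_sqrt 0 = 1"
 unfolding sinc_sqrt_def using powser_zero[of "%n. (- 1) ^ n / fact (2 * n + 1) :: real"] by simp

lemma sinc_sqrt_square: "x * sinc_sqrt (x\<^sup>2) = sin x"
proof (cases "x = 0")
 case False
 have "sinc_sqrt (x\<^sup>2) = sin x / x"
  unfolding sinc_sqrt_def by (rule sums_unique[OF sinc_sqrt_sums[OF False], symmetric])
 thus ?thesis using False by simp
qed simp

lemma cos_sqrt_0 [simp]: "cos_sqrt 0 = 1" using cos_sqrt_square[of 0] by simp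

lemma smooth_on_cos_sqrt: "smooth_on UNIV cos_sqrt"
proof -
 have "summable (%n. (- 1) ^ n / fact (2 * n) * s ^ n)" for s :: real
  by (rule summable_all_of_squares) (use cos_sqrt_sums sums_summable in blast)
 from smooth_on_power_series[OF this] show ?thesis by (simp add: cos_sqrt_def[abs_def])
qed

lemma smooth_on_sinc_sqrt: "smooth_on UNIV sinc_sqrt"
proof -
 have "summable (%n. (- 1) ^ n / fact (2 * n + 1) * (x\<^sup>2) ^ n)" for x :: real
  using sums_summable[OF sinc_sqrt_sums[of x]]
   powser_sums_zero[of "%n. (- 1) ^ n / fact (2 * n + 1) :: real", THEN sums_summable] by (cases "x = 0") auto
 hence "summable (%n. (- 1) ^ n / fact (2 * n + 1) * s ^ n)" for s :: real by (rule summable_all_of_squares)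
 from smooth_on_power_series[OF this] show ?thesis by (simp add: sinc_sqrt_def[abs_def])
qed

section \<open>Geometry of round spheres\<close>

lemma has_vector_derivative_quotient_tendsto:
 assumes "(f has_vector_derivative d) (at t within A)"
 shows "((%s. (f s - f t) /\<^sub>R (s - t)) \<longlongrightarrow> d) (at t within A)"
proof (rule iffD2[OF Lim_null])
 have "((%s. norm ((f s - f t - (s - t) *R d) /\<^sub>R \<bar>s - t\<bar>)) \<longlongrightarrow> 0) (at t within A)"
  using assms unfolding has_vector_derivative_def has_derivative_iff_norm by (auto simp: divide_inverse mult.commute)
 moreover have "eventually (%s. norm ((f s - f t - (s - t) *R d) /\<^sub>R \<bar>s - t\<bar>) = norm ((f s - f t) /\<^sub>R (s - t) - d)) (at t within A)"
 proof -
  have "norm ((f s - f t - (s - t) *R d) /\<^sub>R \<bar>s - t\<bar>) = norm ((f s - f t) /\<^sub>R (s - t) - d)" if "s ~= t" for s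
  proof -
   have "(f s - f t) /\<^sub>R (s - t) - d = (f s - f t - (s - t) *R d) /\<^sub>R (s - t)"
    using that by (simp add: scaleR_diff_right)
   thus ?thesis by simp
  qed
  thus ?thesis by (auto simp: eventually_at intro: exI[of _ 1])
 qed
 ultimately have "((%s. norm ((f s - f t) /\<^sub>R (s - t) - d)) \<longlongrightarrow> 0) (at t within A)"
  by (rule Lim_transform_eventually)
 thus "((%s. (f s - f t) /\<^sub>R (s - t) - d) \<longlongrightarrow> 0) (at t within A)" by (rule tendsto_norm_zero_cancel)
qed

text \<open>Real induction: the supremum of the times up to which \<open>Q\<close> holds throughout
  is itself reached by \<open>left\<close>, and cannot lie below \<open>b\<close> by
  \<open>right\<close>. It propagates length estimates along curves while small errors
  accumulate.\<close>

lemma real_induct_closed: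
 fixes a b :: real
 assumes "a <= b" "Q a"
  and left: "!!t. a < t ==> t <= b ==> (!!s. a <= s ==> s < t ==> Q s) ==> Q t"
  and right: "!!t. a <= t ==> t < b ==> Q t ==> EX d>0. ALL s. t < s & s < t + d & s <= b --> Q s"
 shows "Q b"
proof -
 define A where "A = {t : {a..b}. ALL s:{a..t}. Q s}"
 have aA: "a : A" using assms(1,2) by (auto simp: A_def)
 have bdd: "bdd_above A" by (auto simp: A_def intro!: bdd_aboveI[of _ b])
 define m where "m = Sup A"
 have am: "a <= m" unfolding m_def using aA bdd by (rule cSup_upper)
 have mb: "m <= b" unfolding m_def using aA by (intro cSup_least) (auto simp: A_def)
 have below: "Q s" if s: "a <= s" "s < m" for s
 proof -
  obtain t where "t : A" "s < t" using s(2) aA bdd unfolding m_def by (metis less_cSup_iff empty_iff)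
  thus ?thesis using s by (auto simp: A_def)
 qed
 have Qm: "Q m"
 proof (cases "m = a")
  case False
  thus ?thesis using left[of m] below am mb by auto
 qed (use assms(2) in simp)
 show ?thesis
 proof (cases "m = b")
  case False
  hence "m < b" using mb by simp
  from right[OF am this Qm] obtain d where d: "d > 0" "!!s. m < s ==> s < m + d ==> s <= b ==> Q s" by blast
  define t where "t = min b (m + d / 2)"
  have t: "m < t" "t < m + d" "t <= b" using d(1) \<open>m < b\<close> by (auto simp: t_def)
  have "Q s" if "s : {a..t}" for s using that below[of s] Qm d(2)[of s] t by (cases s m rule: linorder_cases) auto
  hence "t : A" using t am by (auto simp: A_def)
  hence "t <= m" unfolding m_def using bdd by (intro cSup_upper)
  thus ?thesis using t by simp
 qed (use Qm in simp)
qed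

section \<open>Angular distance on a round sphere and lengths of curves\<close>

definition angle :: "real => 'a::euclidean_space => 'a => real" where
 "angle R x y = arccos (x *. y / R\<^sup>2)"

context
 fixes R :: real
 assumes R: "R > 0"
begin

lemma inner_div_bounds:
 assumes "norm x = R" "norm y = R"
 shows "-1 <= x *. y / R\<^sup>2" "x *. y / R\<^sup>2 <= 1"
 using Cauchy_Schwarz_ineq2[of x y] assms R by (auto simp: field_simps power2_eq_square abs_le_iff)

lemma angle_bounds:
 assumes "norm x = R" "norm y = R"
 shows "0 <= angle R x y" "angle R x y <= pi" "cos (angle R x y) = x *. y / R\<^sup>2"
 using inner_div_bounds[OF assms] by (auto simp: angle_def arccos_lbound arccos_ubound)

lemma angle_self: "norm x = R ==> angle R x x = 0" using R by (simp add: angle_def dot_square_norm power2_eq_square)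

text \<open>The parts of \<open>x\<close> and \<open>z\<close> orthogonal to \<open>y\<close> have
  norms \<open>R * sin\<close> of the two angles. Cauchy-Schwarz for these parts bounds the inner
  product of \<open>x\<close> and \<open>z\<close> from below by \<open>R^2 * cos\<close> of the sum
  of the angles.\<close>

lemma angle_triangle:
 assumes x: "norm x = R" and y: "norm y = R" and z: "norm z = R"
 shows "angle R x z <= angle R x y + angle R y z"
proof (cases "angle R x y + angle R y z <= pi")
 case False
 thus ?thesis using angle_bounds[OF x z] by linarith
next
 case True
 let ?a = "angle R x y" and ?b = "angle R y z"
 let ?u = "x - (cos ?a) *R y" and ?w = "z - (cos ?b) *R y"
 note a = angle_bounds[OF x y] and b = angle_bounds[OF y z]
 have sq: "x *. x = R\<^sup>2" "y *. y = R\<^sup>2" "z *. z = R\<^sup>2" using x y z by (auto simp: dot_square_norm)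
 have xy: "x *. y = cos ?a * R\<^sup>2" "y *. z = cos ?b * R\<^sup>2" using a b R by auto
 have "?u *. ?u = x *. x - 2 * cos ?a * (x *. y) + (cos ?a)\<^sup>2 * (y *. y)"
  by (simp add: inner_diff inner_commute power2_eq_square algebra_simps)
 also have "\<dots> = (R * sin ?a)\<^sup>2" unfolding sq xy using sin_cos_squared_add[of ?a] by algebra
 finally have nu: "norm ?u = R * sin ?a"
  using R a sin_ge_zero by (simp add: norm_eq_sqrt_inner real_sqrt_abs2 power2_eq_square)
 have "?w *. ?w = z *. z - 2 * cos ?b * (y *. z) + (cos ?b)\<^sup>2 * (y *. y)"
  by (simp add: inner_diff inner_commute power2_eq_square algebra_simps)
 also have "\<dots> = (R * sin ?b)\<^sup>2" unfolding sq xy using sin_cos_squared_add[of ?b] by algebra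
 finally have nw: "norm ?w = R * sin ?b"
  using R b sin_ge_zero by (simp add: norm_eq_sqrt_inner real_sqrt_abs2 power2_eq_square)
 have "?u *. ?w = x *. z - cos ?b * (x *. y) - cos ?a * (y *. z) + cos ?a * cos ?b * (y *. y)"
  by (simp add: inner_diff inner_commute algebra_simps)
 also have "\<dots> = x *. z - cos ?a * cos ?b * R\<^sup>2" unfolding sq xy by (simp add: algebra_simps)
 finally have "x *. z - cos ?a * cos ?b * R\<^sup>2 >= - (R * sin ?a * (R * sin ?b))"
  using Cauchy_Schwarz_ineq2[of ?u ?w] nu nw by (simp add: abs_le_iff)
 hence "x *. z / R\<^sup>2 >= cos (?a + ?b)" using R by (simp add: cos_add field_simps power2_eq_square)
 hence "arccos (x *. z / R\<^sup>2) <= arccos (cos (?a + ?b))"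
  using inner_div_bounds[OF x z] by (intro arccos_le_arccos) (auto intro: order_trans[OF _ cos_ge_minus_one])
 thus ?thesis using True a b by (simp add: angle_def arccos_cos)
qed

lemma chord_angle:
 assumes "norm x = R" "norm y = R"
 shows "norm (x - y) = 2 * R * sin (angle R x y / 2)"
proof -
 have "(norm (x - y))\<^sup>2 = x *. x - 2 * (x *. y) + y *. y"
  by (simp add: power2_norm_eq_inner inner_diff inner_commute algebra_simps)
 also have "\<dots> = 2 * R\<^sup>2 * (1 - cos (angle R x y))"
  using angle_bounds(3)[OF assms] R by (simp add: dot_square_norm assms field_simps)
 also have "cos (angle R x y) = 1 - 2 * (sin (angle R x y / 2))\<^sup>2" using cos_double_sin[of "angle R x y / 2"] by simp
 finally have "(norm (x - y))\<^sup>2 = (2 * R * sin (angle R x y / 2))\<^sup>2" by (simp add: power_mult_distrib)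
 moreover have "0 <= sin (angle R x y / 2)" using angle_bounds[OF assms] by (intro sin_ge_zero) auto
 ultimately show ?thesis using R by (simp add: power2_eq_iff_nonneg)
qed

lemma chord_le_angle:
 assumes "norm x = R" "norm y = R"
 shows "norm (x - y) <= R * angle R x y" unfolding chord_angle[OF assms]
 using R sin_x_le_x[of "angle R x y / 2"] angle_bounds(1)[OF assms] by (simp add: field_simps)

text \<open>By \<open>chord_angle\<close> the chord determines the angle through
  \<open>arcsin\<close>, so the limit of \<open>arcsin h / h\<close> at 0 gives a bound that is
  uniform over all pairs of points.\<close>

lemma angle_le_chord_eventually:
 assumes "et > 0"
 shows "EX d>0. ALL x y. norm x = R & norm y = R & norm (x - y :: 'a::euclidean_space) < d
   --> R * angle R x y <= (1 + et) * norm (x - y)"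
proof -
 have "(arcsin has_real_derivative 1) (at 0)" using DERIV_arcsin[of 0] by simp
 hence "((%h. arcsin h / h) \<longlongrightarrow> 1) (at 0)" by (simp add: DERIV_def)
 hence "eventually (%h. arcsin h / h < 1 + et) (at 0)" using assms by (intro order_tendstoD) auto
 then obtain d where d: "d > 0" "!!h. h ~= 0 ==> \<bar>h\<bar> < d ==> arcsin h / h < 1 + et"
  by (auto simp: eventually_at dist_real_def)
 have "R * angle R x y <= (1 + et) * norm (x - y)"
  if x: "norm x = R" and y: "norm y = R" and xy: "norm (x - y :: 'a) < 2 * R * d" for x y
 proof -
  define h where "h = sin (angle R x y / 2)"
  have h: "norm (x - y) = 2 * R * h" unfolding h_def by (rule chord_angle[OF x y])
  have as: "arcsin h = angle R x y / 2" unfolding h_def using angle_bounds[OF x y] by (intro arcsin_sin) auto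
  have "h >= 0" using h R by (metis norm_ge_zero zero_le_mult_iff mult_pos_pos not_less zero_less_numeral)
  show ?thesis
  proof (cases "h = 0")
   case True
   hence "angle R x y = 0" using as by simp
   thus ?thesis using h True by simp
  next
   case False
   have "\<bar>h\<bar> < d" using xy h R \<open>h >= 0\<close> by simp
   from d(2)[OF False this] have "arcsin h < (1 + et) * h" using \<open>h >= 0\<close> False by (simp add: field_simps)
   hence "R * angle R x y <= R * (2 * ((1 + et) * h))" using as R by simp
   thus ?thesis unfolding h by (simp add: algebra_simps)
  qed
 qed
 thus ?thesis using d(1) R by (intro exI[of _ "2 * R * d"]) auto
qed

text \<open>Real induction with slack \<open>ep * t\<close>: over a short time the angle is compared
  with the chord, and the chord with the speed. Length enters through a function \<open>g\<close>
  whose derivative dominates the speed.\<close>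

lemma angle_le_length:
 fixes ka :: "real => 'a::euclidean_space"
 assumes sph: "!!t. t : {0..1} ==> norm (ka t) = R"
  and der: "!!t. t : {0..1} ==> (ka has_vector_derivative ka' t) (at t)"
  and g: "!!t. t : {0..1} ==> (g has_real_derivative g' t) (at t)"
  and le: "!!t. t : {0..1} ==> norm (ka' t) <= g' t"
 shows "R * angle R (ka 0) (ka 1) <= g 1 - g 0"
proof (rule field_le_epsilon)
 fix ep :: real assume ep: "ep > 0"
 let ?f = "%t. R * angle R (ka 0) (ka t)"
 define Q where "Q = (%t. ?f t <= g t - g 0 + ep * t)"
 have cka: "isCont ka t" if "t : {0..1}" for t using der[OF that] has_vector_derivative_continuous by blast
 have cg: "isCont g t" if "t : {0..1}" for t using g[OF that] DERIV_isCont by blast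
 have "Q 1"
 proof (rule real_induct_closed[of 0 1])
  show "Q 0" using angle_self[OF sph[of 0]] by (simp add: Q_def)
 next
  fix t assume t: "0 < t" "t <= 1" and Q: "!!s. 0 <= s ==> s < t ==> Q s"
  have t1: "t : {0..1}" using t by auto
  have ev: "eventually (%s. 0 < s & s < t) (at_left t)" using t by (auto simp: eventually_at_left_field)
  have kat: "(ka \<longlongrightarrow> ka t) (at_left t)" "(g \<longlongrightarrow> g t) (at_left t)"
   using cka[OF t1] cg[OF t1] by (auto simp: isCont_def intro: filterlim_mono[OF _ order_refl at_le])
  have "((%s. R * arccos (ka 0 *. ka s / R\<^sup>2)) \<longlongrightarrow> R * arccos (ka 0 *. ka t / R\<^sup>2)) (at_left t)"
  proof (intro tendsto_mult tendsto_const continuous_on_tendsto_compose[OF continuous_on_arccos'] tendsto_divide tendsto_inner kat)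
   show "ka 0 *. ka t / R\<^sup>2 : {-1..1}" using inner_div_bounds[OF sph sph, of 0 t] t1 by auto
   show "eventually (%s. ka 0 *. ka s / R\<^sup>2 : {-1..1}) (at_left t)"
    using ev by eventually_elim (use inner_div_bounds[OF sph sph, of 0] t in auto)
  qed (use R in auto)
  hence lf: "(?f \<longlongrightarrow> ?f t) (at_left t)" by (simp add: angle_def)
  have "((%s. g s - g 0 + ep * s) \<longlongrightarrow> g t - g 0 + ep * t) (at_left t)" by (intro tendsto_intros kat)
  hence "?f t <= g t - g 0 + ep * t"
   by (rule tendsto_le[OF trivial_limit_at_left_real _ lf]) (use ev Q in \<open>auto simp: Q_def elim: eventually_mono\<close>)
  thus "Q t" by (simp add: Q_def)
 next
  fix t assume t: "0 <= t" "t < 1" and Qt: "Q t"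
  have t1: "t : {0..1}" using t by auto
  define m where "m = norm (ka' t)"
  \<comment> \<open>Chosen so that the two errors, angle against chord and difference quotient
    against speed, together cost at most \<open>ep / 2\<close>; the difference quotient of
    \<open>g\<close> spends the other half.\<close>
  define et where "et = min 1 (ep / (2 * (m + 2)))"
  have m0: "m >= 0" by (simp add: m_def)
  have et: "et > 0" "et <= 1" using ep m0 by (auto simp: et_def)
  have "et * (m + 2) <= ep / 2"
  proof -
   have "et <= ep / (2 * (m + 2))" by (simp add: et_def)
   thus ?thesis using m0 by (simp add: field_simps)
  qed
  hence prod: "(1 + et) * (m + et) <= m + ep / 2"
  proof -
   assume "et * (m + 2) <= ep / 2"
   hence 1: "et * m + 2 * et <= ep / 2" by (simp add: algebra_simps)
   have 2: "et * et <= et" using et by (simp add: mult_left_le)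
   have "(1 + et) * (m + et) = m + et * m + et + et * et" by (simp add: algebra_simps)
   thus "(1 + et) * (m + et) <= m + ep / 2" using 1 2 by simp
  qed
  obtain d0 where d0: "d0 > 0" "!!x y. norm x = R ==> norm y = R ==> norm (x - y :: 'a) < d0
    ==> R * angle R x y <= (1 + et) * norm (x - y)" using angle_le_chord_eventually[OF et(1)] by metis
  have "((%s. (ka s - ka t) /\<^sub>R (s - t)) \<longlongrightarrow> ka' t) (at t)"
   by (rule has_vector_derivative_quotient_tendsto[OF der[OF t1]])
  from tendsto_norm[OF this] have "eventually (%s. norm ((ka s - ka t) /\<^sub>R (s - t)) < m + et) (at t)"
   using et by (intro order_tendstoD) (auto simp: m_def)
  moreover have "((%s. (g s - g t) / (s - t)) \<longlongrightarrow> g' t) (at t)"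
   using g[OF t1] by (simp add: has_field_derivative_iff)
  hence "eventually (%s. (g s - g t) / (s - t) > g' t - ep / 2) (at t)" using ep by (intro order_tendstoD) auto
  moreover have "((%s. norm (ka s - ka t)) \<longlongrightarrow> norm (ka t - ka t)) (at t)"
   using cka[OF t1] unfolding isCont_def by (intro tendsto_intros)
  hence "eventually (%s. norm (ka s - ka t) < d0) (at t)" using d0(1) by (intro order_tendstoD) auto
  ultimately have "eventually (%s. norm ((ka s - ka t) /\<^sub>R (s - t)) < m + et & (g s - g t) / (s - t) > g' t - ep / 2
    & norm (ka s - ka t) < d0) (at t)" by eventually_elim auto
  then obtain d where d: "d > 0" "!!s. s ~= t ==> dist s t < d ==> norm ((ka s - ka t) /\<^sub>R (s - t)) < m + et & (g s - g t) / (s - t) > g' t - ep / 2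
    & norm (ka s - ka t) < d0" unfolding eventually_at by blast
  have "Q s" if s: "t < s" "s < t + d" "s <= 1" for s
  proof -
   have s1: "s : {0..1}" using s t by auto
   note ds = d(2)[of s]
   have st: "s ~= t" "dist s t < d" using s by (auto simp: dist_real_def)
   have 1: "norm (ka t - ka s) <= (m + et) * (s - t)"
   proof -
    have "norm ((ka s - ka t) /\<^sub>R (s - t)) = norm (ka t - ka s) / (s - t)"
     unfolding norm_scaleR using s by (simp add: divide_inverse mult.commute norm_minus_commute)
    hence "norm (ka t - ka s) / (s - t) < m + et" using ds[OF st] by simp
    thus ?thesis using s by (simp add: pos_divide_less_eq)
   qed
   have 2: "(g' t - ep / 2) * (s - t) <= g s - g t" using ds[OF st] s by (simp add: field_simps)
   have "R * angle R (ka t) (ka s) <= (1 + et) * norm (ka t - ka s)"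
    using ds[OF st] by (intro d0 sph t1 s1) (simp add: norm_minus_commute)
   also have "\<dots> <= (1 + et) * ((m + et) * (s - t))" using 1 et by (intro mult_left_mono) auto
   also have "\<dots> <= (m + ep / 2) * (s - t)" using prod s by (simp add: mult.assoc[symmetric] mult_right_mono)
   also have "\<dots> <= (g' t + ep / 2) * (s - t)" using le[OF t1] s by (intro mult_right_mono) (auto simp: m_def)
   also have "\<dots> = (g' t - ep / 2) * (s - t) + ep * (s - t)" by (simp add: field_simps)
   also have "\<dots> <= g s - g t + ep * (s - t)" using 2 by simp
   finally have "R * angle R (ka t) (ka s) <= g s - g t + ep * (s - t)" .
   moreover have "?f s <= ?f t + R * angle R (ka t) (ka s)"
    using angle_triangle[of "ka 0" "ka t" "ka s"] sph t1 s1 R by (simp add: distrib_left[symmetric])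
   ultimately show ?thesis using Qt by (simp add: Q_def algebra_simps)
  qed
  thus "EX d>0. ALL s. t < s & s < t + d & s <= 1 --> Q s" using d(1) by blast
 qed simp
 thus "?f 1 <= g 1 - g 0 + ep" by (simp add: Q_def)
qed

text \<open>Cauchy-Schwarz between length and energy, in the form
  \<open>2 * norm (ka' t) * l <= g' t + l^2\<close> for every \<open>l > 0\<close>. The right choice
  of \<open>l\<close> is the distance itself, so distance 0 is treated apart.\<close>

lemma angle_square_le_energy:
 fixes ka :: "real => 'a::euclidean_space"
 assumes sph: "!!t. t : {0..1} ==> norm (ka t) = R"
  and der: "!!t. t : {0..1} ==> (ka has_vector_derivative ka' t) (at t)"
  and g: "!!t. t : {0..1} ==> (g has_real_derivative g' t) (at t)"
  and le: "!!t. t : {0..1} ==> (norm (ka' t))\<^sup>2 <= g' t"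
 shows "(R * angle R (ka 0) (ka 1))\<^sup>2 <= g 1 - g 0"
proof -
 let ?f = "R * angle R (ka 0) (ka 1)"
 have f0: "0 <= ?f" using angle_bounds[OF sph sph] R by simp
 have *: "?f <= ((g 1 - g 0) / l + l) / 2" if l: "l > 0" for l
 proof -
  have "?f <= (g 1 / l + l * 1) / 2 - (g 0 / l + l * 0) / 2"
  proof (rule angle_le_length[OF sph der])
   fix t :: real assume t: "t : {0..1}"
   show "((%t. (g t / l + l * t) / 2) has_real_derivative ((g' t / l + l) / 2)) (at t)"
    using l by (auto intro!: derivative_eq_intros g[OF t])
   have "0 <= (norm (ka' t) - l)\<^sup>2" by simp
   hence "2 * norm (ka' t) * l <= g' t + l\<^sup>2" using le[OF t] by (simp add: power2_diff)
   thus "norm (ka' t) <= (g' t / l + l) / 2" using l by (simp add: field_simps power2_eq_square)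
  qed auto
  also have "\<dots> = ((g 1 - g 0) / l + l) / 2" using l by (simp add: field_simps)
  finally show ?thesis .
 qed
 show ?thesis
 proof (cases "?f = 0")
  case True
  have "g 0 <= g 1"
   by (rule DERIV_nonneg_imp_nondecreasing) (use g le in \<open>auto intro: order_trans[OF zero_le_power2]\<close>)
  thus ?thesis unfolding True by simp
 next
  case False
  hence "?f > 0" using f0 by (metis order_le_less)
  from *[OF this] have "2 * ?f <= (g 1 - g 0) / ?f + ?f" by simp
  hence "?f <= (g 1 - g 0) / ?f" by simp
  thus ?thesis using \<open>?f > 0\<close> by (simp add: field_simps power2_eq_square)
 qed
qed

end

subsection \<open>Bivectors and rotations\<close>

text \<open>The bivector of \<open>p\<close> and \<open>q\<close> as a skew operator, an
  infinitesimal rotation: for orthogonal vectors it sends \<open>p\<close> to a positive multiple of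
  \<open>q\<close> if \<open>p\<close> is not 0.\<close>

definition biv :: "'a::real_inner => 'a => 'a => 'a" where
 "biv p q w = (w *. p) *R q - (w *. q) *R p"

text \<open>The Gram determinant, which is the inner product of bivectors. The Hilbert-Schmidt
  product of the corresponding operators \<open>biv\<close> is twice this.\<close>

definition biv_inner :: "'a::real_inner => 'a => 'a => 'a => real" where
 "biv_inner a b c d = (a *. c) * (b *. d) - (a *. d) * (b *. c)"

lemma bounded_linear_biv: "bounded_linear (biv p q)" unfolding biv_def[abs_def]
 by (intro bounded_linear_sub bounded_linear_scaleR_const bounded_linear_inner_left)

lemma biv_skew: "biv p q u *. w = - (u *. biv p q w)" by (simp add: biv_def inner_diff inner_commute algebra_simps)

text \<open>Compare \<open>M\<close> with \<open>biv z w\<close>, where \<open>w = M z\<close>,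
  which has the same value at \<open>z\<close>: the squared Hilbert-Schmidt norm of the difference
  is nonnegative, and the other terms are explicit because \<open>w\<close> is orthogonal to
  \<open>z\<close>. The factor 2 reflects that a skew matrix holds each entry twice.\<close>

lemma norm_skew_le_Hilbert_Schmidt:
 fixes M :: "'a::euclidean_space => 'a"
 assumes lin: "linear M" and skew: "!!u w. M u *. w = - (u *. M w)" and z: "norm z = 1"
 shows "2 * (norm (M z))\<^sup>2 <= (\<Sum>e\<in>Basis. M e *. M e)"
proof -
 define w where "w = M z"
 have wz: "w *. z = 0" using skew[of z z] by (simp add: w_def inner_commute)
 have "0 <= (\<Sum>e\<in>Basis. (M e - biv z w e) *. (M e - biv z w e))" by (rule sum_nonneg) simp
 also have "\<dots> = (\<Sum>e\<in>Basis. M e *. M e) - 2 * (\<Sum>e\<in>Basis. M e *. biv z w e) + (\<Sum>e\<in>Basis. biv z w e *. biv z w e)"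
  by (simp add: inner_diff inner_commute sum.distrib sum_subtractf sum_distrib_left algebra_simps)
 also have "(\<Sum>e\<in>Basis. M e *. biv z w e) = M (\<Sum>e\<in>Basis. (z *. e) *R e) *. w - M (\<Sum>e\<in>Basis. (w *. e) *R e) *. z"
  by (simp add: linear_sum[OF lin] linear_cmul[OF lin] inner_sum_left biv_def inner_diff_right sum_subtractf inner_commute[of _ w] inner_commute[of _ z])
   (simp add: inner_sum_right inner_commute)
 also have "\<dots> = M z *. w - M w *. z" by (simp add: euclidean_representation)
 also have "\<dots> = 2 * (norm w)\<^sup>2" using skew[of w z] by (simp add: w_def[symmetric] dot_square_norm)
 also have "(\<Sum>e\<in>Basis. biv z w e *. biv z w e) =
   (\<Sum>e\<in>Basis. (e *. z) * (e *. z)) * (w *. w) + (\<Sum>e\<in>Basis. (e *. w) * (e *. w)) * (z *. z) - 2 * (\<Sum>e\<in>Basis. (e *. z) * (e *. w)) * (w *. z)"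
  by (simp add: biv_def inner_diff inner_commute sum.distrib sum_subtractf sum_distrib_left sum_distrib_right algebra_simps)
 also have "\<dots> = 2 * (norm w)\<^sup>2"
  using euclidean_inner[of z z] euclidean_inner[of w w] euclidean_inner[of z w] z wz
  by (simp add: inner_commute dot_square_norm)
 finally show ?thesis by (simp add: w_def)
qed

lemma biv_sum_bound:
 fixes z :: "'a::euclidean_space"
 assumes "norm z = 1"
 shows "(norm (biv x a z + biv p q z))\<^sup>2 <= biv_inner x a x a + 2 * biv_inner x a p q + biv_inner p q p q"
proof -
 have hs: "(\<Sum>e\<in>Basis. biv x a e *. biv p q e) = 2 * biv_inner x a p q" for x a p q :: 'a
 proof -
  have "(\<Sum>e\<in>Basis. biv x a e *. biv p q e) =
   (\<Sum>e\<in>Basis. (x *. e) * (p *. e)) * (a *. q) - (\<Sum>e\<in>Basis. (x *. e) * (q *. e)) * (a *. p)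
   - (\<Sum>e\<in>Basis. (a *. e) * (p *. e)) * (x *. q) + (\<Sum>e\<in>Basis. (a *. e) * (q *. e)) * (x *. p)"
   by (simp add: biv_def inner_diff inner_commute sum.distrib sum_subtractf sum_distrib_left sum_distrib_right algebra_simps)
  thus ?thesis by (simp add: euclidean_inner[symmetric] biv_inner_def)
 qed
 have "2 * (norm (biv x a z + biv p q z))\<^sup>2 <= (\<Sum>e\<in>Basis. (biv x a e + biv p q e) *. (biv x a e + biv p q e))"
 proof (rule norm_skew_le_Hilbert_Schmidt[where M="%w. biv x a w + biv p q w", OF _ _ assms])
  show "linear (%w. biv x a w + biv p q w)" by (intro bounded_linear.linear bounded_linear_add bounded_linear_biv)
  show "(biv x a u + biv p q u) *. w = - (u *. (biv x a w + biv p q w))" for u w by (simp add: inner_add biv_skew)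
 qed
 also have "\<dots> = (\<Sum>e\<in>Basis. biv x a e *. biv x a e) + 2 * (\<Sum>e\<in>Basis. biv x a e *. biv p q e) + (\<Sum>e\<in>Basis. biv p q e *. biv p q e)"
  by (simp add: inner_add inner_commute sum.distrib sum_distrib_left algebra_simps)
 finally show ?thesis unfolding hs by simp
qed

text \<open>The relation \<open>cube\<close> says that all nonzero rotation speeds of
  \<open>A\<close> equal \<open>om\<close>, which gives its exponential in closed form. For
  \<open>om = 0\<close> the divisions by \<open>om\<close> yield 0, and \<open>zero\<close> makes
  the closed form the identity.\<close>

locale skew_generator =
 fixes A :: "'a::euclidean_space => 'a" and om :: real
 assumes bl: "bounded_linear A"
  and skew: "A u *. w = - (u *. A w)"
  and cube: "A (A (A w)) = - (om\<^sup>2) *R A w"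
  and zero: "om = 0 ==> A w = 0"
begin

text \<open>Rodrigues' formula for the exponential of \<open>t\<close> times
  \<open>A\<close>.\<close>

definition rot :: "real => 'a => 'a" where
 "rot t w = w + (sin (om * t) / om) *R A w + ((1 - cos (om * t)) / om\<^sup>2) *R A (A w)"

lemma A_simps: "A (u + w) = A u + A w" "A (c *R u) = c *R A u" "A 0 = 0" "A (u - w) = A u - A w" "A (- u) = - A u"
 using bounded_linear.linear[OF bl] by (auto simp: linear_add linear_cmul linear_0 linear_diff linear_neg)

lemma rot_0 [simp]: "rot 0 w = w" by (simp add: rot_def)

lemma linear_rot: "linear (rot t)" by (rule linearI) (simp_all add: rot_def A_simps algebra_simps)

lemma A_rot: "A (rot t w) = rot t (A w)" by (simp add: rot_def A_simps)

text \<open>With \<open>S = sin\<close> and \<open>K = 1 - cos\<close> this is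
  \<open>S^2 + K^2 = 2 * K\<close>. It carries both the invariance of the norm and the inversion in
  \<open>rot_rot\<close>.\<close>

lemma coeff_identity:
 assumes "om ~= 0"
 shows "(sin (om * t) / om)\<^sup>2 + ((1 - cos (om * t)) / om\<^sup>2)\<^sup>2 * om\<^sup>2 - 2 * ((1 - cos (om * t)) / om\<^sup>2) = 0"
proof -
 have "(sin (om * t))\<^sup>2 + (1 - cos (om * t))\<^sup>2 - 2 * (1 - cos (om * t)) = 0"
  by (simp add: sin_squared_eq power2_diff)
 hence "((sin (om * t))\<^sup>2 + (1 - cos (om * t))\<^sup>2 - 2 * (1 - cos (om * t))) / om\<^sup>2 = 0" by simp
 moreover have "(sin (om * t) / om)\<^sup>2 + ((1 - cos (om * t)) / om\<^sup>2)\<^sup>2 * om\<^sup>2 - 2 * ((1 - cos (om * t)) / om\<^sup>2)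
   = ((sin (om * t))\<^sup>2 + (1 - cos (om * t))\<^sup>2 - 2 * (1 - cos (om * t))) / om\<^sup>2"
 proof -
  have "(S / om)\<^sup>2 + (K / om\<^sup>2)\<^sup>2 * om\<^sup>2 - 2 * (K / om\<^sup>2) = (S\<^sup>2 + K\<^sup>2 - 2 * K) / om\<^sup>2" for S K
   using assms by (simp add: power_divide add_divide_distrib diff_divide_distrib power2_eq_square)
  thus ?thesis .
 qed
 ultimately show ?thesis by simp
qed

lemma norm_rot: "norm (rot t w) = norm w"
proof (cases "om = 0")
 case True
 thus ?thesis unfolding rot_def using zero by simp
next
 case False
 define s where "s = sin (om * t) / om"
 define c where "c = (1 - cos (om * t)) / om\<^sup>2"
 have sc: "s\<^sup>2 + c\<^sup>2 * om\<^sup>2 - 2 * c = 0" unfolding s_def c_def by (rule coeff_identity[OF False])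
 have i: "w *. A w = 0" "A w *. A (A w) = 0" "w *. A (A w) = - (A w *. A w)"
  "A (A w) *. A (A w) = om\<^sup>2 * (A w *. A w)"
  using skew[of w w] skew[of "A w" "A w"] skew[of w "A w"] skew[of "A w" "A (A w)"] by (auto simp: inner_commute cube)
 have "rot t w *. rot t w = w *. w + s\<^sup>2 * (A w *. A w) + c\<^sup>2 * (A (A w) *. A (A w)) + 2 * s * (w *. A w)
   + 2 * c * (w *. A (A w)) + 2 * s * c * (A w *. A (A w))" unfolding rot_def s_def[symmetric] c_def[symmetric]
  by (simp add: inner_add inner_commute algebra_simps power2_eq_square)
 also have "\<dots> = w *. w + (s\<^sup>2 + c\<^sup>2 * om\<^sup>2 - 2 * c) * (A w *. A w)" by (simp add: i algebra_simps)
 finally show ?thesis using sc by (simp add: norm_eq_sqrt_inner)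
qed

lemma inner_rot: "rot t u *. rot t w = u *. w"
proof -
 have "orthogonal_transformation (rot t)" using linear_rot norm_rot by (simp add: orthogonal_transformation)
 thus ?thesis by (simp add: orthogonal_transformation_def)
qed

lemma rot_biv: "rot t (biv p q w) = biv (rot t p) (rot t q) (rot t w)"
 by (simp add: biv_def linear_diff[OF linear_rot] linear_cmul[OF linear_rot] inner_rot)

lemma rot_rot: "rot (- t) (rot t w) = w"
proof (cases "om = 0")
 case True
 thus ?thesis unfolding rot_def using zero by simp
next
 case False
 define s where "s = sin (om * t) / om"
 define c where "c = (1 - cos (om * t)) / om\<^sup>2"
 have sc: "s\<^sup>2 + c\<^sup>2 * om\<^sup>2 - 2 * c = 0" unfolding s_def c_def by (rule coeff_identity[OF False])
 have r: "rot t w = w + s *R A w + c *R A (A w)" for w by (simp add: rot_def s_def c_def)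
 have r': "rot (- t) w = w - s *R A w + c *R A (A w)" for w by (simp add: rot_def s_def c_def)
 have "rot (- t) (rot t w) = w - (s\<^sup>2 + c\<^sup>2 * om\<^sup>2 - 2 * c) *R A (A w)"
  by (simp add: r r' A_simps cube algebra_simps power2_eq_square scaleR_2[symmetric] del: scaleR_2)
 thus ?thesis by (simp add: sc)
qed

lemma has_vector_derivative_rot:
 assumes "(w has_vector_derivative w') (at t)"
 shows "((%t. rot t (w t)) has_vector_derivative rot t (A (w t) + w')) (at t)"
proof (cases "om = 0")
 case True
 thus ?thesis unfolding rot_def using zero assms by simp
next
 case False
 note dA = bounded_linear.has_vector_derivative[OF bl]
 have s: "((%t. sin (om * t) / om) has_real_derivative cos (om * t)) (at t)"
  using False by (auto intro!: derivative_eq_intros)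
 have c: "((%t. (1 - cos (om * t)) / om\<^sup>2) has_real_derivative sin (om * t) / om) (at t)"
  using False by (auto intro!: derivative_eq_intros simp: power2_eq_square)
 have "((%t. rot t (w t)) has_vector_derivative
   w' + ((sin (om * t) / om) *R A w' + cos (om * t) *R A (w t))
   + (((1 - cos (om * t)) / om\<^sup>2) *R A (A w') + (sin (om * t) / om) *R A (A (w t)))) (at t)" unfolding rot_def
  by (intro has_vector_derivative_add has_vector_derivative_scaleR assms s c dA)
 moreover have "rot t (A (w t)) = cos (om * t) *R A (w t) + (sin (om * t) / om) *R A (A (w t))"
  using False by (simp add: rot_def cube scaleR_left_diff_distrib)
 ultimately show ?thesis by (simp add: linear_add[OF linear_rot] rot_def[of t w'] algebra_simps)
qed

end

definition sphere_exp :: "real => 'a::real_inner => 'a => 'a" where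
 "sphere_exp R x v = cos_sqrt ((norm v)\<^sup>2 / R\<^sup>2) *R x + sinc_sqrt ((norm v)\<^sup>2 / R\<^sup>2) *R v"

lemma sphere_exp_eq:
 "R > 0 ==> sphere_exp R x v = cos (norm v / R) *R x + (sin (norm v / R) / (norm v / R)) *R v"
 using cos_sqrt_square[of "norm v / R"] sinc_sqrt_square[of "norm v / R"]
 by (cases "v = 0") (auto simp: sphere_exp_def power_divide field_simps)

text \<open>The generator below is scaled by \<open>R^2\<close> so that it maps \<open>x\<close> to
  \<open>v\<close> and turns with speed \<open>norm v / R\<close>; at time 1 it carries
  \<open>x\<close> to the exponential of \<open>v\<close>.\<close>

locale sphere_rotation =
 fixes R :: real and x v :: "'a::euclidean_space"
 assumes R: "R > 0" and x: "norm x = R" and v: "v *. x = 0"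
begin

sublocale skew_generator "%w. biv x v w /\<^sub>R R\<^sup>2" "norm v / R"
proof (rule skew_generator.intro)
 show "bounded_linear (%w. biv x v w /\<^sub>R R\<^sup>2)" by (rule bounded_linear_const_scaleR[OF bounded_linear_biv])
 show "(biv x v u /\<^sub>R R\<^sup>2) *. w = - (u *. (biv x v w /\<^sub>R R\<^sup>2))" for u w by (simp add: biv_skew)
 have xx: "x *. x = R\<^sup>2" using x by (simp add: dot_square_norm)
 show "biv x v (biv x v (biv x v w /\<^sub>R R\<^sup>2) /\<^sub>R R\<^sup>2) /\<^sub>R R\<^sup>2 = - ((norm v / R)\<^sup>2) *R (biv x v w /\<^sub>R R\<^sup>2)" for w
 proof -
  have s: "biv x v (c *R u) = c *R biv x v u" for c u
   using bounded_linear_biv[of x v] by (simp add: linear_cmul bounded_linear.linear)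
  have "biv x v (biv x v w) = - (((norm v)\<^sup>2 * (w *. x)) *R x) - (R\<^sup>2 * (w *. v)) *R v"
   using v by (simp add: biv_def inner_diff inner_commute x dot_square_norm algebra_simps)
  hence "biv x v (biv x v (biv x v w)) = - ((norm v)\<^sup>2 * R\<^sup>2) *R biv x v w"
   using v by (simp add: biv_def inner_diff inner_commute x dot_square_norm algebra_simps)
  thus ?thesis using R by (simp add: s power_divide field_simps)
 qed
 show "biv x v w /\<^sub>R R\<^sup>2 = 0" if "norm v / R = 0" for w using that R by (simp add: biv_def)
qed

lemma rot_1: "rot 1 x = sphere_exp R x v"
proof (cases "v = 0")
 case True
 thus ?thesis unfolding rot_def using R by (simp add: sphere_exp_eq biv_def)
next
 case False
 have xx: "x *. x = R\<^sup>2" using x by (simp add: dot_square_norm)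
 have 1: "biv x v x /\<^sub>R R\<^sup>2 = v" using v R by (simp add: biv_def xx inner_commute)
 have 2: "biv x v v /\<^sub>R R\<^sup>2 = - ((norm v / R)\<^sup>2) *R x"
  using v R by (simp add: biv_def dot_square_norm divide_inverse power_mult_distrib power_inverse mult.commute)
 show ?thesis unfolding rot_def 1 2 using False R by (simp add: sphere_exp_eq scaleR_left_diff_distrib)
qed

end

lemma norm_sphere_exp:
 fixes x v :: "'a::euclidean_space"
 assumes "R > 0" "norm x = R" "v *. x = 0"
 shows "norm (sphere_exp R x v) = R"
proof -
 interpret sphere_rotation R x v by unfold_locales (use assms in auto)
 show ?thesis using norm_rot[of 1 x] rot_1 assms(2) by simp
qed

text \<open>With \<open>A = x \<and> v\<close> and \<open>C = y \<and> c\<close> acting as infinitesimal rotations, the curve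
 \<open>t \<mapsto> exp(tA) exp(-tA\<^sub>0) exp(tC) y\<close> joins \<open>y\<close> to the exponential of \<open>v\<close>, and its energy is
 bounded by the integral of \<open>|A - A\<^sub>0 + exp(-tA\<^sub>0) C exp(tA\<^sub>0)|\<^sup>2\<close>, which is affine in \<open>v\<close> up to
 the term \<open>|v - v\<^sub>0|\<^sup>2\<close>. This is the squared distance formula of the Riemannian submersion of a
 flat path space onto the rotation group.\<close>
lemma sphere_exp_support:
 fixes x y v0 c :: "'a::euclidean_space"
 assumes R: "R > 0" and x: "norm x = R" and y: "norm y = R" and v0: "v0 *. x = 0" and c: "c *. y = 0"
  and eq: "sphere_exp R y c = sphere_exp R x v0"
 shows "EX L. (c = 0 --> L = 0) & (ALL v. v *. x = 0 -->
  (R * angle R y (sphere_exp R x v))\<^sup>2 <= (norm c)\<^sup>2 + (norm (v - v0))\<^sup>2 + L *. (v - v0))"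
proof -
 interpret B: sphere_rotation R x v0 by unfold_locales (use assms in auto)
 interpret C: sphere_rotation R y c by unfold_locales (use assms in auto)
 let ?b = "%t. B.rot (- t)"
 \<comment> \<open>\<open>F t *. (v - v0)\<close> is the cross term of the energy: twice the
   bivector product of the pair \<open>x\<close>, \<open>v - v0\<close> with the rotated pair
   \<open>y\<close>, \<open>c\<close>, divided by \<open>R^2\<close>. If \<open>c = 0\<close> it
   vanishes, and so does its integral \<open>L\<close>.\<close>
 define F where "F = (%t. (2 / R\<^sup>2) *R ((x *. ?b t y) *R ?b t c - (x *. ?b t c) *R ?b t y))"
 have contb: "continuous_on {0..1} (%t. ?b t w)" for w
  unfolding B.rot_def unfolding divide_inverse by (intro continuous_intros)
 have Fint: "F integrable_on {0..1}" unfolding F_def by (intro integrable_continuous_interval continuous_intros contb)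
 have contF: "continuous_on UNIV F" unfolding F_def B.rot_def unfolding divide_inverse by (intro continuous_intros)
 define L where "L = integral {0..1} F"
 have L0: "L = 0" if "c = 0" using that by (simp add: L_def F_def linear_0[OF B.linear_rot])
 have "(R * angle R y (sphere_exp R x v))\<^sup>2 <= (norm c)\<^sup>2 + (norm (v - v0))\<^sup>2 + L *. (v - v0)"
  if v: "v *. x = 0" for v
 proof -
  interpret A: sphere_rotation R x v by unfold_locales (use assms v in auto)
  \<comment> \<open>The rotation by \<open>v\<close> is split off: \<open>ze\<close> depends on
    \<open>v0\<close> and \<open>c\<close> only, and the norm of \<open>ka'\<close> is found before
    applying the isometry \<open>A.rot t\<close>.\<close>
  define ze where "ze = (%t. ?b t (C.rot t y))"
  define ka where "ka = (%t. A.rot t (ze t))"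
  define ka' where "ka' = (%t. A.rot t ((biv x (v - v0) (ze t) + biv (?b t y) (?b t c) (ze t)) /\<^sub>R R\<^sup>2))"
  define g' where "g' = (%t. (norm (v - v0))\<^sup>2 + F t *. (v - v0) + (norm c)\<^sup>2)"
  define g where "g = (%t. ((norm (v - v0))\<^sup>2 + (norm c)\<^sup>2) * t + (integral {0..t} F) *. (v - v0))"
  have nz: "norm (ze t) = R" for t using y by (simp add: ze_def B.norm_rot C.norm_rot)
  have dze: "(ze has_vector_derivative (biv (?b t y) (?b t c) (ze t) - biv x v0 (ze t)) /\<^sub>R R\<^sup>2) (at t)" for t
  proof -
   have um: "((%x. - x) has_vector_derivative (- 1 :: real)) (at t)" for t by (auto intro!: derivative_eq_intros)
   have dC: "((%t. C.rot t y) has_vector_derivative C.rot t (biv y c y /\<^sub>R R\<^sup>2 + 0)) (at t)" for t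
    by (rule C.has_vector_derivative_rot) simp
   have "((%t. C.rot (- t) y) has_vector_derivative (- 1) *R C.rot (- t) (biv y c y /\<^sub>R R\<^sup>2)) (at t)" for t
    using vector_diff_chain_at[OF um[of t], of "%t. C.rot t y", OF dC[of "- t"]] by (simp add: o_def)
   hence "((%t. B.rot t (C.rot (- t) y)) has_vector_derivative
     B.rot t (biv x v0 (C.rot (- t) y) /\<^sub>R R\<^sup>2 + (- 1) *R C.rot (- t) (biv y c y /\<^sub>R R\<^sup>2))) (at t)" for t
    by (rule B.has_vector_derivative_rot)
   from vector_diff_chain_at[OF um[of t], of "%t. B.rot t (C.rot (- t) y)", OF this[of "- t"]]
   have 1: "(ze has_vector_derivative
     (- 1) *R B.rot (- t) (biv x v0 (C.rot t y) /\<^sub>R R\<^sup>2 + (- 1) *R C.rot t (biv y c y /\<^sub>R R\<^sup>2))) (at t)"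
    by (simp add: o_def ze_def[abs_def])
   have 2: "C.rot t (biv y c y /\<^sub>R R\<^sup>2) = biv y c (C.rot t y) /\<^sub>R R\<^sup>2" using C.A_rot[of t y] by simp
   have 3: "?b t (biv x v0 (C.rot t y) /\<^sub>R R\<^sup>2) = biv x v0 (ze t) /\<^sub>R R\<^sup>2"
    using B.A_rot[of "- t" "C.rot t y"] by (simp add: ze_def)
   have 4: "?b t (biv y c (C.rot t y)) = biv (?b t y) (?b t c) (ze t)" unfolding ze_def by (rule B.rot_biv)
   show ?thesis using 1 unfolding 2
    by (simp add: linear_add[OF B.linear_rot] linear_cmul[OF B.linear_rot] linear_neg[OF B.linear_rot] linear_diff[OF B.linear_rot] 3[simplified linear_cmul[OF B.linear_rot]] 4 algebra_simps)
  qed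
  have dka: "(ka has_vector_derivative ka' t) (at t)" for t
  proof -
   have b: "biv x v (ze t) - biv x v0 (ze t) = biv x (v - v0) (ze t)" by (simp add: biv_def inner_diff_right algebra_simps)
   have e: "biv x v (ze t) /\<^sub>R R\<^sup>2 + (biv (?b t y) (?b t c) (ze t) - biv x v0 (ze t)) /\<^sub>R R\<^sup>2
     = (biv x (v - v0) (ze t) + biv (?b t y) (?b t c) (ze t)) /\<^sub>R R\<^sup>2"
    unfolding b[symmetric] by (simp add: algebra_simps)
   show ?thesis using A.has_vector_derivative_rot[OF dze, of t] unfolding e by (simp add: ka_def[abs_def] ka'_def)
  qed
  have le: "(norm (ka' t))\<^sup>2 <= g' t" for t
  proof -
   define z where "z = ze t /\<^sub>R R"
   have z: "norm z = 1" using nz R by (simp add: z_def)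
   have "biv p q (ze t) = R *R biv p q z" for p q
    using R by (simp add: z_def linear_cmul[OF bounded_linear.linear[OF bounded_linear_biv]])
   hence "(biv x (v - v0) (ze t) + biv (?b t y) (?b t c) (ze t)) /\<^sub>R R\<^sup>2 = (biv x (v - v0) z + biv (?b t y) (?b t c) z) /\<^sub>R R"
    using R by (simp only: scaleR_add_right[symmetric] scaleR_scaleR) (simp add: power2_eq_square)
   hence "norm (ka' t) = norm ((biv x (v - v0) z + biv (?b t y) (?b t c) z) /\<^sub>R R)"
    unfolding ka'_def A.norm_rot by (simp only:)
   hence "norm (ka' t) = norm (biv x (v - v0) z + biv (?b t y) (?b t c) z) / R"
    unfolding norm_scaleR using R by (simp add: divide_inverse mult.commute)
   hence "(norm (ka' t))\<^sup>2 = (norm (biv x (v - v0) z + biv (?b t y) (?b t c) z))\<^sup>2 / R\<^sup>2"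
    by (simp add: power_divide)
   also have "\<dots> <= (biv_inner x (v - v0) x (v - v0) + 2 * biv_inner x (v - v0) (?b t y) (?b t c)
     + biv_inner (?b t y) (?b t c) (?b t y) (?b t c)) / R\<^sup>2"
    using biv_sum_bound[OF z] R by (intro divide_right_mono) auto
   also have "\<dots> = g' t"
   proof -
    have "biv_inner x (v - v0) x (v - v0) = R\<^sup>2 * (norm (v - v0))\<^sup>2"
    proof -
     have "x *. x = R\<^sup>2" "(v - v0) *. x = 0" "x *. (v - v0) = 0"
      using v v0 x by (auto simp: dot_square_norm inner_diff inner_commute)
     thus ?thesis by (simp only: biv_inner_def power2_norm_eq_inner mult_zero_left diff_0_right)
    qed
    moreover have "biv_inner (?b t y) (?b t c) (?b t y) (?b t c) = R\<^sup>2 * (norm c)\<^sup>2"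
    proof -
     have "y *. y = R\<^sup>2" "y *. c = 0" using c y by (auto simp: dot_square_norm inner_commute)
     thus ?thesis by (simp only: biv_inner_def B.inner_rot power2_norm_eq_inner mult_zero_left diff_0_right)
    qed
    moreover have "2 * biv_inner x (v - v0) (?b t y) (?b t c) = R\<^sup>2 * (F t *. (v - v0))"
     using R by (simp add: biv_inner_def F_def inner_diff inner_commute algebra_simps)
    ultimately show ?thesis using R by (simp add: g'_def field_simps)
   qed
   finally show ?thesis .
  qed
  \<comment> \<open>The integral starts at -1, and is differentiated within \<open>{-1..2}\<close>,
    so that its derivative is two-sided also at 0 and 1.\<close>
  define G where "G = (%t. integral {-1..t} F)"
  have dG: "(G has_vector_derivative F t) (at t)" if "t : {0..1}" for t
  proof -
   have "(G has_vector_derivative F t) (at t within {-1..2})" unfolding G_def using that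
    by (intro integral_has_vector_derivative continuous_on_subset[OF contF]) auto
   thus ?thesis using that at_within_interior[of t "{-1..2}"] by simp
  qed
  have "(R * angle R (ka 0) (ka 1))\<^sup>2 <=
    (((norm (v - v0))\<^sup>2 + (norm c)\<^sup>2) * 1 + G 1 *. (v - v0)) - (((norm (v - v0))\<^sup>2 + (norm c)\<^sup>2) * 0 + G 0 *. (v - v0))"
  proof (rule angle_square_le_energy[OF R])
   show "norm (ka t) = R" for t by (simp add: ka_def A.norm_rot nz)
   show "(ka has_vector_derivative ka' t) (at t)" for t by (rule dka)
   show "(norm (ka' t))\<^sup>2 <= g' t" for t by (rule le)
   fix t :: real assume t: "t : {0..1}"
   have "((%t. G t *. (v - v0)) has_real_derivative F t *. (v - v0)) (at t)"
    unfolding has_real_derivative_iff_has_vector_derivative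
    by (rule bounded_linear.has_vector_derivative[OF bounded_linear_inner_left dG[OF t]])
   thus "((%t. ((norm (v - v0))\<^sup>2 + (norm c)\<^sup>2) * t + G t *. (v - v0)) has_real_derivative g' t) (at t)"
    unfolding g'_def by (auto intro!: derivative_eq_intros)
  qed
  moreover have "G 1 - G 0 = L"
  proof -
   have "F integrable_on {-1..1}" by (intro integrable_continuous_interval continuous_on_subset[OF contF]) auto
   from Henstock_Kurzweil_Integration.integral_combine[OF _ _ this, of 0] show ?thesis
    by (simp add: G_def L_def algebra_simps)
  qed
  hence "G 1 *. (v - v0) - G 0 *. (v - v0) = L *. (v - v0)" by (simp add: inner_diff_left[symmetric])
  moreover have "ka 0 = y" by (simp add: ka_def ze_def)
  moreover have "ka 1 = sphere_exp R x v"
  proof -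
   \<comment> \<open>Here \<open>eq\<close> enters: at time 1 the rotation by \<open>c\<close>
     brings \<open>y\<close> to the exponential of \<open>v0\<close>, and the inverse rotation by
     \<open>v0\<close> takes that point back to \<open>x\<close>.\<close>
   have "ze 1 = ?b 1 (B.rot 1 x)" unfolding ze_def using C.rot_1 B.rot_1 eq by simp
   hence "ze 1 = x" by (simp add: B.rot_rot)
   thus ?thesis by (simp add: ka_def A.rot_1)
  qed
  ultimately show ?thesis by simp
 qed
 thus ?thesis using L0 by blast
qed

text \<open>The direction at \<open>x\<close> is the part of \<open>y\<close> orthogonal to
  \<open>x\<close>. The subspace \<open>W\<close>, later the coordinates of one block, keeps the
  logarithm inside the block, and \<open>e\<close> supplies a direction when \<open>y\<close> is
  \<open>x\<close> or its antipode.\<close>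

lemma sphere_log_exists:
 fixes x y :: "'a::euclidean_space"
 assumes R: "R > 0" and x: "norm x = R" and y: "norm y = R"
  and W: "subspace W" "x : W" "y : W" and e: "e : W" "e *. x = 0" "norm e = 1"
 shows "EX v:W. v *. x = 0 & sphere_exp R x v = y & norm v = R * angle R x y"
proof -
 let ?a = "angle R x y"
 note a = angle_bounds[OF R x y]
 have sq: "x *. x = R\<^sup>2" "y *. y = R\<^sup>2" using x y by (auto simp: dot_square_norm)
 have xy: "x *. y = cos ?a * R\<^sup>2" using a R by auto
 let ?u = "y - (cos ?a) *R x"
 have "?u *. ?u = y *. y - 2 * cos ?a * (x *. y) + (cos ?a)\<^sup>2 * (x *. x)"
  by (simp add: inner_diff inner_commute power2_eq_square algebra_simps)
 also have "\<dots> = (R * sin ?a)\<^sup>2" unfolding sq xy using sin_cos_squared_add[of ?a] by algebra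
 finally have nu: "norm ?u = R * sin ?a"
  using R a sin_ge_zero by (simp add: norm_eq_sqrt_inner real_sqrt_abs2 power2_eq_square)
 show ?thesis
 proof (cases "sin ?a = 0")
  case True
  hence yx: "y = cos ?a *R x" using nu by simp
  let ?v = "(R * ?a) *R e"
  have nv: "norm ?v = R * ?a" using e a R by simp
  have "sphere_exp R x ?v = y" unfolding sphere_exp_eq[OF R] nv using R True yx by simp
  thus ?thesis using nv e W by (intro bexI[of _ ?v]) (auto simp: subspace_scale)
 next
  case False
  hence s: "sin ?a > 0" using a sin_ge_zero[of ?a] by simp
  hence a0: "?a > 0" using a by (cases "?a = 0") auto
  let ?v = "(?a / sin ?a) *R ?u"
  have nv: "norm ?v = R * ?a" using nu s a R by simp
  have "sphere_exp R x ?v = y" unfolding sphere_exp_eq[OF R] nv using R s a0 by (simp add: field_simps)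
  moreover have "?v *. x = 0" using xy sq by (simp add: inner_diff inner_commute)
  moreover have "?v : W" using W by (intro subspace_scale subspace_diff)
  ultimately show ?thesis using nv by (intro bexI[of _ ?v]) auto
 qed
qed

section \<open>Products of spheres and a Euclidean space\<close>

text \<open>At least two coordinates per sphere block means positive dimension: on a sphere of
  dimension 0, no geodesic would join a point to its antipode.\<close>

locale sphere_product =
 fixes B :: "'i::finite => nat" and k :: nat and r :: "nat => real"
 assumes r_pos: "j < k ==> 0 < r j" and card_block: "j < k ==> 2 <= card {i. B i = j}"
begin

definition blk :: "nat => real ^ 'i => real ^ 'i" where
 "blk j x = (\<chi> i. if B i = j then x $ i else 0)"

definition free :: "real ^ 'i => real ^ 'i" where
 "free x = (\<chi> i. if B i < k then 0 else x $ i)"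

abbreviation "S \<equiv> spheres_times_euclidean B k r"

lemma linear_blk: "linear (blk j)" by (rule linearI) (auto simp: blk_def vec_eq_iff)

lemma linear_free: "linear free" by (rule linearI) (auto simp: free_def vec_eq_iff)

lemmas blk_simps = linear_add[OF linear_blk] linear_cmul[OF linear_blk] linear_diff[OF linear_blk] linear_0[OF linear_blk]
lemmas free_simps = linear_add[OF linear_free] linear_cmul[OF linear_free] linear_diff[OF linear_free] linear_0[OF linear_free]

lemma bounded_linear_blk: "bounded_linear (blk j)" and bounded_linear_free: "bounded_linear free"
 using linear_blk linear_free linear_linear by auto

lemma continuous_on_blk [continuous_intros]: "continuous_on A f ==> continuous_on A (%x. blk j (f x))"
 by (rule bounded_linear.continuous_on[OF bounded_linear_blk])

lemma continuous_on_free [continuous_intros]: "continuous_on A f ==> continuous_on A (%x. free (f x))"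
 by (rule bounded_linear.continuous_on[OF bounded_linear_free])

lemma smooth_on_blk [smooth_intros]: "open A ==> smooth_on A f ==> smooth_on A (%x. blk j (f x))"
 by (rule smooth_on_bounded_linear[OF bounded_linear_blk])

lemma inner_blk: "blk j x *. blk j y = (\<Sum>i | B i = j. x $ i * y $ i)"
proof -
 have "blk j x *. blk j y = (\<Sum>i\<in>UNIV. if B i = j then x $ i * y $ i else 0)"
  unfolding inner_vec_def by (rule sum.cong) (auto simp: blk_def)
 thus ?thesis by (simp add: sum.If_cases)
qed

lemma blk_inner_right: "blk j x *. y = blk j x *. blk j y" unfolding inner_vec_def by (rule sum.cong) (auto simp: blk_def)

lemma blk_inner_left: "x *. blk j y = blk j x *. blk j y" unfolding inner_vec_def by (rule sum.cong) (auto simp: blk_def)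

lemma free_inner_left: "x *. free y = free x *. free y" unfolding inner_vec_def by (rule sum.cong) (auto simp: free_def)

lemma blk_nth: "B i = j ==> blk j x $ i = x $ i" by (simp add: blk_def)

lemma inner_split: "x *. y = (\<Sum>j<k. blk j x *. blk j y) + free x *. free y"
proof -
 have "(\<Sum>j<k. blk j x *. blk j y) = (\<Sum>j<k. \<Sum>i\<in>UNIV. if B i = j then x $ i * y $ i else 0)"
  unfolding inner_vec_def by (intro sum.cong) (auto simp: blk_def)
 also have "\<dots> = (\<Sum>i\<in>UNIV. \<Sum>j<k. if B i = j then x $ i * y $ i else 0)" by (rule sum.swap)
 also have "\<dots> = (\<Sum>i\<in>UNIV. if B i < k then x $ i * y $ i else 0)" by (intro sum.cong) (auto simp: sum.delta)
 also have "\<dots> + free x *. free y = x *. y"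
  unfolding inner_vec_def sum.distrib[symmetric] by (intro sum.cong) (auto simp: free_def)
 finally show ?thesis by simp
qed

lemma norm_split: "(norm x)\<^sup>2 = (\<Sum>j<k. (norm (blk j x))\<^sup>2) + (norm (free x))\<^sup>2"
 unfolding power2_norm_eq_inner by (rule inner_split)

lemma blk_free_eqI:
 assumes "!!j. j < k ==> blk j x = blk j y" "free x = free y"
 shows "x = y"
proof -
 have "x $ i = y $ i" for i
  using assms(1)[of "B i"] assms(2) by (cases "B i < k") (auto simp: blk_def free_def vec_eq_iff split: if_splits)
 thus ?thesis by (simp add: vec_eq_iff)
qed

lemma S_iff: "x : S \<longleftrightarrow> (ALL j<k. norm (blk j x) = r j)"
proof -
 have "(\<Sum>i | B i = j. (x $ i)\<^sup>2) = (norm (blk j x))\<^sup>2" for j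
  unfolding power2_norm_eq_inner inner_blk by (simp add: power2_eq_square)
 moreover have "(norm (blk j x))\<^sup>2 = (r j)\<^sup>2 \<longleftrightarrow> norm (blk j x) = r j" if "j < k" for j
  using r_pos[OF that] by (simp add: power2_eq_iff_nonneg)
 ultimately show ?thesis unfolding spheres_times_euclidean_def by auto
qed

lemma norm_blk: "x : S ==> j < k ==> norm (blk j x) = r j" by (simp add: S_iff)

lemma closed_S: "closed S"
proof -
 have "S = (\<Inter>j\<in>{..<k}. {x. norm (blk j x) = r j})" using S_iff by auto
 thus ?thesis by (auto intro!: closed_INT closed_Collect_eq continuous_intros)
qed

definition tan :: "real ^ 'i => (real ^ 'i) set" where
 "tan p = {v. ALL j<k. blk j v *. blk j p = 0}"

lemma subspace_tan: "subspace (tan p)" by (auto simp: subspace_def tan_def blk_simps inner_add)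

lemma tanD: "v : tan p ==> j < k ==> blk j v *. blk j p = 0" by (simp add: tan_def)

subsection \<open>Geodesics\<close>

text \<open>The angular speed, shared by all coordinates of one block.\<close>

definition freq :: "real ^ 'i => 'i => real" where
 "freq v i = norm (blk (B i) v) / r (B i)"

definition pexp :: "real ^ 'i => real ^ 'i => real ^ 'i" where
 "pexp p v = (\<chi> i. if B i < k then cos_sqrt ((norm (blk (B i) v))\<^sup>2 / (r (B i))\<^sup>2) * p $ i
   + sinc_sqrt ((norm (blk (B i) v))\<^sup>2 / (r (B i))\<^sup>2) * v $ i else p $ i + v $ i)"

text \<open>The velocity at time 1, equal to \<open>gvel p v 1\<close>, in a form that is smooth
  jointly in both arguments; \<open>gvel\<close> is the trigonometric form for all times.\<close>

definition pvel :: "real ^ 'i => real ^ 'i => real ^ 'i" where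
 "pvel p v = (\<chi> i. if B i < k then cos_sqrt ((norm (blk (B i) v))\<^sup>2 / (r (B i))\<^sup>2) * v $ i
   - ((norm (blk (B i) v))\<^sup>2 / (r (B i))\<^sup>2) * sinc_sqrt ((norm (blk (B i) v))\<^sup>2 / (r (B i))\<^sup>2) * p $ i else v $ i)"

definition gvel :: "real ^ 'i => real ^ 'i => real => real ^ 'i" where
 "gvel p v s = (\<chi> i. if B i < k then cos (freq v i * s) * v $ i - freq v i * sin (freq v i * s) * p $ i else v $ i)"

lemma blk_pexp: "j < k ==> blk j (pexp p v) = sphere_exp (r j) (blk j p) (blk j v)"
 by (auto simp: vec_eq_iff blk_def pexp_def sphere_exp_def)

lemma free_pexp: "free (pexp p v) = free p + free v" by (auto simp: vec_eq_iff free_def pexp_def)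

lemma pexp_0 [simp]: "pexp p 0 = p" by (auto simp: vec_eq_iff pexp_def linear_0[OF linear_blk])

lemma freq_sq: "(norm (blk (B i) v))\<^sup>2 / (r (B i))\<^sup>2 = (freq v i)\<^sup>2" by (simp add: freq_def power_divide)

lemma freq_0: "B i < k ==> freq v i = 0 ==> v $ i = 0" using r_pos[of "B i"] blk_nth[of i "B i" v] by (auto simp: freq_def)

lemma freq_scale: "freq (s *R v) i = \<bar>s\<bar> * freq v i" by (simp add: freq_def blk_simps)

lemma pexp_nth:
 "pexp p (s *R v) $ i = (if B i < k then cos (freq v i * s) * p $ i + (sin (freq v i * s) / freq v i) * v $ i else p $ i + s * v $ i)"
proof (cases "B i < k")
 case True
 have c: "cos_sqrt ((\<bar>s\<bar> * freq v i)\<^sup>2) = cos (freq v i * s)"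
  using cos_sqrt_square[of "freq v i * s"] by (simp add: power_mult_distrib mult.commute)
 have s: "(freq v i * s) * sinc_sqrt ((\<bar>s\<bar> * freq v i)\<^sup>2) = sin (freq v i * s)"
  using sinc_sqrt_square[of "freq v i * s"] by (simp add: power_mult_distrib mult.commute)
 show ?thesis
 proof (cases "freq v i = 0")
  case True
  thus ?thesis using \<open>B i < k\<close> freq_0[of i v] c by (simp add: pexp_def freq_sq freq_scale)
 next
  case False
  hence "sinc_sqrt ((\<bar>s\<bar> * freq v i)\<^sup>2) * s = sin (freq v i * s) / freq v i"
   using s by (simp add: field_simps)
  thus ?thesis using True c by (simp add: pexp_def freq_sq freq_scale mult.assoc[symmetric])
 qed
qed (simp add: pexp_def)

lemma pvel_eq_gvel: "pvel p v = gvel p v 1"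
proof -
 have "x\<^sup>2 * sinc_sqrt (x\<^sup>2) = x * sin x" for x :: real
  using sinc_sqrt_square[of x] by (metis mult.assoc power2_eq_square)
 thus ?thesis by (simp add: vec_eq_iff pvel_def gvel_def freq_sq)
qed

lemma gvel_0 [simp]: "gvel p v 0 = v" by (simp add: gvel_def vec_eq_iff)

lemma gvel_scale: "gvel p (c *R v) s = c *R gvel p v (c * s)"
 by (auto simp: gvel_def vec_eq_iff freq_scale abs_if algebra_simps)

lemma has_vector_derivative_vecI:
 fixes f :: "real => real ^ 'n::finite"
 assumes "!!i. ((%t. f t $ i) has_real_derivative f' $ i) (at t)"
 shows "(f has_vector_derivative f') (at t)"
proof -
 have "((%t. f t *. axis i 1) has_derivative (%h. (h *R f') *. axis i 1)) (at t)" for i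
  using assms[of i] by (simp add: inner_axis real_deriv_iff)
 thus ?thesis unfolding has_vector_derivative_def by (subst has_derivative_componentwise_within) (auto simp: Basis_vec_def)
qed

lemma has_vector_derivative_pexp: "((%s. pexp p (s *R v)) has_vector_derivative gvel p v s) (at s)"
proof (rule has_vector_derivative_vecI)
 fix i
 show "((%s. pexp p (s *R v) $ i) has_real_derivative gvel p v s $ i) (at s)"
  unfolding pexp_nth gvel_def using freq_0[of i v]
  by (cases "B i < k"; cases "freq v i = 0") (auto intro!: derivative_eq_intros simp: algebra_simps)
qed

lemma has_vector_derivative_gvel:
 "((%s. gvel p v s) has_vector_derivative (\<chi> i. if B i < k then - (freq v i)\<^sup>2 * pexp p (s *R v) $ i else 0)) (at s)"
proof (rule has_vector_derivative_vecI)
 fix i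
 show "((%s. gvel p v s $ i) has_real_derivative (\<chi> i. if B i < k then - (freq v i)\<^sup>2 * pexp p (s *R v) $ i else 0) $ i) (at s)"
  unfolding pexp_nth gvel_def using freq_0[of i v] by (cases "B i < k"; cases "freq v i = 0")
   (auto intro!: derivative_eq_intros simp: algebra_simps power2_eq_square)
qed

lemma blk_gvel:
 assumes "B i = j" "j < k"
 shows "blk j (gvel p v s) = cos (freq v i * s) *R blk j v - (freq v i * sin (freq v i * s)) *R blk j p"
  and "freq v i ~= 0 ==> blk j (pexp p (s *R v)) = cos (freq v i * s) *R blk j p + (sin (freq v i * s) / freq v i) *R blk j v"
proof -
 have f: "freq v i' = freq v i" if "B i' = j" for i' using that assms by (simp add: freq_def)
 show "blk j (gvel p v s) = cos (freq v i * s) *R blk j v - (freq v i * sin (freq v i * s)) *R blk j p" unfolding vec_eq_iff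
 proof
  fix i'
  show "blk j (gvel p v s) $ i' = (cos (freq v i * s) *R blk j v - (freq v i * sin (freq v i * s)) *R blk j p) $ i'"
   using f[of i'] assms(2) by (cases "B i' = j") (simp_all add: blk_def gvel_def)
 qed
 show "blk j (pexp p (s *R v)) = cos (freq v i * s) *R blk j p + (sin (freq v i * s) / freq v i) *R blk j v"
  unfolding vec_eq_iff
 proof
  fix i'
  show "blk j (pexp p (s *R v)) $ i' = (cos (freq v i * s) *R blk j p + (sin (freq v i * s) / freq v i) *R blk j v) $ i'"
   using f[of i'] assms(2) by (cases "B i' = j") (simp_all add: blk_def pexp_nth)
 qed
qed

lemma ex_block: "j < k ==> EX i. B i = j"
 using card_block[of j] by (metis (mono_tags) card.empty empty_Collect_eq not_numeral_le_zero)

lemma norm_blk_gvel: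
 assumes p: "p : S" and v: "v : tan p" and j: "j < k"
 shows "norm (blk j (gvel p v s)) = norm (blk j v)"
proof -
 obtain i where i: "B i = j" using ex_block[OF j] by blast
 let ?w = "freq v i"
 have vv: "blk j v *. blk j v = ?w\<^sup>2 * (r j)\<^sup>2"
  using r_pos[OF j] i by (simp add: freq_def power_divide dot_square_norm)
 have pp: "blk j p *. blk j p = (r j)\<^sup>2" using norm_blk[OF p j] by (simp add: dot_square_norm)
 have vp: "blk j v *. blk j p = 0" "blk j p *. blk j v = 0" using tanD[OF v j] by (auto simp: inner_commute)
 have "blk j (gvel p v s) *. blk j (gvel p v s) = (cos (?w * s))\<^sup>2 * (blk j v *. blk j v) + ?w\<^sup>2 * (sin (?w * s))\<^sup>2 * (blk j p *. blk j p)"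
  unfolding blk_gvel(1)[OF i j] by (simp add: inner_diff vp power2_eq_square algebra_simps)
 also have "\<dots> = blk j v *. blk j v" unfolding vv pp using sin_cos_squared_add[of "?w * s"] by algebra
 finally show ?thesis by (simp add: norm_eq_sqrt_inner)
qed

lemma free_gvel: "free (gvel p v s) = free v" by (auto simp: vec_eq_iff free_def gvel_def)

lemma norm_gvel: "p : S ==> v : tan p ==> norm (gvel p v s) = norm v"
 by (rule power2_eq_imp_eq) (simp_all add: norm_split[of "gvel p v s"] norm_split[of v] norm_blk_gvel free_gvel)

lemma pexp_in_S:
 assumes p: "p : S" and v: "v : tan p"
 shows "pexp p v : S" unfolding S_iff using norm_sphere_exp[OF r_pos norm_blk[OF p] tanD[OF v]] by (simp add: blk_pexp)

lemma freq_gvel: "p : S ==> v : tan p ==> B i < k ==> freq (gvel p v s) i = freq v i" by (simp add: freq_def norm_blk_gvel)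

lemma gvel_in_tan:
 assumes p: "p : S" and v: "v : tan p"
 shows "gvel p v s : tan (pexp p (s *R v))" unfolding tan_def
proof (clarify)
 fix j assume j: "j < k"
 obtain i where i: "B i = j" using ex_block[OF j] by blast
 let ?w = "freq v i"
 show "blk j (gvel p v s) *. blk j (pexp p (s *R v)) = 0"
 proof (cases "?w = 0")
  case True
  hence "blk j v = 0" using i r_pos[OF j] by (simp add: freq_def)
  hence "blk j (gvel p v s) = 0" using norm_blk_gvel[OF p v j] by simp
  thus ?thesis by simp
 next
  case False
  have vv: "blk j v *. blk j v = ?w\<^sup>2 * (r j)\<^sup>2"
   using r_pos[OF j] i by (simp add: freq_def power_divide dot_square_norm)
  have pp: "blk j p *. blk j p = (r j)\<^sup>2" using norm_blk[OF p j] by (simp add: dot_square_norm)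
  have vp: "blk j v *. blk j p = 0" "blk j p *. blk j v = 0" using tanD[OF v j] by (auto simp: inner_commute)
  show ?thesis unfolding blk_gvel(1)[OF i j] blk_gvel(2)[OF i j False] using False
   by (simp add: inner_diff inner_add vp vv pp power2_eq_square field_simps)
 qed
qed

text \<open>The addition formulas in each block. With \<open>t\<close> negative it runs a geodesic
  backwards, which is a main use below.\<close>

lemma pexp_pexp:
 assumes p: "p : S" and v: "v : tan p"
 shows "pexp (pexp p (s *R v)) (t *R gvel p v s) = pexp p ((s + t) *R v)"
proof -
 have "pexp (pexp p (s *R v)) (t *R gvel p v s) $ i = pexp p ((s + t) *R v) $ i" for i
 proof (cases "B i < k & freq v i ~= 0")
  case True
  thus ?thesis unfolding pexp_nth using freq_gvel[OF p v, of i s]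
   by (simp add: gvel_def cos_add sin_add distrib_left field_simps)
 next
  case False
  thus ?thesis unfolding pexp_nth using freq_gvel[OF p v, of i s] freq_0[of i v] by (auto simp: gvel_def algebra_simps)
 qed
 thus ?thesis by (simp add: vec_eq_iff)
qed

lemma gvel_gvel:
 assumes p: "p : S" and v: "v : tan p"
 shows "gvel (pexp p (s *R v)) (gvel p v s) t = gvel p v (s + t)"
proof -
 have "gvel (pexp p (s *R v)) (gvel p v s) t $ i = gvel p v (s + t) $ i" for i
 proof (cases "B i < k & freq v i ~= 0")
  case True
  hence 1: "gvel (pexp p (s *R v)) (gvel p v s) t $ i = cos (freq v i * t) * (cos (freq v i * s) * v $ i - freq v i * sin (freq v i * s) * p $ i)
    - freq v i * sin (freq v i * t) * (cos (freq v i * s) * p $ i + (sin (freq v i * s) / freq v i) * v $ i)"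
   using freq_gvel[OF p v, of i s] by (simp add: gvel_def[of "pexp p (s *R v)"] pexp_nth) (simp add: gvel_def)
  show ?thesis unfolding 1 using True by (simp add: gvel_def cos_add sin_add distrib_left field_simps)
 next
  case False
  thus ?thesis using freq_gvel[OF p v, of i s] freq_0[of i v] by (auto simp: gvel_def algebra_simps)
 qed
 thus ?thesis by (simp add: vec_eq_iff)
qed

subsection \<open>The product distance\<close>

definition pdist :: "real ^ 'i => real ^ 'i => real" where
 "pdist p q = sqrt ((\<Sum>j<k. (r j * angle (r j) (blk j p) (blk j q))\<^sup>2) + (norm (free p - free q))\<^sup>2)"

lemma pdist_nonneg: "0 <= pdist p q" by (simp add: pdist_def sum_nonneg)

lemma pdist_sq: "(pdist p q)\<^sup>2 = (\<Sum>j<k. (r j * angle (r j) (blk j p) (blk j q))\<^sup>2) + (norm (free p - free q))\<^sup>2"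
 by (simp add: pdist_def sum_nonneg)

lemma pdist_commute: "pdist p q = pdist q p" by (simp add: pdist_def angle_def inner_commute norm_minus_commute)

lemma norm_le_pdist:
 assumes "p : S" "q : S"
 shows "norm (p - q) <= pdist p q"
proof (rule power2_le_imp_le[OF _ pdist_nonneg])
 have "(norm (blk j p - blk j q))\<^sup>2 <= (r j * angle (r j) (blk j p) (blk j q))\<^sup>2" if "j < k" for j
  by (intro power_mono chord_le_angle[OF r_pos[OF that]] norm_blk assms that norm_ge_zero)
 thus "(norm (p - q))\<^sup>2 <= (pdist p q)\<^sup>2" unfolding norm_split[of "p - q"] pdist_sq blk_simps free_simps
  by (intro add_mono sum_mono) auto
qed

lemma block_log_exists:
 assumes q: "q : S" and j: "j < k" and z: "z : range (blk j)" "norm z = r j"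
 shows "EX c:range (blk j). c *. blk j q = 0 & sphere_exp (r j) (blk j q) c = z & norm c = r j * angle (r j) (blk j q) z"
proof -
 have "\<not> card {i. B i = j} <= Suc 0" using card_block[OF j] by simp
 then obtain i i' where i: "B i = j" "B i' = j" "i ~= i'" using card_le_Suc0_iff_eq[of "{i. B i = j}"] by auto
 \<comment> \<open>A nonzero vector of the block orthogonal to the block of \<open>q\<close>: a
   coordinate axis if that coordinate of \<open>q\<close> vanishes, otherwise two coordinates of
   \<open>q\<close> swapped, with a sign.\<close>
 define e0 where "e0 = (if blk j q $ i = 0 then axis i 1 else (blk j q $ i') *R axis i 1 - (blk j q $ i) *R axis i' (1::real))"
 have e0: "e0 ~= 0" using i by (auto simp: e0_def vec_eq_iff axis_def)
 have e1: "e0 *. blk j q = 0" by (simp add: e0_def inner_diff inner_axis')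
 have "blk j e0 = e0" using i by (auto simp: e0_def blk_def vec_eq_iff axis_def)
 hence e2: "e0 : range (blk j)" by (metis rangeI)
 have W: "subspace (range (blk j))" using linear_blk by (simp add: linear_subspace_image)
 show ?thesis using e0 e1 z j q
  by (intro sphere_log_exists[OF r_pos[OF j] _ _ W _ _ subspace_scale[OF W e2, of "inverse (norm e0)"]]) (auto simp: norm_blk)
qed

text \<open>The blocks decouple: each sphere contributes the bound of
  \<open>sphere_exp_support\<close>, where \<open>c\<close> is a logarithm at \<open>q\<close> of
  the target of \<open>v0\<close>, and the free coordinates contribute an exact quadratic identity.
  At \<open>v = v0\<close> both sides agree, so this is an upper quadratic support.\<close>

lemma pexp_support:
 assumes p: "p : S" and q: "q : S" and v0: "v0 : tan p"
 shows "EX L. ALL v:tan p. (pdist q (pexp p v))\<^sup>2 <= (pdist q (pexp p v0))\<^sup>2 + (norm (v - v0))\<^sup>2 + L *. (v - v0)"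
proof -
 have "EX L. ALL w. w *. blk j p = 0 --> (r j * angle (r j) (blk j q) (sphere_exp (r j) (blk j p) w))\<^sup>2
    <= (r j * angle (r j) (blk j q) (blk j (pexp p v0)))\<^sup>2 + (norm (w - blk j v0))\<^sup>2 + L *. (w - blk j v0)" if j: "j < k" for j
 proof -
  let ?z = "blk j (pexp p v0)"
  have "EX c:range (blk j). c *. blk j q = 0 & sphere_exp (r j) (blk j q) c = ?z & norm c = r j * angle (r j) (blk j q) ?z"
   using pexp_in_S[OF p v0] j by (intro block_log_exists q) (auto simp: norm_blk)
  then obtain c where c: "c *. blk j q = 0" "sphere_exp (r j) (blk j q) c = ?z" "norm c = r j * angle (r j) (blk j q) ?z" by blast
  show ?thesis using sphere_exp_support[OF r_pos[OF j] norm_blk[OF p j] norm_blk[OF q j] tanD[OF v0 j] c(1)] c(2,3) j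
   by (auto simp: blk_pexp)
 qed
 then obtain L where L: "!!j w. j < k ==> w *. blk j p = 0 ==> (r j * angle (r j) (blk j q) (sphere_exp (r j) (blk j p) w))\<^sup>2
    <= (r j * angle (r j) (blk j q) (blk j (pexp p v0)))\<^sup>2 + (norm (w - blk j v0))\<^sup>2 + L j *. (w - blk j v0)" by metis
 define f where "f = free q - free (pexp p v0)"
 have "(pdist q (pexp p v))\<^sup>2 <= (pdist q (pexp p v0))\<^sup>2 + (norm (v - v0))\<^sup>2 + ((\<Sum>j<k. blk j (L j)) - 2 *R free f) *. (v - v0)"
  if v: "v : tan p" for v
 proof -
  have fr: "(norm (free q - free (pexp p v)))\<^sup>2 = (norm f)\<^sup>2 + (norm (free (v - v0)))\<^sup>2 - 2 * (free f *. (v - v0))"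
  proof -
   have "free q - free (pexp p v) = f - free (v - v0)" by (simp add: f_def free_pexp free_simps)
   moreover have "f = free f" by (simp add: f_def free_def vec_eq_iff)
   hence "f *. free (v - v0) = free f *. (v - v0)" by (metis free_inner_left inner_commute)
   ultimately show ?thesis by (simp add: power2_norm_eq_inner inner_diff_left inner_diff_right inner_commute)
  qed
  have bl: "(\<Sum>j<k. (r j * angle (r j) (blk j q) (blk j (pexp p v)))\<^sup>2)
    <= (\<Sum>j<k. (r j * angle (r j) (blk j q) (blk j (pexp p v0)))\<^sup>2 + (norm (blk j (v - v0)))\<^sup>2 + blk j (L j) *. (v - v0))"
  proof (rule sum_mono)
   fix j assume "j : {..<k}"
   hence j: "j < k" by simp
   have "L j *. (blk j v - blk j v0) = blk j (L j) *. (v - v0)"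
    using blk_inner_left[of "L j" j "v - v0"] blk_inner_right[of j "L j" "v - v0"] by (simp add: linear_diff[OF linear_blk])
   thus "(r j * angle (r j) (blk j q) (blk j (pexp p v)))\<^sup>2
    <= (r j * angle (r j) (blk j q) (blk j (pexp p v0)))\<^sup>2 + (norm (blk j (v - v0)))\<^sup>2 + blk j (L j) *. (v - v0)"
    using L[OF j tanD[OF v j]] j by (simp add: blk_pexp blk_simps)
  qed
  show ?thesis unfolding pdist_sq norm_split[of "v - v0"] fr using bl
   by (simp add: sum.distrib inner_diff_left inner_sum_left f_def)
 qed
 thus ?thesis by blast
qed

text \<open>The case \<open>c = 0\<close> of \<open>sphere_exp_support\<close>, in which the curve
  starts at the exponential of \<open>v0\<close> and the linear term vanishes. This is the hinge
  comparison of nonnegative curvature.\<close>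

lemma pdist_pexp_pexp:
 assumes p: "p : S" and v0: "v0 : tan p" and v: "v : tan p"
 shows "pdist (pexp p v0) (pexp p v) <= norm (v0 - v)"
proof (rule power2_le_imp_le)
 have "(r j * angle (r j) (blk j (pexp p v0)) (blk j (pexp p v)))\<^sup>2 <= (norm (blk j (v - v0)))\<^sup>2" if j: "j < k" for j
 proof -
  have "sphere_exp (r j) (blk j (pexp p v0)) 0 = sphere_exp (r j) (blk j p) (blk j v0)"
   using j by (simp add: blk_pexp sphere_exp_def)
  from sphere_exp_support[OF r_pos[OF j] norm_blk[OF p j] norm_blk[OF pexp_in_S[OF p v0] j] tanD[OF v0 j] _ this]
  show ?thesis using tanD[OF v j] j by (auto simp: blk_pexp blk_simps)
 qed
 moreover have "free (pexp p v0) - free (pexp p v) = - free (v - v0)" by (simp add: free_pexp free_simps)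
 ultimately show "(pdist (pexp p v0) (pexp p v))\<^sup>2 <= (norm (v0 - v))\<^sup>2"
  unfolding pdist_sq norm_minus_commute[of v0 v] norm_split[of "v - v0"] by (intro add_mono sum_mono) auto
qed simp

lemma plog_exists:
 assumes p: "p : S" and q: "q : S"
 shows "EX v:tan p. pexp p v = q & norm v = pdist p q"
proof -
 have "ALL j. EX c. j < k --> blk j c *. blk j p = 0 & sphere_exp (r j) (blk j p) (blk j c) = blk j q
   & norm (blk j c) = r j * angle (r j) (blk j p) (blk j q)"
 proof
  fix j
  show "EX c. j < k --> blk j c *. blk j p = 0 & sphere_exp (r j) (blk j p) (blk j c) = blk j q
   & norm (blk j c) = r j * angle (r j) (blk j p) (blk j q)"
   using block_log_exists[OF p, of j "blk j q"] norm_blk[OF q, of j] by fastforce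
 qed
 from choice[OF this] obtain c where c: "!!j. j < k ==> blk j (c j) *. blk j p = 0 & sphere_exp (r j) (blk j p) (blk j (c j)) = blk j q
   & norm (blk j (c j)) = r j * angle (r j) (blk j p) (blk j q)" by blast
 define v where "v = (\<chi> i. if B i < k then c (B i) $ i else q $ i - p $ i)"
 have bv: "blk j v = blk j (c j)" if "j < k" for j using that by (auto simp: v_def blk_def vec_eq_iff)
 have fv: "free v = free q - free p" by (auto simp: v_def free_def vec_eq_iff)
 have "v : tan p" using c bv by (simp add: tan_def)
 moreover have "pexp p v = q" by (rule blk_free_eqI) (use c bv fv in \<open>auto simp: blk_pexp free_pexp\<close>)
 moreover have "(norm v)\<^sup>2 = (pdist p q)\<^sup>2"
  unfolding norm_split[of v] pdist_sq fv using c bv by (simp add: norm_minus_commute)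
 hence "norm v = pdist p q" by (simp add: power2_eq_iff_nonneg pdist_nonneg)
 ultimately show ?thesis by blast
qed

text \<open>Both outer points are compared in the tangent space at the middle point
  \<open>q\<close>, whose exponential map does not increase distances.\<close>

lemma pdist_triangle:
 assumes p: "p : S" and q: "q : S" and s: "s : S"
 shows "pdist p s <= pdist p q + pdist q s"
proof -
 obtain v where v: "v : tan q" "pexp q v = p" "norm v = pdist q p" using plog_exists[OF q p] by blast
 obtain w where w: "w : tan q" "pexp q w = s" "norm w = pdist q s" using plog_exists[OF q s] by blast
 have "pdist p s <= norm (v - w)" using pdist_pexp_pexp[OF q v(1) w(1)] v w by simp
 also have "\<dots> <= norm v + norm w" by (rule norm_triangle_ineq4)
 finally show ?thesis using v w by (simp add: pdist_commute)
qed

lemma pdist_self: "p : S ==> pdist p p = 0" by (simp add: pdist_def angle_self r_pos norm_blk)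

lemma pdist_pexp: "p : S ==> v : tan p ==> pdist p (pexp p v) <= norm v"
 using pdist_pexp_pexp[of p 0 v] subspace_0[OF subspace_tan] by simp

lemma continuous_on_pdist: "continuous_on (S \<times> S) (%(p, q). pdist p q)"
proof -
 have "continuous_on (S \<times> S) (%x. angle (r j) (blk j (fst x)) (blk j (snd x)))" if "j < k" for j unfolding angle_def
 proof (rule continuous_on_arccos)
  show "continuous_on (S \<times> S) (%x. blk j (fst x) *. blk j (snd x) / (r j)\<^sup>2)"
   using r_pos[OF that] by (intro continuous_intros) auto
  show "ALL x:S \<times> S. - 1 <= blk j (fst x) *. blk j (snd x) / (r j)\<^sup>2 & blk j (fst x) *. blk j (snd x) / (r j)\<^sup>2 <= 1"
   using inner_div_bounds[OF r_pos[OF that] norm_blk norm_blk] that by auto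
 qed
 thus ?thesis unfolding pdist_def case_prod_beta by (intro continuous_intros) auto
qed

subsection \<open>Smoothness\<close>

lemma smooth_on_norm_blk_sq:
 assumes "open A" "smooth_on A f"
 shows "smooth_on A (%x. (norm (blk j (f x)))\<^sup>2 / (r j)\<^sup>2)" unfolding power2_norm_eq_inner divide_inverse
 by (intro smooth_on_mult smooth_on_inner smooth_on_blk smooth_on_const assms)

lemma smooth_on_pexp:
 assumes "open A" "smooth_on A f" "smooth_on A g"
 shows "smooth_on A (%x. pexp (f x) (g x))" unfolding pexp_def
proof (rule smooth_on_vec[OF assms(1)])
 fix i
 note cs = smooth_on_compose[OF assms(1) open_UNIV _ smooth_on_norm_blk_sq[OF assms(1,3)] smooth_on_cos_sqrt, of "B i"]
  smooth_on_compose[OF assms(1) open_UNIV _ smooth_on_norm_blk_sq[OF assms(1,3)] smooth_on_sinc_sqrt, of "B i"]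
 show "smooth_on A (%x. if B i < k then cos_sqrt ((norm (blk (B i) (g x)))\<^sup>2 / (r (B i))\<^sup>2) * f x $ i
   + sinc_sqrt ((norm (blk (B i) (g x)))\<^sup>2 / (r (B i))\<^sup>2) * g x $ i else f x $ i + g x $ i)"
 proof (cases "B i < k")
  case True
  show ?thesis unfolding if_P[OF True]
   by (intro smooth_on_add smooth_on_diff smooth_on_mult smooth_on_norm_blk_sq smooth_on_vec_nth assms cs subset_UNIV)
 next
  case False
  show ?thesis unfolding if_not_P[OF False] by (intro smooth_on_add smooth_on_vec_nth assms)
 qed
qed

lemma smooth_on_pvel:
 assumes "open A" "smooth_on A f" "smooth_on A g"
 shows "smooth_on A (%x. pvel (f x) (g x))" unfolding pvel_def
proof (rule smooth_on_vec[OF assms(1)])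
 fix i
 note cs = smooth_on_compose[OF assms(1) open_UNIV _ smooth_on_norm_blk_sq[OF assms(1,3)] smooth_on_cos_sqrt, of "B i"]
  smooth_on_compose[OF assms(1) open_UNIV _ smooth_on_norm_blk_sq[OF assms(1,3)] smooth_on_sinc_sqrt, of "B i"]
 show "smooth_on A (%x. if B i < k then cos_sqrt ((norm (blk (B i) (g x)))\<^sup>2 / (r (B i))\<^sup>2) * g x $ i
   - (norm (blk (B i) (g x)))\<^sup>2 / (r (B i))\<^sup>2 * sinc_sqrt ((norm (blk (B i) (g x)))\<^sup>2 / (r (B i))\<^sup>2) * f x $ i else g x $ i)"
 proof (cases "B i < k")
  case True
  show ?thesis unfolding if_P[OF True]
   by (intro smooth_on_add smooth_on_diff smooth_on_mult smooth_on_norm_blk_sq smooth_on_vec_nth assms cs subset_UNIV)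
 next
  case False
  show ?thesis unfolding if_not_P[OF False] by (intro smooth_on_add smooth_on_vec_nth assms)
 qed
qed

definition W :: "(real ^ 'i) set" where
 "W = {x. ALL j<k. blk j x ~= 0}"

text \<open>The blockwise radial retraction of \<open>W\<close> onto the product. Composition with
  it turns functions on the product into functions on an open set, which can be differentiated in
  the ambient space.\<close>

definition ret :: "real ^ 'i => real ^ 'i" where
 "ret x = (\<chi> i. if B i < k then r (B i) / norm (blk (B i) x) * x $ i else x $ i)"

definition tproj :: "real ^ 'i => real ^ 'i => real ^ 'i" where
 "tproj p v = v - (\<Sum>j<k. (blk j v *. blk j p / (r j)\<^sup>2) *R blk j p)"

lemma open_W: "open W"
proof -
 have "W = (\<Inter>j\<in>{..<k}. {x. blk j x ~= 0})" by (auto simp: W_def)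
 thus ?thesis by (auto intro!: open_INT open_Collect_neq continuous_intros)
qed

lemma S_subset_W: "S \<subseteq> W" using norm_blk r_pos by (fastforce simp: W_def)

lemma ret_in_S: "x : W ==> ret x : S"
proof -
 assume "x : W"
 have "norm (blk j (ret x)) = r j" if "j < k" for j
 proof -
  have "blk j (ret x) = (r j / norm (blk j x)) *R blk j x" using that by (auto simp: blk_def ret_def vec_eq_iff)
  thus ?thesis using \<open>x : W\<close> that r_pos[OF that] by (simp add: W_def)
 qed
 thus ?thesis by (simp add: S_iff)
qed

lemma ret_id: "p : S ==> ret p = p" using r_pos by (auto simp: ret_def vec_eq_iff norm_blk less_imp_neq[THEN not_sym])

lemma smooth_on_ret: "smooth_on W ret" unfolding ret_def[abs_def]
proof (rule smooth_on_vec[OF open_W])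
 fix i
 have sq: "smooth_on W (%x. sqrt (blk (B i) x *. blk (B i) x))" if "B i < k"
  using that by (intro smooth_on_sqrt open_W smooth_on_inner smooth_on_blk smooth_on_id) (auto simp: W_def)
 show "smooth_on W (%x. if B i < k then r (B i) / norm (blk (B i) x) * x $ i else x $ i)"
 proof (cases "B i < k")
  case True
  show ?thesis unfolding if_P[OF True] norm_eq_sqrt_inner
   by (intro smooth_on_mult smooth_on_divide smooth_on_const smooth_on_vec_nth smooth_on_id open_W sq[OF True])
    (use True in \<open>auto simp: W_def\<close>)
 next
  case False
  show ?thesis unfolding if_not_P[OF False] by (intro smooth_on_vec_nth smooth_on_id open_W)
 qed
qed

lemma blk_sum_blk: "j < k ==> blk j (\<Sum>j'<k. c j' *R blk j' x) = c j *R blk j x"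
 by (auto simp: vec_eq_iff blk_def sum.delta if_distrib cong: if_cong)

lemma free_sum_blk: "free (\<Sum>j'<k. c j' *R blk j' x) = 0"
 by (auto simp: vec_eq_iff blk_def free_def sum.delta if_distrib cong: if_cong)

lemma blk_tproj: "j < k ==> blk j (tproj p v) = blk j v - (blk j v *. blk j p / (r j)\<^sup>2) *R blk j p"
 unfolding tproj_def blk_simps by (simp add: blk_sum_blk)

lemma free_tproj: "free (tproj p v) = free v" unfolding tproj_def free_simps by (simp add: free_sum_blk)

lemma tproj_in_tan: "p : S ==> tproj p v : tan p"
 using r_pos by (auto simp: tan_def blk_tproj inner_diff dot_square_norm norm_blk less_imp_neq[THEN not_sym])

lemma tproj_id: "v : tan p ==> tproj p v = v" by (simp add: tproj_def tanD)

lemma inner_tproj: "w : tan p ==> w *. tproj p v = w *. v"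
 unfolding inner_split[of w] by (simp add: blk_tproj free_tproj inner_diff_right tanD)

text \<open>The derivative exists by \<open>smooth_on_ret\<close>, so it is determined by its values
  along lines, where in each sphere block the function is an explicit quotient of one real
  variable.\<close>

lemma has_derivative_ret:
 assumes p: "p : S"
 shows "(ret has_derivative tproj p) (at p)"
proof -
 have pW: "p : W" using p S_subset_W by auto
 note d = smooth_on_deriv[OF smooth_on_ret open_W pW]
 let ?D = "FD ret (at p)"
 have n: "((%t. ret (p + t *R v)) has_vector_derivative ?D v) (at 0)" for v
  using deriv_along_line[where f=ret and p=p and t=0] d by simp
 have "?D v $ i = tproj p v $ i" for v i
 proof (cases "B i < k")
  case False
  have "((%t. ret (p + t *R v) $ i) has_vector_derivative ?D v $ i) (at 0)"
   by (rule bounded_linear.has_vector_derivative[OF bounded_linear_vec_nth n])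
  moreover have "((%t. ret (p + t *R v) $ i) has_vector_derivative v $ i) (at 0)"
   using False by (auto simp: ret_def intro!: derivative_eq_intros)
  moreover have "tproj p v $ i = v $ i" using False free_tproj[of p v] by (auto simp: free_def vec_eq_iff split: if_splits)
  ultimately show ?thesis using vector_derivative_unique_at by metis
 next
  case True
  let ?j = "B i"
  define m where "m = (%t. (blk ?j p + t *R blk ?j v) *. (blk ?j p + t *R blk ?j v))"
  have m0: "m 0 = (r ?j)\<^sup>2" using norm_blk[OF p True] by (simp add: m_def dot_square_norm)
  have rj: "r ?j > 0" by (rule r_pos[OF True])
  have "(m has_real_derivative 2 * (blk ?j v *. blk ?j p)) (at 0)"
  proof -
   have "m = (%t. blk ?j p *. blk ?j p + 2 * t * (blk ?j v *. blk ?j p) + t\<^sup>2 * (blk ?j v *. blk ?j v))"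
    by (simp add: m_def fun_eq_iff inner_add inner_commute power2_eq_square algebra_simps)
   thus ?thesis by (auto intro!: derivative_eq_intros)
  qed
  hence X: "((%t. inverse (sqrt (m t))) has_real_derivative - (2 * (blk ?j v *. blk ?j p) * (inverse (r ?j) / 2)) / (r ?j)\<^sup>2) (at 0)"
   using m0 rj by (auto intro!: derivative_eq_intros simp: power2_eq_square field_simps)
  have Y: "((%t. p $ i + t * v $ i) has_real_derivative v $ i) (at 0)" by (auto intro!: derivative_eq_intros)
  have "((%t. r ?j * inverse (sqrt (m t)) * (p $ i + t * v $ i)) has_real_derivative
    (r ?j * (- (2 * (blk ?j v *. blk ?j p) * (inverse (r ?j) / 2)) / (r ?j)\<^sup>2)) * p $ i + (r ?j * inverse (r ?j)) * v $ i) (at 0)"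
   using DERIV_mult[OF DERIV_cmult[OF X, of "r ?j"] Y] m0 rj by (simp add: mult.commute[of "v $ i"])
  moreover have "(%t. ret (p + t *R v) $ i) = (%t. r ?j * inverse (sqrt (m t)) * (p $ i + t * v $ i))"
   using True by (auto simp: ret_def m_def norm_eq_sqrt_inner blk_simps divide_inverse)
  moreover have "(r ?j * (- (2 * (blk ?j v *. blk ?j p) * (inverse (r ?j) / 2)) / (r ?j)\<^sup>2)) * p $ i + (r ?j * inverse (r ?j)) * v $ i = tproj p v $ i"
  proof -
   have "tproj p v $ i = blk ?j (tproj p v) $ i" by (simp add: blk_nth)
   also have "\<dots> = v $ i - (blk ?j v *. blk ?j p / (r ?j)\<^sup>2) * p $ i" by (simp add: blk_tproj[OF True] blk_nth)
   finally show ?thesis using rj by (simp add: field_simps power2_eq_square)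
  qed
  ultimately have "((%t. ret (p + t *R v) $ i) has_vector_derivative tproj p v $ i) (at 0)"
   by (simp add: has_real_derivative_iff_has_vector_derivative)
  moreover have "((%t. ret (p + t *R v) $ i) has_vector_derivative ?D v $ i) (at 0)"
   by (rule bounded_linear.has_vector_derivative[OF bounded_linear_vec_nth n])
  ultimately show ?thesis using vector_derivative_unique_at by metis
 qed
 hence "?D = tproj p" by (simp add: fun_eq_iff vec_eq_iff)
 thus ?thesis using d by simp
qed

end

section \<open>Charts of products of spheres\<close>

lemma open_preimage_of_continuous_map:
 assumes "open A" "continuous_on A f" "f ` A \<subseteq> S" "continuous_map (top_of_set S) X pr" "openin X V"
 shows "open {x : A. pr (f x) : V}"
proof -
 have "continuous_map (top_of_set A) (top_of_set S) f" using assms(2,3) by (auto simp: continuous_map_in_subtopology)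
 hence "continuous_map (top_of_set A) X (pr \<circ> f)" using assms(4) by (rule continuous_map_compose)
 hence "openin (top_of_set A) {x : A. (pr \<circ> f) x : V}" using assms(5) by (simp add: continuous_map_def)
 thus ?thesis using assms(1) by (simp add: openin_open_eq)
qed

lemma FD_eqI: "(f has_derivative f') (at x) ==> FD f (at x) = f'" by (metis frechet_derivative_at)

text \<open>A Riemannian submersion in ambient terms: the coordinates of \<open>pr\<close> are
  extended by \<open>ret\<close>, and horizontal vectors are vectors of \<open>real ^ 'i\<close>
  orthogonal to the tangential kernel. Charts and model space of the total space no longer occur, so
  the geometry below is done with explicit formulas.\<close>

locale submersion_data = sphere_product B k r for B :: "'i::finite => nat" and k and r +
 fixes M :: "('m, 'e::euclidean_space) riemannian" and pr :: "real ^ 'i => 'm"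
 assumes manifold: "riemannian_manifold M"
  and cont_pr: "continuous_map (top_of_set S) (man_top M) pr"
  and surj_pr: "pr ` S = topspace (man_top M)"
  and smooth_coord: "b : atlas M ==> smooth_on {q : W. pr (ret q) : fst b} (%q. snd b (pr (ret q)))"
  and horizontal_bij: "b : atlas M ==> p : S ==> pr p : fst b ==>
   D = FD (%q. snd b (pr (ret q))) (at p) ==>
   H = {u : tan p. ALL w:tan p. D w = 0 --> u *. w = 0} ==>
   bij_betw D H UNIV & (ALL u:H. ALL v:H. metric M b (snd b (pr p)) (D u) (D v) = u *. v)"

locale sphere_product_dim = sphere_product B k r for B :: "'i::finite => nat" and k and r +
 fixes d :: "'d::euclidean_space itself"
 assumes dim: "DIM('d) + k = CARD('i)"
begin

abbreviation P :: "(real ^ 'i, 'd) riemannian" where "P \<equiv> submanifold S"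

text \<open>The tangent space is the orthogonal complement of the \<open>k\<close> vectors
  \<open>blk j p\<close>, which are nonzero and pairwise orthogonal.\<close>

lemma dim_tan:
 assumes p: "p : S"
 shows "dim (tan p) = DIM('d)"
proof -
 define A where "A = (%j. blk j p) ` {..<k}"
 have nz: "blk j p ~= 0" if "j < k" for j using S_subset_W p that by (auto simp: W_def)
 have orth: "blk j p *. blk j' p = 0" if "j ~= j'" for j j'
  unfolding inner_vec_def using that by (intro sum.neutral) (auto simp: blk_def)
 have inj: "inj_on (%j. blk j p) {..<k}"
 proof (rule inj_onI, rule ccontr)
  fix j j' assume "j : {..<k}" "j' : {..<k}" "blk j p = blk j' p" "j ~= j'"
  thus False using orth[of j j'] nz[of j] by simp
 qed
 have "independent A"
 proof (rule pairwise_orthogonal_independent)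
  show "pairwise orthogonal A" by (auto simp: A_def pairwise_def orthogonal_def intro!: orth)
  show "0 \<notin> A" using nz by (force simp: A_def)
 qed
 hence dA: "dim A = k" using inj by (simp add: dim_eq_card_independent A_def card_image)
 have "dim {y : UNIV. ALL x:span A. orthogonal x y} + dim (span A) = dim (UNIV :: (real ^ 'i) set)"
  by (rule dim_subspace_orthogonal_to_vectors) auto
 moreover have "{y : UNIV. ALL x:span A. orthogonal x y} = {y : UNIV. ALL x:A. orthogonal x y}"
 proof -
  have "orthogonal x y" if "x : span A" "ALL z:A. orthogonal z y" for x y
   using orthogonal_to_span[OF that(1), of y] that(2) by (metis orthogonal_commute)
  thus ?thesis using span_base by blast
 qed
 ultimately have "dim {y : UNIV. ALL x:A. orthogonal x y} + dim A = dim (UNIV :: (real ^ 'i) set)" by simp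
 moreover have "{y : UNIV. ALL x:A. orthogonal x y} = tan p"
 proof -
  have "(ALL x:A. orthogonal x y) \<longleftrightarrow> y : tan p" for y
   unfolding A_def tan_def orthogonal_def by (simp add: inner_commute[of _ y] blk_inner_left[of y]) auto
  thus ?thesis by blast
 qed
 ultimately show ?thesis using dA dim by (simp add: dim_UNIV)
qed

text \<open>A linear isometry of the model space onto the tangent space at \<open>p\<close>; its
  adjoint \<open>Linv p\<close> inverts it there.\<close>

definition L :: "real ^ 'i => 'd => real ^ 'i" where
 "L p = (SOME f. linear f & range f = tan p & (ALL x. norm (f x) = norm x))"

lemma L:
 assumes p: "p : S"
 shows "linear (L p)" "range (L p) = tan p" "norm (L p x) = norm x" "inj (L p)" "L p x : tan p" "L p x *. L p y = x *. y"
proof -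
 obtain f :: "'d => real ^ 'i" and g where f: "linear f" "f ` UNIV = tan p" "!!x. x : UNIV ==> norm (f x) = norm x"
  using isometries_subspaces[of "UNIV :: 'd set" "tan p"] subspace_tan dim_tan[OF p] by (metis dim_UNIV subspace_UNIV)
 hence "EX f :: 'd => real ^ 'i. linear f & range f = tan p & (ALL x. norm (f x) = norm x)" by (intro exI[of _ f]) auto
 from someI_ex[OF this] have *: "linear (L p) & range (L p) = tan p & (ALL x. norm (L p x) = norm x)" unfolding L_def .
 thus "linear (L p)" "range (L p) = tan p" "norm (L p x) = norm x" by auto
 show "L p x : tan p" using * by blast
 show "inj (L p)"
 proof (rule injI)
  fix x y assume "L p x = L p y"
  hence "norm (L p (x - y)) = 0" using linear_diff[of "L p" x y] * by simp
  thus "x = y" using * by simp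
 qed
 have pol: "4 * (u *. v) = (norm (u + v))\<^sup>2 - (norm (u - v))\<^sup>2" for u v :: "'x::real_inner"
  by (simp add: power2_norm_eq_inner inner_add inner_diff inner_commute)
 have "4 * (L p x *. L p y) = 4 * (x *. y)"
  unfolding pol linear_add[OF conjunct1[OF *], symmetric] linear_diff[OF conjunct1[OF *], symmetric] using * by simp
 thus "L p x *. L p y = x *. y" by simp
qed

definition Linv :: "real ^ 'i => real ^ 'i => 'd" where
 "Linv p v = (\<Sum>e\<in>Basis. (v *. L p e) *R e)"

lemma bounded_linear_Linv: "bounded_linear (Linv p)" unfolding Linv_def[abs_def]
 by (intro bounded_linear_sum bounded_linear_scaleR_const bounded_linear_inner_left)

lemma Linv_L: "p : S ==> Linv p (L p x) = x" by (simp add: Linv_def L euclidean_representation)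

lemma L_Linv: "p : S ==> v : tan p ==> L p (Linv p v) = v" by (metis L(2) Linv_L rangeE)

definition Oc :: "real ^ 'i => (real ^ 'i) set" where
 "Oc p = {q. ALL j<k. 0 < blk j q *. blk j p}"

text \<open>The gnomonic projection in each sphere block: \<open>q\<close> is scaled into the affine
  tangent plane at \<open>p\<close>. Its inverse is radial projection, so the chart and its inverse
  are both explicit and smooth, and the chart image is the whole model space.\<close>

definition cen :: "real ^ 'i => real ^ 'i => real ^ 'i" where
 "cen p q = (\<chi> i. if B i < k then (r (B i))\<^sup>2 / (blk (B i) q *. blk (B i) p) * q $ i - p $ i else q $ i - p $ i)"

definition crd :: "real ^ 'i => real ^ 'i => 'd" where "crd p q = Linv p (cen p q)"

definition par :: "real ^ 'i => 'd => real ^ 'i" where "par p x = ret (p + L p x)"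

definition pchart :: "real ^ 'i => (real ^ 'i, 'd) chart" where
 "pchart p = (S \<inter> Oc p, crd p)"

lemma open_Oc: "open (Oc p)"
proof -
 have "Oc p = (\<Inter>j\<in>{..<k}. {q. 0 < blk j q *. blk j p})" by (auto simp: Oc_def)
 thus ?thesis by (auto intro!: open_INT open_Collect_less continuous_intros)
qed

lemma smooth_on_crd: "smooth_on (Oc p) (crd p)" unfolding crd_def[abs_def]
proof (rule smooth_on_bounded_linear[OF bounded_linear_Linv open_Oc])
 show "smooth_on (Oc p) (cen p)" unfolding cen_def[abs_def]
 proof (rule smooth_on_vec[OF open_Oc])
  fix i
  show "smooth_on (Oc p) (%q. if B i < k then (r (B i))\<^sup>2 / (blk (B i) q *. blk (B i) p) * q $ i - p $ i else q $ i - p $ i)"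
  proof (cases "B i < k")
   case True
   show ?thesis unfolding if_P[OF True]
    by (intro smooth_on_diff smooth_on_mult smooth_on_divide smooth_on_const smooth_on_inner smooth_on_blk
      smooth_on_vec_nth smooth_on_id open_Oc) (use True in \<open>auto simp: Oc_def\<close>)
  next
   case False
   show ?thesis unfolding if_not_P[OF False] by (intro smooth_on_diff smooth_on_const smooth_on_vec_nth smooth_on_id open_Oc)
  qed
 qed
qed

lemma pos_inner:
 assumes p: "p : S" and u: "u : tan p" and j: "j < k"
 shows "blk j (p + u) *. blk j p = (r j)\<^sup>2" "blk j (p + u) ~= 0"
proof -
 show *: "blk j (p + u) *. blk j p = (r j)\<^sup>2"
  using tanD[OF u j] norm_blk[OF p j] by (simp add: blk_simps inner_add dot_square_norm)
 thus "blk j (p + u) ~= 0" using r_pos[OF j] by auto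
qed

lemma in_W: "p : S ==> u : tan p ==> p + u : W" using pos_inner by (simp add: W_def)

lemma blk_ret: "j < k ==> blk j (ret x) = (r j / norm (blk j x)) *R blk j x" by (auto simp: blk_def ret_def vec_eq_iff)

lemma free_ret: "free (ret x) = free x" by (auto simp: free_def ret_def vec_eq_iff)

lemma blk_cen: "j < k ==> blk j (cen p q) = ((r j)\<^sup>2 / (blk j q *. blk j p)) *R blk j q - blk j p"
 by (auto simp: blk_def cen_def vec_eq_iff)

lemma free_cen: "free (cen p q) = free q - free p" by (auto simp: free_def cen_def vec_eq_iff)

lemma ret_in_dom:
 assumes p: "p : S" and u: "u : tan p"
 shows "ret (p + u) : S \<inter> Oc p" "cen p (ret (p + u)) = u"
proof -
 have pos: "0 < r j / norm (blk j (p + u))" if "j < k" for j using pos_inner[OF p u that] r_pos[OF that] by simp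
 have "0 < blk j (ret (p + u)) *. blk j p" if "j < k" for j
  unfolding blk_ret[OF that] using pos[OF that] pos_inner[OF p u that] r_pos[OF that] by simp
 thus "ret (p + u) : S \<inter> Oc p" using ret_in_S in_W[OF p u] by (simp add: Oc_def)
 show "cen p (ret (p + u)) = u"
 proof (rule blk_free_eqI)
  fix j assume j: "j < k"
  have "norm (blk j (p + u)) ~= 0" using pos_inner[OF p u j] by simp
  thus "blk j (cen p (ret (p + u))) = blk j u"
   using r_pos[OF j] pos_inner[OF p u j] by (simp add: blk_cen[OF j] blk_ret[OF j]) (simp add: blk_simps)
 qed (simp add: free_cen free_ret free_simps)
qed

lemma cen_in_tan: "p : S ==> q : Oc p ==> cen p q : tan p"
 by (auto simp: tan_def blk_cen inner_diff dot_square_norm norm_blk Oc_def less_imp_neq[THEN not_sym])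

lemma ret_cen:
 assumes p: "p : S" and q: "q : S \<inter> Oc p"
 shows "ret (p + cen p q) = q"
proof (rule blk_free_eqI)
 fix j assume j: "j < k"
 have pos: "0 < blk j q *. blk j p" using q j by (auto simp: Oc_def)
 have nq: "norm (blk j q) = r j" using q j by (simp add: norm_blk)
 have "blk j (p + cen p q) = ((r j)\<^sup>2 / (blk j q *. blk j p)) *R blk j q" using j by (simp add: blk_simps blk_cen)
 thus "blk j (ret (p + cen p q)) = blk j q" using pos r_pos[OF j] nq by (simp add: blk_ret[OF j])
qed (simp add: free_ret free_simps free_cen)

lemma crd_par: "p : S ==> crd p (par p x) = x" by (simp add: crd_def par_def ret_in_dom L Linv_L)

lemma par_crd: "p : S ==> q : S \<inter> Oc p ==> par p (crd p q) = q"
 by (simp add: crd_def par_def L_Linv cen_in_tan ret_cen)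

lemma par_in: "p : S ==> par p x : S \<inter> Oc p" by (simp add: par_def ret_in_dom L(5) del: Int_iff)

lemma par_0: "p : S ==> par p 0 = p" by (simp add: par_def ret_id linear_0[OF L(1)])

lemma self_in_Oc: "p : S ==> p : Oc p" using par_in[of p 0] by (simp add: par_0)

lemma crd_self: "p : S ==> crd p p = 0" using crd_par[of p 0] by (simp add: par_0)

lemma smooth_on_par: "p : S ==> smooth_on UNIV (par p)" unfolding par_def[abs_def]
 by (rule smooth_on_compose[OF open_UNIV open_W _ _ smooth_on_ret])
  (auto intro!: smooth_on_add smooth_on_const smooth_on_bounded_linear[OF linear_conv_bounded_linear[THEN iffD1, OF L(1)] open_UNIV smooth_on_id] in_W L(5))

lemma chart_image_pchart: "p : S ==> chart_image (pchart p) = UNIV"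
proof -
 assume p: "p : S"
 have "x : crd p ` (S \<inter> Oc p)" for x using crd_par[OF p] par_in[OF p] by (metis imageI)
 thus ?thesis by (auto simp: pchart_def)
qed

lemma chart_inv_pchart: "p : S ==> chart_inv (pchart p) = par p"
proof
 fix x assume p: "p : S"
 have "inj_on (crd p) (S \<inter> Oc p)" by (rule inj_on_inverseI[where g="par p"]) (use par_crd p in blast)
 thus "chart_inv (pchart p) x = par p x"
  using inv_into_f_eq[of "crd p" "S \<inter> Oc p" "par p x" x] par_in[OF p] crd_par[OF p] by (simp add: pchart_def)
qed

lemma inj_D_par: "p : S ==> inj (FD (par p) (at x))"
proof -
 assume p: "p : S"
 have "(par p has_derivative FD (par p) (at x)) (at x)" using smooth_on_deriv[OF smooth_on_par[OF p]] by simp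
 moreover have "(crd p has_derivative FD (crd p) (at (par p x))) (at (par p x))"
  using smooth_on_deriv[OF smooth_on_crd open_Oc] par_in[OF p] by blast
 ultimately have "((%x. crd p (par p x)) has_derivative (%v. FD (crd p) (at (par p x)) (FD (par p) (at x) v))) (at x)"
  by (rule has_derivative_compose)
 hence "(%v. FD (crd p) (at (par p x)) (FD (par p) (at x) v)) = (%v. v)"
  using crd_par[OF p] has_derivative_unique[OF _ has_derivative_ident] by simp
 thus ?thesis by (intro inj_on_inverseI[where g="FD (crd p) (at (par p x))"]) (simp add: fun_eq_iff)
qed

lemma pchart_in_atlas:
 assumes p: "p : S"
 shows "pchart p : atlas P"
proof -
 have "x : crd p ` (S \<inter> Oc p)" for x using crd_par[OF p] par_in[OF p] by (metis imageI)
 moreover have "x : range (par p)" if "x : S \<inter> Oc p" for x using par_crd[OF p that] by (metis rangeI)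
 ultimately have "homeomorphism (S \<inter> Oc p) UNIV (crd p) (par p)" unfolding homeomorphism_def
  using par_crd[OF p] crd_par[OF p] par_in[OF p]
   smooth_on_cont[OF smooth_on_crd[of p]] smooth_on_cont[OF smooth_on_par[OF p]] by (auto intro: continuous_on_subset)
 moreover have "openin (top_of_set S) (S \<inter> Oc p)" using open_Oc by blast
 moreover have "fst (pchart p) = S \<inter> Oc p" "snd (pchart p) = crd p" by (auto simp: pchart_def)
 ultimately show ?thesis using smooth_on_par[OF p] inj_D_par[OF p] chart_inv_pchart[OF p] chart_image_pchart[OF p]
  by (auto simp: submanifold_def)
qed

lemma D_par_0:
 assumes p: "p : S"
 shows "(par p has_derivative L p) (at 0)"
proof -
 have "((%x. p + L p x) has_derivative L p) (at 0)"
  using L(1)[OF p] by (auto intro!: derivative_eq_intros linear_imp_has_derivative)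
 moreover have "(ret has_derivative tproj p) (at (p + L p 0))" using has_derivative_ret[OF p] by (simp add: linear_0[OF L(1)[OF p]])
 ultimately have "((%x. ret (p + L p x)) has_derivative (%x. tproj p (L p x))) (at 0)" by (rule has_derivative_compose)
 thus ?thesis by (simp add: par_def[abs_def] tproj_id L(5)[OF p])
qed

text \<open>At each point \<open>p\<close> the chart \<open>pchart p\<close> centred there suffices:
  the derivative of \<open>par p\<close> at 0 is the isometry \<open>L p\<close>, which carries
  metric and horizontal space of the chart to those of the ambient space.\<close>

lemma submersion_data:
 assumes M: "riemannian_manifold M" and sub: "riemannian_submersion P M pr"
 shows "submersion_data B k r M pr"
proof
 show "riemannian_manifold M" by (rule M)
 show c: "continuous_map (top_of_set S) (man_top M) pr" "pr ` S = topspace (man_top M)"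
  using sub by (auto simp: riemannian_submersion_def submanifold_def)
 have opn: "openin (man_top M) (fst b)" if "b : atlas M" for b
  using M that by (auto simp: riemannian_manifold_def smooth_manifold_def)
 have sm: "smooth_on {x. pr (par p x) : fst b} (%x. snd b (pr (par p x)))" if b: "b : atlas M" and p: "p : S" for b p
 proof -
  have "smooth_on (crd p ` {x : S \<inter> Oc p. pr x : fst b}) (snd b \<circ> pr \<circ> par p)"
   using sub b pchart_in_atlas[OF p] chart_inv_pchart[OF p] unfolding riemannian_submersion_def by (auto simp: pchart_def)
  moreover have "crd p ` {x : S \<inter> Oc p. pr x : fst b} = {x. pr (par p x) : fst b}"
   proof (intro equalityI subsetI)
   fix x assume "x : {x. pr (par p x) : fst b}"
   thus "x : crd p ` {x : S \<inter> Oc p. pr x : fst b}"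
    using par_in[OF p, of x] crd_par[OF p, of x] by (intro image_eqI[of _ _ "par p x"]) auto
  qed (use par_crd[OF p] in auto)
  ultimately show ?thesis by (simp add: o_def)
 qed
 have op1: "open {x. pr (par p x) : fst b}" if b: "b : atlas M" and p: "p : S" for b p
  using open_preimage_of_continuous_map[OF open_UNIV smooth_on_cont[OF smooth_on_par[OF p]] _ c(1) opn[OF b]]
   par_in[OF p] by auto
 have op2: "open {q : W. pr (ret q) : fst b}" if b: "b : atlas M" for b
  using open_preimage_of_continuous_map[OF open_W smooth_on_cont[OF smooth_on_ret] _ c(1) opn[OF b]]
   ret_in_S by auto
 show smF: "smooth_on {q : W. pr (ret q) : fst b} (%q. snd b (pr (ret q)))" if b: "b : atlas M" for b
 proof (rule smooth_on_local[OF op2[OF b]])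
  fix q0 assume q0: "q0 : {q : W. pr (ret q) : fst b}"
  define p where "p = ret q0"
  have p: "p : S" using q0 ret_in_S by (simp add: p_def)
  \<comment> \<open>Near \<open>q0\<close> the retraction stays in the domain of the chart centred
    at \<open>ret q0\<close>, where the extended map is the coordinate expression of
    \<open>pr\<close> after the smooth map \<open>crd p (ret q)\<close>.\<close>
  define T where "T = {q : W. pr (ret q) : fst b} \<inter> {q : W. ret q : Oc p}"
  have "open (W \<inter> ret -` Oc p)" by (rule continuous_open_preimage[OF smooth_on_cont[OF smooth_on_ret] open_W open_Oc])
  moreover have "W \<inter> ret -` Oc p = {q : W. ret q : Oc p}" by auto
  ultimately have oT: "open T" unfolding T_def using op2[OF b] by (simp add: open_Int)
  have smr: "smooth_on T ret" by (rule smooth_on_subset[OF smooth_on_ret]) (auto simp: T_def)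
  have smc: "smooth_on T (%q. crd p (ret q))"
   by (rule smooth_on_compose[OF oT open_Oc _ smr smooth_on_crd]) (auto simp: T_def)
  have pc: "par p (crd p (ret q)) = ret q" if "q : T" for q
   using that par_crd[OF p, of "ret q"] ret_in_S by (auto simp: T_def)
  have "smooth_on T (%q. snd b (pr (par p (crd p (ret q)))))"
   by (rule smooth_on_compose[OF oT op1[OF b p] _ smc sm[OF b p]]) (use pc in \<open>auto simp: T_def\<close>)
  hence "smooth_on T (%q. snd b (pr (ret q)))"
   using smooth_on_cong[OF oT, of "%q. snd b (pr (par p (crd p (ret q))))" "%q. snd b (pr (ret q))"] pc by simp
  thus "EX T. open T & q0 : T & smooth_on T (%q. snd b (pr (ret q)))"
   using oT q0 self_in_Oc[OF p] by (intro exI[of _ T]) (auto simp: T_def p_def)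
 qed
 fix b p D H
 assume b: "b : atlas M" and p: "p : S" and pb: "pr p : fst b"
  and D: "D = FD (%q. snd b (pr (ret q))) (at p)"
  and H: "H = {u : tan p. ALL w:tan p. D w = 0 --> u *. w = 0}"
 let ?F = "%q. snd b (pr (ret q))"
 have pU: "p : {q : W. pr (ret q) : fst b}" using p pb S_subset_W by (auto simp: ret_id)
 have dF: "(?F has_derivative D) (at p)" unfolding D by (rule smooth_on_deriv[OF smF[OF b] op2[OF b] pU])
 have "((%x. p + L p x) has_derivative L p) (at 0)"
  using L(1)[OF p] by (auto intro!: derivative_eq_intros linear_imp_has_derivative)
 moreover have "(?F has_derivative D) (at (p + L p 0))" using dF by (simp add: linear_0[OF L(1)[OF p]])
 ultimately have "((%x. ?F (p + L p x)) has_derivative (%x. D (L p x))) (at 0)" by (rule has_derivative_compose)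
 hence D': "FD (snd b \<circ> pr \<circ> par p) (at 0) = (%x. D (L p x))" by (intro FD_eqI) (simp add: o_def par_def)
 have met: "metric P (pchart p) 0 u w = u *. w" for u w using FD_eqI[OF D_par_0[OF p]] L(6)[OF p]
  by (simp add: submanifold_def chart_inv_pchart[OF p])
 have in1: "p : fst (pchart p)" using p self_in_Oc[OF p] by (simp add: pchart_def)
 have sn: "snd (pchart p) p = 0" using crd_self[OF p] by (simp add: pchart_def)
 define H' where "H' = {u::'d. ALL w. D (L p w) = 0 --> u *. w = 0}"
 have *: "bij_betw (%x. D (L p x)) H' UNIV &
   (ALL u:H'. ALL v:H'. metric M b (snd b (pr p)) (D (L p u)) (D (L p v)) = u *. v)"
 proof -
  let ?D' = "FD (snd b \<circ> pr \<circ> chart_inv (pchart p)) (at (snd (pchart p) p))"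
  have "ALL x:fst (pchart p). pr x : fst b -->
    (let D = FD (snd b \<circ> pr \<circ> chart_inv (pchart p)) (at (snd (pchart p) x));
       H = {u. ALL w. D w = 0 --> metric P (pchart p) (snd (pchart p) x) u w = 0}
     in surj D & bij_betw D H UNIV &
      (ALL u:H. ALL v:H. metric M b (snd b (pr x)) (D u) (D v) = metric P (pchart p) (snd (pchart p) x) u v))"
   using sub b pchart_in_atlas[OF p] unfolding riemannian_submersion_def by blast
  from bspec[OF this in1, THEN mp, OF pb]
  show ?thesis unfolding Let_def sn chart_inv_pchart[OF p] D' met H'_def by blast
 qed
 have LH: "L p ` H' = H"
 proof -
  have "u : L p ` H'" if "u : H" for u
  proof -
   have ut: "u : tan p" using that H by auto
   hence uL: "u = L p (Linv p u)" by (simp add: L_Linv[OF p])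
   have "Linv p u *. w = 0" if "D (L p w) = 0" for w
   proof -
    have "u *. L p w = 0" using \<open>u : H\<close> H that L(5)[OF p] by auto
    thus ?thesis using uL L(6)[OF p] by metis
   qed
   thus ?thesis using uL by (auto simp: H'_def)
  qed
  moreover have "L p x : H" if "x : H'" for x
  proof -
   have "L p x *. w = 0" if w: "w : tan p" "D w = 0" for w
    using \<open>x : H'\<close> w L(6)[OF p, of x "Linv p w"] L_Linv[OF p w(1)] by (auto simp: H'_def)
   thus ?thesis using H L(5)[OF p] by auto
  qed
  ultimately show ?thesis by blast
 qed
 have "bij_betw D (L p ` H') UNIV"
 proof -
  have "bij_betw (D \<circ> L p) H' UNIV" using * by (simp add: o_def)
  moreover have "bij_betw (L p) H' (L p ` H')" using inj_on_subset[OF L(4)[OF p] subset_UNIV] by (simp add: bij_betw_def)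
  ultimately show ?thesis using bij_betw_comp_iff by blast
 qed
 thus "bij_betw D H UNIV & (ALL u:H. ALL v:H. metric M b (snd b (pr p)) (D u) (D v) = u *. v)"
  unfolding LH[symmetric] using * L(6)[OF p] by auto
qed

subsection \<open>The product itself\<close>

lemma atlas_P:
 assumes "a : atlas P"
 shows "openin (top_of_set S) (fst a)" "open (chart_image a)"
  "homeomorphism (fst a) (chart_image a) (snd a) (chart_inv a)"
  "smooth_on (chart_image a) (chart_inv a)"
  "z : chart_image a ==> inj (FD (chart_inv a) (at z))"
  "fst a \<subseteq> S"
  "x : fst a ==> chart_inv a (snd a x) = x"
  "z : chart_image a ==> chart_inv a z : fst a & snd a (chart_inv a z) = z"
proof -
 show 1: "openin (top_of_set S) (fst a)" "open (chart_image a)"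
  "homeomorphism (fst a) (chart_image a) (snd a) (chart_inv a)"
  "smooth_on (chart_image a) (chart_inv a)"
  "z : chart_image a ==> inj (FD (chart_inv a) (at z))" for z using assms by (auto simp: submanifold_def)
 show "fst a \<subseteq> S" using 1(1) by (simp add: openin_imp_subset)
 show "x : fst a ==> chart_inv a (snd a x) = x" using 1(3) by (simp add: homeomorphism_def)
 show "z : chart_image a ==> chart_inv a z : fst a & snd a (chart_inv a z) = z" for z by (meson f_inv_into_f inv_into_into)
qed

text \<open>An arbitrary chart is compared with the gnomonic one, which is smooth on an open set of
  the ambient space. The change of coordinates \<open>th\<close> has injective derivative because
  \<open>chart_inv b\<close> has; its local inverse after \<open>crd p\<close> is the
  extension.\<close>

lemma chart_extends_smoothly:
 assumes b: "b : atlas P" and p: "p : fst b"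
 obtains N be where "open N" "p : N" "smooth_on N be" "!!q. q : N ==> q : S ==> q : fst b & be q = snd b q"
proof -
 note A = atlas_P[OF b]
 have pS: "p : S" using p A(6) by blast
 define z0 where "z0 = snd b p"
 have z0: "z0 : chart_image b" using p by (simp add: z0_def)
 define V0 where "V0 = chart_image b \<inter> chart_inv b -` Oc p"
 have oV0: "open V0" unfolding V0_def by (rule continuous_open_preimage[OF smooth_on_cont[OF A(4)] A(2) open_Oc])
 have z0V: "z0 : V0" using z0 A(7)[OF p] self_in_Oc[OF pS] by (simp add: V0_def z0_def)
 define th where "th = (%z. crd p (chart_inv b z))"
 have smb: "smooth_on V0 (chart_inv b)" using A(4) by (rule smooth_on_subset) (auto simp: V0_def)
 have smth: "smooth_on V0 th"
  unfolding th_def by (rule smooth_on_compose[OF oV0 open_Oc _ smb smooth_on_crd]) (auto simp: V0_def)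
 have pt: "par p (th z) = chart_inv b z" if "z : V0" for z
  using that A(6,8) par_crd[OF pS, of "chart_inv b z"] by (auto simp: th_def V0_def)
 have "((%z. par p (th z)) has_derivative (%v. FD (par p) (at (th z0)) (FD th (at z0) v))) (at z0)"
  by (rule has_derivative_compose[OF smooth_on_deriv[OF smth oV0 z0V] smooth_on_deriv[OF smooth_on_par[OF pS] open_UNIV UNIV_I]])
 hence "(chart_inv b has_derivative (%v. FD (par p) (at (th z0)) (FD th (at z0) v))) (at z0)"
  by (rule has_derivative_transform_within_open[OF _ oV0 z0V pt])
 from FD_eqI[OF this] A(5)[OF z0] have "inj (FD th (at z0))" by (auto simp: inj_def)
 then obtain U Vg g where g: "open U" "U \<subseteq> V0" "z0 : U" "open Vg" "th z0 : Vg" "homeomorphism U Vg th g" "smooth_on Vg g"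
  using smooth_inverse_function[OF oV0 z0V smth] by metis
 have "openin (top_of_set (fst b)) (fst b \<inter> snd b -` U)"
  using A(3) g(1) by (intro continuous_openin_preimage_gen) (auto simp: homeomorphism_def)
 hence "openin (top_of_set S) (fst b \<inter> snd b -` U)" using A(1) openin_trans by blast
 then obtain N1 where N1: "open N1" "fst b \<inter> snd b -` U = S \<inter> N1" by (metis openin_open)
 define N where "N = N1 \<inter> (Oc p \<inter> crd p -` Vg)"
 have oN2: "open (Oc p \<inter> crd p -` Vg)"
  by (rule continuous_open_preimage[OF smooth_on_cont[OF smooth_on_crd] open_Oc g(4)])
 have th: "th (snd b q) = crd p q" if "q : fst b" for q using A(7)[OF that] by (simp add: th_def)
 show ?thesis
 proof (rule that[of N "%q. g (crd p q)"])
  show "open N" unfolding N_def using N1(1) oN2 by blast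
  show "p : N" unfolding N_def using N1 p pS g(3,5) self_in_Oc[OF pS] th[OF p] by (auto simp: z0_def)
  show "smooth_on N (%q. g (crd p q))"
   by (rule smooth_on_compose[OF \<open>open N\<close> g(4) _ smooth_on_subset[OF smooth_on_crd[of p]] g(7)]) (auto simp: N_def)
  fix q assume q: "q : N" "q : S"
  hence "q : fst b" "snd b q : U" using N1(2) by (auto simp: N_def)
  thus "q : fst b & g (crd p q) = snd b q" using th[of q] g(6) by (auto simp: homeomorphism_def)
 qed
qed

lemma transition:
 assumes a: "a : atlas P" and b: "b : atlas P"
 shows "smooth_on (snd a ` (fst a \<inter> fst b)) (snd b \<circ> chart_inv a)"
  and "x : fst a \<inter> fst b ==> FD (chart_inv a) (at (snd a x)) v =
   FD (chart_inv b) (at (snd b x)) (FD (snd b \<circ> chart_inv a) (at (snd a x)) v)"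
proof -
 note A = atlas_P[OF a] and A' = atlas_P[OF b]
 let ?V = "snd a ` (fst a \<inter> fst b)"
 have Veq: "?V = {z : chart_image a. chart_inv a z : fst b}"
 proof (intro equalityI subsetI)
  fix z assume "z : {z : chart_image a. chart_inv a z : fst b}"
  thus "z : snd a ` (fst a \<inter> fst b)" using A(8)[of z] by (intro image_eqI[of _ _ "chart_inv a z"]) auto
 qed (use A(7) in auto)
 obtain N where N: "open N" "fst b = S \<inter> N" using A'(1) by (metis openin_open)
 have "?V = chart_image a \<inter> chart_inv a -` N" unfolding Veq N(2) using A(6) by (auto simp: A(7))
 moreover have "open (chart_image a \<inter> chart_inv a -` N)"
  by (rule continuous_open_preimage[OF smooth_on_cont[OF A(4)] A(2) N(1)])
 ultimately have oV: "open ?V" by simp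
 show sm: "smooth_on ?V (snd b \<circ> chart_inv a)"
 proof (rule smooth_on_local[OF oV])
  fix z assume z: "z : ?V"
  hence "chart_inv a z : fst b" "z : chart_image a" unfolding Veq by auto
  from chart_extends_smoothly[OF b this(1)] obtain N be where N: "open N" "chart_inv a z : N" "smooth_on N be"
   "!!q. q : N ==> q : S ==> q : fst b & be q = snd b q" by blast
  define T where "T = chart_image a \<inter> chart_inv a -` N"
  have oT: "open T" unfolding T_def by (rule continuous_open_preimage[OF smooth_on_cont[OF A(4)] A(2) N(1)])
  have smT: "smooth_on T (chart_inv a)" using A(4) by (rule smooth_on_subset) (auto simp: T_def)
  have "smooth_on T (%z. be (chart_inv a z))" by (rule smooth_on_compose[OF oT N(1) _ smT N(3)]) (auto simp: T_def)
  moreover have "be (chart_inv a z) = (snd b \<circ> chart_inv a) z" if "z : T" for z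
   using that N(4)[of "chart_inv a z"] A(6,8) by (auto simp: T_def)
  ultimately have "smooth_on T (snd b \<circ> chart_inv a)"
   using smooth_on_cong[OF oT, of "%z. be (chart_inv a z)" "snd b \<circ> chart_inv a"] by blast
  thus "EX T. open T & z : T & smooth_on T (snd b \<circ> chart_inv a)"
   using oT N(2) \<open>z : chart_image a\<close> by (intro exI[of _ T]) (auto simp: T_def)
 qed
 assume x: "x : fst a \<inter> fst b"
 let ?z = "snd a x"
 have z: "?z : ?V" using x by blast
 have e: "(snd b \<circ> chart_inv a) ?z = snd b x" using A(7) x by simp
 have "snd b x : chart_image b" using x by blast
 hence "((%z. chart_inv b ((snd b \<circ> chart_inv a) z)) has_derivative
   (%v. FD (chart_inv b) (at (snd b x)) (FD (snd b \<circ> chart_inv a) (at ?z) v))) (at ?z)"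
  using has_derivative_compose[OF smooth_on_deriv[OF sm oV z]] smooth_on_deriv[OF A'(4) A'(2)] e by metis
 moreover have "chart_inv b ((snd b \<circ> chart_inv a) z) = chart_inv a z" if "z : ?V" for z
  using that A'(7) unfolding Veq by auto
 ultimately have "(chart_inv a has_derivative
   (%v. FD (chart_inv b) (at (snd b x)) (FD (snd b \<circ> chart_inv a) (at ?z) v))) (at ?z)"
  using has_derivative_transform_within_open[OF _ oV z] by blast
 from FD_eqI[OF this] show "FD (chart_inv a) (at (snd a x)) v =
   FD (chart_inv b) (at (snd b x)) (FD (snd b \<circ> chart_inv a) (at (snd a x)) v)" by simp
qed

lemma riemannian_manifold_P: "riemannian_manifold P" unfolding riemannian_manifold_def smooth_manifold_def
proof (intro conjI ballI allI impI)
 have mt: "man_top P = top_of_set S" by (simp add: submanifold_def)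
 have met: "metric P a z u v = FD (chart_inv a) (at z) u *. FD (chart_inv a) (at z) v" for a z u v
  by (simp add: submanifold_def)
 show "Hausdorff_space (man_top P)" unfolding mt by (simp add: Hausdorff_space_subtopology)
 show "second_countable (man_top P)" unfolding mt
 proof (rule second_countable_subtopology)
  obtain \<B> :: "(real ^ 'i) set set" where \<B>: "countable \<B>" "topological_basis \<B>"
   using ex_countable_basis by blast
  have "EX V:\<B>. x : V & V \<subseteq> U" if "open U & x : U" for U x
   using topological_basisE[OF \<B>(2), of U x] that by metis
  thus "second_countable (euclidean :: (real ^ 'i) topology)" unfolding second_countable_def open_openin[symmetric]
   using \<B> topological_basis_open[OF \<B>(2)] by blast
 qed
 show "topspace (man_top P) = \<Union> (fst ` atlas P)"
 proof
  show "topspace (man_top P) \<subseteq> \<Union> (fst ` atlas P)"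
  proof
   fix p assume "p : topspace (man_top P)"
   hence p: "p : S" unfolding mt by simp
   hence "p : fst (pchart p)" using self_in_Oc by (simp add: pchart_def)
   thus "p : \<Union> (fst ` atlas P)" using pchart_in_atlas[OF p] by blast
  qed
  show "\<Union> (fst ` atlas P) \<subseteq> topspace (man_top P)" unfolding mt using atlas_P(6) by simp blast
 qed
 fix a assume a: "a : atlas P"
 note A = atlas_P[OF a]
 show "openin (man_top P) (fst a)" "open (chart_image a)" using A unfolding mt by auto
 show "homeomorphic_map (subtopology (man_top P) (fst a)) (top_of_set (chart_image a)) (snd a)"
 proof -
  have "subtopology (man_top P) (fst a) = top_of_set (fst a)"
   unfolding mt using A(6) by (simp add: subtopology_subtopology Int_absorb1)
  moreover have "homeomorphic_maps (top_of_set (fst a)) (top_of_set (chart_image a)) (snd a) (chart_inv a)"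
   using A(3) unfolding homeomorphic_maps_def homeomorphism_def by (auto simp: continuous_map_in_subtopology)
  ultimately show ?thesis using homeomorphic_map_maps by metis
 qed
 show "smooth_on (snd a ` (fst a \<inter> fst b)) (snd b \<circ> chart_inv a)" if "b : atlas P" for b
  by (rule transition(1)[OF a that])
 show "metric P a z u v = metric P a z v u" if "z : chart_image a" for z u v unfolding met by (rule inner_commute)
 show "smooth_on (chart_image a) (%z. metric P a z u v)" for u v unfolding met by (intro smooth_on_inner smooth_on_FD A)
 show "bilinear (metric P a z)" if z: "z : chart_image a" for z
 proof -
  have "linear (FD (chart_inv a) (at z))" using smooth_on_deriv[OF A(4) A(2) z] has_derivative_linear by blast
  note l = linear_add[OF this] linear_cmul[OF this]
  have "metric P a z = (%u v. FD (chart_inv a) (at z) u *. FD (chart_inv a) (at z) v)" by (intro ext) (rule met)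
  thus ?thesis unfolding bilinear_def by (intro conjI allI linearI) (simp_all add: l inner_add_left inner_add_right)
 qed
 show "0 < metric P a z u u" if z: "z : chart_image a" and "u ~= 0" for z u
 proof -
  have "linear (FD (chart_inv a) (at z))" using smooth_on_deriv[OF A(4) A(2) z] has_derivative_linear by blast
  hence "FD (chart_inv a) (at z) u ~= 0" using A(5)[OF z] that(2) by (metis injD linear_0)
  thus ?thesis unfolding met by simp
 qed
 show "metric P a (snd a x) u v =
    metric P b (snd b x) (FD (snd b \<circ> chart_inv a) (at (snd a x)) u)
               (FD (snd b \<circ> chart_inv a) (at (snd a x)) v)"
  if "b : atlas P" "x : fst a \<inter> fst b" for b x u v unfolding met using transition(2)[OF a that] by simp
qed

text \<open>The derivative of a transition map has trivial kernel, so every vector is horizontal,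
  and the isometry condition reduces to the compatibility of the metric under transitions.\<close>

lemma riemannian_submersion_id: "riemannian_submersion P P id" unfolding riemannian_submersion_def
proof (intro conjI ballI allI impI)
 show "continuous_map (man_top P) (man_top P) id" by simp
 show "id ` topspace (man_top P) = topspace (man_top P)" by simp
 fix a b assume a: "a : atlas P" and b: "b : atlas P"
 note A = atlas_P[OF a]
 have e: "{x : fst a. id x : fst b} = fst a \<inter> fst b" by auto
 have e2: "snd b \<circ> id \<circ> chart_inv a = snd b \<circ> chart_inv a" by simp
 show "smooth_on (snd a ` {x : fst a. id x : fst b}) (snd b \<circ> id \<circ> chart_inv a)"
  unfolding e e2 by (rule transition(1)[OF a b])
 fix x assume x: "x : fst a" "id x : fst b"
 hence xx: "x : fst a \<inter> fst b" by simp
 let ?D = "FD (snd b \<circ> chart_inv a) (at (snd a x))"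
 have z: "snd a x : chart_image a" using x by blast
 have inj: "inj ?D" using A(5)[OF z] transition(2)[OF a b xx] by (auto simp: inj_def)
 have "linear ?D"
 proof -
  have "openin (top_of_set S) (fst a \<inter> fst b)" using A(1) atlas_P(1)[OF b] by blast
  hence "openin (top_of_set (fst a)) (fst a \<inter> fst b)" using A(6) by (meson inf_le1 openin_subset_trans)
  hence "openin (top_of_set (chart_image a)) (snd a ` (fst a \<inter> fst b))" using A(3) homeomorphism_imp_open_map by blast
  hence "open (snd a ` (fst a \<inter> fst b))" using A(2) openin_open_eq by blast
  thus ?thesis using smooth_on_deriv[OF transition(1)[OF a b]] xx has_derivative_linear by blast
 qed
 hence surj: "surj ?D" using inj by (simp add: linear_injective_imp_surjective)
 have H: "{u. ALL w. ?D w = 0 --> metric P a (snd a x) u w = 0} = UNIV"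
 proof -
  have "w = 0" if "?D w = 0" for w using that inj \<open>linear ?D\<close> by (metis injD linear_0)
  moreover have "metric P a (snd a x) u 0 = 0" for u
  proof -
   have "bilinear (metric P a (snd a x))" using riemannian_manifold_P a z unfolding riemannian_manifold_def by blast
   thus ?thesis by (rule bilinear_rzero)
  qed
  ultimately show ?thesis by auto
 qed
 have m: "metric P b (snd b x) (?D u) (?D v) = metric P a (snd a x) u v" for u v
  using transition(2)[OF a b xx] by (simp add: submanifold_def)
 show "let D = FD (snd b \<circ> id \<circ> chart_inv a) (at (snd a x));
     H = {u. ALL w. D w = 0 --> metric P a (snd a x) u w = 0}
   in surj D & bij_betw D H UNIV &
     (ALL u:H. ALL v:H. metric P b (snd b (id x)) (D u) (D v) = metric P a (snd a x) u v)"
  unfolding e2 Let_def H using surj inj m by (simp add: bij_betw_def)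
qed

end

context submersion_data
begin

section \<open>The horizontal distribution of a submersion\<close>

abbreviation "d \<equiv> riem_dist M"

lemma man: shows Hausdorff: "Hausdorff_space (man_top M)"
  and topspace_eq: "topspace (man_top M) = (\<Union>a\<in>atlas M. fst a)"
  and openin_chart: "a : atlas M ==> openin (man_top M) (fst a)"
  and open_chart_image: "a : atlas M ==> open (chart_image a)"
  and homeo_chart: "a : atlas M ==> homeomorphic_map (subtopology (man_top M) (fst a)) (top_of_set (chart_image a)) (snd a)"
  and smooth_transition: "a : atlas M ==> b : atlas M ==> smooth_on (snd a ` (fst a \<inter> fst b)) (snd b \<circ> chart_inv a)"
  and bilinear_metric: "a : atlas M ==> z : chart_image a ==> bilinear (metric M a z)"
  and metric_commute: "a : atlas M ==> z : chart_image a ==> metric M a z u v = metric M a z v u"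
  and metric_pos: "a : atlas M ==> z : chart_image a ==> u ~= 0 ==> 0 < metric M a z u u"
  and smooth_metric: "a : atlas M ==> smooth_on (chart_image a) (%z. metric M a z u v)"
  and metric_compat: "a : atlas M ==> b : atlas M ==> x : fst a \<inter> fst b ==>
    metric M a (snd a x) u v =
    metric M b (snd b x) (FD (snd b \<circ> chart_inv a) (at (snd a x)) u)
               (FD (snd b \<circ> chart_inv a) (at (snd a x)) v)"
proof -
 have m: "riemannian_manifold M" by (rule manifold)
 hence s: "smooth_manifold M" unfolding riemannian_manifold_def by blast
 show "Hausdorff_space (man_top M)" "topspace (man_top M) = (\<Union>a\<in>atlas M. fst a)"
  using s unfolding smooth_manifold_def by blast+
 show "a : atlas M ==> openin (man_top M) (fst a)" "a : atlas M ==> open (chart_image a)"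
  "a : atlas M ==> homeomorphic_map (subtopology (man_top M) (fst a)) (top_of_set (chart_image a)) (snd a)"
  "a : atlas M ==> b : atlas M ==> smooth_on (snd a ` (fst a \<inter> fst b)) (snd b \<circ> chart_inv a)"
  using s unfolding smooth_manifold_def by blast+
 show "a : atlas M ==> z : chart_image a ==> bilinear (metric M a z)"
  "a : atlas M ==> z : chart_image a ==> metric M a z u v = metric M a z v u"
  "a : atlas M ==> z : chart_image a ==> u ~= 0 ==> 0 < metric M a z u u"
  "a : atlas M ==> smooth_on (chart_image a) (%z. metric M a z u v)"
  "a : atlas M ==> b : atlas M ==> x : fst a \<inter> fst b ==>
    metric M a (snd a x) u v =
    metric M b (snd b x) (FD (snd b \<circ> chart_inv a) (at (snd a x)) u)
               (FD (snd b \<circ> chart_inv a) (at (snd a x)) v)" using m unfolding riemannian_manifold_def by blast+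
qed

lemma chart_subset_topspace: "a : atlas M ==> fst a \<subseteq> topspace (man_top M)"
 using openin_chart openin_subset by blast

lemma inj_on_chart: "a : atlas M ==> inj_on (snd a) (fst a)"
 using homeomorphic_imp_injective_map[OF homeo_chart] chart_subset_topspace by (simp add: Int_absorb1)

lemma chart_inv_chart [simp]: "a : atlas M ==> x : fst a ==> chart_inv a (snd a x) = x" by (simp add: inj_on_chart)

lemma chart_chart_inv: "z : chart_image a ==> chart_inv a z : fst a" "z : chart_image a ==> snd a (chart_inv a z) = z"
 by (meson inv_into_into) (meson f_inv_into_f)

lemma open_transition_domain:
 assumes a: "a : atlas M" and b: "b : atlas M"
 shows "open (snd a ` (fst a \<inter> fst b))"
proof -
 have "openin (subtopology (man_top M) (fst a)) (fst a \<inter> fst b)"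
  using openin_chart[OF a] openin_chart[OF b] by (simp add: openin_open_subtopology openin_Int)
 hence "openin (top_of_set (chart_image a)) (snd a ` (fst a \<inter> fst b))"
  using homeomorphic_imp_open_map[OF homeo_chart[OF a]] unfolding open_map_def by blast
 thus ?thesis using open_chart_image[OF a] openin_open_eq by blast
qed

lemma metric_simps:
 assumes "a : atlas M" "z : chart_image a"
 shows "metric M a z (u + u') v = metric M a z u v + metric M a z u' v"
  "metric M a z v (u + u') = metric M a z v u + metric M a z v u'"
  "metric M a z (u - u') v = metric M a z u v - metric M a z u' v"
  "metric M a z v (u - u') = metric M a z v u - metric M a z v u'"
  "metric M a z (c *R u) v = c * metric M a z u v"
  "metric M a z v (c *R u) = c * metric M a z v u"
  "metric M a z 0 v = 0" "metric M a z v 0 = 0" "metric M a z (- u) v = - metric M a z u v" "metric M a z v (- u) = - metric M a z v u"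
 using bilinear_metric[OF assms]
 by (simp_all add: bilinear_ladd bilinear_radd bilinear_lsub bilinear_rsub bilinear_lmul bilinear_rmul bilinear_lzero bilinear_rzero bilinear_lneg bilinear_rneg)

lemma metric_nonneg: "a : atlas M ==> z : chart_image a ==> 0 <= metric M a z u u"
 using metric_pos[of a z u] metric_simps(7)[of a z 0] by (cases "u = 0") auto

lemma metric_eqI:
 assumes "a : atlas M" "z : chart_image a" "!!v. metric M a z u v = metric M a z w v"
 shows "u = w"
proof (rule ccontr)
 assume "u ~= w"
 hence "0 < metric M a z (u - w) (u - w)" using metric_pos[OF assms(1,2)] by simp
 thus False using assms by (simp add: metric_simps)
qed

lemma smooth_on_metric:
 assumes a: "a : atlas M" and A: "open A" "smooth_on A f" "f ` A \<subseteq> chart_image a" "smooth_on A u" "smooth_on A v"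
 shows "smooth_on A (%x. metric M a (f x) (u x) (v x))"
proof -
 have "smooth_on A (%x. \<Sum>e\<in>Basis. \<Sum>e'\<in>Basis. (u x *. e) * (v x *. e') * metric M a (f x) e e')"
  using smooth_on_compose[OF A(1) open_chart_image[OF a] A(3,2) smooth_metric[OF a]] A
  by (intro smooth_on_sum smooth_on_mult smooth_on_inner smooth_on_const)
 moreover have "metric M a (f x) (u x) (v x) = (\<Sum>e\<in>Basis. \<Sum>e'\<in>Basis. (u x *. e) * (v x *. e') * metric M a (f x) e e')"
  if "x : A" for x
 proof -
  have b: "bilinear (metric M a (f x))" using bilinear_metric[OF a] A(3) that by blast
  have "metric M a (f x) (u x) (v x) = metric M a (f x) (\<Sum>e\<in>Basis. (u x *. e) *R e) (\<Sum>e'\<in>Basis. (v x *. e') *R e')"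
   by (simp only: euclidean_representation)
  also have "\<dots> = (\<Sum>e\<in>Basis. \<Sum>e'\<in>Basis. metric M a (f x) ((u x *. e) *R e) ((v x *. e') *R e'))"
   by (subst bilinear_sum[OF b]) (simp add: sum.cartesian_product)
  finally show ?thesis by (simp add: bilinear_lmul[OF b] bilinear_rmul[OF b] ac_simps)
 qed
 ultimately show ?thesis using smooth_on_cong[OF A(1), of "%x. metric M a (f x) (u x) (v x)"
   "%x. \<Sum>e\<in>Basis. \<Sum>e'\<in>Basis. (u x *. e) * (v x *. e') * metric M a (f x) e e'"] by simp
qed

definition U :: "('m, 'e) chart => (real ^ 'i) set" where
 "U b = {q : W. pr (ret q) : fst b}"

definition F :: "('m, 'e) chart => real ^ 'i => 'e" where
 "F b q = snd b (pr (ret q))"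

definition DF :: "('m, 'e) chart => real ^ 'i => real ^ 'i => 'e" where
 "DF b p = FD (F b) (at p)"

text \<open>The horizontal lift: the vector representing the functional \<open>v \<mapsto> g(xi, DF v)\<close>.\<close>
definition lam :: "('m, 'e) chart => real ^ 'i => 'e => real ^ 'i" where
 "lam b p xi = (\<Sum>e\<in>Basis. metric M b (F b p) xi (DF b p e) *R e)"

text \<open>Quantifying over charts keeps \<open>hor\<close> a notion of the point alone;
  \<open>hor_iff\<close> shows that each chart around the point decides it.\<close>

definition hor :: "real ^ 'i => (real ^ 'i) set" where
 "hor p = {u : tan p. EX b:atlas M. pr p : fst b & u : range (lam b p)}"

lemma ex_chart: "p : S ==> EX b:atlas M. pr p : fst b" using surj_pr topspace_eq by blast

lemma open_U: "b : atlas M ==> open (U b)" unfolding U_def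
 by (rule open_preimage_of_continuous_map[OF open_W smooth_on_cont[OF smooth_on_ret] _ cont_pr openin_chart])
  (use ret_in_S in auto)

lemma smooth_on_F: "b : atlas M ==> smooth_on (U b) (F b)" using smooth_coord[of b] unfolding U_def F_def[abs_def] .

lemma F_in: "q : U b ==> F b q : chart_image b" by (auto simp: U_def F_def)

lemma in_U: "p : S ==> pr p : fst b ==> p : U b" using S_subset_W by (auto simp: U_def ret_id)

lemma U_imp: "p : S ==> p : U b ==> pr p : fst b" by (simp add: U_def ret_id)

lemma F_S: "p : S ==> F b p = snd b (pr p)" by (simp add: F_def ret_id)

lemma chart_inv_F: "b : atlas M ==> p : S ==> p : U b ==> chart_inv b (F b p) = pr p" by (simp add: F_S U_imp)

lemma has_derivative_F: "b : atlas M ==> q : U b ==> (F b has_derivative DF b q) (at q)"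
 unfolding DF_def by (rule smooth_on_deriv[OF smooth_on_F open_U])

lemma linear_DF: "b : atlas M ==> q : U b ==> linear (DF b q)" using has_derivative_F has_derivative_linear by blast

lemma smooth_on_DF:
 "b : atlas M ==> open A ==> smooth_on A f ==> f ` A \<subseteq> U b ==> smooth_on A v ==> smooth_on A (%x. DF b (f x) (v x))"
 unfolding DF_def by (rule smooth_on_FD_apply[OF _ open_U smooth_on_F])

text \<open>\<open>F b\<close> is unchanged by \<open>ret\<close>, whose derivative at
  \<open>p\<close> is \<open>tproj p\<close>.\<close>

lemma DF_tproj:
 assumes b: "b : atlas M" and p: "p : S" "p : U b"
 shows "DF b p (tproj p v) = DF b p v"
proof -
 have rr: "ret (ret q) = ret q" if "q : W" for q using ret_in_S[OF that] by (rule ret_id)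
 have "(F b has_derivative DF b p) (at (ret p))" using has_derivative_F[OF b p(2)] p by (simp add: ret_id)
 from has_derivative_compose[OF has_derivative_ret[OF p(1)] this]
 have "((%q. F b (ret q)) has_derivative (%v. DF b p (tproj p v))) (at p)" .
 hence "(F b has_derivative (%v. DF b p (tproj p v))) (at p)"
  by (rule has_derivative_transform_within_open[OF _ open_W]) (use p S_subset_W rr in \<open>auto simp: F_def\<close>)
 from has_derivative_unique[OF this has_derivative_F[OF b p(2)]] show ?thesis by (simp add: fun_eq_iff)
qed

text \<open>The horizontal vector \<open>h\<close> over \<open>xi\<close> given by the locale
  represents the functional that defines \<open>lam\<close>. To test this on \<open>v\<close>, pass
  to the tangential part of \<open>v\<close> and subtract the horizontal \<open>t\<close> with the
  same image: the difference lies in the kernel, to which \<open>h\<close> is orthogonal.\<close>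

lemma lam:
 assumes b: "b : atlas M" and p: "p : S" "p : U b"
 shows lam_in_tan: "lam b p xi : tan p"
  and DF_lam: "DF b p (lam b p xi) = xi"
  and inner_lam: "lam b p xi *. v = metric M b (F b p) xi (DF b p v)"
  and norm_lam: "(norm (lam b p xi))\<^sup>2 = metric M b (F b p) xi xi"
  and lam_in_hor: "lam b p xi : hor p"
proof -
 define H where "H = {u : tan p. ALL w:tan p. DF b p w = 0 --> u *. w = 0}"
 have "DF b p = FD (%q. snd b (pr (ret q))) (at p)" by (simp add: DF_def F_def[abs_def])
 from horizontal_bij[OF b p(1) U_imp[OF p] this H_def]
 have bij: "bij_betw (DF b p) H UNIV" and iso: "!!u v. u : H ==> v : H ==> metric M b (F b p) (DF b p u) (DF b p v) = u *. v"
  using F_S[OF p(1)] by auto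
 note lin = linear_DF[OF b p(2)]
 obtain h where h: "h : H" "DF b p h = xi" using bij by (metis UNIV_I bij_betw_def imageE)
 have hv: "h *. v = metric M b (F b p) xi (DF b p v)" for v
 proof -
  obtain t where t: "t : H" "DF b p t = DF b p v" using bij by (metis UNIV_I bij_betw_def imageE)
  have "tproj p v - t : tan p" using t(1) tproj_in_tan[OF p(1)] by (auto simp: H_def intro: subspace_diff[OF subspace_tan])
  moreover have "DF b p (tproj p v - t) = 0" using linear_diff[OF lin] DF_tproj[OF b p] t(2) by simp
  ultimately have "h *. (tproj p v - t) = 0" using h(1) by (auto simp: H_def)
  hence "h *. t = h *. tproj p v" by (simp add: inner_diff_right)
  also have "\<dots> = h *. v" using h(1) by (intro inner_tproj) (auto simp: H_def)
  finally show ?thesis using iso[OF h(1) t(1)] h t by simp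
 qed
 have "lam b p xi = (\<Sum>e\<in>Basis. (h *. e) *R e)" unfolding lam_def hv ..
 hence lh: "lam b p xi = h" by (simp add: euclidean_representation)
 show 1: "lam b p xi : tan p" using h unfolding lh by (simp add: H_def)
 show "DF b p (lam b p xi) = xi" using h unfolding lh by simp
 show "lam b p xi *. v = metric M b (F b p) xi (DF b p v)" for v unfolding lh by (rule hv)
 show "(norm (lam b p xi))\<^sup>2 = metric M b (F b p) xi xi" unfolding power2_norm_eq_inner lh using hv[of h] h by simp
 show "lam b p xi : hor p" unfolding hor_def using 1 b U_imp[OF p] by blast
qed

lemma linear_lam:
 assumes b: "b : atlas M" and p: "p : S" "p : U b"
 shows "linear (lam b p)"
 by (rule linearI) (simp_all add: lam_def metric_simps[OF b F_in[OF p(2)]] algebra_simps sum.distrib scaleR_sum_right)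

lemma smooth_on_lam:
 assumes b: "b : atlas M" and A: "open A" "smooth_on A f" "f ` A \<subseteq> U b" "smooth_on A u"
 shows "smooth_on A (%x. lam b (f x) (u x))"
proof -
 have "(%x. F b (f x)) ` A \<subseteq> chart_image b" using A(3) F_in by blast
 thus ?thesis unfolding lam_def
  by (intro smooth_on_sum smooth_on_scaleR smooth_on_const smooth_on_metric[OF b] smooth_on_DF[OF b] A
    smooth_on_compose[OF A(1) open_U[OF b] A(3,2) smooth_on_F[OF b]])
qed

text \<open>\<open>lam b p\<close> after \<open>DF b p\<close> is the orthogonal projection onto the
  horizontal space; \<open>lam_DF_eqI\<close> is the case of equality.\<close>

lemma norm_lam_DF_le:
 assumes b: "b : atlas M" and p: "p : S" "p : U b"
 shows "norm (lam b p (DF b p u)) <= norm u"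
proof -
 have "(norm (lam b p (DF b p u)))\<^sup>2 = lam b p (DF b p u) *. u" using norm_lam[OF assms] inner_lam[OF assms] by simp
 also have "\<dots> <= norm (lam b p (DF b p u)) * norm u" by (rule norm_cauchy_schwarz)
 finally show ?thesis by (cases "lam b p (DF b p u) = 0") (simp_all add: power2_eq_square)
qed

lemma lam_DF_eqI:
 assumes b: "b : atlas M" and p: "p : S" "p : U b" and le: "norm u <= norm (lam b p (DF b p u))"
 shows "lam b p (DF b p u) = u"
proof -
 let ?l = "lam b p (DF b p u)"
 have eq: "norm u = norm ?l" using le norm_lam_DF_le[OF assms(1-3)] by (rule antisym)
 have "?l *. u = (norm ?l)\<^sup>2" using norm_lam[OF assms(1-3)] inner_lam[OF assms(1-3)] by simp
 moreover have "(norm (?l - u))\<^sup>2 = (norm ?l)\<^sup>2 - 2 * (?l *. u) + (norm u)\<^sup>2"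
  by (simp add: power2_norm_eq_inner inner_diff inner_commute)
 ultimately have "(norm (?l - u))\<^sup>2 = 0" using eq by simp
 thus ?thesis by simp
qed

text \<open>A vector is horizontal if and only if it is the horizontal lift of its image in some chart,
 and then in all charts: the norm of the projection does not depend on the chart.\<close>
lemma DF_change_chart:
 assumes a: "a : atlas M" and b: "b : atlas M" and p: "p : S" "p : U a" "p : U b"
 shows "DF b p v = FD (snd b \<circ> chart_inv a) (at (F a p)) (DF a p v)"
proof -
 let ?T = "snd b \<circ> chart_inv a"
 have Fp: "F a p : snd a ` (fst a \<inter> fst b)" using U_imp[OF p(1)] p by (auto simp: F_S)
 have "((%q. ?T (F a q)) has_derivative (%v. FD ?T (at (F a p)) (DF a p v))) (at p)"
  by (rule has_derivative_compose[OF has_derivative_F[OF a p(2)]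
     smooth_on_deriv[OF smooth_transition[OF a b] open_transition_domain[OF a b] Fp]])
 hence "(F b has_derivative (%v. FD ?T (at (F a p)) (DF a p v))) (at p)"
  by (rule has_derivative_transform_within_open[OF _ open_U[OF a] p(2)]) (use a in \<open>auto simp: F_def U_def\<close>)
 from has_derivative_unique[OF this has_derivative_F[OF b p(3)]] show ?thesis by (simp add: fun_eq_iff)
qed

lemma metric_DF_change_chart:
 assumes a: "a : atlas M" and b: "b : atlas M" and p: "p : S" "p : U a" "p : U b"
 shows "metric M a (F a p) (DF a p u) (DF a p v) = metric M b (F b p) (DF b p u) (DF b p v)"
 using metric_compat[OF a b, of "pr p"] U_imp[OF p(1)] p DF_change_chart[OF assms] by (simp add: F_S)

lemma hor_iff:
 assumes b: "b : atlas M" and p: "p : S" "p : U b"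
 shows "u : hor p \<longleftrightarrow> lam b p (DF b p u) = u"
proof
 assume "u : hor p"
 then obtain a xi where a: "a : atlas M" "pr p : fst a" "u = lam a p xi" unfolding hor_def by blast
 have pa: "p : U a" using in_U[OF p(1) a(2)] .
 have "(norm u)\<^sup>2 = metric M a (F a p) (DF a p u) (DF a p u)"
  using norm_lam[OF a(1) p(1) pa, of xi] DF_lam[OF a(1) p(1) pa, of xi] a(3) by simp
 also have "\<dots> = metric M b (F b p) (DF b p u) (DF b p u)" by (rule metric_DF_change_chart[OF a(1) b p(1) pa p(2)])
 also have "\<dots> = (norm (lam b p (DF b p u)))\<^sup>2" using norm_lam[OF b p] by simp
 finally have "norm u = norm (lam b p (DF b p u))" by (simp add: power2_eq_iff_nonneg)
 thus "lam b p (DF b p u) = u" by (intro lam_DF_eqI[OF b p]) simp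
next
 assume "lam b p (DF b p u) = u"
 thus "u : hor p" using lam_in_hor[OF b p, of "DF b p u"] by simp
qed

lemma hor_tan: "u : hor p ==> u : tan p" by (simp add: hor_def)

lemma subspace_hor:
 assumes p: "p : S"
 shows "subspace (hor p)"
proof -
 obtain b where b: "b : atlas M" "pr p : fst b" using ex_chart[OF p] by blast
 note pU = in_U[OF p b(2)]
 show ?thesis
 proof (rule subspaceI)
  show "0 : hor p"
   unfolding hor_iff[OF b(1) p pU] by (simp add: linear_0[OF linear_DF[OF b(1) pU]] linear_0[OF linear_lam[OF b(1) p pU]])
  show "u + v : hor p" if "u : hor p" "v : hor p" for u v using that unfolding hor_iff[OF b(1) p pU]
   by (simp add: linear_add[OF linear_DF[OF b(1) pU]] linear_add[OF linear_lam[OF b(1) p pU]])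
  show "c *R u : hor p" if "u : hor p" for c u using that unfolding hor_iff[OF b(1) p pU]
   by (simp add: linear_cmul[OF linear_DF[OF b(1) pU]] linear_cmul[OF linear_lam[OF b(1) p pU]])
 qed
qed

lemma hor_inner:
 assumes b: "b : atlas M" and p: "p : S" "p : U b" and u: "u : hor p"
 shows "u *. v = metric M b (F b p) (DF b p u) (DF b p v)"
 using inner_lam[OF b p, of "DF b p u" v] u[unfolded hor_iff[OF b p]] by simp

lemma hor_eqI:
 assumes b: "b : atlas M" and p: "p : S" "p : U b" and "u : hor p" "v : hor p" "DF b p u = DF b p v"
 shows "u = v" using assms hor_iff[OF b p] by metis

section \<open>The distance of the base\<close>

lemma pexp_line_in_S: "p : S ==> u : tan p ==> pexp p (s *R u) : S" by (intro pexp_in_S subspace_scale[OF subspace_tan])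

lemma continuous_on_pexp_line: "continuous_on J (%s. pexp p (s *R u))"
 by (intro continuous_at_imp_continuous_on ballI has_vector_derivative_continuous[OF has_vector_derivative_pexp])

lemma continuous_on_gvel: "continuous_on J (gvel p u)"
 by (intro continuous_at_imp_continuous_on ballI has_vector_derivative_continuous[OF has_vector_derivative_gvel])

lemma continuous_map_pexp:
 assumes p: "p : S" and u: "u : tan p"
 shows "continuous_map (top_of_set J) (man_top M) (%s. pr (pexp p (s *R u)))"
proof -
 have "continuous_map (top_of_set J) (top_of_set S) (%s. pexp p (s *R u))"
  using pexp_line_in_S[OF p u] continuous_on_pexp_line by (auto simp: continuous_map_in_subtopology)
 from continuous_map_compose[OF this cont_pr] show ?thesis by (simp add: o_def)
qed

lemma has_vector_derivative_F_pexp: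
 assumes b: "b : atlas M" and p: "p : S" and u: "u : tan p" and "pexp p (s *R u) : U b"
 shows "((%s. F b (pexp p (s *R u))) has_vector_derivative DF b (pexp p (s *R u)) (gvel p u s)) (at s)"
proof -
 have "((%s. pexp p (s *R u)) has_derivative (%h. h *R gvel p u s)) (at s)"
  using has_vector_derivative_pexp unfolding has_vector_derivative_def .
 from has_derivative_compose[OF this has_derivative_F[OF b assms(4)]]
 show ?thesis using linear_cmul[OF linear_DF[OF b assms(4)]] by (simp add: has_vector_derivative_def)
qed

lemma snd_pi_pexp: "p : S ==> u : tan p ==> (snd b \<circ> (%s. pr (pexp p (s *R u)))) = (%s. F b (pexp p (s *R u)))"
 by (simp add: fun_eq_iff F_S pexp_line_in_S)

lemma eventually_in_chart:
 assumes "continuous_map (top_of_set J) (man_top M) ga" "t : J" "ga t : fst b" "b : atlas M"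
 shows "eventually (%s. s : J --> ga s : fst b) (nhds t)"
proof -
 have "openin (top_of_set J) {s : J. ga s : fst b}"
  using assms(1) openin_chart[OF assms(4)] by (simp add: continuous_map_def)
 then obtain T where T: "open T" "{s : J. ga s : fst b} = J \<inter> T" by (metis openin_open)
 hence "t : T" using assms by blast
 hence "eventually (%s. s : T) (nhds t)" using T(1) by (intro eventually_nhds_in_open)
 thus ?thesis by eventually_elim (use T(2) in blast)
qed

text \<open>\<open>speed\<close> selects its chart by \<open>SOME\<close>; compatibility of the
  metric moves the computation to any chart at hand.\<close>

lemma speed_eq:
 assumes b: "b : atlas M" and cont: "continuous_map (top_of_set J) (man_top M) ga" and t: "t : J" "ga t : fst b"
  and J: "at t within J ~= bot" and w: "((snd b \<circ> ga) has_vector_derivative w) (at t within J)"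
 shows "speed M J ga t = sqrt (metric M b (snd b (ga t)) w w)"
proof -
 define a where "a = (SOME a. a : atlas M & ga t : fst a)"
 have a: "a : atlas M" "ga t : fst a" using someI[of "%a. a : atlas M & ga t : fst a" b] b t unfolding a_def by auto
 let ?T = "snd a \<circ> chart_inv b"
 let ?D = "FD ?T (at (snd b (ga t)))"
 have zt: "snd b (ga t) : snd b ` (fst b \<inter> fst a)" using a t by blast
 have dT: "(?T has_derivative ?D) (at (snd b (ga t)))"
  by (rule smooth_on_deriv[OF smooth_transition[OF b a(1)] open_transition_domain[OF b a(1)] zt])
 have "((snd b \<circ> ga) has_derivative (%h. h *R w)) (at t within J)" using w unfolding has_vector_derivative_def .
 from has_derivative_compose[OF this, of ?T ?D] dT
 have "((%s. ?T ((snd b \<circ> ga) s)) has_derivative (%h. ?D (h *R w))) (at t within J)" by simp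
 hence 1: "((%s. ?T ((snd b \<circ> ga) s)) has_vector_derivative ?D w) (at t within J)"
  unfolding has_vector_derivative_def using linear_cmul[OF has_derivative_linear[OF dT]] by simp
 have ev: "eventually (%s. ?T ((snd b \<circ> ga) s) = (snd a \<circ> ga) s) (at t within J)"
  using eventually_in_chart[OF cont t b] unfolding eventually_at_filter by eventually_elim (use b in auto)
 have "((snd a \<circ> ga) has_vector_derivative ?D w) (at t within J)" using 1 unfolding has_vector_derivative_def
  by (rule has_derivative_transform_eventually[OF _ ev]) (use t b in auto)
 hence "vector_derivative (snd a \<circ> ga) (at t within J) = ?D w" by (rule vector_derivative_within[OF J])
 thus ?thesis unfolding speed_def a_def[symmetric] Let_def using metric_compat[OF b a(1), of "ga t" w w] a t by simp
qed

lemma speed_pexp: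
 assumes b: "b : atlas M" and p: "p : S" and u: "u : tan p" and t: "t : J" "pexp p (t *R u) : U b"
  and J: "at t within J ~= bot"
 shows "speed M J (%s. pr (pexp p (s *R u))) t = norm (lam b (pexp p (t *R u)) (DF b (pexp p (t *R u)) (gvel p u t)))"
proof -
 let ?q = "pexp p (t *R u)"
 have q: "?q : S" by (rule pexp_line_in_S[OF p u])
 have "((snd b \<circ> (%s. pr (pexp p (s *R u)))) has_vector_derivative DF b ?q (gvel p u t)) (at t within J)"
  unfolding snd_pi_pexp[OF p u] by (rule has_vector_derivative_at_within[OF has_vector_derivative_F_pexp[OF b p u t(2)]])
 from speed_eq[OF b continuous_map_pexp[OF p u] t(1) U_imp[OF q t(2)] J this]
 show ?thesis using norm_lam[OF b q t(2)] by (simp add: F_S[OF q] real_sqrt_unique)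
qed

lemma at_within_Icc_not_bot: "t : {0..1} ==> at t within {0..1::real} ~= bot" by (simp add: trivial_limit_within islimpt_Icc)

lemma speed_nonneg:
 assumes "continuous_map (top_of_set {0..1}) (man_top M) ga" "t : {0..1}"
 shows "0 <= speed M {0..1} ga t"
proof -
 define a where "a = (SOME a. a : atlas M & ga t : fst a)"
 have "ga t : topspace (man_top M)" using assms by (auto simp: continuous_map_def)
 then obtain b where "b : atlas M & ga t : fst b" using topspace_eq by blast
 from someI[of "%a. a : atlas M & ga t : fst a", OF this] have "a : atlas M" "ga t : fst a" unfolding a_def by auto
 thus ?thesis unfolding speed_def a_def[symmetric] Let_def by (simp add: metric_nonneg)
qed

text \<open>The projection does not lengthen vectors, so projected geodesics, horizontal or not,
  compete for the distance with length at most \<open>norm u\<close>. Continuity of the speed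
  supplies the integrability that \<open>rectifiable_curve\<close> demands.\<close>

lemma rectifiable_pexp:
 assumes p: "p : S" and u: "u : tan p"
 defines "ga \<equiv> %s. pr (pexp p (s *R u))"
 shows "rectifiable_curve M ga" "integral {0..1} (speed M {0..1} ga) <= norm u"
proof -
 let ?q = "%s. pexp p (s *R u)"
 have q: "?q s : S" for s by (rule pexp_line_in_S[OF p u])
 have cont: "continuous_map (top_of_set {0..1}) (man_top M) ga" unfolding ga_def by (rule continuous_map_pexp[OF p u])
 have cq: "continuous_on J ?q" for J by (rule continuous_on_pexp_line)
 have oq: "open {s. ?q s : U b}" if "b : atlas M" for b using open_vimage[OF open_U[OF that] cq] by (simp add: vimage_def)
 have cD: "continuous_on {s. ?q s : U b} (%s. DF b (?q s) (gvel p u s))" if b: "b : atlas M" for b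
 proof -
  have "continuous_on (U b \<times> UNIV) (%x. DF b (fst x) (snd x))" using open_U[OF b]
   by (intro smooth_on_cont smooth_on_DF[OF b] smooth_on_fst smooth_on_snd smooth_on_id open_Times open_UNIV) auto
  from continuous_on_compose2[OF this continuous_on_Pair[OF continuous_on_pexp_line[of "{s. ?q s : U b}" p u] continuous_on_gvel[of _ p u]]]
  show ?thesis by (simp add: image_subset_iff)
 qed
 have cs: "continuous_on {0..1} (speed M {0..1} ga)" unfolding continuous_on_eq_continuous_within
 proof
  fix t :: real assume t: "t : {0..1}"
  obtain b where b: "b : atlas M" "pr (?q t) : fst b" using ex_chart[OF q] by blast
  have tU: "?q t : U b" by (rule in_U[OF q b(2)])
  have "continuous_on (U b \<times> UNIV) (%x. lam b (fst x) (snd x))" using open_U[OF b(1)]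
   by (intro smooth_on_cont smooth_on_lam[OF b(1)] smooth_on_fst smooth_on_snd smooth_on_id open_Times open_UNIV) auto
  from continuous_on_compose2[OF this continuous_on_Pair[OF cq cD[OF b(1)]]]
  have "continuous_on {s. ?q s : U b} (%s. lam b (?q s) (DF b (?q s) (gvel p u s)))" by (simp add: image_subset_iff)
  hence "isCont (%s. norm (lam b (?q s) (DF b (?q s) (gvel p u s)))) t"
   using oq[OF b(1)] tU by (auto intro: continuous_intros simp: continuous_on_eq_continuous_at)
  hence 1: "continuous (at t within {0..1}) (%s. norm (lam b (?q s) (DF b (?q s) (gvel p u s))))"
   by (rule continuous_at_imp_continuous_within)
  have eq: "norm (lam b (?q s) (DF b (?q s) (gvel p u s))) = speed M {0..1} ga s" if "s : {0..1}" "?q s : U b" for s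
   unfolding ga_def using speed_pexp[OF b(1) p u that at_within_Icc_not_bot[OF that(1)]] by simp
  obtain ep where ep: "ep > 0" "!!s. dist s t < ep ==> ?q s : U b"
   using oq[OF b(1)] tU unfolding open_dist by (metis (no_types, lifting) mem_Collect_eq)
  show "continuous (at t within {0..1}) (speed M {0..1} ga)"
   by (rule continuous_transform_within[OF 1 ep(1) t]) (use eq ep(2) in auto)
 qed
 have int: "speed M {0..1} ga integrable_on {0..1}" by (rule integrable_continuous_interval[OF cs])
 have pw: "(snd a \<circ> ga) piecewise_C1_differentiable_on {s..t}" if a: "a : atlas M" and sub: "ga ` {s..t} \<subseteq> fst a" for a s t
 proof -
  have inU: "?q ta : U a" if "ta : {s..t}" for ta
  proof -
   have "ga ta : fst a" using sub that by blast
   thus ?thesis unfolding ga_def by (rule in_U[OF q])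
  qed
  have "(snd a \<circ> ga) C1_differentiable_on {s..t}" unfolding C1_differentiable_on_def ga_def snd_pi_pexp[OF p u]
   using has_vector_derivative_F_pexp[OF a p u inU] inU
   by (intro exI[of _ "%s. DF a (?q s) (gvel p u s)"] conjI continuous_on_subset[OF cD[OF a]]) auto
  thus ?thesis by (simp add: C1_differentiable_imp_piecewise)
 qed
 show "rectifiable_curve M ga" unfolding rectifiable_curve_def using cont int pw by blast
 have "speed M {0..1} ga t <= norm u" if t: "t : {0..1}" for t
 proof -
  obtain b where b: "b : atlas M" "pr (?q t) : fst b" using ex_chart[OF q] by blast
  have tU: "?q t : U b" by (rule in_U[OF q b(2)])
  show ?thesis unfolding ga_def speed_pexp[OF b(1) p u t tU at_within_Icc_not_bot[OF t]]
   using norm_lam_DF_le[OF b(1) q tU, of "gvel p u t"] norm_gvel[OF p u] by simp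
 qed
 hence "integral {0..1} (speed M {0..1} ga) <= integral {0..1} (%t::real. norm u)" by (intro integral_le int) auto
 thus "integral {0..1} (speed M {0..1} ga) <= norm u" by simp
qed

lemma lengths_bdd_below:
 "bdd_below {integral {0..1} (speed M {0..1} ga) | ga. rectifiable_curve M ga & ga 0 = x & ga 1 = y}"
 by (rule bdd_belowI[of _ 0]) (auto simp: rectifiable_curve_def intro!: integral_nonneg speed_nonneg)

lemma d_pexp_le:
 assumes p: "p : S" and u: "u : tan p"
 shows "d (pr p) (pr (pexp p u)) <= norm u"
proof -
 have "d (pr p) (pr (pexp p u)) <= integral {0..1} (speed M {0..1} (%s. pr (pexp p (s *R u))))"
  unfolding riem_dist_def using rectifiable_pexp(1)[OF p u]
  by (intro cInf_lower lengths_bdd_below) (auto intro!: exI[of _ "%s. pr (pexp p (s *R u))"])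
 thus ?thesis using rectifiable_pexp(2)[OF p u] by simp
qed

lemma d_le_pdist: "p : S ==> q : S ==> d (pr p) (pr q) <= pdist p q" using plog_exists[of p q] d_pexp_le by fastforce

subsection \<open>Normal coordinates\<close>

lemma smooth_on_pexp_const: "open A ==> smooth_on A u ==> smooth_on A (%x. pexp p (u x))"
 by (intro smooth_on_pexp smooth_on_const)

lemma smooth_on_lam_const:
 assumes "b : atlas M" "p : S" "p : U b" "open A" "smooth_on A u"
 shows "smooth_on A (%x. lam b p (u x))"
 using linear_conv_bounded_linear[THEN iffD1, OF linear_lam[OF assms(1-3)]] assms(4,5)
 by (intro smooth_on_bounded_linear[where L="lam b p"])

lemma smooth_on_exp_coordinates:
 assumes a: "a : atlas M" and p: "p : S" "p : U a" and b: "b : atlas M"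
 defines "A \<equiv> {xi. pexp p (lam a p xi) : U b}" shows "open A" "smooth_on A (%xi. F b (pexp p (lam a p xi)))"
proof -
 have sm: "smooth_on UNIV (%xi. pexp p (lam a p xi))"
  by (intro smooth_on_pexp_const smooth_on_lam_const[OF a p] smooth_on_id open_UNIV)
 show oA: "open A" using open_vimage[OF open_U[OF b] smooth_on_cont[OF sm]] by (simp add: A_def vimage_def)
 show "smooth_on A (%xi. F b (pexp p (lam a p xi)))"
  by (rule smooth_on_compose[OF oA open_U[OF b] _ smooth_on_subset[OF sm subset_UNIV] smooth_on_F[OF b]]) (auto simp: A_def)
qed

lemma exp_coordinates_0:
 assumes b: "b : atlas M" and p: "p : S" "p : U b"
 shows "pexp p (lam b p 0) = p" "FD (%xi. F b (pexp p (lam b p xi))) (at 0) = (%xi. xi)"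
proof -
 show 0: "pexp p (lam b p 0) = p" by (simp add: linear_0[OF linear_lam[OF b p]])
 show "FD (%xi. F b (pexp p (lam b p xi))) (at 0) = (%xi. xi)" (is "FD ?f _ = _")
 proof (intro ext vector_derivative_unique_at)
  fix xi
  have "(?f has_derivative FD ?f (at 0)) (at 0)"
   by (rule smooth_on_deriv[OF smooth_on_exp_coordinates(2,1)[OF b p b]]) (simp add: 0 p)
  thus "((%t. ?f (0 + t *R xi)) has_vector_derivative FD ?f (at 0) xi) (at 0)" by (intro deriv_along_line) simp
  have "((%s. F b (pexp p (s *R lam b p xi))) has_vector_derivative DF b (pexp p (0 *R lam b p xi)) (gvel p (lam b p xi) 0)) (at 0)"
   by (rule has_vector_derivative_F_pexp[OF b p(1) lam_in_tan[OF b p]]) (use p in simp)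
  thus "((%t. ?f (0 + t *R xi)) has_vector_derivative xi) (at 0)"
   by (simp add: linear_cmul[OF linear_lam[OF b p]] DF_lam[OF b p])
 qed
qed

text \<open>\<open>et\<close> is a local inverse of the horizontal exponential at \<open>p\<close>.
  The points \<open>pexp p (lam b p (et z))\<close> form a section of the projection through
  \<open>p\<close>, and the norm of \<open>lam b p (et z)\<close> bounds the distance from
  \<open>pr p\<close> to the point with coordinates \<open>z\<close>.\<close>

definition normal_coords :: "('m, 'e) chart => real ^ 'i => 'e set => ('e => 'e) => bool" where
 "normal_coords b p Z et \<longleftrightarrow> open Z & F b p : Z & Z \<subseteq> chart_image b & smooth_on Z et & et (F b p) = 0 &
  (et has_derivative (%v. v)) (at (F b p)) &
  (ALL z:Z. pexp p (lam b p (et z)) : U b & pexp p (lam b p (et z)) : S &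
    F b (pexp p (lam b p (et z))) = z & pr (pexp p (lam b p (et z))) = chart_inv b z)"

lemma normal_coordsD:
 assumes "normal_coords b p Z et"
 shows "open Z" "F b p : Z" "Z \<subseteq> chart_image b" "smooth_on Z et" "et (F b p) = 0" "(et has_derivative (%v. v)) (at (F b p))"
  "z : Z ==> pexp p (lam b p (et z)) : U b & pexp p (lam b p (et z)) : S &
    F b (pexp p (lam b p (et z))) = z & pr (pexp p (lam b p (et z))) = chart_inv b z"
 using assms unfolding normal_coords_def by blast+

lemma normal_coordinates:
 assumes b: "b : atlas M" and p: "p : S" "p : U b"
 shows "EX Z et. normal_coords b p Z et"
proof -
 define f where "f = (%xi. F b (pexp p (lam b p xi)))"
 define A where "A = {xi. pexp p (lam b p xi) : U b}"
 note c = exp_coordinates_0[OF b p]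
 have oA: "open A" and smf: "smooth_on A f" unfolding A_def f_def by (rule smooth_on_exp_coordinates[OF b p b])+
 have A0: "0 : A" using p by (simp add: A_def c)
 have f0: "f 0 = F b p" by (simp add: f_def c)
 have df: "(f has_derivative FD f (at 0)) (at 0)" by (rule smooth_on_deriv[OF smf oA A0])
 have Df: "FD f (at 0) xi = xi" for xi by (simp add: f_def c)
 have "inj (FD f (at 0))" by (simp add: inj_def Df)
 then obtain A' Z g where g: "open A'" "A' \<subseteq> A" "0 : A'" "open Z" "f 0 : Z" "homeomorphism A' Z f g" "smooth_on Z g"
  using smooth_inverse_function[OF oA A0 smf] by metis
 have gz: "g z : A" "f (g z) = z" if "z : Z" for z using g(2,6) that by (auto simp: homeomorphism_def)
 have g0: "g (F b p) = 0" using g(3,6) f0 by (metis homeomorphism_apply1)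
 show ?thesis unfolding normal_coords_def
 proof (intro exI[of _ Z] exI[of _ g] conjI)
  show "Z \<subseteq> chart_image b"
  proof
   fix z assume "z : Z"
   thus "z : chart_image b" using gz[of z] F_in unfolding A_def f_def by (metis mem_Collect_eq)
  qed
  show "ALL z:Z. pexp p (lam b p (g z)) : U b & pexp p (lam b p (g z)) : S & F b (pexp p (lam b p (g z))) = z & pr (pexp p (lam b p (g z))) = chart_inv b z"
  proof
   fix z assume that: "z : Z"
   have 1: "pexp p (lam b p (g z)) : U b" "F b (pexp p (lam b p (g z))) = z" using gz[OF that] by (auto simp: A_def f_def)
   have 2: "pexp p (lam b p (g z)) : S" by (rule pexp_in_S[OF p(1) lam_in_tan[OF b p]])
   show "pexp p (lam b p (g z)) : U b & pexp p (lam b p (g z)) : S & F b (pexp p (lam b p (g z))) = z & pr (pexp p (lam b p (g z))) = chart_inv b z"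
    using 1 2 chart_inv_F[OF b 2 1(1)] by simp
  qed
  have dg: "(g has_derivative FD g (at (F b p))) (at (F b p))" using smooth_on_deriv[OF g(7,4)] g(5) f0 by simp
  have "(f has_derivative FD f (at 0)) (at (g (F b p)))" using df g0 by simp
  from has_derivative_compose[OF dg this]
  have "((%z. f (g z)) has_derivative FD g (at (F b p))) (at (F b p))" by (simp add: Df)
  hence "((%z. z) has_derivative FD g (at (F b p))) (at (F b p))"
   by (rule has_derivative_transform_within_open[OF _ g(4)]) (use g(5) f0 gz in auto)
  from has_derivative_unique[OF this has_derivative_ident] dg show "(g has_derivative (%v. v)) (at (F b p))" by simp
 qed (use g f0 g0 in auto)
qed

subsection \<open>Approximate horizontal lifts of curves\<close>

lemma continuous_on_pdist_right:
 assumes "p : S"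
 shows "continuous_on S (pdist p)"
proof -
 have "continuous_on S (%q. (%(p, q). pdist p q) (p, q))"
  by (rule continuous_on_compose2[OF continuous_on_pdist]) (use assms in \<open>auto intro: continuous_intros\<close>)
 thus ?thesis by simp
qed

text \<open>The product is closed and the \<open>q n\<close> stay bounded, so a subsequence
  converges in it; uniqueness of limits in the Hausdorff base puts its limit into the fibre of
  \<open>y\<close>.\<close>

lemma fibre_limit:
 assumes p: "p : S" and q: "!!n. q n : S" "!!n. pdist p (q n) <= c n" and c: "c \<longlonglongrightarrow> c0"
  and lim: "limitin (man_top M) (%n. pr (q n)) y sequentially"
 shows "EX q':S. pr q' = y & pdist p q' <= c0"
proof -
 obtain K where K: "!!n. c n <= K" using c convergent_imp_bounded[OF c] unfolding bounded_iff by (metis UNIV_I abs_le_D1 image_eqI real_norm_def)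
 have "q n : S \<inter> cball p K" for n using q[of n] norm_le_pdist[OF p q(1)[of n]] K[of n] by (simp add: dist_norm)
 moreover have "compact (S \<inter> cball p K)" using closed_S by (simp add: closed_Int_compact)
 ultimately obtain q' r where r: "strict_mono r" "q' : S" "(q \<circ> r) \<longlonglongrightarrow> q'"
  unfolding compact_def by (metis IntD1)
 have "limitin (top_of_set S) (q \<circ> r) q' sequentially" using r q by (simp add: limitin_subtopology)
 from continuous_map_limit[OF cont_pr this]
 have 1: "limitin (man_top M) (%n. pr (q (r n))) (pr q') sequentially" by (simp add: o_def)
 have 2: "limitin (man_top M) (%n. pr (q (r n))) y sequentially" using limitin_subsequence[OF r(1) lim] by (simp add: o_def)
 have "pr q' = y" using limitin_Hausdorff_unique[OF 1 2 _ Hausdorff] by simp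
 moreover have "(%n. pdist p (q (r n))) \<longlonglongrightarrow> pdist p q'"
  using continuous_on_tendsto_compose[OF continuous_on_pdist_right[OF p] r(3,2)] q by (simp add: o_def)
 hence "pdist p q' <= c0"
  by (rule LIMSEQ_le[OF _ LIMSEQ_subseq_LIMSEQ[OF c r(1)]]) (use q in \<open>auto simp: o_def\<close>)
 ultimately show ?thesis using r(2) by blast
qed

lemma limitin_const_base: "y : topspace (man_top M) ==> limitin (man_top M) (%n. y) y net" by (simp add: limitin_const)

text \<open>Real induction in place of a differential equation for lifts: from a point over
  \<open>ga ta\<close> one moves to the point over \<open>ga ta'\<close> given by normal
  coordinates, which costs the length \<open>G ta' - G ta\<close> up to \<open>ep\<close> times the
  elapsed time. The limit \<open>ep\<close> to 0 is taken by \<open>fibre_limit\<close>.\<close>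

lemma lift_in_chart:
 assumes b: "b : atlas M" and cont: "continuous_map (top_of_set {0..1}) (man_top M) ga"
  and st: "0 <= s" "s <= t" "t <= 1" and im: "ga ` {s..t} \<subseteq> fst b"
  and pc: "(snd b \<circ> ga) piecewise_C1_differentiable_on {s..t}"
  and int01: "speed M {0..1} ga integrable_on {0..1}" and q: "q : S" "pr q = ga s"
 shows "EX q':S. pr q' = ga t & pdist q q' <= integral {s..t} (speed M {0..1} ga)"
proof -
 define v where "v = speed M {0..1} ga"
 define G where "G = (%ta. integral {s..ta} v)"
 define xi where "xi = snd b \<circ> ga"
 obtain X D where X: "finite X" and D: "!!x. x : {s..t} - X ==> (xi has_vector_derivative D x) (at x)"
  and cD: "continuous_on ({s..t} - X) D" and cxi: "continuous_on {s..t} xi"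
  using pc unfolding piecewise_C1_differentiable_on_def C1_differentiable_on_def xi_def by metis
 have int: "v integrable_on {s..t}" unfolding v_def by (rule integrable_subinterval_real[OF int01]) (use st in auto)
 have vn: "0 <= v ta" if "ta : {s..t}" for ta unfolding v_def using that st by (intro speed_nonneg[OF cont]) auto
 have cG: "continuous_on {s..t} G" unfolding G_def by (rule indefinite_integral_continuous_1[OF int])
 have Gdiff: "G ta' - G ta = integral {ta..ta'} v" if "s <= ta" "ta <= ta'" "ta' <= t" for ta ta'
 proof -
  have "v integrable_on {s..ta'}" by (rule integrable_subinterval_real[OF int]) (use that in auto)
  from Henstock_Kurzweil_Integration.integral_combine[OF that(1,2) this] show ?thesis by (simp add: G_def)
 qed
 have Gmono: "G ta <= G ta'" if "s <= ta" "ta <= ta'" "ta' <= t" for ta ta'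
 proof -
  have "0 <= integral {ta..ta'} v" by (rule integral_nonneg[OF integrable_subinterval_real[OF int]]) (use that vn in auto)
  thus ?thesis using Gdiff[OF that] by simp
 qed
 have xi_in: "ga ta : fst b" "xi ta : chart_image b" "chart_inv b (xi ta) = ga ta" if "ta : {s..t}" for ta
 proof -
  show 1: "ga ta : fst b" using im that by blast
  thus "xi ta : chart_image b" "chart_inv b (xi ta) = ga ta" using b by (simp_all add: xi_def)
 qed
 have v_eq: "v ta = sqrt (metric M b (xi ta) (D ta) (D ta))" if ta: "ta : {s..t} - X" for ta
 proof -
  have t01: "ta : {0..1}" using ta st by auto
  show ?thesis
   unfolding v_def using speed_eq[OF b cont t01 _ at_within_Icc_not_bot[OF t01], of "D ta"] D[OF ta] xi_in(1)[of ta] ta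
   by (auto simp: xi_def intro: has_vector_derivative_at_within)
 qed
 have cv: "continuous_on ({s..t} - X) v"
 proof -
  have "continuous_on (chart_image b \<times> UNIV) (%x. metric M b (fst x) (snd x) (snd x))" using open_chart_image[OF b]
   by (intro smooth_on_cont smooth_on_metric[OF b] smooth_on_fst smooth_on_snd smooth_on_id open_Times open_UNIV) auto
  from continuous_on_compose2[OF this continuous_on_Pair[OF continuous_on_subset[OF cxi, of "{s..t} - X"] cD]]
  have "continuous_on ({s..t} - X) (%ta. metric M b (xi ta) (D ta) (D ta))" using xi_in(2) by (auto simp: image_subset_iff)
  hence "continuous_on ({s..t} - X) (%ta. sqrt (metric M b (xi ta) (D ta) (D ta)))" by (intro continuous_intros)
  thus ?thesis using v_eq continuous_on_cong[OF refl, of "{s..t} - X" v "%ta. sqrt (metric M b (xi ta) (D ta) (D ta))"] by simp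
 qed
 have approx: "EX q':S. pr q' = ga t & pdist q q' <= G t + ep * (t - s) + ep * real (card X)" if ep: "ep > 0" for ep
 proof -
  \<comment> \<open>Counts the exceptional parameters already passed. The derivative may be
    unbounded near them, so leaving one is granted an extra error \<open>ep\<close>, for which
    continuity of the curve is enough.\<close>
  define N where "N = (%ta. real (card {x : X. x < ta}))"
  have Nmono: "N ta <= N ta'" if "ta <= ta'" for ta ta' unfolding N_def using X that by (intro of_nat_mono card_mono) auto
  define Q where "Q = (%ta. EX q':S. pr q' = ga ta & pdist q q' <= G ta + ep * (ta - s) + ep * N ta)"
  have "Q t"
  proof (rule real_induct_closed[OF st(2)])
   show "Q s" unfolding Q_def using q pdist_self[OF q(1)] ep by (intro bexI[of _ q]) (auto simp: G_def N_def)
  next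
   fix ta assume ta: "s < ta" "ta <= t" and QQ: "!!si. s <= si ==> si < ta ==> Q si"
   define si where "si = (%n. ta - (ta - s) * inverse (real (Suc n)))"
   have si: "s <= si n" "si n < ta" for n
   proof -
    have "inverse (real (Suc n)) <= 1" by (simp add: inverse_eq_divide)
    hence "(ta - s) * inverse (real (Suc n)) <= (ta - s) * 1" using ta by (intro mult_left_mono) auto
    thus "s <= si n" by (simp add: si_def)
    show "si n < ta" using ta by (simp add: si_def)
   qed
   have "si \<longlonglongrightarrow> ta - (ta - s) * 0" unfolding si_def by (intro tendsto_intros LIMSEQ_inverse_real_of_nat)
   hence silim: "si \<longlonglongrightarrow> ta" by simp
   from QQ[OF si] obtain q' where q': "!!n. q' n : S" "!!n. pr (q' n) = ga (si n)"
    "!!n. pdist q (q' n) <= G (si n) + ep * (si n - s) + ep * N (si n)" unfolding Q_def by metis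
   have Glim: "(%n. G (si n)) \<longlonglongrightarrow> G ta"
   proof (rule continuous_on_tendsto_compose[OF cG silim])
    show "ta : {s..t}" using ta by auto
    show "eventually (%n. si n : {s..t}) sequentially"
     using si ta by (intro always_eventually allI) (metis atLeastAtMost_iff less_imp_le order_trans)
   qed
   have "EX q'':S. pr q'' = ga ta & pdist q q'' <= G ta + ep * (ta - s) + ep * N ta"
   proof (rule fibre_limit[OF q(1) q'(1)])
    show "pdist q (q' n) <= G (si n) + ep * (si n - s) + ep * N ta" for n
     using q'(3)[of n] Nmono[of "si n" ta] si[of n] ep by (smt (verit) mult_left_mono)
    show "(%n. G (si n) + ep * (si n - s) + ep * N ta) \<longlonglongrightarrow> G ta + ep * (ta - s) + ep * N ta"
     by (intro tendsto_intros Glim silim)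
    have in01: "si n : {0..1}" "ta : {0..1}" for n using si[of n] ta st by auto
    hence "limitin (top_of_set {0..1}) si ta sequentially" using silim by (simp add: limitin_subtopology)
    from continuous_map_limit[OF cont this]
    show "limitin (man_top M) (%n. pr (q' n)) (ga ta) sequentially" by (simp add: o_def q')
   qed
   thus "Q ta" unfolding Q_def .
  next
   fix ta assume ta: "s <= ta" "ta < t" and "Q ta"
   then obtain q1 where q1: "q1 : S" "pr q1 = ga ta" "pdist q q1 <= G ta + ep * (ta - s) + ep * N ta" unfolding Q_def by blast
   have tain: "ta : {s..t}" using ta by auto
   have q1U: "q1 : U b" using in_U[OF q1(1)] xi_in(1)[OF tain] q1(2) by simp
   have Fq1: "F b q1 = xi ta" using q1 by (simp add: F_S xi_def)
   obtain Z et where "normal_coords b q1 Z et" using normal_coordinates[OF b q1(1) q1U] by blast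
   note Z = normal_coordsD[OF this, unfolded Fq1]
   define f where "f = (%ta'. lam b q1 (et (xi ta')))"
   have linl: "linear (lam b q1)" by (rule linear_lam[OF b q1(1) q1U])
   have bl: "bounded_linear (lam b q1)" using linl linear_conv_bounded_linear by blast
   have fta: "f ta = 0" by (simp add: f_def Z(5) linear_0[OF linl])
   have step: "Q ta'" if "ta < ta'" "ta' <= t" "xi ta' : Z" "norm (f ta') <= G ta' - G ta + ep * (ta' - ta) + ep * (N ta' - N ta)" for ta'
   proof -
    let ?q' = "pexp q1 (f ta')"
    have "?q' : S" "pr ?q' = ga ta'" using Z(7)[OF that(3)] xi_in(3)[of ta'] that ta by (auto simp: f_def)
    moreover have "pdist q ?q' <= pdist q q1 + norm (f ta')"
     using pdist_triangle[OF q(1) q1(1) \<open>?q' : S\<close>] pdist_pexp[OF q1(1) lam_in_tan[OF b q1(1) q1U], of "et (xi ta')"]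
     by (simp add: f_def)
    ultimately show ?thesis unfolding Q_def using that(4) q1(3) by (intro bexI[of _ ?q']) (auto simp: algebra_simps)
   qed
   have xit: "(xi \<longlongrightarrow> xi ta) (at ta within {s..t})" using cxi tain by (simp add: continuous_on_def)
   hence evZ: "eventually (%ta'. xi ta' : Z) (at ta within {s..t})" using Z(1,2) by (rule topological_tendstoD)
   have "eventually (%ta'. ta < ta' --> xi ta' : Z & norm (f ta') <= G ta' - G ta + ep * (ta' - ta) + ep * (N ta' - N ta)) (at ta within {s..t})"
   proof (cases "ta : X")
    case True
    have "isCont et (xi ta)" using Z(6) has_derivative_continuous by blast
    hence "((%ta'. et (xi ta')) \<longlongrightarrow> et (xi ta)) (at ta within {s..t})" using xit by (rule isCont_tendsto_compose)
    hence "(f \<longlongrightarrow> f ta) (at ta within {s..t})" unfolding f_def by (rule bounded_linear.tendsto[OF bl])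
    hence "((%ta'. norm (f ta')) \<longlongrightarrow> 0) (at ta within {s..t})" unfolding fta by (rule tendsto_norm_zero)
    hence "eventually (%ta'. norm (f ta') < ep) (at ta within {s..t})" using ep by (rule order_tendstoD)
    moreover have "eventually (%ta'. ta' : {s..t}) (at ta within {s..t})" by (simp add: eventually_at_filter)
    ultimately show ?thesis using evZ
    proof eventually_elim
     case (elim ta')
     have "ep <= G ta' - G ta + ep * (ta' - ta) + ep * (N ta' - N ta)" if "ta < ta'"
     proof -
      have "card (insert ta {x : X. x < ta}) <= card {x : X. x < ta'}" using X True that by (intro card_mono) auto
      hence "N ta + 1 <= N ta'" using X by (simp add: N_def)
      hence "ep * 1 <= ep * (N ta' - N ta)" using ep by (intro mult_left_mono) auto
      moreover have "0 <= ep * (ta' - ta)" using ep that by simp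
      moreover have "G ta <= G ta'" using Gmono[of ta ta'] ta elim that by auto
      ultimately show ?thesis by simp
     qed
     thus ?case using elim by auto
    qed
   next
    case False
    define m where "m = norm (lam b q1 (D ta))"
    have taX: "ta : {s..t} - X" using tain False by simp
    have vm: "v ta = m"
     unfolding v_eq[OF taX] m_def using norm_lam[OF b q1(1) q1U, of "D ta"] Fq1 by (simp add: real_sqrt_unique)
    have "(xi has_derivative (%h. h *R D ta)) (at ta)" using D[OF taX] unfolding has_vector_derivative_def .
    from has_derivative_compose[OF this Z(6)] have "((%ta'. et (xi ta')) has_vector_derivative D ta) (at ta)"
     unfolding has_vector_derivative_def .
    from bounded_linear.has_vector_derivative[OF bl this]
    have "(f has_vector_derivative lam b q1 (D ta)) (at ta)" unfolding f_def .
    hence "(f has_vector_derivative lam b q1 (D ta)) (at ta within {s..t})" by (rule has_vector_derivative_at_within)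
    from tendsto_norm[OF has_vector_derivative_quotient_tendsto[OF this]]
    have 1: "eventually (%ta'. norm ((f ta' - f ta) /\<^sub>R (ta' - ta)) < m + ep / 2) (at ta within {s..t})"
     using ep by (intro order_tendstoD) (auto simp: m_def)
    have "continuous (at ta within ({s..t} - X)) v" using cv taX by (simp add: continuous_on_eq_continuous_within)
    from integral_has_vector_derivative_continuous_at[OF int taX X this]
    have "(G has_vector_derivative m) (at ta within ({s..t} - X))" unfolding G_def vm .
    from has_vector_derivative_quotient_tendsto[OF this]
    have "eventually (%ta'. (G ta' - G ta) /\<^sub>R (ta' - ta) > m - ep / 2) (at ta within ({s..t} - X))"
     using ep by (intro order_tendstoD) auto
    \<comment> \<open>The derivative of \<open>G\<close> was obtained within the complement of
      \<open>X\<close>; as \<open>X\<close> is finite and \<open>ta\<close> is not in it, this is no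
      restriction near \<open>ta\<close>.\<close>
    moreover have "at ta within ({s..t} - X) = at ta within {s..t}"
    proof (rule at_within_nhd[of ta "- (X - {ta})"])
     show "open (- (X - {ta}))" by (intro open_Compl finite_imp_closed finite_Diff X)
    qed (use False in auto)
    ultimately have 2: "eventually (%ta'. (G ta' - G ta) /\<^sub>R (ta' - ta) > m - ep / 2) (at ta within {s..t})" by simp
    show ?thesis using 1 2 evZ
    proof eventually_elim
     case (elim ta')
     have "norm (f ta') <= G ta' - G ta + ep * (ta' - ta) + ep * (N ta' - N ta)" if h: "ta < ta'"
     proof -
      have "norm ((f ta' - f ta) /\<^sub>R (ta' - ta)) = norm (f ta') / (ta' - ta)"
       unfolding norm_scaleR fta using h by (simp add: divide_inverse mult.commute)
      hence "norm (f ta') < (m + ep / 2) * (ta' - ta)" using elim(1) h by (simp add: pos_divide_less_eq)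
      moreover have "(m - ep / 2) * (ta' - ta) < G ta' - G ta"
       using elim(2) h by (simp add: pos_less_divide_eq divide_inverse_commute[symmetric] )
      moreover have "(m + ep / 2) * (ta' - ta) = (m - ep / 2) * (ta' - ta) + ep * (ta' - ta)" by (simp add: field_simps)
      moreover have "0 <= ep * (N ta' - N ta)" using Nmono[of ta ta'] h ep by simp
      ultimately show ?thesis by linarith
     qed
     thus ?case using elim by auto
    qed
   qed
   then obtain d where d: "d > 0" "!!ta'. ta' : {s..t} ==> ta' ~= ta ==> dist ta' ta < d ==> ta < ta' --> xi ta' : Z & norm (f ta') <= G ta' - G ta + ep * (ta' - ta) + ep * (N ta' - N ta)"
    unfolding eventually_at by blast
   show "EX d>0. ALL ta'. ta < ta' & ta' < ta + d & ta' <= t --> Q ta'"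
    by (rule exI[of _ d]) (use d ta step in \<open>auto simp: dist_real_def\<close>)
  qed
  then obtain q' where q': "q' : S" "pr q' = ga t" "pdist q q' <= G t + ep * (t - s) + ep * N t" unfolding Q_def by blast
  have "N t <= card X" unfolding N_def using X by (intro of_nat_mono card_mono) auto
  hence "ep * N t <= ep * real (card X)" using ep by (intro mult_left_mono) auto
  thus ?thesis using q' by (intro bexI[of _ q']) auto
 qed
 have "EX q'. ALL n. q' n : S & pr (q' n) = ga t & pdist q (q' n) <= G t + inverse (real (Suc n)) * (t - s) + inverse (real (Suc n)) * real (card X)"
 proof (rule choice, rule allI)
  fix n
  show "EX q'. q' : S & pr q' = ga t & pdist q q' <= G t + inverse (real (Suc n)) * (t - s) + inverse (real (Suc n)) * real (card X)"
   using approx[of "inverse (real (Suc n))"] by (simp add: Bex_def del: of_nat_Suc)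
 qed
 then obtain q' where q': "!!n. q' n : S" "!!n. pr (q' n) = ga t"
  "!!n. pdist q (q' n) <= G t + inverse (real (Suc n)) * (t - s) + inverse (real (Suc n)) * real (card X)" by blast
 have "EX q'':S. pr q'' = ga t & pdist q q'' <= G t + 0 * (t - s) + 0 * real (card X)"
 proof (rule fibre_limit[where q=q' and c="%n. G t + inverse (real (Suc n)) * (t - s) + inverse (real (Suc n)) * real (card X)", OF q(1) q'(1,3)])
  show "(%n. G t + inverse (real (Suc n)) * (t - s) + inverse (real (Suc n)) * real (card X)) \<longlonglongrightarrow> G t + 0 * (t - s) + 0 * real (card X)"
   by (intro tendsto_intros LIMSEQ_inverse_real_of_nat)
  have "ga t : topspace (man_top M)" using xi_in(1)[of t] st chart_subset_topspace[OF b] by auto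
  thus "limitin (man_top M) (%n. pr (q' n)) (ga t) sequentially" unfolding q'(2) by (rule limitin_const_base)
 qed
 thus ?thesis by (simp add: G_def v_def)
qed

text \<open>Lifts over short intervals, each inside one chart, are concatenated: \<open>P\<close> is
  additive by the triangle inequality and holds on small intervals, as \<open>Bolzano\<close>
  requires.\<close>

lemma lift_curve:
 assumes ga: "rectifiable_curve M ga" and q: "q : S" "pr q = ga 0"
 shows "EX q':S. pr q' = ga 1 & pdist q q' <= integral {0..1} (speed M {0..1} ga)"
proof -
 let ?v = "speed M {0..1} ga"
 have cont: "continuous_map (top_of_set {0..1}) (man_top M) ga" and int: "?v integrable_on {0..1}"
  and pc: "!!a s t. a : atlas M ==> 0 <= s ==> s <= t ==> t <= 1 ==> ga ` {s..t} \<subseteq> fst a ==> (snd a \<circ> ga) piecewise_C1_differentiable_on {s..t}"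
  using ga unfolding rectifiable_curve_def by blast+
 define P where "P = (%s t. 0 <= s --> t <= 1 --> (ALL q:S. pr q = ga s --> (EX q':S. pr q' = ga t & pdist q q' <= integral {s..t} ?v)))"
 have "P 0 1"
 proof (rule Bolzano)
  fix a b c assume ab: "P a b" and bc: "P b c" and le: "a <= b" "b <= c"
  show "P a c" unfolding P_def
  proof (intro impI ballI)
   fix q assume h: "0 <= a" "c <= 1" "q : S" "pr q = ga a"
   obtain q1 where q1: "q1 : S" "pr q1 = ga b" "pdist q q1 <= integral {a..b} ?v" using ab h le unfolding P_def by auto
   obtain q2 where q2: "q2 : S" "pr q2 = ga c" "pdist q1 q2 <= integral {b..c} ?v" using bc q1 h le unfolding P_def by auto
   have "?v integrable_on {a..c}" by (rule integrable_subinterval_real[OF int]) (use h in auto)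
   from Henstock_Kurzweil_Integration.integral_combine[OF le this]
   show "EX q':S. pr q' = ga c & pdist q q' <= integral {a..c} ?v"
    using q1 q2 pdist_triangle[OF h(3) q1(1) q2(1)] by (intro bexI[of _ q2]) auto
  qed
 next
  fix x :: real assume x: "0 <= x" "x <= 1"
  have "ga x : topspace (man_top M)" using cont x by (auto simp: continuous_map_def)
  then obtain b where b: "b : atlas M" "ga x : fst b" using topspace_eq by blast
  from eventually_in_chart[OF cont _ b(2,1)] x
  obtain de where de: "de > 0" "!!s. dist s x < de ==> s : {0..1} ==> ga s : fst b" unfolding eventually_nhds_metric by auto
  have "P a c" if "a <= x" "x <= c" "c - a < de" for a c unfolding P_def
  proof (intro impI ballI)
   fix q assume h: "0 <= a" "c <= 1" "q : S" "pr q = ga a"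
   have im: "ga ` {a..c} \<subseteq> fst b" using that h by (auto intro!: de(2) simp: dist_real_def)
   have ac: "a <= c" using that by simp
   show "EX q':S. pr q' = ga c & pdist q q' <= integral {a..c} ?v"
    by (rule lift_in_chart[OF b(1) cont h(1) ac h(2) im pc[OF b(1) h(1) ac h(2) im] int h(3,4)])
  qed
  thus "EX d>0. ALL a b. a <= x & x <= b & b - a < d --> P a b" using de(1) by blast
 qed simp
 thus ?thesis using q unfolding P_def by auto
qed

lemma ex_fibre: "y : topspace (man_top M) ==> EX p:S. pr p = y" unfolding surj_pr[symmetric] by (erule imageE) blast

text \<open>Nearly shortest curves lift to end points in the fibre of \<open>y\<close> at nearly the
  same distance from \<open>p\<close>, and \<open>fibre_limit\<close> yields an end point attaining
  the infimum.\<close>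

lemma d_lift:
 assumes p: "p : S" and y: "y : topspace (man_top M)"
 shows "EX q:S. pr q = y & pdist p q = d (pr p) y"
proof -
 define A where "A = {integral {0..1} (speed M {0..1} ga) | ga. rectifiable_curve M ga & ga 0 = pr p & ga 1 = y}"
 have dA: "d (pr p) y = Inf A" by (simp add: riem_dist_def A_def)
 obtain q0 where q0: "q0 : S" "pr q0 = y" using ex_fibre[OF y] by blast
 obtain u where u: "u : tan p" "pexp p u = q0" using plog_exists[OF p q0(1)] by blast
 have ne: "A ~= {}"
  using rectifiable_pexp(1)[OF p u(1)] u(2) q0(2) unfolding A_def by (auto intro!: exI[of _ "%s. pr (pexp p (s *R u))"])
 have "EX q. q : S & pr q = y & pdist p q <= d (pr p) y + inverse (real (Suc n))" for n
 proof -
  have "Inf A < d (pr p) y + inverse (real (Suc n))" unfolding dA by simp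
  from cInf_lessD[OF ne this] obtain ga where ga: "rectifiable_curve M ga" "ga 0 = pr p" "ga 1 = y"
   "integral {0..1} (speed M {0..1} ga) < d (pr p) y + inverse (real (Suc n))" unfolding A_def by auto
  from lift_curve[OF ga(1) p] ga show ?thesis by force
 qed
 then obtain q where q: "!!n. q n : S" "!!n. pr (q n) = y" "!!n. pdist p (q n) <= d (pr p) y + inverse (real (Suc n))" by metis
 have "EX q':S. pr q' = y & pdist p q' <= d (pr p) y + 0"
 proof (rule fibre_limit[OF p q(1,3)])
  show "(%n. d (pr p) y + inverse (real (Suc n))) \<longlonglongrightarrow> d (pr p) y + 0"
   by (intro tendsto_intros LIMSEQ_inverse_real_of_nat)
  show "limitin (man_top M) (%n. pr (q n)) y sequentially" unfolding q(2) by (rule limitin_const_base[OF y])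
 qed
 then obtain q' where "q' : S" "pr q' = y" "pdist p q' <= d (pr p) y" by auto
 thus ?thesis using d_le_pdist[OF p, of q'] by (intro bexI[of _ q']) auto
qed

lemma pi_in: "p : S ==> pr p : topspace (man_top M)" unfolding surj_pr[symmetric] by (rule imageI)

lemma minimizer_exists:
 assumes p: "p : S" and y: "y : topspace (man_top M)"
 shows "EX u:tan p. pr (pexp p u) = y & norm u = d (pr p) y" using d_lift[OF assms] plog_exists[OF p] by metis

lemma d_nonneg: "x : topspace (man_top M) ==> y : topspace (man_top M) ==> 0 <= d x y"
 using d_lift pdist_nonneg ex_fibre by metis

lemma d_commute: "x : topspace (man_top M) ==> y : topspace (man_top M) ==> d x y = d y x"
proof -
 have le: "d y x <= d x y" if xy: "x : topspace (man_top M)" "y : topspace (man_top M)" for x y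
 proof -
  obtain p where p: "p : S" "pr p = x" using ex_fibre[OF xy(1)] by blast
  obtain q where q: "q : S" "pr q = y" "pdist p q = d x y" using d_lift[OF p(1) xy(2)] p by blast
  show ?thesis using d_le_pdist[OF q(1) p(1)] p q by (simp add: pdist_commute)
 qed
 thus "x : topspace (man_top M) ==> y : topspace (man_top M) ==> d x y = d y x" by (intro antisym) auto
qed

lemma d_triangle:
 assumes "x : topspace (man_top M)" "y : topspace (man_top M)" "z : topspace (man_top M)"
 shows "d x z <= d x y + d y z"
proof -
 obtain p where p: "p : S" "pr p = x" using ex_fibre[OF assms(1)] by blast
 obtain q where q: "q : S" "pr q = y" "pdist p q = d x y" using d_lift[OF p(1) assms(2)] p by blast
 obtain s where s: "s : S" "pr s = z" "pdist q s = d y z" using d_lift[OF q(1) assms(3)] q by blast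
 show ?thesis using d_le_pdist[OF p(1) s(1)] pdist_triangle[OF p(1) q(1) s(1)] p q s by simp
qed

lemma d_hinge:
 assumes p: "p : S" and u: "u : tan p" and v: "v : tan p"
 shows "d (pr (pexp p u)) (pr (pexp p v)) <= norm (u - v)"
 using d_le_pdist[OF pexp_in_S[OF p u] pexp_in_S[OF p v]] pdist_pexp_pexp[OF p u v] by simp

text \<open>The support in the product, taken for the point \<open>q\<close> over \<open>y\<close>
  nearest to \<open>pexp p v0\<close>: at \<open>v0\<close> the two distances agree, and elsewhere
  the distance of the base is the smaller one.\<close>

lemma d_support:
 assumes p: "p : S" and y: "y : topspace (man_top M)" and v0: "v0 : tan p"
 shows "EX L. ALL v:tan p. (d y (pr (pexp p v)))\<^sup>2 <= (d y (pr (pexp p v0)))\<^sup>2 + (norm (v - v0))\<^sup>2 + L *. (v - v0)"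
proof -
 have z: "pexp p v0 : S" by (rule pexp_in_S[OF p v0])
 obtain q where q: "q : S" "pr q = y" "pdist (pexp p v0) q = d (pr (pexp p v0)) y" using d_lift[OF z y] by blast
 hence e: "pdist q (pexp p v0) = d y (pr (pexp p v0))" using d_commute[OF y pi_in[OF z]] by (simp add: pdist_commute)
 obtain L where L: "!!v. v : tan p ==> (pdist q (pexp p v))\<^sup>2 <= (pdist q (pexp p v0))\<^sup>2 + (norm (v - v0))\<^sup>2 + L *. (v - v0)"
  using pexp_support[OF p q(1) v0] by blast
 have "(d y (pr (pexp p v)))\<^sup>2 <= (pdist q (pexp p v))\<^sup>2" if v: "v : tan p" for v
  using d_le_pdist[OF q(1) pexp_in_S[OF p v]] d_nonneg[OF y pi_in[OF pexp_in_S[OF p v]]] unfolding q(2) by (rule power_mono)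
 note le = this
 show ?thesis
 proof (intro exI ballI)
  fix v assume v: "v : tan p"
  show "(d y (pr (pexp p v)))\<^sup>2 <= (d y (pr (pexp p v0)))\<^sup>2 + (norm (v - v0))\<^sup>2 + L *. (v - v0)"
   using L[OF v] le[OF v] unfolding e by (rule order_trans[rotated])
 qed
qed

text \<open>By \<open>d_support\<close>, \<open>f\<close> lies above an affine function that touches
  it at the intermediate vector: the term \<open>norm (v - v0)\<close> squared of the support is
  cancelled by the quadratic part of \<open>norm u\<close> squared.\<close>

theorem d_convexity:
 assumes p: "p : S" and y: "y : topspace (man_top M)" and u: "u0 : tan p" "u1 : tan p" and t: "0 <= t" "t <= 1"
 defines "f \<equiv> %u. (norm u)\<^sup>2 - (d y (pr (pexp p u)))\<^sup>2"
 shows "f ((1 - t) *R u0 + t *R u1) <= (1 - t) * f u0 + t * f u1"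
proof -
 let ?v = "(1 - t) *R u0 + t *R u1"
 have v: "?v : tan p" using u by (intro subspace_add subspace_scale subspace_tan)
 obtain L where L: "!!w. w : tan p ==> (d y (pr (pexp p w)))\<^sup>2 <= (d y (pr (pexp p ?v)))\<^sup>2 + (norm (w - ?v))\<^sup>2 + L *. (w - ?v)"
  using d_support[OF p y v] by blast
 have *: "f w >= f ?v + (2 *R ?v - L) *. (w - ?v)" if "w : tan p" for w
 proof -
  have "(norm w)\<^sup>2 - (norm (w - ?v))\<^sup>2 = (norm ?v)\<^sup>2 + 2 * (?v *. (w - ?v))"
  proof -
   have "(norm (v + e))\<^sup>2 - (norm e)\<^sup>2 = (norm v)\<^sup>2 + 2 * (v *. e)" for v e :: "real ^ 'i"
    by (simp add: power2_norm_eq_inner inner_add inner_commute)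
   from this[of ?v "w - ?v"] show ?thesis by simp
  qed
  thus ?thesis using L[OF that] by (simp add: f_def inner_diff_left)
 qed
 have "(1 - t) * f u0 + t * f u1 >= (1 - t) * (f ?v + (2 *R ?v - L) *. (u0 - ?v)) + t * (f ?v + (2 *R ?v - L) *. (u1 - ?v))"
  using *[OF u(1)] *[OF u(2)] t by (intro add_mono mult_left_mono) auto
 also have "(1 - t) * (f ?v + (2 *R ?v - L) *. (u0 - ?v)) + t * (f ?v + (2 *R ?v - L) *. (u1 - ?v))
   = f ?v + (2 *R ?v - L) *. ((1 - t) *R (u0 - ?v) + t *R (u1 - ?v))"
  by (simp only: inner_add_right inner_scaleR_right) (simp add: algebra_simps)
 also have "(1 - t) *R (u0 - ?v) + t *R (u1 - ?v) = 0" by (simp add: algebra_simps)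
 finally show ?thesis by simp
qed

section \<open>Horizontal geodesics\<close>

lemma d_along_minimizer:
 assumes p: "p : S" and u: "u : tan p" and min: "norm u <= d (pr p) (pr (pexp p u))" and t: "0 <= t" "t <= 1"
 shows "d (pr p) (pr (pexp p (t *R u))) = t * norm u" "d (pr (pexp p (t *R u))) (pr (pexp p u)) = (1 - t) * norm u"
proof -
 have tu: "t *R u : tan p" using u by (rule subspace_scale[OF subspace_tan])
 have top: "pr p : topspace (man_top M)" "pr (pexp p u) : topspace (man_top M)" "pr (pexp p (t *R u)) : topspace (man_top M)"
  using p pexp_in_S[OF p u] pexp_in_S[OF p tu] by (auto intro: pi_in)
 have 1: "d (pr p) (pr (pexp p (t *R u))) <= t * norm u" using d_pexp_le[OF p tu] t by simp
 have "t *R u - u = (t - 1) *R u" by (simp add: algebra_simps)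
 hence 2: "d (pr (pexp p (t *R u))) (pr (pexp p u)) <= (1 - t) * norm u" using d_hinge[OF p tu u] t by simp
 have "norm u <= d (pr p) (pr (pexp p (t *R u))) + d (pr (pexp p (t *R u))) (pr (pexp p u))"
  using min d_triangle[OF top(1,3,2)] by simp
 moreover have "(1 - t) * norm u = norm u - t * norm u" by (simp add: algebra_simps)
 ultimately show "d (pr p) (pr (pexp p (t *R u))) = t * norm u" "d (pr (pexp p (t *R u))) (pr (pexp p u)) = (1 - t) * norm u"
  using 1 2 by linarith+
qed

text \<open>By normal coordinates the point reached at time \<open>t\<close> is also reached by the
  vector \<open>f t\<close>, which is \<open>t\<close> times the horizontal part of \<open>u\<close>
  up to \<open>o(t)\<close>. As initial pieces of a minimizer minimize, the horizontal part is as
  long as \<open>u\<close>.\<close>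

lemma minimizer_horizontal:
 assumes p: "p : S" and u: "u : tan p" and min: "norm u <= d (pr p) (pr (pexp p u))"
 shows "u : hor p"
proof -
 obtain b where b: "b : atlas M" "pr p : fst b" using ex_chart[OF p] by blast
 have pU: "p : U b" by (rule in_U[OF p b(2)])
 obtain Z et where "normal_coords b p Z et" using normal_coordinates[OF b(1) p pU] by blast
 note Z = normal_coordsD[OF this]
 let ?z = "%t. F b (pexp p (t *R u))"
 define f where "f = (%t. lam b p (et (?z t)))"
 have linl: "linear (lam b p)" by (rule linear_lam[OF b(1) p pU])
 have bl: "bounded_linear (lam b p)" using linl linear_conv_bounded_linear by blast
 have dz: "(?z has_vector_derivative DF b p u) (at 0)" using has_vector_derivative_F_pexp[OF b(1) p u, of 0] pU by simp
 hence "(?z has_derivative (%h. h *R DF b p u)) (at 0)" unfolding has_vector_derivative_def .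
 from has_derivative_compose[OF this, of et "%v. v"] Z(6)
 have "((%t. et (?z t)) has_vector_derivative DF b p u) (at 0)" unfolding has_vector_derivative_def by simp
 from bounded_linear.has_vector_derivative[OF bl this]
 have df: "(f has_vector_derivative lam b p (DF b p u)) (at 0)" unfolding f_def .
 have f0: "f 0 = 0" by (simp add: f_def Z(5) linear_0[OF linl])
 have lim: "((%t. norm ((f t - f 0) /\<^sub>R (t - 0))) \<longlongrightarrow> norm (lam b p (DF b p u))) (at_right 0)"
  using tendsto_norm[OF has_vector_derivative_quotient_tendsto[OF df]] by (rule tendsto_mono[OF at_le, rotated]) simp
 have "(?z \<longlongrightarrow> ?z 0) (at_right 0)"
  using has_vector_derivative_continuous[OF dz] by (auto simp: continuous_within intro: tendsto_mono[OF at_le, rotated])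
 hence "eventually (%t. ?z t : Z) (at_right 0)" using Z(1,2) by (intro topological_tendstoD) auto
 moreover have "eventually (%t. pexp p (t *R u) : U b) (at_right 0)"
 proof (rule topological_tendstoD[OF _ open_U[OF b(1)]])
  have "((%t. pexp p (t *R u)) \<longlongrightarrow> pexp p (0 *R u)) (at 0)"
   using has_vector_derivative_continuous[OF has_vector_derivative_pexp[of p u 0]] by (simp add: isCont_def)
  thus "((%t. pexp p (t *R u)) \<longlongrightarrow> pexp p (0 *R u)) (at_right 0)"
   by (rule tendsto_mono[OF at_le, rotated]) simp
 qed (use pU in simp)
 moreover have "eventually (%t. 0 < t & t < (1::real)) (at_right 0)"
  by (auto simp: eventually_at_right_field intro: exI[of _ 1])
 ultimately have "eventually (%t. norm u <= norm ((f t - f 0) /\<^sub>R (t - 0))) (at_right 0)"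
 proof eventually_elim
  case (elim t)
  have "pexp p (t *R u) : S" by (rule pexp_line_in_S[OF p u])
  hence "pr (pexp p (t *R u)) = pr (pexp p (f t))"
   unfolding f_def using Z(7)[OF elim(1)] chart_inv_F[OF b(1) _ elim(2)] by simp
  hence "t * norm u <= norm (f t)"
   using d_along_minimizer(1)[OF p u min, of t] elim(3) d_pexp_le[OF p lam_in_tan[OF b(1) p pU], of "et (?z t)"]
   by (simp add: f_def)
  thus ?case using elim(3) by (simp add: f0 field_simps)
 qed
 hence "norm u <= norm (lam b p (DF b p u))" by (rule tendsto_lowerbound[OF lim]) simp
 thus ?thesis unfolding hor_iff[OF b(1) p pU] by (rule lam_DF_eqI[OF b(1) p pU])
qed

lemma hor_scale: "p : S ==> u : hor p ==> c *R u : hor p" using subspace_scale[OF subspace_hor] by blast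

section \<open>Short horizontal geodesics minimize\<close>

lemma metric_le_norm:
 assumes b: "b : atlas M" and z0: "z0 : chart_image b"
 obtains K N where "0 < K" "open N" "z0 : N" "N \<subseteq> chart_image b" "!!z w. z : N ==> metric M b z w w <= K\<^sup>2 * (norm w)\<^sup>2"
proof -
 define s where "s = (%z. \<Sum>e\<in>Basis. \<Sum>e'\<in>Basis. \<bar>metric M b z e e'\<bar>)"
 have cs: "continuous_on (chart_image b) s"
  unfolding s_def using smooth_on_cont[OF smooth_metric[OF b]] by (intro continuous_intros)
 define K2 where "K2 = s z0 + 1"
 have s0: "0 <= s z" for z unfolding s_def by (intro sum_nonneg) auto
 define N where "N = chart_image b \<inter> s -` {..< K2}"
 have oN: "open N" unfolding N_def by (rule continuous_open_preimage[OF cs open_chart_image[OF b]]) auto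
 have "metric M b z w w <= (sqrt K2)\<^sup>2 * (norm w)\<^sup>2" if z: "z : N" for z w
 proof -
  have zc: "z : chart_image b" using z by (simp add: N_def)
  have "metric M b z w w = metric M b z (\<Sum>e\<in>Basis. (w *. e) *R e) (\<Sum>e'\<in>Basis. (w *. e') *R e')"
   by (simp only: euclidean_representation)
  also have "\<dots> = (\<Sum>e\<in>Basis. \<Sum>e'\<in>Basis. metric M b z ((w *. e) *R e) ((w *. e') *R e'))"
   by (subst bilinear_sum[OF bilinear_metric[OF b zc]]) (simp add: sum.cartesian_product)
  also have "\<dots> <= (\<Sum>e\<in>Basis. \<Sum>e'\<in>Basis. \<bar>metric M b z e e'\<bar> * (norm w)\<^sup>2)"
  proof (intro sum_mono)
   fix e e' :: 'e assume "e : Basis" "e' : Basis"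
   hence "\<bar>w *. e\<bar> * \<bar>w *. e'\<bar> <= norm w * norm w" by (intro mult_mono Basis_le_norm) auto
   hence "\<bar>metric M b z e e'\<bar> * (\<bar>w *. e\<bar> * \<bar>w *. e'\<bar>) <= \<bar>metric M b z e e'\<bar> * (norm w)\<^sup>2"
    by (intro mult_left_mono) (auto simp: power2_eq_square)
   moreover have "(w *. e) * ((w *. e') * metric M b z e e') <= \<bar>metric M b z e e'\<bar> * (\<bar>w *. e\<bar> * \<bar>w *. e'\<bar>)"
    by (rule order_trans[OF abs_ge_self]) (simp add: abs_mult ac_simps)
   moreover have "metric M b z ((w *. e) *R e) ((w *. e') *R e') = (w *. e) * ((w *. e') * metric M b z e e')"
    by (simp add: metric_simps[OF b zc] ac_simps)
   ultimately show "metric M b z ((w *. e) *R e) ((w *. e') *R e') <= \<bar>metric M b z e e'\<bar> * (norm w)\<^sup>2"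
    by linarith
  qed
  also have "\<dots> = s z * (norm w)\<^sup>2" by (simp add: s_def sum_distrib_right)
  also have "\<dots> <= K2 * (norm w)\<^sup>2" using z by (intro mult_right_mono) (auto simp: N_def)
  also have "K2 = (sqrt K2)\<^sup>2" using s0[of z0] by (simp add: K2_def)
  finally show ?thesis .
 qed
 moreover have "0 < sqrt K2" using s0[of z0] by (simp add: K2_def)
 ultimately show ?thesis using that[of "sqrt K2" N] oN z0 by (auto simp: N_def K2_def)
qed

text \<open>On horizontal vectors, the differential of the projection is bounded below, uniformly by
 the isometry property, so \<open>u \<mapsto> pr (pexp p u)\<close> is injective on small horizontal vectors,
 uniformly in \<open>p\<close>. As a minimizer to \<open>pr (pexp p u)\<close> is horizontal, it must be \<open>u\<close>.\<close>
lemma injectivity_radius_local: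
 assumes p0: "p0 : S"
 shows "EX e>0. ALL p:S. ALL u:hor p. dist p p0 < e & norm u < e --> d (pr p) (pr (pexp p u)) = norm u"
proof -
 obtain b where b: "b : atlas M" "pr p0 : fst b" using ex_chart[OF p0] by blast
 have p0U: "p0 : U b" by (rule in_U[OF p0 b(2)])
 obtain K N where K: "0 < K" "open N" "F b p0 : N" "N \<subseteq> chart_image b" "!!z w. z : N ==> metric M b z w w <= K\<^sup>2 * (norm w)\<^sup>2"
  using metric_le_norm[OF b(1) F_in[OF p0U]] by metis
 define Ph where "Ph = (%x. F b (pexp (fst x) (snd x)))"
 define A where "A = {x. pexp (fst x) (snd x) : U b}"
 have smp: "smooth_on UNIV (%x. pexp (fst x) (snd x))"
  by (intro smooth_on_pexp smooth_on_fst smooth_on_snd smooth_on_id open_UNIV)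
 have oA: "open A" using open_vimage[OF open_U[OF b(1)] smooth_on_cont[OF smp]] by (simp add: A_def vimage_def)
 have smPh: "smooth_on A Ph" unfolding Ph_def
  by (rule smooth_on_compose[OF oA open_U[OF b(1)] _ smooth_on_subset[OF smp subset_UNIV] smooth_on_F[OF b(1)]]) (auto simp: A_def)
 define D where "D = (%x h. FD Ph (at x) (0, h))"
 have dPh: "(Ph has_derivative FD Ph (at x)) (at x)" if "x : A" for x by (rule smooth_on_deriv[OF smPh oA that])
 have linD: "linear (D x)" if "x : A" for x unfolding D_def
  by (intro linear_compose[OF _ has_derivative_linear[OF dPh[OF that]], unfolded o_def] linearI) auto
 have dD: "((%u. Ph (p, u)) has_derivative D (p, u)) (at u)" if "(p, u) : A" for p u unfolding D_def
  by (rule has_derivative_compose[where f="%u. (p, u)" and g=Ph, OF _ dPh[OF that]]) (auto intro!: derivative_eq_intros)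
 have pA: "(p, 0) : A" if "p : U b" for p using that by (simp add: A_def)
 have D0: "D (p, 0) h = DF b p h" if p: "p : S" "p : U b" and h: "h : tan p" for p h
 proof -
  have 1: "((%t. Ph (p, 0 + t *R h)) has_vector_derivative D (p, 0) h) (at 0)"
   by (rule deriv_along_line) (use dD[OF pA[OF p(2)]] in simp)
  have 2: "((%t. Ph (p, 0 + t *R h)) has_vector_derivative DF b p h) (at 0)"
   using has_vector_derivative_F_pexp[OF b(1) p(1) h, of 0] p(2) by (simp add: Ph_def)
  show ?thesis by (rule vector_derivative_unique_at[OF 1 2])
 qed
 define ep where "ep = (%x. \<Sum>e\<in>Basis. norm (D x e - D (p0, 0) e))"
 have p0A: "(p0, 0) : A" by (rule pA[OF p0U])
 have cep: "continuous_on A ep" unfolding ep_def D_def by (intro continuous_intros smooth_on_cont[OF smooth_on_FD[OF smPh]])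
 \<comment> \<open>Comparing both \<open>D (p, v)\<close> and \<open>D (p, 0)\<close> with
   \<open>D (p0, 0)\<close> doubles \<open>1 / (4 * K)\<close> to \<open>1 / (2 * K)\<close>, half
   of the lower bound \<open>1 / K\<close> that \<open>DF b p\<close> has on horizontal vectors;
   this leaves injectivity.\<close>
 have oep: "open (A \<inter> ep -` {..< 1 / (4 * K)})" by (rule continuous_open_preimage[OF cep oA]) auto
 moreover have "(p0, 0) : A \<inter> ep -` {..< 1 / (4 * K)}" using p0A K(1) by (simp add: ep_def)
 ultimately obtain e1 where e1: "e1 > 0" "!!x. dist x (p0, 0) < e1 ==> x : A \<inter> ep -` {..< 1 / (4 * K)}"
  unfolding open_dist by blast
 have "open (U b \<inter> F b -` N)" by (rule continuous_open_preimage[OF smooth_on_cont[OF smooth_on_F[OF b(1)]] open_U[OF b(1)] K(2)])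
 moreover have "p0 : U b \<inter> F b -` N" using p0U K(3) by simp
 ultimately obtain e2 where e2: "e2 > 0" "!!p. dist p p0 < e2 ==> p : U b \<inter> F b -` N" unfolding open_dist by blast
 define e where "e = min e2 (e1 / 2)"
 have close: "dist (p, u) (p0, 0) < e1" if "dist p p0 < e" "norm u < e" for p u
 proof -
  have "dist (p, u) (p0, 0) <= dist p p0 + dist u 0" unfolding dist_Pair_Pair by (rule sqrt_sum_squares_le_sum) auto
  also have "\<dots> < e1" using that by (simp add: e_def)
  finally show ?thesis .
 qed
 have inj: "u = u'" if p: "p : S" "dist p p0 < e" and u: "u : hor p" "norm u < e" "u' : hor p" "norm u' < e"
  and eq: "Ph (p, u) = Ph (p, u')" for p u u'
 proof -
  have pU: "p : U b" "F b p : N" using e2(2)[of p] p(2) by (auto simp: e_def)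
  have onD: "norm (D (p, v) h - D (p, 0) h) <= (1 / (2 * K)) * norm h" if v: "norm v < e" for v h
  proof -
   have "norm (D x h - D (p0, 0) h) <= (1 / (4 * K)) * norm h" if x: "dist x (p0, 0) < e1" for x
   proof -
    have "linear (%h. D x h - D (p0, 0) h)" using linD e1(2)[OF x] p0A by (intro linear_compose_sub) auto
    from linear_norm_le_sum_Basis[OF this, of h] have "norm (D x h - D (p0, 0) h) <= ep x * norm h" by (simp add: ep_def)
    also have "\<dots> <= (1 / (4 * K)) * norm h" using e1(2)[OF x] by (intro mult_right_mono) auto
    finally show ?thesis .
   qed
   from this[OF close[OF p(2) v]] this[OF close[OF p(2), of 0]]
   have "norm (D (p, v) h - D (p0, 0) h) + norm (D (p, 0) h - D (p0, 0) h) <= (1 / (4 * K)) * norm h + (1 / (4 * K)) * norm h"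
    using e1(1) e2(1) by (simp add: e_def)
   moreover have "norm (D (p, v) h - D (p, 0) h) <= norm (D (p, v) h - D (p0, 0) h) + norm (D (p, 0) h - D (p0, 0) h)"
    using norm_triangle_ineq4[of "D (p, v) h - D (p0, 0) h" "D (p, 0) h - D (p0, 0) h"] by simp
   ultimately show ?thesis by simp
  qed
  have lin0: "linear (D (p, 0))" by (rule linD[OF pA[OF pU(1)]])
  have "norm ((Ph (p, u) - D (p, 0) u) - (Ph (p, u') - D (p, 0) u')) <= (1 / (2 * K)) * norm (u - u')"
  proof (rule differentiable_bound[of "ball 0 e" "%v. Ph (p, v) - D (p, 0) v" "%v h. D (p, v) h - D (p, 0) h"])
   fix v assume v: "v : ball (0 :: real ^ 'i) e"
   have vA: "(p, v) : A" using e1(2)[OF close[OF p(2), of v]] v by simp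
   have "((%v. Ph (p, v) - D (p, 0) v) has_derivative (%h. D (p, v) h - D (p, 0) h)) (at v)"
    by (intro has_derivative_diff dD[OF vA] linear_imp_has_derivative lin0)
   thus "((%v. Ph (p, v) - D (p, 0) v) has_derivative (%h. D (p, v) h - D (p, 0) h)) (at v within ball 0 e)"
    by (rule has_derivative_at_withinI)
   show "onorm (%h. D (p, v) h - D (p, 0) h) <= 1 / (2 * K)" by (rule onorm_bound) (use onD[of v] v K(1) in auto)
  qed (use u in auto)
  hence "norm (D (p, 0) (u - u')) <= (1 / (2 * K)) * norm (u - u')"
   using eq linear_diff[OF lin0, of u u'] by (simp add: norm_minus_commute)
  moreover have h: "u - u' : hor p" using u by (intro subspace_diff[OF subspace_hor[OF p(1)]])
  ultimately have 1: "norm (DF b p (u - u')) <= (1 / (2 * K)) * norm (u - u')" using D0[OF p(1) pU(1) hor_tan[OF h]] by simp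
  have "(norm (u - u'))\<^sup>2 <= K\<^sup>2 * (norm (DF b p (u - u')))\<^sup>2"
   unfolding power2_norm_eq_inner[of "u - u'"] hor_inner[OF b(1) p(1) pU(1) h] by (rule K(5)[OF pU(2)])
  hence "(norm (u - u'))\<^sup>2 <= (K * norm (DF b p (u - u')))\<^sup>2" by (simp add: power_mult_distrib)
  hence "norm (u - u') <= K * norm (DF b p (u - u'))" by (rule power2_le_imp_le) (use K(1) in simp)
  also have "\<dots> <= K * ((1 / (2 * K)) * norm (u - u'))" using 1 K(1) by (intro mult_left_mono) auto
  also have "\<dots> = norm (u - u') / 2" using K(1) by simp
  finally show ?thesis by simp
 qed
 have "d (pr p) (pr (pexp p u)) = norm u" if p: "p : S" "dist p p0 < e" and u: "u : hor p" "norm u < e" for p u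
 proof -
  have ut: "u : tan p" by (rule hor_tan[OF u(1)])
  have q: "pexp p u : S" by (rule pexp_in_S[OF p(1) ut])
  obtain u' where u': "u' : tan p" "pr (pexp p u') = pr (pexp p u)" "norm u' = d (pr p) (pr (pexp p u))"
   using minimizer_exists[OF p(1) pi_in[OF q]] by blast
  have "u' : hor p" by (rule minimizer_horizontal[OF p(1) u'(1)]) (simp add: u')
  moreover have "norm u' < e" using u' d_pexp_le[OF p(1) ut] u(2) by simp
  moreover have "Ph (p, u) = Ph (p, u')" using u'(2) q pexp_in_S[OF p(1) u'(1)] by (simp add: Ph_def F_S)
  ultimately have "u = u'" using inj[OF p u] by blast
  thus ?thesis using u'(3) by simp
 qed
 moreover have "e > 0" using e1(1) e2(1) by (simp add: e_def)
 ultimately show ?thesis by blast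
qed

text \<open>A sequence of counterexamples with radii tending to 0 would accumulate at a point of the
  closed set \<open>S\<close>, against the local radius there. A geodesic stays in a bounded part
  for bounded times by \<open>norm_pexp_line_le\<close>.\<close>

lemma injectivity_radius:
 "EX rh>0. ALL p:S. norm p <= R --> (ALL u:hor p. norm u < rh --> d (pr p) (pr (pexp p u)) = norm u)"
proof (rule ccontr)
 assume neg: "\<not> ?thesis"
 have "EX p u. p : S & norm p <= R & u : hor p & norm u < inverse (real (Suc n)) & d (pr p) (pr (pexp p u)) ~= norm u" for n
 proof -
  have "0 < inverse (real (Suc n))" by simp
  thus ?thesis using neg by blast
 qed
 then obtain p u where pu: "!!n. p n : S" "!!n. norm (p n) <= R" "!!n. u n : hor (p n)" "!!n. norm (u n) < inverse (real (Suc n))"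
  "!!n. d (pr (p n)) (pr (pexp (p n) (u n))) ~= norm (u n)" by metis
 have "p n : S \<inter> cball 0 R" for n using pu by simp
 moreover have "compact (S \<inter> cball 0 R)" using closed_S by (simp add: closed_Int_compact)
 ultimately obtain p0 s where s: "strict_mono s" "p0 : S" "(p \<circ> s) \<longlonglongrightarrow> p0"
  unfolding compact_def by (metis IntD1)
 obtain e where e: "e > 0" "!!p u. p : S ==> u : hor p ==> dist p p0 < e ==> norm u < e ==> d (pr p) (pr (pexp p u)) = norm u"
  using injectivity_radius_local[OF s(2)] by blast
 have "eventually (%n. dist ((p \<circ> s) n) p0 < e) sequentially" using s(3) e(1) by (rule tendstoD)
 moreover have "eventually (%n. inverse (real (Suc n)) < e) sequentially"
  using LIMSEQ_inverse_real_of_nat e(1) by (rule order_tendstoD)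
 ultimately obtain n where n: "dist (p (s n)) p0 < e" "inverse (real (Suc n)) < e"
  using eventually_happens'[OF sequentially_bot, OF eventually_conj] by (auto simp: o_def)
 have "n <= s n" using s(1) by (rule seq_suble)
 hence "inverse (real (Suc (s n))) <= inverse (real (Suc n))" by (intro le_imp_inverse_le) auto
 hence "norm (u (s n)) < e" using pu(4)[of "s n"] n(2) by linarith
 thus False using e(2)[OF pu(1,3) n(1)] pu(5) by blast
qed

lemma norm_pexp_line_le: "p : S ==> u : tan p ==> norm (pexp p (s *R u)) <= norm p + \<bar>s\<bar> * norm u"
proof -
 assume p: "p : S" and u: "u : tan p"
 have su: "s *R u : tan p" using u by (rule subspace_scale[OF subspace_tan])
 have "norm (p - pexp p (s *R u)) <= \<bar>s\<bar> * norm u"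
  using norm_le_pdist[OF p pexp_in_S[OF p su]] pdist_pexp[OF p su] by simp
 thus ?thesis using norm_triangle_ineq2[of "pexp p (s *R u)" p] by (simp add: norm_minus_commute)
qed

text \<open>Any time is reached by finitely many equal steps shorter than \<open>h\<close>. In the
  applications \<open>h\<close> comes from an injectivity radius valid along the whole piece of
  geodesic.\<close>

lemma geodesic_induct:
 fixes T h :: real and P :: "real => bool"
 assumes p: "p : S" and u: "u : tan p" and "P 0" and "h > 0"
  and step: "!!s t. \<bar>s\<bar> <= \<bar>T\<bar> ==> \<bar>t\<bar> < h ==> P s ==> P (s + t)"
 shows "P T"
proof -
 obtain n :: nat where n: "\<bar>T\<bar> / h < real n" using reals_Archimedean2 by blast
 have n0: "0 < real n" using n \<open>h > 0\<close> by (metis abs_ge_zero divide_nonneg_pos order_le_less_trans)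
 have small: "\<bar>T / n\<bar> < h" using n n0 \<open>h > 0\<close> by (simp add: field_simps)
 have "P (m * (T / n))" if "m <= n" for m :: nat using that
 proof (induction m)
  case (Suc m)
  have "\<bar>real m * (T / real n)\<bar> = (m / n) * \<bar>T\<bar>" using n0 by (simp add: abs_mult)
  also have "\<dots> <= 1 * \<bar>T\<bar>" using Suc.prems n0 by (intro mult_right_mono) auto
  finally show ?case using step[OF _ small Suc.IH] Suc.prems by (simp add: algebra_simps add_divide_distrib)
 qed (use \<open>P 0\<close> in simp)
 from this[of n] show ?thesis using n0 by simp
qed

text \<open>A short piece with horizontal initial velocity minimizes, hence so does the reversed
  piece, and initial velocities of minimizers are horizontal. Applied at the far end, this is
  horizontality there.\<close>

lemma gvel_hor:
 assumes p: "p : S" and u: "u : hor p"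
 shows "gvel p u T : hor (pexp p (T *R u))"
proof -
 have ut: "u : tan p" by (rule hor_tan[OF u])
 obtain rh where rh: "rh > 0"
  "!!q v. q : S ==> norm q <= norm p + \<bar>T\<bar> * norm u ==> v : hor q ==> norm v < rh ==> d (pr q) (pr (pexp q v)) = norm v"
  using injectivity_radius[of "norm p + \<bar>T\<bar> * norm u"] by blast
 define h where "h = rh / (norm u + 1)"
 have h: "h > 0" using rh(1) by (simp add: h_def add_nonneg_pos)
 show ?thesis
 proof (rule geodesic_induct[where P="%s. gvel p u s : hor (pexp p (s *R u))", OF p ut _ h])
  show "gvel p u 0 : hor (pexp p (0 *R u))" using u by simp
  fix s t assume s: "\<bar>s\<bar> <= \<bar>T\<bar>" and t: "\<bar>t\<bar> < h" and IH: "gvel p u s : hor (pexp p (s *R u))"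
  let ?q = "pexp p (s *R u)" and ?v = "gvel p u s"
  have q: "?q : S" by (rule pexp_line_in_S[OF p ut])
  have vt: "?v : tan ?q" by (rule hor_tan[OF IH])
  have nv: "norm ?v = norm u" by (rule norm_gvel[OF p ut])
  show "gvel p u (s + t) : hor (pexp p ((s + t) *R u))"
  proof (cases "t = 0")
   case False
   let ?e = "pexp ?q (t *R ?v)" and ?w = "gvel ?q ?v t"
   have e: "?e : S" by (rule pexp_line_in_S[OF q vt])
   have "norm (t *R ?v) < rh"
   proof -
    have "norm (t *R ?v) <= \<bar>t\<bar> * (norm u + 1)" using nv by (simp add: mult_left_mono)
    also have "\<dots> < h * (norm u + 1)" using t by (intro mult_strict_right_mono) (auto simp: add_nonneg_pos)
    also have "\<dots> = rh" by (simp add: h_def add_nonneg_eq_0_iff)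
    finally show ?thesis .
   qed
   moreover have "norm ?q <= norm p + \<bar>T\<bar> * norm u"
    using norm_pexp_line_le[OF p ut, of s] s mult_right_mono[OF s, of "norm u"] by simp
   ultimately have dq: "d (pr ?q) (pr ?e) = norm (t *R ?v)" by (intro rh(2) q hor_scale IH)
   have wt: "?w : tan ?e" by (rule gvel_in_tan[OF q vt])
   have rev_eq: "pexp ?e ((- t) *R ?w) = ?q" using pexp_pexp[OF q vt, of t "- t"] by simp
   have "(- t) *R ?w : hor ?e"
   proof (rule minimizer_horizontal[OF e])
    show "(- t) *R ?w : tan ?e" by (rule subspace_scale[OF subspace_tan wt])
    show "norm ((- t) *R ?w) <= d (pr ?e) (pr (pexp ?e ((- t) *R ?w)))"
     unfolding rev_eq using dq d_commute[OF pi_in[OF e] pi_in[OF q]] norm_gvel[OF q vt] by simp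
   qed
   hence "(- inverse t) *R ((- t) *R ?w) : hor ?e" by (rule hor_scale[OF e])
   hence "?w : hor ?e" using False by simp
   thus ?thesis using gvel_gvel[OF p ut, of s t] pexp_pexp[OF p ut, of s t] by simp
  qed (use IH in simp)
 qed
qed

subsection \<open>Geodesics of the base are determined by their initial velocity\<close>

text \<open>The hinge comparison in normal coordinates at \<open>q\<close> gives an upper bound of
  the distance to \<open>pexp q w\<close> that is differentiable at \<open>q\<close>. If
  \<open>w\<close> minimizes, it touches the distance there, so first variations are available even
  where the distance is not smooth.\<close>

lemma d_upper_function:
 assumes b: "b : atlas M" and q: "q : S" "q : U b" and w: "w : tan q" "w ~= 0"
 obtains Z f where "open Z" "F b q : Z" "Z \<subseteq> chart_image b" "!!z. z : Z ==> d (pr (pexp q w)) (chart_inv b z) <= f z"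
  "f (F b q) = norm w" "(f has_derivative (%xi. - (metric M b (F b q) (DF b q w) xi / norm w))) (at (F b q))"
proof -
 obtain Z et where "normal_coords b q Z et" using normal_coordinates[OF b q] by blast
 note Z = normal_coordsD[OF this]
 have linl: "linear (lam b q)" by (rule linear_lam[OF b q])
 have bl: "bounded_linear (lam b q)" using linl linear_conv_bounded_linear by blast
 define f where "f = (%z. norm (w - lam b q (et z)))"
 have w0: "w - lam b q (et (F b q)) = w" by (simp add: Z(5) linear_0[OF linl])
 show ?thesis
 proof (rule that[of Z f])
  show "d (pr (pexp q w)) (chart_inv b z) <= f z" if "z : Z" for z
   using d_hinge[OF q(1) w(1) lam_in_tan[OF b q]] Z(7)[OF that] unfolding f_def by metis
  show "f (F b q) = norm w" by (simp add: f_def w0)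
  have "((%z. w - lam b q (et z)) has_derivative (%xi. - lam b q xi)) (at (F b q))"
   using has_derivative_diff[OF has_derivative_const bounded_linear.has_derivative[OF bl Z(6)], of w] by simp
  moreover have "(norm has_derivative (%h. h *. sgn w)) (at (w - lam b q (et (F b q))))"
   unfolding w0 by (rule has_derivative_norm[OF w(2)])
  ultimately have "(f has_derivative (%xi. - lam b q xi *. sgn w)) (at (F b q))"
   unfolding f_def by (rule has_derivative_compose)
  moreover have "- lam b q xi *. sgn w = - (metric M b (F b q) (DF b q w) xi / norm w)" for xi
   using inner_lam[OF b q, of xi w] metric_commute[OF b F_in[OF q(2)]] by (simp add: sgn_div_norm divide_inverse)
  ultimately show "(f has_derivative (%xi. - (metric M b (F b q) (DF b q w) xi / norm w))) (at (F b q))" by simp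
 qed (use Z in auto)
qed

text \<open>By the triangle inequality, the sum of the two upper bounds is at least the distance
  between the two ends, and by \<open>min\<close> this makes the sum minimal at the meeting point.
  So its differential vanishes there.\<close>

lemma no_corner:
 assumes b: "b : atlas M" and q1: "q1 : S" "q1 : U b" and q2: "q2 : S" "q2 : U b" and eq: "pr q1 = pr q2"
  and w1: "w1 : tan q1" "w1 ~= 0" and w2: "w2 : tan q2" "w2 ~= 0"
  and min: "norm w1 + norm w2 <= d (pr (pexp q1 w1)) (pr (pexp q2 w2))"
 shows "DF b q1 w1 /\<^sub>R norm w1 = - (DF b q2 w2 /\<^sub>R norm w2)"
proof -
 have Feq: "F b q1 = F b q2" using eq q1 q2 by (simp add: F_S)
 let ?z = "F b q1"
 obtain Z1 f1 where 1: "open Z1" "?z : Z1" "Z1 \<subseteq> chart_image b" "!!z. z : Z1 ==> d (pr (pexp q1 w1)) (chart_inv b z) <= f1 z"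
  "f1 ?z = norm w1" "(f1 has_derivative (%xi. - (metric M b ?z (DF b q1 w1) xi / norm w1))) (at ?z)"
  by (rule d_upper_function[OF b q1 w1]) (rule that)
 obtain Z2 f2 where 2: "open Z2" "?z : Z2" "Z2 \<subseteq> chart_image b" "!!z. z : Z2 ==> d (pr (pexp q2 w2)) (chart_inv b z) <= f2 z"
  "f2 ?z = norm w2" "(f2 has_derivative (%xi. - (metric M b ?z (DF b q2 w2) xi / norm w2))) (at ?z)"
  by (rule d_upper_function[OF b q2 w2, unfolded Feq[symmetric]]) (rule that)
 have zc: "?z : chart_image b" by (rule F_in[OF q1(2)])
 have s1: "pexp q1 w1 : S" and s2: "pexp q2 w2 : S" using pexp_in_S q1 q2 w1 w2 by auto
 have "(%xi. - (metric M b ?z (DF b q1 w1) xi / norm w1) + - (metric M b ?z (DF b q2 w2) xi / norm w2)) = (%xi. 0)"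
 proof (rule differential_zero_maxmin)
  show "open (Z1 \<inter> Z2)" "?z : Z1 \<inter> Z2" using 1 2 by auto
  show "((%z. f1 z + f2 z) has_derivative (%xi. - (metric M b ?z (DF b q1 w1) xi / norm w1) + - (metric M b ?z (DF b q2 w2) xi / norm w2))) (at ?z)"
   by (rule has_derivative_add[OF 1(6) 2(6)])
  have "f1 ?z + f2 ?z <= f1 z + f2 z" if z: "z : Z1 \<inter> Z2" for z
  proof -
   have ci: "chart_inv b z : topspace (man_top M)" using chart_chart_inv(1)[of z b] 1(3) z chart_subset_topspace[OF b] by blast
   have "norm w1 + norm w2 <= d (pr (pexp q1 w1)) (chart_inv b z) + d (chart_inv b z) (pr (pexp q2 w2))"
    using min d_triangle[OF pi_in[OF s1] ci pi_in[OF s2]] by linarith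
   thus ?thesis using 1(4)[of z] 2(4)[of z] z 1(5) 2(5) d_commute[OF ci pi_in[OF s2]] by simp
  qed
  thus "(ALL y:Z1 \<inter> Z2. f1 y + f2 y <= f1 ?z + f2 ?z) | (ALL y:Z1 \<inter> Z2. f1 ?z + f2 ?z <= f1 y + f2 y)" by blast
 qed
 note * = this
 have "metric M b ?z (DF b q1 w1) xi / norm w1 = - (metric M b ?z (DF b q2 w2) xi / norm w2)" for xi
  using fun_cong[OF *, of xi] by linarith
 thus ?thesis by (intro metric_eqI[OF b zc]) (simp add: metric_simps[OF b zc] divide_inverse mult.commute)
qed

text \<open>Horizontal lifts, at two points of one fibre, of the same tangent vector of the
  base.\<close>

definition related :: "real ^ 'i => real ^ 'i => real ^ 'i => real ^ 'i => bool" where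
 "related p u q v \<longleftrightarrow> p : S & q : S & u : hor p & v : hor q & pr p = pr q &
   (ALL b:atlas M. p : U b --> DF b p u = DF b q v)"

lemma U_fibre: "p : S ==> q : S ==> pr p = pr q ==> p : U b \<longleftrightarrow> q : U b" using in_U U_imp by metis

lemma relatedI:
 assumes "p : S" "q : S" "u : hor p" "v : hor q" "pr p = pr q" and b: "b : atlas M" "p : U b" "DF b p u = DF b q v"
 shows "related p u q v"
proof -
 have "DF a p u = DF a q v" if a: "a : atlas M" "p : U a" for a
 proof -
  have qa: "q : U a" "q : U b" using U_fibre assms a b by blast+
  show ?thesis
   using DF_change_chart[OF b(1) a(1) assms(1) b(2) a(2), of u] DF_change_chart[OF b(1) a(1) assms(2) qa(2,1), of v] assms
   by (simp add: F_S)
 qed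
 thus ?thesis using assms by (simp add: related_def)
qed

lemma related_norm:
 assumes "related p u q v"
 shows "norm u = norm v"
proof -
 have r: "p : S" "q : S" "u : hor p" "v : hor q" "pr p = pr q" using assms by (auto simp: related_def)
 obtain b where b: "b : atlas M" "pr p : fst b" using ex_chart[OF r(1)] by blast
 have U: "p : U b" "q : U b" using in_U b r by auto
 have "u *. u = v *. v"
  using hor_inner[OF b(1) r(1) U(1) r(3)] hor_inner[OF b(1) r(2) U(2) r(4)] assms b U by (simp add: related_def F_S)
 thus ?thesis by (simp add: norm_eq_sqrt_inner)
qed

lemma related_scale: "related p u q v ==> related p (c *R u) q (c *R v)"
proof -
 assume "related p u q v"
 hence r: "p : S" "q : S" "u : hor p" "v : hor q" "pr p = pr q" "!!b. b : atlas M ==> p : U b ==> DF b p u = DF b q v"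
  by (auto simp: related_def)
 have "DF b p (c *R u) = DF b q (c *R v)" if b: "b : atlas M" "p : U b" for b
  using r(6)[OF b] linear_cmul[OF linear_DF[OF b]] linear_cmul[OF linear_DF[OF b(1), of q]] U_fibre[OF r(1,2,5)] b by simp
 thus ?thesis using r hor_scale by (simp add: related_def)
qed

text \<open>The geodesic through \<open>p\<close> from time \<open>- ep\<close> to \<open>ep\<close>
  minimizes. Replace its first half by a minimizer from \<open>q\<close> to the same end, with
  vector \<open>w\<close> at \<open>q\<close>: the broken path still minimizes in the base, so it
  has no corner, and \<open>w\<close> must be \<open>- ep\<close> times \<open>v\<close>.\<close>

lemma related_step:
 assumes rel: "related p u q v" and ep: "ep > 0"
  and rh: "!!q v. q : S ==> norm q <= R ==> v : hor q ==> norm v < rh ==> d (pr q) (pr (pexp q v)) = norm v"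
  and R: "norm p + ep * norm u <= R" and small: "2 * ep * norm u < rh"
 shows "pr (pexp p ((- ep) *R u)) = pr (pexp q ((- ep) *R v))"
proof -
 have r: "p : S" "q : S" "u : hor p" "v : hor q" "pr p = pr q" "!!b. b : atlas M ==> p : U b ==> DF b p u = DF b q v"
  using rel by (auto simp: related_def)
 note nuv = related_norm[OF rel]
 show ?thesis
 proof (cases "u = 0")
  case True
  thus ?thesis using nuv r(5) by simp
 next
  case False
  have ut: "u : tan p" and vt: "v : tan q" using r hor_tan by auto
  obtain b where b: "b : atlas M" "pr p : fst b" using ex_chart[OF r(1)] by blast
  have U: "p : U b" "q : U b" using in_U b r by auto
  let ?s = "pexp p ((- ep) *R u)" and ?v = "gvel p u (- ep)"
  have s: "?s : S" by (rule pexp_line_in_S[OF r(1) ut])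
  have vh: "?v : hor ?s" by (rule gvel_hor[OF r(1,3)])
  have nv: "norm ?v = norm u" by (rule norm_gvel[OF r(1) ut])
  have "d (pr ?s) (pr (pexp ?s ((2 * ep) *R ?v))) = norm ((2 * ep) *R ?v)"
   by (rule rh) (use s hor_scale[OF s vh] norm_pexp_line_le[OF r(1) ut, of "- ep"] ep R small nv in auto)
  moreover have "pexp ?s ((2 * ep) *R ?v) = pexp p (ep *R u)" using pexp_pexp[OF r(1) ut, of "- ep" "2 * ep"] by simp
  ultimately have long: "d (pr ?s) (pr (pexp p (ep *R u))) = 2 * ep * norm u" using ep nv by simp
  obtain w where w: "w : tan q" "pr (pexp q w) = pr ?s" "norm w = d (pr q) (pr ?s)"
   using minimizer_exists[OF r(2) pi_in[OF s]] by blast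
  have wh: "w : hor q" by (rule minimizer_horizontal[OF r(2) w(1)]) (simp add: w)
  have eu: "ep *R u : tan p" using ut by (rule subspace_scale[OF subspace_tan])
  have meu: "(- ep) *R u : tan p" using ut by (rule subspace_scale[OF subspace_tan])
  have le: "norm w <= ep * norm u" using d_pexp_le[OF r(1) meu] w(3) r(5) ep by simp
  have "d (pr p) (pr (pexp p (ep *R u))) <= ep * norm u" using d_pexp_le[OF r(1) eu] ep by simp
  hence "2 * ep * norm u <= norm w + ep * norm u"
   using long d_triangle[OF pi_in[OF s] pi_in[OF r(1)] pi_in[OF pexp_in_S[OF r(1) eu]]] w(3) r(5)
    d_commute[OF pi_in[OF s] pi_in[OF r(1)]] by simp
  hence nw: "norm w = ep * norm u" using le by simp
  have w0: "w ~= 0" using nw False ep by auto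
  have "DF b q w /\<^sub>R norm w = - (DF b p (ep *R u) /\<^sub>R norm (ep *R u))"
   by (rule no_corner[OF b(1) r(2) U(2) r(1) U(1) r(5)[symmetric] w(1) w0 eu])
    (use False ep long w(2) nw in auto)
  hence "DF b q w /\<^sub>R norm w = (- DF b p (ep *R u)) /\<^sub>R norm w" using nw ep by simp
  hence "DF b q w = - DF b p (ep *R u)" using w0 by (simp only: scaleR_cancel_left) auto
  also have "\<dots> = DF b q ((- ep) *R v)"
   unfolding linear_cmul[OF linear_DF[OF b(1) U(1)]] linear_cmul[OF linear_DF[OF b(1) U(2)]] r(6)[OF b(1) U(1)] by simp
  finally have "w = (- ep) *R v" by (intro hor_eqI[OF b(1) r(2) U(2) wh hor_scale[OF r(2,4)]])
  thus ?thesis using w(2) by simp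
 qed
qed

text \<open>For short times the projections agree by \<open>related_step\<close>, used with the
  velocities for backward and with their opposites for forward times. Agreement on an open interval
  of times can be differentiated, so the velocities stay related and the next step can
  start.\<close>

theorem related_geodesics:
 assumes rel: "related p u q v"
 shows "related (pexp p (T *R u)) (gvel p u T) (pexp q (T *R v)) (gvel q v T)"
proof -
 have r: "p : S" "q : S" "u : hor p" "v : hor q" using rel by (auto simp: related_def)
 have ut: "u : tan p" and vt: "v : tan q" using r hor_tan by auto
 define R where "R = norm p + (\<bar>T\<bar> + 1) * norm u"
 obtain rh where rh: "rh > 0"
  "!!q v. q : S ==> norm q <= R ==> v : hor q ==> norm v < rh ==> d (pr q) (pr (pexp q v)) = norm v"
  using injectivity_radius[of R] by blast
 define h where "h = min 1 (rh / (2 * (norm u + 1)))"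
 have h: "h > 0" "h <= 1" using rh(1) by (auto simp: h_def add_nonneg_pos)
 have hr: "2 * ep * norm u < rh" if "0 < ep" "ep < h" for ep
 proof -
  have "2 * ep * norm u <= ep * (2 * (norm u + 1))" using that by (simp add: algebra_simps)
  also have "\<dots> < (rh / (2 * (norm u + 1))) * (2 * (norm u + 1))"
   using that by (intro mult_strict_right_mono) (auto simp: h_def add_nonneg_pos)
  also have "\<dots> = rh" by (simp add: add_nonneg_eq_0_iff)
  finally show ?thesis .
 qed
 show ?thesis
 proof (rule geodesic_induct[where P="%s. related (pexp p (s *R u)) (gvel p u s) (pexp q (s *R v)) (gvel q v s)", OF r(1) ut _ h(1)])
  show "related (pexp p (0 *R u)) (gvel p u 0) (pexp q (0 *R v)) (gvel q v 0)" using rel by simp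
  fix s t assume s: "\<bar>s\<bar> <= \<bar>T\<bar>" and t: "\<bar>t\<bar> < h"
  let ?p = "pexp p (s *R u)" and ?u = "gvel p u s" and ?q = "pexp q (s *R v)" and ?v = "gvel q v s"
  assume IH: "related ?p ?u ?q ?v"
  hence r': "?p : S" "?q : S" "?u : hor ?p" "?v : hor ?q" by (auto simp: related_def)
  have ut': "?u : tan ?p" and vt': "?v : tan ?q" using r' hor_tan by auto
  have nu: "norm ?u = norm u" by (rule norm_gvel[OF r(1) ut])
  have eq: "pr (pexp ?p (ta *R ?u)) = pr (pexp ?q (ta *R ?v))" if ta: "\<bar>ta\<bar> < h" for ta
  proof -
   have neg: "pr (pexp ?p ((- ep) *R x)) = pr (pexp ?q ((- ep) *R y))" if "0 < ep" "ep < h" "related ?p x ?q y" "norm x = norm u" for ep x y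
   proof (rule related_step[OF that(3,1) rh(2)])
    have "\<bar>s\<bar> * norm u <= \<bar>T\<bar> * norm u" using s by (intro mult_right_mono) auto
    moreover have "ep * norm u <= 1 * norm u" using that(2) h(2) by (intro mult_right_mono) auto
    ultimately show "norm ?p + ep * norm x <= R"
     using norm_pexp_line_le[OF r(1) ut, of s] that(4) by (simp add: R_def algebra_simps)
    show "2 * ep * norm x < rh" using hr[OF that(1,2)] that(4) by simp
   qed auto
   consider "ta = 0" | "ta > 0" | "ta < 0" by linarith
   thus ?thesis
   proof cases
    case 1
    thus ?thesis using IH by (simp add: related_def)
   next
    case 2
    from neg[OF 2 _ related_scale[OF IH, of "-1"]] ta nu show ?thesis by simp
   next
    case 3
    from neg[of "- ta", OF _ _ IH nu] 3 ta show ?thesis by simp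
   qed
  qed
  let ?p' = "pexp ?p (t *R ?u)" and ?q' = "pexp ?q (t *R ?v)"
  have S': "?p' : S" "?q' : S" using pexp_line_in_S r' ut' vt' by auto
  obtain b where b: "b : atlas M" "pr ?p' : fst b" using ex_chart[OF S'(1)] by blast
  have U: "?p' : U b" "?q' : U b" using in_U[OF S'(1)] in_U[OF S'(2)] b eq[OF t] by auto
  have 1: "((%t. F b (pexp ?p (t *R ?u))) has_vector_derivative DF b ?p' (gvel ?p ?u t)) (at t)"
   by (rule has_vector_derivative_F_pexp[OF b(1) r'(1) ut' U(1)])
  have 2: "((%t. F b (pexp ?q (t *R ?v))) has_vector_derivative DF b ?q' (gvel ?q ?v t)) (at t)"
   by (rule has_vector_derivative_F_pexp[OF b(1) r'(2) vt' U(2)])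
  have "((%t. F b (pexp ?p (t *R ?u))) has_vector_derivative DF b ?q' (gvel ?q ?v t)) (at t)"
  proof (rule has_vector_derivative_transform_within_open[OF 2])
   show "open {-h<..<h}" "t : {-h<..<h}" using t by auto
   show "F b (pexp ?q (ta *R ?v)) = F b (pexp ?p (ta *R ?u))" if "ta : {-h<..<h}" for ta
    using eq[of ta] that by (simp add: abs_less_iff F_S pexp_line_in_S r' ut' vt')
  qed
  from vector_derivative_unique_at[OF 1 this]
  have DFeq: "DF b ?p' (gvel ?p ?u t) = DF b ?q' (gvel ?q ?v t)" .
  have "related ?p' (gvel ?p ?u t) ?q' (gvel ?q ?v t)"
   by (rule relatedI[OF S' gvel_hor[OF r'(1,3)] gvel_hor[OF r'(2,4)] eq[OF t] b(1) U(1) DFeq])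
  thus "related (pexp p ((s + t) *R u)) (gvel p u (s + t)) (pexp q ((s + t) *R v)) (gvel q v (s + t))"
   by (simp add: pexp_pexp[OF r(1) ut] pexp_pexp[OF r(2) vt] gvel_gvel[OF r(1) ut] gvel_gvel[OF r(2) vt])
 qed
qed

section \<open>Projected geodesics and the cut locus\<close>

lemma metric_has_derivative:
 assumes b: "b : atlas M" and z: "xi t : chart_image b"
  and d: "(xi has_vector_derivative xi') (at t)" "(al has_vector_derivative al') (at t)" "(be has_vector_derivative be') (at t)"
 shows "((%t. metric M b (xi t) (al t) (be t)) has_real_derivative
   FD (%z. metric M b z (al t) (be t)) (at (xi t)) xi' + metric M b (xi t) al' (be t) + metric M b (xi t) (al t) be') (at t)"
proof -
 define Ps where "Ps = (%x. metric M b (fst x) (fst (snd x)) (snd (snd x)))"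
 define A where "A = chart_image b \<times> (UNIV :: ('e \<times> 'e) set)"
 have oA: "open A" unfolding A_def by (intro open_Times open_chart_image[OF b] open_UNIV)
 have sm: "smooth_on A Ps"
  unfolding Ps_def by (rule smooth_on_metric[OF b oA]) (use oA in \<open>simp_all add: smooth_on_fst smooth_on_snd smooth_on_id\<close>, simp add: A_def)
 let ?x = "(xi t, al t, be t)"
 have xA: "?x : A" using z by (simp add: A_def)
 let ?D = "FD Ps (at ?x)"
 have dPs: "(Ps has_derivative ?D) (at ?x)" by (rule smooth_on_deriv[OF sm oA xA])
 have lin: "linear ?D" using dPs has_derivative_linear by blast
 have 1: "?D (xi', 0) = FD (%z. metric M b z (al t) (be t)) (at (xi t)) xi'"
  using fun_cong[OF frechet_derivative_at[OF FD_slice(1)[OF oA xA sm]]] by (simp add: Ps_def)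
 have "bounded_bilinear (metric M b (xi t))" using bilinear_metric[OF b z] bilinear_conv_bounded_bilinear by blast
 from bounded_bilinear.FDERIV[OF this, OF has_derivative_fst[OF has_derivative_ident] has_derivative_snd[OF has_derivative_ident], of "(al t, be t)" UNIV]
 have "((%w. Ps (xi t, w)) has_derivative (%h. metric M b (xi t) (al t) (snd h) + metric M b (xi t) (fst h) (be t))) (at (al t, be t))"
  by (simp add: Ps_def)
 from has_derivative_unique[OF FD_slice(2)[OF oA xA sm] this]
 have 2: "?D (0, (al', be')) = metric M b (xi t) (al t) be' + metric M b (xi t) al' (be t)" by (simp add: fun_eq_iff)
 have "((%t. (xi t, al t, be t)) has_derivative (%h. (h *R xi', h *R al', h *R be'))) (at t)"
  using d unfolding has_vector_derivative_def by (intro has_derivative_Pair)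
 from has_derivative_compose[OF this dPs]
 have "((%t. Ps (xi t, al t, be t)) has_derivative (%h. ?D (h *R (xi', al', be')))) (at t)" by simp
 hence "((%t. Ps (xi t, al t, be t)) has_real_derivative ?D (xi', al', be')) (at t)"
  unfolding real_deriv_iff by (simp only: linear_cmul[OF lin] real_scaleR_def mult.commute)
 moreover have "?D (xi', al', be') = ?D (xi', 0) + ?D (0, (al', be'))"
  using linear_add[OF lin, of "(xi', 0)" "(0, al', be')"] by simp
 ultimately show ?thesis unfolding 1 2 by (simp add: Ps_def algebra_simps)
qed

lemma christoffel_eqI:
 assumes b: "b : atlas M" and z: "z : chart_image b"
  and eq: "!!y. metric M b z x y = (FD (%z'. metric M b z' v y) (at z) u
  + FD (%z'. metric M b z' u y) (at z) v
  - FD (%z'. metric M b z' u v) (at z) y) / 2" shows "christoffel (metric M b) z u v = x" unfolding christoffel_def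
proof (rule the_equality)
 show "ALL y. metric M b z x y = (FD (%z'. metric M b z' v y) (at z) u
  + FD (%z'. metric M b z' u y) (at z) v
  - FD (%z'. metric M b z' u v) (at z) y) / 2" using eq by blast
 fix w assume "ALL y. metric M b z w y = (FD (%z'. metric M b z' v y) (at z) u
  + FD (%z'. metric M b z' u y) (at z) v
  - FD (%z'. metric M b z' u v) (at z) y) / 2"
 hence "metric M b z w y = metric M b z x y" for y using eq[of y] by (simp only:)
 thus "w = x" by (rule metric_eqI[OF b z])
qed

text \<open>Off the product, the coordinate expression of the projection is invariant under blockwise
 rescaling; rescaling a point to the product rescales vectors by the factors \<open>r j / norm (blk j q)\<close>.\<close>
lemma metric_DF_le:
 assumes b: "b : atlas M" and q: "q : U b" and ge: "!!j. j < k ==> r j <= norm (blk j q)"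
 shows "metric M b (F b q) (DF b q v) (DF b q v) <= (norm v)\<^sup>2"
proof -
 define La where "La = (%x::real ^ 'i. (\<chi> i. if B i < k then r (B i) / norm (blk (B i) q) * x $ i else x $ i))"
 have lin: "linear La" by (rule linearI) (auto simp: La_def vec_eq_iff algebra_simps add_divide_distrib)
 have qW: "q : W" using q by (simp add: U_def)
 have pos: "0 < r j / norm (blk j q)" if "j < k" for j using qW that r_pos[OF that] by (simp add: W_def)
 have bl: "blk j (La x) = (r j / norm (blk j q)) *R blk j x" if "j < k" for j x
  using that by (auto simp: La_def blk_def vec_eq_iff)
 have rl: "ret (La x) = ret x" for x
 proof -
  have "ret (La x) $ i = ret x $ i" for i
  proof (cases "B i < k")
   case True
   have "La x $ i = r (B i) / norm (blk (B i) q) * x $ i" using True by (simp add: La_def)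
   moreover have "norm (blk (B i) q) ~= 0" using pos[OF True] by auto
   ultimately show ?thesis using True r_pos[OF True] by (simp add: ret_def bl)
  qed (simp add: ret_def La_def)
  thus ?thesis by (simp add: vec_eq_iff)
 qed
 have Laq: "La q = ret q" by (simp add: La_def ret_def)
 have S: "ret q : S" by (rule ret_in_S[OF qW])
 have rU: "ret q : U b" using q S S_subset_W by (auto simp: U_def ret_id)
 have FLa: "F b (La x) = F b x" for x by (simp add: F_def rl)
 have "(La has_derivative La) (at q)" by (rule linear_imp_has_derivative[OF lin])
 moreover have "(F b has_derivative DF b (ret q)) (at (La q))" unfolding Laq by (rule has_derivative_F[OF b rU])
 ultimately have "((%x. F b (La x)) has_derivative (%v. DF b (ret q) (La v))) (at q)" by (rule has_derivative_compose)
 hence "(F b has_derivative (%v. DF b (ret q) (La v))) (at q)" unfolding FLa .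
 from has_derivative_unique[OF this has_derivative_F[OF b q]]
 have DFq: "DF b q v = DF b (ret q) (La v)" by (simp add: fun_eq_iff)
 have "F b q = F b (ret q)" using FLa[of q] Laq by simp
 hence "metric M b (F b q) (DF b q v) (DF b q v) = (norm (lam b (ret q) (DF b (ret q) (La v))))\<^sup>2"
  unfolding DFq using norm_lam[OF b S rU] by simp
 also have "\<dots> <= (norm (La v))\<^sup>2" using norm_lam_DF_le[OF b S rU] by (intro power_mono) auto
 also have "\<dots> <= (norm v)\<^sup>2"
 proof -
  have "(norm (blk j (La v)))\<^sup>2 <= (norm (blk j v))\<^sup>2" if j: "j < k" for j
  proof -
   have "r j / norm (blk j q) <= 1" using ge[OF j] r_pos[OF j] by (simp add: divide_le_eq_1)
   hence "norm (blk j (La v)) <= 1 * norm (blk j v)"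
    unfolding bl[OF j] norm_scaleR using pos[OF j] by (intro mult_right_mono) auto
   thus ?thesis by (intro power_mono) auto
  qed
  moreover have "free (La v) = free v" by (auto simp: free_def La_def vec_eq_iff)
  ultimately show ?thesis unfolding norm_split[of "La v"] norm_split[of v] by (intro add_mono sum_mono) auto
 qed
 finally show ?thesis .
qed

text \<open>The equation is tested against \<open>y\<close> with horizontal lift \<open>ta\<close>.
  The acceleration upstairs is normal to the product, so the inner product of the velocity with the
  fixed vector \<open>ta\<close> has derivative 0, which is \<open>E1\<close>. Along the line in
  direction \<open>ta\<close> the metric norm of the image of the velocity is largest at the point
  itself, by \<open>metric_DF_le\<close>, which is \<open>E2\<close>. Symmetry of the second
  derivatives of \<open>F b\<close> joins the two.\<close>

lemma geodesic_equation_pexp: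
 assumes b: "b : atlas M" and p: "p : S" and u: "u : hor p" and t0: "pr (pexp p (t0 *R u)) : fst b"
 shows "geodesic_equation_at (metric M b) J (snd b \<circ> (%t. pr (pexp p (t *R u)))) t0"
proof -
 have ut: "u : tan p" by (rule hor_tan[OF u])
 let ?q = "%t. pexp p (t *R u)" and ?v = "gvel p u"
 have qS: "?q t : S" for t by (rule pexp_line_in_S[OF p ut])
 define xi where "xi = (%t. F b (?q t))"
 define w where "w = (%t. DF b (?q t) (?v t))"
 define T where "T = {t. ?q t : U b}"
 have oT: "open T" using open_vimage[OF open_U[OF b] continuous_on_pexp_line] by (simp add: T_def vimage_def)
 have t0T: "t0 : T" using in_U[OF qS t0] by (simp add: T_def)
 let ?x = "pexp p (t0 *R u)" and ?V = "gvel p u t0"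
 have q0U: "?x : U b" using t0T by (simp add: T_def)
 have dxi: "(xi has_vector_derivative w t) (at t)" if "t : T" for t
  unfolding xi_def w_def by (rule has_vector_derivative_F_pexp[OF b p ut]) (use that in \<open>simp add: T_def\<close>)
 let ?z = "xi t0"
 have zc: "?z : chart_image b" unfolding xi_def by (rule F_in[OF q0U])
 have smDF: "smooth_on (U b \<times> UNIV) (%x. DF b (fst x) (snd x))"
  using open_U[OF b] by (intro smooth_on_DF[OF b] smooth_on_fst smooth_on_snd smooth_on_id open_Times open_UNIV) auto
 let ?v' = "(\<chi> i. if B i < k then - (freq u i)\<^sup>2 * pexp p (t0 *R u) $ i else 0) :: real ^ 'i"
 have dv: "(gvel p u has_vector_derivative ?v') (at t0)" by (rule has_vector_derivative_gvel)
 have dq: "((%t. pexp p (t *R u)) has_vector_derivative ?V) (at t0)" by (rule has_vector_derivative_pexp)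
 have "((%t. (?q t, ?v t)) has_derivative (%h. (h *R ?V, h *R ?v'))) (at t0)"
  using dq dv unfolding has_vector_derivative_def by (intro has_derivative_Pair)
 moreover have "((%x. DF b (fst x) (snd x)) has_derivative FD (%x. DF b (fst x) (snd x)) (at (?x, ?V))) (at (?x, ?V))"
  using q0U by (intro smooth_on_deriv[OF smDF] open_Times open_U[OF b] open_UNIV) auto
 ultimately have "((%t. DF b (fst (?q t, ?v t)) (snd (?q t, ?v t))) has_derivative
   (%h. FD (%x. DF b (fst x) (snd x)) (at (?x, ?V)) (h *R ?V, h *R ?v'))) (at t0)"
  by (rule has_derivative_compose[where f="%t. (?q t, ?v t)" and g="%x. DF b (fst x) (snd x)"])
 hence "w differentiable (at t0)" unfolding w_def fst_conv snd_conv differentiable_def by blast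
 then obtain W where W: "(w has_vector_derivative W) (at t0)" unfolding vector_derivative_works by blast
 have smq: "smooth_on (U b) (%q. DF b q x)" for x
  by (intro smooth_on_DF[OF b open_U[OF b]] smooth_on_id smooth_on_const open_U[OF b]) auto
 have key: "metric M b ?z (- W) y = (FD (%z'. metric M b z' (w t0) y) (at ?z) (w t0)
  + FD (%z'. metric M b z' (w t0) y) (at ?z) (w t0)
  - FD (%z'. metric M b z' (w t0) (w t0)) (at ?z) y) / 2" for y
 proof -
  define ta where "ta = lam b ?x y"
  have ta: "ta : tan ?x" "DF b ?x ta = y" unfolding ta_def using lam_in_tan[OF b qS q0U] DF_lam[OF b qS q0U] by auto
  let ?H = "FD (%q. DF b q ta) (at ?x) ?V"
  have "((%q. DF b q ta) has_derivative FD (%q. DF b q ta) (at ?x)) (at ?x)"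
   by (rule smooth_on_deriv[OF smq open_U[OF b] q0U])
  from has_derivative_compose[OF dq[unfolded has_vector_derivative_def] this]
  have dbe: "((%t. DF b (?q t) ta) has_vector_derivative ?H) (at t0)" unfolding has_vector_derivative_def
   using linear_cmul[OF has_derivative_linear[OF smooth_on_deriv[OF smq open_U[OF b] q0U]]] by simp
  have "((%t. metric M b (xi t) (w t) (DF b (?q t) ta)) has_real_derivative
    FD (%z. metric M b z (w t0) (DF b ?x ta)) (at ?z) (w t0) + metric M b ?z W (DF b ?x ta) + metric M b ?z (w t0) ?H) (at t0)"
   by (rule metric_has_derivative[OF b zc dxi[OF t0T] W dbe])
  hence "((%t. ?v t *. ta) has_real_derivative
    FD (%z. metric M b z (w t0) y) (at ?z) (w t0) + metric M b ?z W y + metric M b ?z (w t0) ?H) (at t0)" unfolding ta(2)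
  proof (rule has_field_derivative_transform_within_open[OF _ oT t0T])
   fix t assume "t : T"
   hence "?q t : U b" by (simp add: T_def)
   from hor_inner[OF b qS this gvel_hor[OF p u], of ta]
   show "metric M b (xi t) (w t) (DF b (?q t) ta) = ?v t *. ta" by (simp add: xi_def w_def)
  qed
  moreover have "((%t. ?v t *. ta) has_real_derivative ?v' *. ta) (at t0)"
   unfolding has_real_derivative_iff_has_vector_derivative
   by (rule bounded_linear.has_vector_derivative[OF bounded_linear_inner_left dv])
  moreover have "?v' *. ta = 0"
  proof -
   have "blk j ?v' *. blk j ta = 0" if j: "j < k" for j
   proof -
    have "blk j ?v' = (- (norm (blk j u) / r j)\<^sup>2) *R blk j ?x" using j by (auto simp: blk_def vec_eq_iff freq_def)
    thus ?thesis using tanD[OF ta(1) j] by (simp add: inner_commute)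
   qed
   moreover have "free ?v' = 0" by (auto simp: free_def vec_eq_iff)
   ultimately show ?thesis unfolding inner_split[of ?v'] by simp
  qed
  ultimately have E1: "FD (%z. metric M b z (w t0) y) (at ?z) (w t0) + metric M b ?z W y + metric M b ?z (w t0) ?H = 0"
   using DERIV_unique by simp
  define ph where "ph = (%s. metric M b (F b (?x + s *R ta)) (DF b (?x + s *R ta) ?V) (DF b (?x + s *R ta) ?V))"
  let ?H' = "FD (%q. DF b q ?V) (at ?x) ta"
  have l0: "?x + 0 *R ta = ?x" by simp
  have 1: "((%s. F b (?x + s *R ta)) has_vector_derivative DF b ?x ta) (at 0)"
   using deriv_along_line[of "F b" "DF b ?x" ?x 0 ta] has_derivative_F[OF b q0U] by simp
  have 2: "((%s. DF b (?x + s *R ta) ?V) has_vector_derivative ?H') (at 0)"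
   using deriv_along_line[of "%q. DF b q ?V" "FD (%q. DF b q ?V) (at ?x)" ?x 0 ta]
    smooth_on_deriv[OF smq open_U[OF b] q0U, of ?V] by simp
  have "F b (?x + 0 *R ta) : chart_image b" using zc by (simp add: xi_def)
  from metric_has_derivative[of b "%s. F b (?x + s *R ta)" 0, OF b this 1 2 2]
  have dph: "(ph has_real_derivative FD (%z. metric M b z (w t0) (w t0)) (at ?z) y + 2 * metric M b ?z (w t0) ?H') (at 0)"
   using metric_commute[OF b zc] by (simp add: ph_def[abs_def] xi_def w_def ta(2) algebra_simps)
  have "open {s. ?x + s *R ta : U b}"
  proof -
   have "continuous_on UNIV (%s. ?x + s *R ta)" by (intro continuous_intros)
   from open_vimage[OF open_U[OF b] this] show ?thesis by (simp add: vimage_def)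
  qed
  moreover have "0 : {s. ?x + s *R ta : U b}" using q0U by simp
  ultimately obtain e where e: "e > 0" "!!s. dist s 0 < e ==> ?x + s *R ta : U b" unfolding open_dist by blast
  have "ph s <= ph 0" if s: "\<bar>0 - s\<bar> < e" for s
  proof -
   have sU: "?x + s *R ta : U b" by (rule e(2)) (use s in \<open>simp add: dist_real_def\<close>)
   \<comment> \<open>A tangent line leaves each sphere outwards, by Pythagoras.\<close>
   have "r j <= norm (blk j (?x + s *R ta))" if j: "j < k" for j
   proof (rule power2_le_imp_le)
    have "(norm (blk j (?x + s *R ta)))\<^sup>2 = (norm (blk j ?x))\<^sup>2 + (s * norm (blk j ta))\<^sup>2"
     using tanD[OF ta(1) j]
     by (simp add: power2_norm_eq_inner blk_simps inner_add inner_commute power_mult_distrib) (simp add: power2_eq_square)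
    thus "(r j)\<^sup>2 <= (norm (blk j (?x + s *R ta)))\<^sup>2" using norm_blk[OF qS j] by simp
   qed simp
   from metric_DF_le[OF b sU this, of ?V] have "ph s <= (norm ?V)\<^sup>2" by (simp add: ph_def)
   also have "(norm ?V)\<^sup>2 = ph 0"
    using hor_inner[OF b qS q0U gvel_hor[OF p u], of ?V] by (simp add: ph_def power2_norm_eq_inner)
   finally show ?thesis .
  qed
  hence E2: "FD (%z. metric M b z (w t0) (w t0)) (at ?z) y + 2 * metric M b ?z (w t0) ?H' = 0"
   by (intro DERIV_local_max[OF dph e(1)]) auto
  have "?H = ?H'" unfolding DF_def by (rule FD_commute[OF open_U[OF b] q0U smooth_on_F[OF b]])
  thus ?thesis using E1 E2 by (simp add: metric_simps[OF b zc])
 qed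
 have chr: "christoffel (metric M b) ?z (w t0) (w t0) = - W" by (rule christoffel_eqI[OF b zc key])
 have sn: "snd b \<circ> (%t. pr (?q t)) = xi" unfolding xi_def by (rule snd_pi_pexp[OF p ut])
 show ?thesis unfolding geodesic_equation_at_def sn
 proof (intro exI[of _ w] conjI)
  have "eventually (%s. s : T) (nhds t0)" using oT t0T by (rule eventually_nhds_in_open)
  thus "\<forall>\<^sub>F s in nhds t0. s : J --> (xi has_vector_derivative w s) (at s within J)"
   by eventually_elim (use dxi has_vector_derivative_at_within in blast)
  show "(w has_vector_derivative - christoffel (metric M b) (xi t0) (w t0) (w t0)) (at t0 within J)"
   unfolding chr using has_vector_derivative_at_within[OF W] by simp
 qed
qed

lemma unit_speed_geodesic_ray_pexp:
 assumes p: "p : S" and u: "u : hor p" and n: "norm u = 1"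
 shows "unit_speed_geodesic_ray M (%t. pr (pexp p (t *R u)))" unfolding unit_speed_geodesic_ray_def
proof (intro conjI allI impI ballI)
 have ut: "u : tan p" by (rule hor_tan[OF u])
 show "continuous_map (top_of_set {0..}) (man_top M) (%t. pr (pexp p (t *R u)))" by (rule continuous_map_pexp[OF p ut])
 fix t :: real assume t: "0 <= t"
 have q: "pexp p (t *R u) : S" by (rule pexp_line_in_S[OF p ut])
 obtain b where b: "b : atlas M" "pr (pexp p (t *R u)) : fst b" using ex_chart[OF q] by blast
 have U: "pexp p (t *R u) : U b" by (rule in_U[OF q b(2)])
 have nb: "at t within {0..} ~= bot"
 proof -
  have "t islimpt {t..t + 1}" by (simp add: islimpt_Icc)
  hence "t islimpt {0..}" by (rule islimpt_subset) (use t in auto)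
  thus ?thesis by (simp add: trivial_limit_within)
 qed
 show "speed M {0..} (%t. pr (pexp p (t *R u))) t = 1"
  using speed_pexp[OF b(1) p ut _ U nb] t gvel_hor[OF p u, of t] norm_gvel[OF p ut] n unfolding hor_iff[OF b(1) q U] by simp
 show "geodesic_equation_at (metric M a) {0..} (snd a \<circ> (%t. pr (pexp p (t *R u)))) t"
  if "a : atlas M" "pr (pexp p (t *R u)) : fst a" for a by (rule geodesic_equation_pexp[OF that(1) p u that(2)])
qed

text \<open>The unit speed geodesic of \<open>u\<close> minimizes up to time \<open>norm u\<close>.
  Its end is not in the cut locus, so the last clause of the definition must fail: at some later
  time \<open>t\<close> the distance is still at least \<open>t\<close>, and \<open>1 + de\<close>
  is \<open>t\<close> in units of \<open>norm u\<close>.\<close>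

lemma minimizer_extends:
 assumes p: "p : S" and u: "u : tan p" "u ~= 0" and min: "norm u <= d (pr p) (pr (pexp p u))"
  and cut: "pr (pexp p u) \<notin> cut_locus M (pr p)"
 shows "EX de>0. (1 + de) * norm u <= d (pr p) (pr (pexp p ((1 + de) *R u)))"
proof -
 have uh: "u : hor p" by (rule minimizer_horizontal[OF p u(1) min])
 let ?T = "norm u"
 define e where "e = u /\<^sub>R ?T"
 have e: "e : hor p" "norm e = 1" unfolding e_def using u(2) hor_scale[OF p uh] by auto
 define ga where "ga = (%t. pr (pexp p (t *R e)))"
 have te: "t *R e = (t / ?T) *R u" for t by (simp add: e_def divide_inverse)
 have "unit_speed_geodesic_ray M ga" unfolding ga_def by (rule unit_speed_geodesic_ray_pexp[OF p e])
 moreover have "ga 0 = pr p" by (simp add: ga_def)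
 moreover have "ga ?T = pr (pexp p u)" using u(2) by (simp add: ga_def te)
 moreover have "d (pr p) (ga t) = t" if "t : {0..?T}" for t
  using d_along_minimizer(1)[OF p u(1) min, of "t / ?T"] that u(2) by (simp add: ga_def te)
 ultimately have ray: "unit_speed_geodesic_ray M ga" "ga 0 = pr p" "ga ?T = pr (pexp p u)" "ALL t:{0..?T}. d (pr p) (ga t) = t"
  by blast+
 have "\<not> (ALL t>?T. d (pr p) (ga t) < t)"
 proof
  assume "ALL t>?T. d (pr p) (ga t) < t"
  hence "unit_speed_geodesic_ray M ga & ga 0 = pr p & 0 < ?T & ga ?T = pr (pexp p u) &
   (ALL t:{0..?T}. d (pr p) (ga t) = t) & (ALL t>?T. d (pr p) (ga t) < t)" using ray u(2) by simp
  thus False using cut unfolding cut_locus_def mem_Collect_eq by blast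
 qed
 then obtain t where t: "t > ?T" "t <= d (pr p) (ga t)" by force
 have "1 + (t / ?T - 1) = t / ?T" by simp
 thus ?thesis using t u(2) by (intro exI[of _ "t / ?T - 1"]) (simp add: ga_def te)
qed

text \<open>The second minimizer followed by a prolongation of the first is again minimizing, so it
  has no corner and both arrive with the same velocity in the base. Upstairs their ends may be
  different points of one fibre; \<open>related_geodesics\<close>, run backwards, compares them at
  \<open>p\<close>.\<close>

theorem minimizer_unique:
 assumes p: "p : S" and u: "u : tan p" "norm u <= d (pr p) (pr (pexp p u))"
  and v: "v : tan p" "norm v <= d (pr p) (pr (pexp p v))" and eq: "pr (pexp p u) = pr (pexp p v)"
  and cut: "pr (pexp p u) \<notin> cut_locus M (pr p)"
 shows "u = v"
proof -
 have nuv: "norm u = norm v" using u v eq d_pexp_le[OF p u(1)] d_pexp_le[OF p v(1)] by simp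
 show ?thesis
 proof (cases "u = 0")
  case True
  thus ?thesis using nuv by simp
 next
  case False
  have uh: "u : hor p" and vh: "v : hor p" using minimizer_horizontal[OF p] u v by auto
  obtain de where de: "de > 0" "(1 + de) * norm u <= d (pr p) (pr (pexp p ((1 + de) *R u)))"
   using minimizer_extends[OF p u(1) False u(2) cut] by blast
  let ?q1 = "pexp p u" and ?w1 = "gvel p u 1" and ?q2 = "pexp p v" and ?w2 = "gvel p v 1"
  have q: "?q1 : S" "?q2 : S" using pexp_in_S[OF p] u v by auto
  obtain b where b: "b : atlas M" "pr ?q1 : fst b" using ex_chart[OF q(1)] by blast
  have U: "?q1 : U b" "?q2 : U b" using in_U q b eq by auto
  have w: "?w1 : hor ?q1" "?w2 : hor ?q2" using gvel_hor[OF p uh, of 1] gvel_hor[OF p vh, of 1] by auto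
  have nw: "norm ?w1 = norm u" "norm ?w2 = norm u" using norm_gvel[OF p u(1)] norm_gvel[OF p v(1)] nuv by auto
  have "DF b ?q2 ((- 1) *R ?w2) /\<^sub>R norm ((- 1) *R ?w2) = - (DF b ?q1 (de *R ?w1) /\<^sub>R norm (de *R ?w1))"
  proof (rule no_corner[OF b(1) q(2) U(2) q(1) U(1) eq[symmetric]])
   show "(- 1) *R ?w2 : tan ?q2" by (rule subspace_scale[OF subspace_tan hor_tan[OF w(2)]])
   show "de *R ?w1 : tan ?q1" by (rule subspace_scale[OF subspace_tan hor_tan[OF w(1)]])
   show "(- 1) *R ?w2 ~= 0" "de *R ?w1 ~= 0" using nw False de(1) by auto
   have "pexp ?q2 ((- 1) *R ?w2) = p" using pexp_pexp[OF p v(1), of 1 "- 1"] by simp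
   moreover have "pexp ?q1 (de *R ?w1) = pexp p ((1 + de) *R u)" using pexp_pexp[OF p u(1), of 1 de] by simp
   ultimately show "norm ((- 1) *R ?w2) + norm (de *R ?w1) <= d (pr (pexp ?q2 ((- 1) *R ?w2))) (pr (pexp ?q1 (de *R ?w1)))"
    using de nw by (simp add: algebra_simps)
  qed
  moreover have "norm ((- 1) *R ?w2) = norm u" "norm (de *R ?w1) = de * norm u" using nw de(1) by (auto simp only: norm_scaleR)
  ultimately have "(- 1) *R DF b ?q2 ?w2 /\<^sub>R norm u = - (de *R DF b ?q1 ?w1 /\<^sub>R (de * norm u))"
   unfolding linear_cmul[OF linear_DF[OF b(1) U(1)]] linear_cmul[OF linear_DF[OF b(1) U(2)]] by (simp only:)
  hence "DF b ?q2 ?w2 /\<^sub>R norm u = DF b ?q1 ?w1 /\<^sub>R norm u" using de(1) by simp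
  hence "DF b ?q1 ?w1 = DF b ?q2 ?w2" using False by (simp only: scaleR_cancel_left) auto
  hence "related ?q1 ?w1 ?q2 ?w2" by (rule relatedI[OF q w eq b(1) U(1)])
  from related_geodesics[OF this, of "- 1"] have "related p u p v"
   using pexp_pexp[OF p u(1), of 1 "- 1"] pexp_pexp[OF p v(1), of 1 "- 1"] gvel_gvel[OF p u(1), of 1 "- 1"] gvel_gvel[OF p v(1), of 1 "- 1"]
   by simp
  moreover obtain a where a: "a : atlas M" "pr p : fst a" using ex_chart[OF p] by blast
  ultimately have "DF a p u = DF a p v" using in_U[OF p] by (simp add: related_def)
  thus ?thesis using hor_eqI[OF a(1) p in_U[OF p a(2)] uh vh] by blast
 qed
qed

end

section \<open>Minimizers that extend have no conjugate points\<close>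

text \<open>Solve \<open>E xi' = E xi + s *R ka\<close> for small \<open>s\<close>: by
  linearization, \<open>L\<close> of \<open>(xi' - xi) / s\<close> approximates \<open>ka\<close>,
  and the range of \<open>L\<close> is closed, being a subspace. The solutions may be selected
  without any continuity.\<close>

lemma surj_derivative_if_Lipschitz_solvable:
 fixes E :: "'a::euclidean_space => 'b::euclidean_space"
 assumes D: "(E has_derivative L) (at xi)" and e: "0 < e"
  and sol: "!!z. norm (z - E xi) < e ==> EX xi'. norm (xi' - xi) <= K * norm (z - E xi) & E xi' = z"
 shows "surj L"
proof -
 have lin: "linear L" using D has_derivative_linear by blast
 have K: "0 <= K | (ALL v::'b. v = 0)"
 proof (rule disjCI)
  assume "\<not> (ALL v::'b. v = 0)"
  then obtain v :: 'b where v: "v ~= 0" by blast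
  obtain xi' where "norm (xi' - xi) <= K * norm (E xi + (e / 2 / norm v) *R v - E xi)"
   using sol[of "E xi + (e / 2 / norm v) *R v"] v e by auto
  moreover have "norm (E xi + (e / 2 / norm v) *R v - E xi) = e / 2" using v e by simp
  ultimately have "0 <= K * (e / 2)" using norm_ge_zero[of "xi' - xi"] by (simp only:)
  thus "0 <= K" using e by (simp add: zero_le_mult_iff)
 qed
 have "ka : range L" for ka
 proof (cases "ka = 0")
  case True
  thus ?thesis using linear_0[OF lin] by (metis rangeI)
 next
  case False
  hence K: "0 <= K" using K by blast
  have "ka : closure (range L)" unfolding closure_approachable
  proof (intro allI impI)
   fix ep :: real assume ep: "0 < ep"
   \<comment> \<open>The linearization error is then at most \<open>mu * K * s * norm ka\<close>,
     which is less than \<open>s * ep\<close>; the summand 1 keeps the denominator positive.\<close>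
   define mu where "mu = ep / (2 * (K + 1) * norm ka)"
   have mu: "0 < mu" using ep K False by (simp add: mu_def)
   obtain d where d: "0 < d" "!!y. norm (y - xi) < d ==> norm (E y - E xi - L (y - xi)) <= mu * norm (y - xi)"
    using D[unfolded has_derivative_at_alt] mu by blast
   define s where "s = min (e / 2) (d / (2 * (K + 1))) / norm ka"
   have s: "0 < s" using e d(1) K False by (simp add: s_def)
   have sn: "s * norm ka = min (e / 2) (d / (2 * (K + 1)))" using False by (simp add: s_def)
   hence se: "s * norm ka < e" "s * norm ka <= d / (2 * (K + 1))" using e by auto
   obtain xi' where x': "norm (xi' - xi) <= K * (s * norm ka)" "E xi' = E xi + s *R ka"
    using sol[of "E xi + s *R ka"] se s by auto
   have "K * (s * norm ka) <= K * (d / (2 * (K + 1)))" using se K by (intro mult_left_mono) auto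
   also have "\<dots> < d" using d(1) K add_nonneg_pos[of "K * d" "d * 2"] by (simp add: field_simps)
   finally have "norm (xi' - xi) < d" using x'(1) by simp
   from d(2)[OF this] have "norm (s *R ka - L (xi' - xi)) <= mu * norm (xi' - xi)" using x'(2) by simp
   also have "\<dots> <= mu * (K * (s * norm ka))" using x'(1) mu by (intro mult_left_mono) auto
   also have "mu * (K * (s * norm ka)) = s * (ep * (K / (2 * (K + 1))))" using False by (simp add: mu_def)
   also have "\<dots> < s * ep" using s ep K by (intro mult_strict_left_mono) (use K ep add_nonneg_pos[of "K * ep" "ep * 2"] in \<open>auto simp: field_simps\<close>)
   finally have "norm (s *R (ka - L ((1 / s) *R (xi' - xi)))) < s * ep"
    using s linear_cmul[OF lin, of "1 / s" "xi' - xi"] scaleR_diff_right[of s ka "(1 / s) *R L (xi' - xi)"] by (simp only:) simp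
   hence "norm (ka - L ((1 / s) *R (xi' - xi))) < ep" using s by simp
   thus "EX y:range L. dist y ka < ep" by (auto simp: dist_norm norm_minus_commute)
  qed
  thus ?thesis using closed_subspace[OF linear_subspace_image[OF lin subspace_UNIV]] by (simp add: closure_closed)
 qed
 thus ?thesis by blast
qed

context submersion_data
begin

text \<open>The triangle inequality through the end of the prolonged minimizer gives the lower bound
  \<open>(1 + de) * n - m\<close>, where \<open>m\<close> bounds the remaining distance;
  \<open>norm h <= norm u\<close> keeps it nonnegative, so that it may be squared.\<close>

lemma d_squared_lower_bound:
 assumes p: "p : S" and u: "u : tan p" and de: "0 < de"
  and ext: "(1 + de) * norm u <= d (pr p) (pr (pexp p ((1 + de) *R u)))" and un: "u ~= 0"
  and h: "h : tan (pexp p u)" "norm h <= norm u"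
 shows "(norm u)\<^sup>2 + 2 * (gvel p u 1 *. h) - (norm h)\<^sup>2 / de <= (d (pr p) (pr (pexp (pexp p u) h)))\<^sup>2"
proof -
 let ?q = "pexp p u" and ?w = "gvel p u 1"
 define n where "n = norm u"
 have q: "?q : S" by (rule pexp_in_S[OF p u])
 have n: "0 < n" using un by (simp add: n_def)
 have wn: "norm ?w = n" using norm_gvel[OF p u] by (simp add: n_def)
 have wt: "?w : tan ?q" using gvel_in_tan[OF p u, of 1] by simp
 have dwt: "de *R ?w : tan ?q" by (rule subspace_scale[OF subspace_tan wt])
 define m where "m = norm (de *R ?w - h)"
 have qh: "pexp ?q h : S" by (rule pexp_in_S[OF q h(1)])
 have qd: "pexp ?q (de *R ?w) : S" by (rule pexp_in_S[OF q dwt])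
 have e: "pexp ?q (de *R ?w) = pexp p ((1 + de) *R u)" using pexp_pexp[OF p u, of 1 de] by simp
 have "d (pr (pexp ?q h)) (pr (pexp ?q (de *R ?w))) <= m"
  using d_hinge[OF q h(1) dwt] by (simp add: m_def norm_minus_commute)
 moreover have "(1 + de) * n <= d (pr p) (pr (pexp ?q h)) + d (pr (pexp ?q h)) (pr (pexp ?q (de *R ?w)))"
  using ext d_triangle[OF pi_in[OF p] pi_in[OF qh] pi_in[OF qd]] unfolding e n_def by linarith
 ultimately have ge: "(1 + de) * n - m <= d (pr p) (pr (pexp ?q h))" by linarith
 have "m <= norm (de *R ?w) + norm h" unfolding m_def by (rule norm_triangle_ineq4)
 hence "0 <= (1 + de) * n - m" using de wn h(2) by (simp add: n_def algebra_simps)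
 hence sq: "((1 + de) * n - m)\<^sup>2 <= (d (pr p) (pr (pexp ?q h)))\<^sup>2" by (rule power_mono[OF ge])
 have m2: "m\<^sup>2 = de\<^sup>2 * n\<^sup>2 - 2 * de * (?w *. h) + (norm h)\<^sup>2"
  unfolding m_def power2_norm_eq_inner wn[symmetric]
  by (simp add: inner_diff inner_commute power2_eq_square[of de] algebra_simps)
 \<comment> \<open>At \<open>h = 0\<close> the value of \<open>m\<close> is \<open>de * n\<close>,
   so this square costs nothing to first order; its weight is chosen to replace the linear term in
   \<open>m\<close> by \<open>m^2 / de\<close>, which is quadratic in \<open>h\<close>.\<close>
 have "0 <= (m - de * n)\<^sup>2 / (de * n) * ((1 + de) * n)" using de n by (intro mult_nonneg_nonneg divide_nonneg_nonneg) auto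
 also have "(m - de * n)\<^sup>2 / (de * n) * ((1 + de) * n) = m\<^sup>2 / de + m\<^sup>2 - 2 * (1 + de) * n * m + (1 + de) * de * n\<^sup>2"
  using de n by (simp add: field_simps power2_eq_square)
 finally have "(1 + de) * n\<^sup>2 - m\<^sup>2 / de <= ((1 + de) * n - m)\<^sup>2"
  by (simp add: power2_eq_square algebra_simps)
 moreover have "(1 + de) * n\<^sup>2 - m\<^sup>2 / de = n\<^sup>2 + 2 * (?w *. h) - (norm h)\<^sup>2 / de"
  unfolding m2 using de by (simp add: field_simps power2_eq_square)
 ultimately show ?thesis using sq by (simp add: n_def)
qed

text \<open>The minimizer ending at \<open>pr q'\<close> with velocity \<open>w\<close> gives a supergradient of the squared distance,
 hence a subgradient of the convex function of \<open>d_convexity\<close>.\<close>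
lemma d_squared_subgradient:
 assumes q: "q : S" and b: "b : atlas M" and h: "h : tan q" "k' : tan q" and e: "pexp q h : U b"
  and q': "q' : S" "pr q' = pr (pexp q h)" and w: "w : tan q'" "norm w = d (pr (pexp q' (- w))) (pr q')"
  and dz: "((%t. F b (pexp q (h + t *R k'))) has_vector_derivative ka) (at 0)"
 defines "x \<equiv> pr (pexp q' (- w))"
 shows "(norm h)\<^sup>2 - (d x (pr (pexp q h)))\<^sup>2 + 2 * (h *. k') - 2 * metric M b (F b (pexp q h)) (DF b q' w) ka
  <= (norm (h + k'))\<^sup>2 - (d x (pr (pexp q (h + k'))))\<^sup>2"
proof -
 define Q where "Q = (%h. (norm h)\<^sup>2 - (d x (pr (pexp q h)))\<^sup>2)"
 define z where "z = (%t. F b (pexp q (h + t *R k')))"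
 have eS: "pexp q h : S" by (rule pexp_in_S[OF q h(1)])
 have q'U: "q' : U b" using U_fibre[OF q'(1) eS q'(2)] e by simp
 have mw: "- w : tan q'" by (rule subspace_neg[OF subspace_tan w(1)])
 have xt: "x : topspace (man_top M)" unfolding x_def by (rule pi_in[OF pexp_in_S[OF q'(1) mw]])
 have z0: "z 0 = F b q'" using q' eS by (simp add: z_def F_S)
 obtain Z et where "normal_coords b q' Z et" using normal_coordinates[OF b q'(1) q'U] by blast
 note Z = normal_coordsD[OF this]
 have linl: "linear (lam b q')" by (rule linear_lam[OF b q'(1) q'U])
 have bl: "bounded_linear (lam b q')" using linl linear_conv_bounded_linear by blast
 define l where "l = (%t. lam b q' (et (z t)))"
 have l0: "l 0 = 0" by (simp add: l_def z0 Z(5) linear_0[OF linl])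
 have dz': "(z has_derivative (%t. t *R ka)) (at 0)" using dz by (simp add: z_def has_vector_derivative_def)
 have "(et has_derivative (%v. v)) (at (z 0))" using Z(6) by (simp add: z0)
 from has_derivative_compose[OF dz' this] have "((%t. et (z t)) has_vector_derivative ka) (at 0)"
  by (simp add: has_vector_derivative_def)
 hence dl: "(l has_vector_derivative lam b q' ka) (at 0)"
  unfolding l_def by (rule bounded_linear.has_vector_derivative[OF bl])
 \<comment> \<open>By the hinge comparison at \<open>q'\<close> between \<open>- w\<close> and
   \<open>l t\<close>, \<open>ps t\<close> is a lower bound of \<open>Q (h + t *R k')\<close> near
   0, with equality at 0. Convexity bounds the increase of \<open>Q\<close> by
   \<open>t * (Q (h + k') - Q h)\<close>, so this bounds the derivative of \<open>ps\<close> at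
   0.\<close>
 define ps where "ps = (%t. (h + t *R k') *. (h + t *R k') - (w *. w + 2 * (w *. l t) + l t *. l t))"
 have dh: "((%t. h + t *R k') has_vector_derivative k') (at 0)" by (auto intro!: derivative_eq_intros)
 have inner_der: "((%t. f t *. g t) has_real_derivative f 0 *. g' + f' *. g 0) (at 0)"
  if "(f has_vector_derivative f') (at 0)" "(g has_vector_derivative g') (at 0)" for f g :: "real => real ^ 'i" and f' g'
  using bounded_bilinear.has_vector_derivative[OF bounded_bilinear_inner that]
  unfolding has_real_derivative_iff_has_vector_derivative .
 have "(ps has_real_derivative (((h + 0 *R k') *. k' + k' *. (h + 0 *R k')) -
   (0 + 2 * (w *. lam b q' ka + 0 *. l 0) + (l 0 *. lam b q' ka + lam b q' ka *. l 0)))) (at 0)"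
  unfolding ps_def by (intro DERIV_diff DERIV_add DERIV_cmult DERIV_const inner_der dh dl has_vector_derivative_const)
 moreover have "w *. lam b q' ka = metric M b (F b (pexp q h)) (DF b q' w) ka"
  using inner_lam[OF b q'(1) q'U, of ka w] metric_commute[OF b F_in[OF q'U]] z0 by (simp add: inner_commute z_def)
 ultimately have dps: "(ps has_real_derivative 2 * (h *. k') - 2 * metric M b (F b (pexp q h)) (DF b q' w) ka) (at 0)"
  by (simp add: l0 inner_commute)
 have ps0: "ps 0 = Q h" using w(2) q'(2) by (simp add: ps_def l0 Q_def x_def flip: power2_norm_eq_inner)
 have contz: "isCont z 0" using dz' has_derivative_continuous by blast
 have ev1: "eventually (%t. z t : Z) (at 0)" using topological_tendstoD[OF contz[unfolded isCont_def] Z(1)] Z(2) z0 by simp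
 have "isCont (%t. pexp q (h + t *R k')) 0"
 proof -
  have "smooth_on UNIV (%t::real. pexp q (h + t *R k'))"
   by (intro smooth_on_pexp_const smooth_on_add smooth_on_scaleR smooth_on_const smooth_on_id open_UNIV)
  from smooth_on_cont[OF this] show ?thesis by (simp add: continuous_on_eq_continuous_at)
 qed
 hence ev2: "eventually (%t. pexp q (h + t *R k') : U b) (at 0)"
  using topological_tendstoD[OF _ open_U[OF b]] e unfolding isCont_def by force
 have ht: "h + t *R k' : tan q" for t using subspace_add[OF subspace_tan h(1) subspace_scale[OF subspace_tan h(2)]] .
 have "eventually (%t. ps t <= Q (h + t *R k')) (at 0)" using ev1 ev2
 proof eventually_elim
  case (elim t)
  have "pexp q (h + t *R k') : S" by (rule pexp_in_S[OF q ht])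
  hence "chart_inv b (z t) = pr (pexp q (h + t *R k'))" unfolding z_def by (rule chart_inv_F[OF b _ elim(2)])
  hence eq: "pr (pexp q' (l t)) = pr (pexp q (h + t *R k'))" using Z(7)[OF elim(1)] by (simp add: l_def)
  have "l t : tan q'" unfolding l_def by (rule lam_in_tan[OF b q'(1) q'U])
  from d_hinge[OF q'(1) mw this] have le: "d x (pr (pexp q (h + t *R k'))) <= norm (- w - l t)" by (simp add: eq x_def)
  have "0 <= d x (pr (pexp q (h + t *R k')))" by (rule d_nonneg[OF xt pi_in[OF pexp_in_S[OF q ht]]])
  with le have "(d x (pr (pexp q (h + t *R k'))))\<^sup>2 <= (norm (- w - l t))\<^sup>2" by (rule power_mono)
  thus ?case by (simp add: Q_def ps_def power2_norm_eq_inner[of "h + t *R k'"] power2_norm_eq_inner[of "- w - l t"] inner_diff inner_commute)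
 qed
 hence evr: "eventually (%t. ps t <= Q (h + t *R k')) (at_right 0)" by (rule filter_leD[OF at_le, rotated]) simp
 have lim: "((%t. (ps t - ps 0) / (t - 0)) \<longlongrightarrow> 2 * (h *. k') - 2 * metric M b (F b (pexp q h)) (DF b q' w) ka) (at_right 0)"
  using dps unfolding has_field_derivative_iff by (rule tendsto_mono[OF at_le, rotated]) simp
 have "2 * (h *. k') - 2 * metric M b (F b (pexp q h)) (DF b q' w) ka <= Q (h + k') - Q h"
 proof (rule tendsto_upperbound[OF lim _ trivial_limit_at_right_real])
  have "eventually (%t::real. t : {0<..<1}) (at_right 0)" by (rule eventually_at_right_real) simp
  thus "eventually (%t. (ps t - ps 0) / (t - 0) <= Q (h + k') - Q h) (at_right 0)" using evr
  proof eventually_elim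
   case (elim t)
   have "Q ((1 - t) *R h + t *R (h + 1 *R k')) <= (1 - t) * Q h + t * Q (h + 1 *R k')"
    unfolding Q_def by (rule d_convexity[OF q xt h(1) ht]) (use elim in auto)
   moreover have "(1 - t) *R h + t *R (h + 1 *R k') = h + t *R k'" by (simp add: algebra_simps)
   ultimately have "ps t - ps 0 <= t * (Q (h + k') - Q h)" using elim(2) by (simp add: ps0 algebra_simps)
   thus ?case using elim(1) by (simp add: pos_divide_le_eq mult.commute)
  qed
 qed
 thus ?thesis by (simp add: Q_def)
qed

text \<open>Seen from the end point \<open>q\<close>, the squared distance to \<open>pr p\<close> is
  squeezed between quadratics with the same linear part: above by the hinge comparison, below by the
  prolonged minimizer. With convexity this controls the subgradients, hence by
  \<open>d_squared_subgradient\<close> the arrival velocities of all minimizers ending nearby.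
  Running geodesics back from their arrival data is a smooth map \<open>Y\<close>, which transfers
  the estimate to the initial velocities.\<close>

lemma minimizer_Lipschitz:
 assumes p: "p : S" and u: "u : tan p" "u ~= 0" and min: "norm u <= d (pr p) (pr (pexp p u))"
  and cut: "pr (pexp p u) \<notin> cut_locus M (pr p)"
  and a: "a : atlas M" "p : U a" and b: "b : atlas M" and qU: "pexp p u : U b"
 obtains K e where "0 < e" "!!z. norm (z - F b (pexp p u)) < e ==>
  EX xi. norm (xi - DF a p u) <= K * norm (z - F b (pexp p u)) & F b (pexp p (lam a p xi)) = z"
proof -
 obtain de where de: "de > 0" "(1 + de) * norm u <= d (pr p) (pr (pexp p ((1 + de) *R u)))"
  using minimizer_extends[OF p u min cut] by blast
 have uh: "u : hor p" by (rule minimizer_horizontal[OF p u(1) min])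
 define q where "q = pexp p u"
 define w where "w = gvel p u 1"
 define y where "y = F b q"
 have q: "q : S" unfolding q_def by (rule pexp_in_S[OF p u(1)])
 have qU: "q : U b" using qU by (simp add: q_def)
 have wh: "w : hor q" unfolding w_def q_def using gvel_hor[OF p uh, of 1] by simp
 have wt: "w : tan q" by (rule hor_tan[OF wh])
 have wn: "norm w = norm u" unfolding w_def by (rule norm_gvel[OF p u(1)])
 have qp: "pexp q (- w) = p" using pexp_pexp[OF p u(1), of 1 "- 1"] by (simp add: q_def w_def)
 have gp: "gvel q w (- 1) = u" using gvel_gvel[OF p u(1), of 1 "- 1"] by (simp add: q_def w_def)
 have linl: "linear (lam b q)" by (rule linear_lam[OF b q qU])
 have bl: "bounded_linear (lam b q)" using linl linear_conv_bounded_linear by blast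
 note lt = lam_in_tan[OF b q qU]
 obtain Z et where "normal_coords b q Z et" using normal_coordinates[OF b q qU] by blast
 note Z = normal_coordsD[OF this]
 define ex where "ex = (%ze. pexp q (lam b q ze))"
 define f where "f = (%ze. F b (ex ze))"
 define Z0 where "Z0 = ex -` U b"
 have smex: "smooth_on A ex" if "open A" for A
  unfolding ex_def using that by (intro smooth_on_pexp_const smooth_on_lam_const[OF b q qU] smooth_on_id)
 have oZ0: "open Z0" and smf: "smooth_on Z0 f"
  using smooth_on_exp_coordinates[OF b q qU b] by (simp_all add: Z0_def f_def[abs_def] ex_def vimage_def)
 have ex0: "ex 0 = q" by (simp add: ex_def linear_0[OF linl])
 have Z00: "0 : Z0" by (simp add: Z0_def ex0 qU)
 define Df where "Df = (%ze. FD f (at ze))"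
 have df: "(f has_derivative Df ze) (at ze)" if "ze : Z0" for ze unfolding Df_def by (rule smooth_on_deriv[OF smf oZ0 that])
 have linD: "linear (Df ze)" if "ze : Z0" for ze using df[OF that] has_derivative_linear by blast
 have Df0: "Df 0 ka = ka" for ka using exp_coordinates_0(2)[OF b q qU] by (simp add: Df_def f_def[abs_def] ex_def)
 have "inj (FD f (at 0))" using Df0 by (simp add: inj_def Df_def)
 then obtain U0 V0 g0 where U0: "open U0" "U0 \<subseteq> Z0" "0 : U0" "!!x. x : U0 ==> bij (FD f (at x))"
  by (rule smooth_inverse_function[OF oZ0 Z00 smf]) (rule that)
 \<comment> \<open>The velocity \<open>om\<close> at \<open>f ze\<close> lowered by the metric and
   pulled back to the coordinates \<open>ze\<close>. In this form velocities at different points can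
   be compared; it is the momentum estimated below.\<close>
 define A where "A = (%ze om. \<Sum>e\<in>Basis. metric M b (f ze) om (Df ze e) *R e)"
 have fin: "f ze : chart_image b" if "ze : U0" for ze using that U0(2) F_in[of "ex ze" b] by (auto simp: f_def Z0_def)
 have Ainner: "A ze om *. ka = metric M b (f ze) om (Df ze ka)" if z: "ze : U0" for ze om ka
 proof -
  have "linear (%ka. metric M b (f ze) om (Df ze ka))"
   using linD[of ze] z U0(2) by (intro linearI) (auto simp: linear_add linear_cmul metric_simps[OF b fin[OF z]])
  from linear_basis_expansion[OF this, of ka] show ?thesis
   by (simp add: A_def inner_sum_left inner_sum_right mult.commute inner_commute[of _ ka])
 qed
 have linA: "linear (A ze)" if z: "ze : U0" for ze
  by (rule linearI) (simp_all add: A_def metric_simps[OF b fin[OF z]] scaleR_left_distrib sum.distrib scaleR_sum_right)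
 have bijA: "bij (A ze)" if z: "ze : U0" for ze
 proof -
  have "om = 0" if "A ze om = 0" for om
  proof -
   obtain ka where "om = Df ze ka" using U0(4)[OF z] unfolding bij_def surj_def Df_def by blast
   hence "metric M b (f ze) om om = 0" using Ainner[OF z, of om ka] that by simp
   thus ?thesis using metric_pos[OF b fin[OF z], of om] by force
  qed
  hence "inj (A ze)" using linear_injective_0[OF linA[OF z]] by blast
  thus ?thesis using linear_injective_imp_surjective[OF linA[OF z]] by (simp add: bij_def)
 qed
 define G where "G = (%x. inv (A (fst x)) (snd x))"
 have oU: "open (U0 \<times> (UNIV :: 'e set))" using U0(1) by (intro open_Times open_UNIV)
 have smG: "smooth_on (U0 \<times> UNIV) G" unfolding G_def
 proof (rule smooth_on_inverse_family)
  show "smooth_on (U0 \<times> UNIV) (%x :: 'e \<times> 'e. A (fst x) v)" for v unfolding A_def Df_def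
  proof (intro smooth_on_sum smooth_on_scaleR smooth_on_const smooth_on_metric[OF b] oU)
   have fst: "smooth_on (U0 \<times> UNIV) (fst :: 'e \<times> 'e => 'e)" by (intro smooth_on_fst smooth_on_id oU)
   have sub: "fst ` (U0 \<times> (UNIV :: 'e set)) \<subseteq> Z0" using U0(2) by auto
   show "smooth_on (U0 \<times> UNIV) (%x :: 'e \<times> 'e. f (fst x))" by (rule smooth_on_compose[OF oU oZ0 sub fst smf])
   show "(%x. f (fst x)) ` (U0 \<times> (UNIV :: 'e set)) \<subseteq> chart_image b" using fin by auto
   show "smooth_on (U0 \<times> UNIV) (%x :: 'e \<times> 'e. FD f (at (fst x)) i)" for i
    by (rule smooth_on_compose[OF oU oZ0 sub fst smooth_on_FD[OF smf]])
  qed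
  show "smooth_on (U0 \<times> UNIV) (snd :: 'e \<times> 'e => 'e)" by (intro smooth_on_snd smooth_on_id oU)
 qed (use linA bijA oU in auto)
 have GA: "G (ze, A ze om) = om" if "ze : U0" for ze om using bijA[OF that] by (simp add: G_def bij_def)
 \<comment> \<open>From an arrival point \<open>fst x\<close> and a momentum \<open>snd x\<close>:
   \<open>V\<close> is the reversed arrival velocity, \<open>pb\<close> the starting point, and
   \<open>Y\<close> the initial velocity in the chart \<open>a\<close>.\<close>
 define V where "V = (%x. - lam b (ex (fst x)) (G x))"
 define pb where "pb = (%x. pexp (ex (fst x)) (V x))"
 define N where "N = {x : U0 \<times> UNIV. pb x : U a}"
 define Y where "Y = (%x. - DF a (pb x) (pvel (ex (fst x)) (V x)))"
 have smexf: "smooth_on (U0 \<times> UNIV) (%x :: 'e \<times> 'e. ex (fst x))"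
  by (rule smooth_on_compose[OF oU open_UNIV _ smooth_on_fst[OF oU smooth_on_id[OF oU]] smex[OF open_UNIV]]) simp
 have smV: "smooth_on (U0 \<times> UNIV) V"
  unfolding V_def using U0(2) by (intro smooth_on_minus smooth_on_lam[OF b] oU smexf smG) (auto simp: Z0_def)
 have smpb: "smooth_on (U0 \<times> UNIV) pb" unfolding pb_def by (intro smooth_on_pexp oU smexf smV)
 have oN: "open N"
 proof -
  have "open ((U0 \<times> UNIV) \<inter> pb -` U a)"
   by (rule continuous_open_preimage[OF smooth_on_cont[OF smpb] oU open_U[OF a(1)]])
  moreover have "N = (U0 \<times> UNIV) \<inter> pb -` U a" unfolding N_def by blast
  ultimately show ?thesis by (simp only:)
 qed
 have NU: "N \<subseteq> U0 \<times> UNIV" by (auto simp: N_def)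
 have smY: "smooth_on N Y" unfolding Y_def
  by (intro smooth_on_minus smooth_on_DF[OF a(1)] smooth_on_pvel oN smooth_on_subset[OF smpb NU] smooth_on_subset[OF smexf NU] smooth_on_subset[OF smV NU])
   (auto simp: N_def)
 have bk: "pb (ze, A ze (DF b e w')) = pexp e (- w') & Y (ze, A ze (DF b e w')) = DF a (pexp e (- w')) (gvel e w' (- 1))"
  if z: "ze : U0" and e: "e = ex ze" "w' : hor e" and bk: "pexp e (- w') : U a" for ze e w'
 proof -
  have eU: "e : U b" using z U0(2) e(1) by (auto simp: Z0_def)
  have eS: "e : S" unfolding e(1) ex_def by (rule pexp_in_S[OF q lt])
  have "lam b e (DF b e w') = w'" using hor_iff[OF b eS eU] e(2) by simp
  hence V: "V (ze, A ze (DF b e w')) = - w'" using GA[OF z] e(1) by (simp add: V_def)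
  have "pvel e (- w') = - gvel e w' (- 1)" using gvel_scale[of e "- 1" w' 1] by (simp add: pvel_eq_gvel)
  thus ?thesis using V e(1) linear_neg[OF linear_DF[OF a(1) bk]] by (simp add: Y_def pb_def)
 qed
 define ga where "ga = A 0 (DF b q w)"
 have b0: "pb (0, ga) = p" "Y (0, ga) = DF a p u" using bk[OF U0(3) ex0[symmetric] wh] qp gp a(2) by (auto simp: ga_def)
 have x0N: "(0, ga) : N" using U0(3) b0(1) a(2) by (simp add: N_def)
 obtain K1 e1 where K1: "0 < K1" "0 < e1" "!!x. norm (x - (0, ga)) < e1 ==> norm (Y x - Y (0, ga)) <= K1 * norm (x - (0, ga))"
  by (rule has_derivative_imp_Lipschitz_at[OF smooth_on_deriv[OF smY oN x0N]]) (rule that)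
 obtain K2 e2 where K2: "0 < K2" "0 < e2" "!!z. norm (z - y) < e2 ==> norm (et z - et y) <= K2 * norm (z - y)"
  by (rule has_derivative_imp_Lipschitz_at[OF Z(6)[folded y_def]]) (rule that)
 obtain C where C: "0 < C" "!!v. norm (lam b q v) <= norm v * C" using bounded_linear.pos_bounded[OF bl] by blast
 obtain e3 where e3: "0 < e3" "ball y e3 \<subseteq> Z" using Z(1,2) open_contains_ball unfolding y_def by blast
 obtain e4 where e4: "0 < e4" "ball 0 e4 \<subseteq> U0" using U0(1,3) open_contains_ball by blast
 define cA where "cA = 1 + 1 / de"
 have cA: "0 < cA" using de(1) by (simp add: cA_def add_pos_pos)
 define K3 where "K3 = 1 + (2 * cA + 1) * C * (\<Sum>e\<in>(Basis :: 'e set). norm (lam b q e))"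
 have K3: "1 <= K3" using cA C(1) by (simp add: K3_def sum_nonneg)
 text \<open>The key estimate: in the coordinates \<open>ze\<close>, the momentum with which a minimizer from \<open>pr p\<close> arrives at
  \<open>f ze\<close> differs from the momentum \<open>ga\<close> of the given one by \<open>O(norm ze)\<close>.\<close>
 have momentum: "norm (A ze (DF b q' w') - ga) <= (K3 - 1) * norm ze"
  if z: "ze : U0" "ze ~= 0" "2 * (C * norm ze) <= norm u" and q': "q' : S" "pr q' = pr (ex ze)" "w' : tan q'" "pexp q' (- w') = p" "norm w' = d (pr p) (pr q')"
  for ze q' w'
 proof -
  define h where "h = lam b q ze"
  have ht: "h : tan q" unfolding h_def by (rule lt)
  have eU: "pexp q h : U b" using z(1) U0(2) by (auto simp: Z0_def ex_def h_def)
  have h0: "0 < norm h" using DF_lam[OF b q qU, of ze] z(2) linear_0[OF linear_DF[OF b qU]] by (auto simp: h_def)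
  have hC: "norm h <= norm ze * C" unfolding h_def by (rule C(2))
  hence hu: "2 * norm h <= norm u" using z(3) by (simp add: mult.commute)
  define D where "D = (%h. d (pr p) (pr (pexp q h)))"
  \<comment> \<open>The test vector has the length of \<open>h\<close>: the subgradient inequality
    leads from \<open>h\<close> to \<open>h + ?k\<close>, the upper bound of the squared distance is
    used at \<open>h\<close> and the lower one at \<open>h + ?k\<close>, and all errors are
    multiples of \<open>norm h\<close> squared. Rescaling in \<open>two\<close> divides by one
    factor \<open>norm h\<close>.\<close>
  have one: "w *. lam b q ka - A ze (DF b q' w') *. ka <= (2 * cA + 1) * (norm h)\<^sup>2" if kn: "norm (lam b q ka) = norm h" for ka
  proof -
   let ?k = "lam b q ka"
   have hk: "h + t *R ?k = lam b q (ze + t *R ka)" for t by (simp add: h_def linear_add[OF linl] linear_cmul[OF linl])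
   have "((%t. F b (pexp q (h + t *R ?k))) has_vector_derivative Df ze ka) (at 0)"
    unfolding hk using deriv_along_line[of f "Df ze" ze 0 ka] df z(1) U0(2) by (auto simp: f_def ex_def)
   from d_squared_subgradient[OF q b ht lt eU q'(1) _ q'(3) _ this]
   have s: "(norm h)\<^sup>2 - (D h)\<^sup>2 + 2 * (h *. ?k) - 2 * metric M b (F b (pexp q h)) (DF b q' w') (Df ze ka)
    <= (norm (h + ?k))\<^sup>2 - (D (h + ?k))\<^sup>2" using q' by (simp add: h_def ex_def D_def)
   have m: "metric M b (F b (pexp q h)) (DF b q' w') (Df ze ka) = A ze (DF b q' w') *. ka"
    unfolding Ainner[OF z(1)] by (simp add: f_def ex_def h_def)
   have nhk: "norm (h + ?k) <= 2 * norm h" using norm_triangle_ineq[of h ?k] kn by simp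
   have hkt: "h + ?k : tan q" by (rule subspace_add[OF subspace_tan ht lt])
   have "norm (h + ?k) <= norm u" using nhk hu by simp
   from d_squared_lower_bound[OF p u(1) de u(2) hkt[unfolded q_def] this[unfolded q_def]]
   have l: "(norm u)\<^sup>2 + 2 * (w *. (h + ?k)) - (norm (h + ?k))\<^sup>2 / de <= (D (h + ?k))\<^sup>2"
    by (simp add: q_def w_def D_def)
   have "D h <= norm (- w - h)" using d_hinge[OF q subspace_neg[OF subspace_tan wt] ht] by (simp add: D_def qp)
   moreover have "0 <= D h" unfolding D_def by (rule d_nonneg[OF pi_in[OF p] pi_in[OF pexp_in_S[OF q ht]]])
   ultimately have "(D h)\<^sup>2 <= (norm (- w - h))\<^sup>2" by (intro power_mono)
   also have "\<dots> = (norm u)\<^sup>2 + 2 * (w *. h) + (norm h)\<^sup>2"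
    unfolding wn[symmetric] power2_norm_eq_inner by (simp add: inner_diff inner_commute)
   finally have hi: "(D h)\<^sup>2 <= (norm u)\<^sup>2 + 2 * (w *. h) + (norm h)\<^sup>2" .
   have "- (h *. ?k) <= norm h * norm ?k" using Cauchy_Schwarz_ineq2[of h ?k] by linarith
   hence cs: "- (h *. ?k) <= (norm h)\<^sup>2" using kn by (simp add: power2_eq_square)
   have "(norm (h + ?k))\<^sup>2 <= (2 * norm h)\<^sup>2" using nhk by (intro power_mono) auto
   hence "cA * (norm (h + ?k))\<^sup>2 <= cA * (4 * (norm h)\<^sup>2)" using cA by (intro mult_left_mono) (auto simp: power_mult_distrib)
   hence n4: "(norm (h + ?k))\<^sup>2 + (norm (h + ?k))\<^sup>2 / de <= 4 * (cA * (norm h)\<^sup>2)" by (simp add: cA_def algebra_simps)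
   have "2 * (w *. ?k) - 2 * (A ze (DF b q' w') *. ka) <= 4 * (cA * (norm h)\<^sup>2) + 2 * (norm h)\<^sup>2"
    using s l hi cs n4 unfolding m by (simp add: inner_add_right)
   thus ?thesis by (simp add: algebra_simps)
  qed
  have two: "w *. lam b q ka - A ze (DF b q' w') *. ka <= (2 * cA + 1) * norm h * norm (lam b q ka)" if k0: "ka ~= 0" for ka
  proof -
   have kp: "0 < norm (lam b q ka)" using DF_lam[OF b q qU, of ka] k0 linear_0[OF linear_DF[OF b qU]] by auto
   define s where "s = norm h / norm (lam b q ka)"
   have s: "0 < s" using h0 kp by (simp add: s_def)
   have "norm (lam b q (s *R ka)) = norm h" using s kp by (simp add: linear_cmul[OF linl]) (simp add: s_def)
   from one[OF this] have "s * (w *. lam b q ka - A ze (DF b q' w') *. ka) <= (2 * cA + 1) * (norm h)\<^sup>2"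
    by (simp add: linear_cmul[OF linl] algebra_simps)
   also have "\<dots> = s * ((2 * cA + 1) * norm h * norm (lam b q ka))" using kp by (simp add: s_def power2_eq_square)
   finally show ?thesis using s by simp
  qed
  have gai: "ga *. ka = w *. lam b q ka" for ka
   using inner_lam[OF b q qU, of ka w] metric_commute[OF b F_in[OF qU], of ka] Ainner[OF U0(3), of "DF b q w" ka]
   by (simp add: ga_def Df0 f_def ex0 inner_commute[of w])
  have comp: "\<bar>(A ze (DF b q' w') - ga) *. e\<bar> <= (2 * cA + 1) * norm h * norm (lam b q e)" if "e : Basis" for e
  proof -
   have "e ~= 0" "- e ~= 0" using that by auto
   from two[OF this(1)] two[OF this(2)] show ?thesis by (simp add: gai inner_diff_left linear_neg[OF linl])
  qed
  have "norm (A ze (DF b q' w') - ga) <= (\<Sum>e\<in>Basis. \<bar>(A ze (DF b q' w') - ga) *. e\<bar>)" by (rule norm_le_l1)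
  also have "\<dots> <= (\<Sum>e\<in>Basis. (2 * cA + 1) * norm h * norm (lam b q e))" using comp by (rule sum_mono)
  also have "\<dots> = (2 * cA + 1) * (\<Sum>e\<in>Basis. norm (lam b q e)) * norm h" by (simp add: sum_distrib_left sum_distrib_right algebra_simps)
  also have "\<dots> <= (2 * cA + 1) * (\<Sum>e\<in>Basis. norm (lam b q e)) * (norm ze * C)"
   using hC cA by (intro mult_left_mono) (auto simp: sum_nonneg)
  finally show ?thesis by (simp add: K3_def algebra_simps)
 qed
 \<comment> \<open>In order: the Lipschitz range of \<open>et\<close>, the ball inside
   \<open>Z\<close>, \<open>ze\<close> inside \<open>U0\<close>, the smallness required by
   \<open>momentum\<close>, and the Lipschitz range of \<open>Y\<close>.\<close>
 define e5 where "e5 = min (min e2 e3) (min (e4 / K2) (min (norm u / (2 * C * K2)) (e1 / (K3 * K2))))"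
 show ?thesis
 proof (rule that[of e5 "K1 * (K3 * K2)"])
  show "0 < e5" using K1 K2 e3 e4 C K3 u(2) by (simp add: e5_def)
  fix z assume "norm (z - F b (pexp p u)) < e5"
  hence zn: "norm (z - y) < e5" by (simp add: y_def q_def)
  define ze where "ze = et z"
  have zZ: "z : Z" using zn e3(2) by (auto simp: e5_def dist_norm norm_minus_commute)
  have zen: "norm ze <= K2 * norm (z - y)" using K2(3)[of z] zn Z(5) by (simp add: ze_def e5_def y_def)
  have z4: "K2 * norm (z - y) < e4" "2 * (C * (K2 * norm (z - y))) < norm u" "K3 * (K2 * norm (z - y)) < e1"
   using zn K2(1) C(1) K3 by (simp_all add: e5_def pos_less_divide_eq mult_ac)
  have zU: "ze : U0" using zen z4(1) e4(2) by (auto simp: dist_norm)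
  have fz: "f ze = z" "ex ze : S" "pr (ex ze) = chart_inv b z" "ex ze : U b" using Z(7)[OF zZ] by (auto simp: f_def ex_def ze_def)
  show "EX xi. norm (xi - DF a p u) <= K1 * (K3 * K2) * norm (z - F b (pexp p u)) & F b (pexp p (lam a p xi)) = z"
  proof (cases "ze = 0")
   case True
   hence "z = y" using fz(1) by (simp add: f_def ex0 y_def)
   moreover have "lam a p (DF a p u) = u" using hor_iff[OF a(1) p a(2)] uh by simp
   ultimately show ?thesis by (intro exI[of _ "DF a p u"]) (simp add: y_def q_def)
  next
   case False
   obtain u0 where u0: "u0 : tan p" "pr (pexp p u0) = pr (ex ze)" "norm u0 = d (pr p) (pr (ex ze))"
    using minimizer_exists[OF p pi_in[OF fz(2)]] by blast
   define q' where "q' = pexp p u0"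
   define w' where "w' = gvel p u0 1"
   have u0h: "u0 : hor p" by (rule minimizer_horizontal[OF p u0(1)]) (use u0 in simp)
   have q': "q' : S" "pr q' = pr (ex ze)" unfolding q'_def using pexp_in_S[OF p u0(1)] u0 by auto
   have w'h: "w' : hor q'" using gvel_hor[OF p u0h, of 1] by (simp add: w'_def q'_def)
   have q'p: "pexp q' (- w') = p" using pexp_pexp[OF p u0(1), of 1 "- 1"] by (simp add: q'_def w'_def)
   have q'u: "gvel q' w' (- 1) = u0" using gvel_gvel[OF p u0(1), of 1 "- 1"] by (simp add: q'_def w'_def)
   have w'n: "norm w' = d (pr p) (pr q')" using norm_gvel[OF p u0(1), of 1] u0 q' by (simp add: w'_def)
   have q'U: "q' : U b" using U_fibre[OF q'(1) fz(2) q'(2)] fz(4) by simp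
   have small: "2 * (C * norm ze) <= norm u"
   proof -
    have "2 * (C * norm ze) <= 2 * (C * (K2 * norm (z - y)))" using zen C(1) by simp
    thus ?thesis using z4(2) by simp
   qed
   have mom: "norm (A ze (DF b q' w') - ga) <= (K3 - 1) * norm ze"
    by (rule momentum[OF zU False small q' hor_tan[OF w'h] q'p w'n])
   have "norm ((ze, A ze (DF b q' w')) - (0, ga)) <= norm ze + norm (A ze (DF b q' w') - ga)"
    using norm_Pair_le[of ze "A ze (DF b q' w') - ga"] by simp
   also have "\<dots> <= K3 * norm ze" using mom by (simp add: algebra_simps)
   also have "\<dots> <= K3 * (K2 * norm (z - y))" using zen K3 by (intro mult_left_mono) auto
   finally have n1: "norm ((ze, A ze (DF b q' w')) - (0, ga)) <= K3 * (K2 * norm (z - y))" .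
   hence "norm (Y (ze, A ze (DF b q' w')) - Y (0, ga)) <= K1 * norm ((ze, A ze (DF b q' w')) - (0, ga))"
    using z4(3) by (intro K1(3)) simp
   also have "\<dots> <= K1 * (K3 * (K2 * norm (z - y)))" using n1 K1(1) by (intro mult_left_mono) auto
   finally have n2: "norm (Y (ze, A ze (DF b q' w')) - DF a p u) <= K1 * (K3 * K2) * norm (z - y)" by (simp add: b0 mult.assoc)
   \<comment> \<open>The minimizer ends at \<open>q'\<close>, while the coordinates refer to
     \<open>ex ze\<close>, another point of the same fibre. Its velocity is lifted there, and
     \<open>related_geodesics\<close> shows that running back yields the same initial velocity in
     the base.\<close>
   define w2 where "w2 = lam b (ex ze) (DF b q' w')"
   have w2: "w2 : hor (ex ze)" "DF b (ex ze) w2 = DF b q' w'"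
    unfolding w2_def using lam_in_hor[OF b fz(2,4)] DF_lam[OF b fz(2,4)] by auto
   have "related (ex ze) w2 q' w'" by (rule relatedI[OF fz(2) q'(1) w2(1) w'h q'(2)[symmetric] b fz(4) w2(2)])
   from related_geodesics[OF this, of "- 1"]
   have rel: "related (pexp (ex ze) (- w2)) (gvel (ex ze) w2 (- 1)) p u0" using q'p q'u by simp
   hence "pexp (ex ze) (- w2) : U a" using U_fibre[of _ p a] a(2) by (auto simp: related_def)
   with rel have "DF a (pexp (ex ze) (- w2)) (gvel (ex ze) w2 (- 1)) = DF a p u0" "pexp (ex ze) (- w2) : U a"
    using a(1) by (auto simp: related_def)
   hence "Y (ze, A ze (DF b q' w')) = DF a p u0" using bk[OF zU refl w2(1)] w2(2) by simp
   hence "norm (DF a p u0 - DF a p u) <= K1 * (K3 * K2) * norm (z - y)" using n2 by simp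
   moreover have "lam a p (DF a p u0) = u0" using hor_iff[OF a(1) p a(2)] u0h by simp
   moreover have "F b (pexp p u0) = z" using q' q'(1) fz(1,2) by (simp add: q'_def[symmetric] f_def F_S)
   ultimately show ?thesis by (intro exI[of _ "DF a p u0"]) (simp add: y_def q_def)
  qed
 qed
qed

text \<open>Lipschitz solvability makes the derivative surjective, hence bijective since the
  dimensions agree. At \<open>u = 0\<close>, which \<open>minimizer_Lipschitz\<close> excludes,
  normal coordinates at \<open>p\<close> provide the solutions.\<close>

theorem minimizer_nonconjugate:
 assumes p: "p : S" and u: "u : tan p" and min: "norm u <= d (pr p) (pr (pexp p u))"
  and cut: "pr (pexp p u) \<notin> cut_locus M (pr p)"
  and a: "a : atlas M" "p : U a" and b: "b : atlas M" and qU: "pexp p u : U b"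
 shows "bij (FD (%xi. F b (pexp p (lam a p xi))) (at (DF a p u)))"
proof -
 let ?E = "%xi. F b (pexp p (lam a p xi))" and ?xi = "DF a p u"
 have uh: "u : hor p" by (rule minimizer_horizontal[OF p u min])
 have lu: "lam a p ?xi = u" using hor_iff[OF a(1) p a(2)] uh by simp
 have "?xi : {xi. pexp p (lam a p xi) : U b}" using qU by (simp add: lu)
 note D = smooth_on_deriv[OF smooth_on_exp_coordinates(2,1)[OF a(1) p a(2) b] this]
 have "EX K e. 0 < e & (ALL z. norm (z - ?E ?xi) < e --> (EX xi. norm (xi - ?xi) <= K * norm (z - ?E ?xi) & ?E xi = z))"
 proof (cases "u = 0")
  case False
  obtain K e where "0 < e" "!!z. norm (z - F b (pexp p u)) < e ==>
   EX xi. norm (xi - DF a p u) <= K * norm (z - F b (pexp p u)) & F b (pexp p (lam a p xi)) = z"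
   by (rule minimizer_Lipschitz[OF p u False min cut a b qU]) (rule that)
  thus ?thesis unfolding lu by blast
 next
  case True
  have bp: "p : U b" using qU True by simp
  obtain Z et where "normal_coords b p Z et" using normal_coordinates[OF b p bp] by blast
  note Z = normal_coordsD[OF this]
  \<comment> \<open>Normal coordinates are expressed by velocities in the chart \<open>b\<close>,
    the exponential map by velocities in the chart \<open>a\<close>; \<open>th\<close>
    translates.\<close>
  define th where "th = (%xi. DF a p (lam b p xi))"
  have linth: "linear th"
   unfolding th_def using linear_compose[OF linear_lam[OF b p bp] linear_DF[OF a]] by (simp add: o_def)
  have "((%z. th (et z)) has_derivative (%v. th v)) (at (F b p))"
   using bounded_linear.has_derivative[OF _ Z(6)] linth linear_conv_bounded_linear by blast
  then obtain K e where K: "0 < e" "!!z. norm (z - F b p) < e ==> norm (th (et z) - th (et (F b p))) <= K * norm (z - F b p)"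
   by (rule has_derivative_imp_Lipschitz_at) (rule that)
  obtain e' where e': "0 < e'" "ball (F b p) e' \<subseteq> Z" using Z(1,2) open_contains_ball by blast
  have xi0: "?xi = 0" using True linear_0[OF linear_DF[OF a]] by simp
  have E0: "?E ?xi = F b p" unfolding lu using True by simp
  have "EX xi. norm (xi - ?xi) <= K * norm (z - ?E ?xi) & ?E xi = z" if z: "norm (z - ?E ?xi) < min e e'" for z
  proof (intro exI[of _ "th (et z)"] conjI)
   have zZ: "z : Z" using z e'(2) unfolding E0 by (auto simp: dist_norm norm_minus_commute)
   show "norm (th (et z) - ?xi) <= K * norm (z - ?E ?xi)"
    using K(2)[of z] z unfolding E0 by (simp add: xi0 Z(5) linear_0[OF linth])
   have "lam a p (th (et z)) = lam b p (et z)" using hor_iff[OF a(1) p a(2)] lam_in_hor[OF b p bp] by (simp add: th_def)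
   thus "?E (th (et z)) = z" using Z(7)[OF zZ] by simp
  qed
  thus ?thesis using K(1) e'(1) by (intro exI[of _ K] exI[of _ "min e e'"]) simp
 qed
 then obtain K e where Ke: "0 < e" "!!z. norm (z - ?E ?xi) < e ==> EX xi. norm (xi - ?xi) <= K * norm (z - ?E ?xi) & ?E xi = z"
  by blast
 have "surj (FD ?E (at ?xi))" by (rule surj_derivative_if_Lipschitz_solvable[OF D Ke])
 thus ?thesis using linear_surjective_imp_injective[OF has_derivative_linear[OF D]] by (simp add: bij_def)
qed

section \<open>The cost off the cut locus\<close>

lemma d_eq_0_imp_eq:
 assumes "x : topspace (man_top M)" "y : topspace (man_top M)" "d x y = 0"
 shows "x = y"
proof -
 obtain p where p: "p : S" "pr p = x" using ex_fibre[OF assms(1)] by blast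
 obtain u where "u : tan p" "pr (pexp p u) = y" "norm u = d x y" using minimizer_exists[OF p(1) assms(2)] p(2) by blast
 thus ?thesis using assms(3) p(2) by simp
qed

lemma lam_eqI:
 assumes b: "b : atlas M" and p: "p : S" "p : U b" and u: "u : hor p"
 shows "lam b p (DF b p u) = u" using hor_iff[OF b p] u by simp

text \<open>The lengths converge, so a subsequence of the \<open>v n\<close> converges. Its limit is
  tangent at \<open>p\<close>, has minimal length and ends over the right point of the base, so it
  is \<open>u\<close> by uniqueness. Convergence of the end points is asked in the base only, since
  their position in the fibre is not controlled.\<close>

lemma minimizers_tendsto:
 assumes p: "p : S" and u: "u : tan p" and min: "norm u <= d (pr p) (pr (pexp p u))"
  and cut: "pr (pexp p u) \<notin> cut_locus M (pr p)"
  and s: "!!n. s n : S" "s \<longlonglongrightarrow> p" and v: "!!n. v n : tan (s n)" "!!n. norm (v n) = d (pr (s n)) (pr (pexp (s n) (v n)))"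
  and lim: "(%n. d (pr p) (pr (s n))) \<longlonglongrightarrow> 0" "(%n. d (pr (pexp p u)) (pr (pexp (s n) (v n)))) \<longlonglongrightarrow> 0"
 obtains ph where "strict_mono (ph :: nat => nat)" "(%n. v (ph n)) \<longlonglongrightarrow> u"
proof -
 let ?x = "pr p" and ?y = "pr (pexp p u)"
 define e where "e = (%n. pexp (s n) (v n))"
 have e: "e n : S" for n unfolding e_def by (rule pexp_in_S[OF s(1) v(1)])
 have q: "pexp p u : S" by (rule pexp_in_S[OF p u])
 note tops = pi_in[OF p] pi_in[OF s(1)] pi_in[OF q] pi_in[OF e]
 have vd: "norm (v n) = d (pr (s n)) (pr (e n))" for n using v(2) by (simp add: e_def)
 have diff: "\<bar>norm (v n) - d ?x ?y\<bar> <= d ?x (pr (s n)) + d ?y (pr (e n))" for n unfolding vd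
  using d_triangle[OF tops(2)[of n] tops(1) tops(4)[of n]] d_triangle[OF tops(1) tops(3) tops(4)[of n]]
   d_triangle[OF tops(1) tops(2)[of n] tops(3)] d_triangle[OF tops(2)[of n] tops(4)[of n] tops(3)]
   d_commute[OF tops(1) tops(2)[of n]] d_commute[OF tops(3) tops(4)[of n]] by linarith
 have "(%n. d ?x (pr (s n)) + d ?y (pr (e n))) \<longlonglongrightarrow> 0" using tendsto_add[OF lim] by (simp add: e_def)
 hence "(%n. norm (v n) - d ?x ?y) \<longlonglongrightarrow> 0"
  by (rule Lim_null_comparison[rotated]) (use diff in \<open>simp add: always_eventually\<close>)
 hence nlim: "(%n. norm (v n)) \<longlonglongrightarrow> d ?x ?y" by (simp add: LIM_zero_iff)
 hence "Bseq (%n. norm (v n))" by (rule convergent_imp_Bseq[OF convergentI])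
 then obtain R where R: "!!n. norm (norm (v n)) <= R" using BseqE by blast
 hence "ALL n. v n : cball 0 R" by simp
 with compact_imp_seq_compact[OF compact_cball[of "0 :: real ^ 'i" R]]
 obtain v' ph where ph: "strict_mono (ph :: nat => nat)" "(v \<circ> ph) \<longlonglongrightarrow> v'" unfolding seq_compact_def by blast
 have vl: "(%n. v (ph n)) \<longlonglongrightarrow> v'" using ph(2) by (simp add: o_def)
 have sub: "(%n. f (ph n)) \<longlonglongrightarrow> l" if "f \<longlonglongrightarrow> l" for f :: "nat => 'z::topological_space" and l
  using LIMSEQ_subseq_LIMSEQ[OF that ph(1)] by (simp add: o_def)
 have sl: "(%n. s (ph n)) \<longlonglongrightarrow> p" by (rule sub[OF s(2)])
 have cb: "continuous_on UNIV (blk j)" for j using linear_blk linear_conv_bounded_linear linear_continuous_on by blast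
 have cbl: "(%n. blk j (f n)) \<longlonglongrightarrow> blk j l" if "f \<longlonglongrightarrow> l" for f l j
  using continuous_on_tendsto_compose[OF cb that] by simp
 have v't: "v' : tan p" unfolding tan_def
 proof (intro CollectI allI impI)
  fix j assume j: "j < k"
  have "(%n. blk j (v (ph n)) *. blk j (s (ph n))) \<longlonglongrightarrow> blk j v' *. blk j p"
   by (intro tendsto_inner cbl sl vl)
  moreover have "blk j (v (ph n)) *. blk j (s (ph n)) = 0" for n by (rule tanD[OF v(1) j])
  ultimately show "blk j v' *. blk j p = 0" by (simp add: LIMSEQ_const_iff)
 qed
 have "(%n. norm (v (ph n))) \<longlonglongrightarrow> d ?x ?y" by (rule sub[OF nlim])
 moreover have "(%n. norm (v (ph n))) \<longlonglongrightarrow> norm v'" by (rule tendsto_norm[OF vl])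
 ultimately have nv': "norm v' = d ?x ?y" using LIMSEQ_unique by blast
 have e'S: "pexp p v' : S" by (rule pexp_in_S[OF p v't])
 have "continuous_on UNIV (%x. pexp (fst x) (snd x))"
  by (intro smooth_on_cont smooth_on_pexp open_UNIV smooth_on_fst smooth_on_snd smooth_on_id)
 from continuous_on_tendsto_compose[OF this tendsto_Pair[OF sl vl]]
 have el: "(%n. e (ph n)) \<longlonglongrightarrow> pexp p v'" by (simp add: e_def)
 have "(%n. pdist (pexp p v') (e (ph n))) \<longlonglongrightarrow> pdist (pexp p v') (pexp p v')"
  using continuous_on_tendsto_compose[OF continuous_on_pdist_right[OF e'S] el e'S] e by simp
 moreover have "(%n. d ?y (pr (e (ph n)))) \<longlonglongrightarrow> 0" using sub[OF lim(2)] by (simp add: e_def)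
 ultimately have "(%n. pdist (pexp p v') (e (ph n)) + d ?y (pr (e (ph n)))) \<longlonglongrightarrow> 0 + 0"
  using pdist_self[OF e'S] by (intro tendsto_add) simp_all
 moreover have "d (pr (pexp p v')) ?y <= pdist (pexp p v') (e (ph n)) + d ?y (pr (e (ph n)))" for n
  using d_triangle[OF pi_in[OF e'S] tops(4)[of "ph n"] tops(3)] d_le_pdist[OF e'S e[of "ph n"]]
   d_commute[OF tops(3) tops(4)[of "ph n"]] by linarith
 ultimately have "d (pr (pexp p v')) ?y <= 0" by (intro LIMSEQ_le_const) auto
 hence eq: "?y = pr (pexp p v')" using d_nonneg[OF pi_in[OF e'S] tops(3)] d_eq_0_imp_eq[OF pi_in[OF e'S] tops(3)] by simp
 have "u = v'" by (rule minimizer_unique[OF p u min v't _ eq cut]) (simp add: nv' flip: eq)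
 thus ?thesis using that[OF ph(1)] vl by simp
qed

text \<open>Near \<open>(z0, z0')\<close>, the coordinates \<open>u (z, z')\<close> of the initial velocity of the minimizer from the point
 with coordinates \<open>z\<close> to the one with coordinates \<open>z'\<close> depend smoothly on \<open>(z, z')\<close>.\<close>
definition log_coordinates :: "('m, 'e) chart => ('m, 'e) chart => ('e \<times> 'e) set => ('e \<times> 'e => 'e) => bool" where
 "log_coordinates a b V u \<longleftrightarrow> open V & V \<subseteq> chart_image a \<times> chart_image b & smooth_on V u &
   (ALL z z'. (z, z') : V -->
    cost M (chart_inv a z) (chart_inv b z') = metric M a z (u (z, z')) (u (z, z')) / 2 &
    bij (FD (%w. u (z, w)) (at z')) &
    (ALL ze. FD (%w. cost M (chart_inv a w) (chart_inv b z')) (at z) ze = - metric M a z (u (z, z')) ze))"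

text \<open>The inverse function theorem applies to \<open>Ph\<close>, the map
  \<open>(z, xi)\<close> to \<open>(z, E (z, xi))\<close>, because minimizers off the cut locus are
  not conjugate. Its local inverse gives some geodesic to each nearby target; \<open>good\<close>
  makes it the minimizing one. Conversely, initial velocities in \<open>X\<close> are recovered by
  \<open>L\<close>.\<close>

theorem ex_log_coordinates:
 assumes p: "p : S" and u: "u : tan p" and min: "norm u <= d (pr p) (pr (pexp p u))"
  and cut: "pr (pexp p u) \<notin> cut_locus M (pr p)"
  and a: "a : atlas M" "p : U a" and b: "b : atlas M" and qU: "pexp p u : U b"
 obtains V L X where "log_coordinates a b V L" "(F a p, F b (pexp p u)) : V"
  "!!z' v. (F a p, z') : V ==> v : tan p ==> pr (pexp p v) = chart_inv b z' ==> norm v = d (pr p) (chart_inv b z') ==> DF a p v = L (F a p, z')"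
  "open X" "DF a p u : X" "!!xi. xi : X ==> pexp p (lam a p xi) : U b & (F a p, F b (pexp p (lam a p xi))) : V & L (F a p, F b (pexp p (lam a p xi))) = xi"
proof -
 define q where "q = pexp p u"
 have q: "q : S" unfolding q_def by (rule pexp_in_S[OF p u])
 have qU: "q : U b" using qU by (simp add: q_def)
 have uh: "u : hor p" by (rule minimizer_horizontal[OF p u min])
 define z0 where "z0 = F a p"
 define y0 where "y0 = F b q"
 define xi0 where "xi0 = DF a p u"
 have lu: "lam a p xi0 = u" unfolding xi0_def by (rule lam_eqI[OF a(1) p a(2) uh])
 have linl: "linear (lam a p)" by (rule linear_lam[OF a(1) p a(2)])
 obtain Z et where "normal_coords a p Z et" using normal_coordinates[OF a(1) p a(2)] by blast
 note Z = normal_coordsD[OF this]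
 obtain Z' et' where "normal_coords b q Z' et'" using normal_coordinates[OF b q qU] by blast
 note Z' = normal_coordsD[OF this]
 define si where "si = (%z. pexp p (lam a p (et z)))"
 have si: "si z : U a" "si z : S" "F a (si z) = z" "pr (si z) = chart_inv a z" if "z : Z" for z
  using Z(7)[OF that] by (auto simp: si_def)
 have z0Z: "z0 : Z" using Z(2) by (simp add: z0_def)
 have si0: "si z0 = p" by (simp add: si_def z0_def Z(5) linear_0[OF linl])
 have smsi: "smooth_on Z si" unfolding si_def by (intro smooth_on_pexp_const smooth_on_lam_const[OF a(1) p a(2)] Z(1,4))
 define ex where "ex = (%x. pexp (si (fst x)) (lam a (si (fst x)) (snd x)))"
 have exS: "ex x : S" if "fst x : Z" for x
  unfolding ex_def by (rule pexp_in_S[OF si(2)[OF that] lam_in_tan[OF a(1) si(2)[OF that] si(1)[OF that]]])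
 have oZU: "open (Z \<times> (UNIV :: 'e set))" using Z(1) by (intro open_Times open_UNIV)
 have smsif: "smooth_on (Z \<times> UNIV) (%x :: 'e \<times> 'e. si (fst x))"
  by (rule smooth_on_compose[OF oZU Z(1) _ smooth_on_fst[OF oZU smooth_on_id[OF oZU]] smsi]) auto
 have smex: "smooth_on (Z \<times> UNIV) ex"
  unfolding ex_def using si(1) by (intro smooth_on_pexp smooth_on_lam[OF a(1)] oZU smsif smooth_on_snd smooth_on_id) auto
 define Om where "Om = (Z \<times> UNIV) \<inter> ex -` U b"
 have oOm: "open Om" unfolding Om_def by (rule continuous_open_preimage[OF smooth_on_cont[OF smex] oZU open_U[OF b]])
 define E where "E = (%x. F b (ex x))"
 have smE: "smooth_on Om E"
  unfolding E_def by (rule smooth_on_compose[OF oOm open_U[OF b] _ smooth_on_subset[OF smex] smooth_on_F[OF b]]) (auto simp: Om_def)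
 define Ph where "Ph = (%x. (fst x, E x))"
 have smPh: "smooth_on Om Ph" unfolding Ph_def by (intro smooth_on_Pair smooth_on_fst smooth_on_id oOm smE)
 have ex0: "ex (z0, xi) = pexp p (lam a p xi)" for xi by (simp add: ex_def si0)
 have x0: "(z0, xi0) : Om" using z0Z qU by (simp add: Om_def ex0 lu q_def)
 have injPh: "inj (FD Ph (at (z0, xi0)))"
 proof -
  note dPh = smooth_on_deriv[OF smPh oOm x0]
  note dE = smooth_on_deriv[OF smE oOm x0]
  have "(Ph has_derivative (%v. (fst v, FD E (at (z0, xi0)) v))) (at (z0, xi0))"
   unfolding Ph_def by (intro has_derivative_Pair has_derivative_fst has_derivative_ident dE)
  from has_derivative_unique[OF dPh this]
  have DPh: "FD Ph (at (z0, xi0)) v = (fst v, FD E (at (z0, xi0)) v)" for v by simp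
  have "((%xi. (z0, xi)) has_derivative (%v. (0, v))) (at xi0)" by (intro has_derivative_Pair has_derivative_const has_derivative_ident)
  from has_derivative_compose[OF this dE]
  have "((%xi. F b (pexp p (lam a p xi))) has_derivative (%v. FD E (at (z0, xi0)) (0, v))) (at xi0)" by (simp add: E_def ex0)
  hence "FD (%xi. F b (pexp p (lam a p xi))) (at xi0) = (%v. FD E (at (z0, xi0)) (0, v))"
   by (rule frechet_derivative_at[symmetric])
  with minimizer_nonconjugate[OF p u min cut a b] qU
  have bij: "bij (%v. FD E (at (z0, xi0)) (0, v))" by (simp add: q_def xi0_def)
  have linE: "linear (FD E (at (z0, xi0)))" using dE has_derivative_linear by blast
  have "v = 0" if v: "FD Ph (at (z0, xi0)) v = 0" for v
  proof -
   have v1: "fst v = 0" "FD E (at (z0, xi0)) v = 0" using v by (auto simp: DPh zero_prod_def)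
   hence "v = (0, snd v)" by (simp add: prod_eq_iff)
   with v1(2) have "FD E (at (z0, xi0)) (0, snd v) = FD E (at (z0, xi0)) (0, 0)"
    using linear_0[OF linE] by (simp add: zero_prod_def)
   hence "snd v = 0" using injD[OF bij_is_inj[OF bij]] by blast
   with v1(1) show ?thesis by (simp add: prod_eq_iff)
  qed
  thus ?thesis using linear_injective_0[OF has_derivative_linear[OF dPh]] by blast
 qed
 obtain U1 V1 g where IFT: "open U1" "U1 \<subseteq> Om" "(z0, xi0) : U1" "open V1" "Ph (z0, xi0) : V1" "homeomorphism U1 V1 Ph g" "smooth_on V1 g"
  by (rule smooth_inverse_function[OF oOm x0 smPh injPh]) (rule that)
 have Ph0: "Ph (z0, xi0) = (z0, y0)" by (simp add: Ph_def E_def ex0 lu y0_def q_def)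
 have g: "g y : U1" "Ph (g y) = y" if "y : V1" for y using IFT(6) that unfolding homeomorphism_def by auto
 have g': "Ph x : V1" "g (Ph x) = x" if "x : U1" for x using IFT(6) that unfolding homeomorphism_def by auto
 define L where "L = (%y. snd (g y))"
 have gL: "g y = (fst y, L y)" if "y : V1" for y
 proof -
  have "fst (g y) = fst y" using g(2)[OF that] by (metis Ph_def fst_conv)
  thus ?thesis by (simp add: L_def prod_eq_iff)
 qed
 \<comment> \<open>All minimizers between the two points have their data in \<open>U1\<close>, where
   \<open>Ph\<close> is injective. If this failed arbitrarily near \<open>(z0, y0)\<close>, the
   offending minimizers would have a subsequence tending to \<open>u\<close> by
   \<open>minimizers_tendsto\<close>, although the data of \<open>u\<close> lie in the open set
   \<open>U1\<close>.\<close>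
 define good where "good = (%x. fst x : Z & snd x : Z' & (ALL v:tan (si (fst x)). pr (pexp (si (fst x)) v) = chart_inv b (snd x) -->
  norm v = d (chart_inv a (fst x)) (chart_inv b (snd x)) --> (fst x, DF a (si (fst x)) v) : U1))"
 have "EX e>0. ALL x. dist x (z0, y0) < e --> good x"
 proof (rule ccontr)
  assume neg: "\<not> (EX e>0. ALL x. dist x (z0, y0) < e --> good x)"
  have oZZ: "open (Z \<times> Z')" using Z(1) Z'(1) by (rule open_Times)
  have "(z0, y0) : Z \<times> Z'" using z0Z Z'(2) by (simp add: y0_def)
  then obtain e0 where e0: "0 < e0" "!!x. dist x (z0, y0) < e0 ==> x : Z \<times> Z'" using oZZ unfolding open_dist by blast
  have "EX x v. dist x (z0, y0) < min e0 (inverse (real (Suc n))) & v : tan (si (fst x)) & pr (pexp (si (fst x)) v) = chart_inv b (snd x) &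
   norm v = d (chart_inv a (fst x)) (chart_inv b (snd x)) & (fst x, DF a (si (fst x)) v) \<notin> U1" for n
  proof -
   have "0 < min e0 (inverse (real (Suc n)))" using e0(1) by simp
   with neg obtain x where x: "dist x (z0, y0) < min e0 (inverse (real (Suc n)))" "\<not> good x" by blast
   have "fst x : Z" "snd x : Z'" using e0(2)[of x] x(1) by auto
   with x show ?thesis unfolding good_def by blast
  qed
  then obtain x v where xv: "!!n. dist (x n) (z0, y0) < min e0 (inverse (real (Suc n)))" "!!n. v n : tan (si (fst (x n)))"
   "!!n. pr (pexp (si (fst (x n))) (v n)) = chart_inv b (snd (x n))"
   "!!n. norm (v n) = d (chart_inv a (fst (x n))) (chart_inv b (snd (x n)))" "!!n. (fst (x n), DF a (si (fst (x n))) (v n)) \<notin> U1"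
   by metis
  have xZ: "fst (x n) : Z" "snd (x n) : Z'" for n using e0(2)[of "x n"] xv(1)[of n] by auto
  have "(%n. dist (x n) (z0, y0)) \<longlonglongrightarrow> 0"
  proof (rule Lim_null_comparison[OF _ LIMSEQ_inverse_real_of_nat])
   show "\<forall>\<^sub>F n in sequentially. norm (dist (x n) (z0, y0)) <= inverse (real (Suc n))"
    using xv(1) by (intro always_eventually allI) (simp add: less_imp_le)
  qed
  hence xl: "x \<longlonglongrightarrow> (z0, y0)" using tendsto_dist_iff by blast
  have zl: "(%n. fst (x n)) \<longlonglongrightarrow> z0" using tendsto_fst[OF xl] by simp
  have yl: "(%n. snd (x n)) \<longlonglongrightarrow> y0" using tendsto_snd[OF xl] by simp
  have sl: "(%n. si (fst (x n))) \<longlonglongrightarrow> p"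
   using continuous_on_tendsto_compose[OF smooth_on_cont[OF smsi] zl z0Z] xZ by (simp add: si0)
  have l1: "(%n. norm (lam a p (et (fst (x n))))) \<longlonglongrightarrow> 0"
  proof -
   have "continuous_on Z (%z. norm (lam a p (et z)))"
    by (intro continuous_on_norm smooth_on_cont smooth_on_lam_const[OF a(1) p a(2)] Z(1,4))
   from continuous_on_tendsto_compose[OF this zl z0Z] show ?thesis using xZ by (simp add: z0_def Z(5) linear_0[OF linl])
  qed
  have l2: "(%n. norm (lam b q (et' (snd (x n))))) \<longlonglongrightarrow> 0"
  proof -
   have "continuous_on Z' (%z. norm (lam b q (et' z)))"
    by (intro continuous_on_norm smooth_on_cont smooth_on_lam_const[OF b q qU] Z'(1,4))
   from continuous_on_tendsto_compose[OF this yl] show ?thesis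
    using xZ Z'(2) by (simp add: y0_def Z'(5) linear_0[OF linear_lam[OF b q qU]])
  qed
  have top: "chart_inv b (snd (x n)) : topspace (man_top M)" "chart_inv a (fst (x n)) : topspace (man_top M)" for n
   using chart_chart_inv(1) chart_subset_topspace b a(1) xZ Z(3) Z'(3) by (metis subset_iff)+
  have d1: "(%n. d (pr p) (pr (si (fst (x n))))) \<longlonglongrightarrow> 0"
  proof (rule Lim_null_comparison[OF _ l1], intro always_eventually allI)
   fix n show "norm (d (pr p) (pr (si (fst (x n))))) <= norm (lam a p (et (fst (x n))))"
    unfolding si_def using d_pexp_le[OF p lam_in_tan[OF a(1) p a(2)]] d_nonneg[OF pi_in[OF p] pi_in[OF pexp_in_S[OF p lam_in_tan[OF a(1) p a(2)]]]] by simp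
  qed
  have d2: "(%n. d (pr (pexp p u)) (pr (pexp (si (fst (x n))) (v n)))) \<longlonglongrightarrow> 0"
  proof (rule Lim_null_comparison[OF _ l2], intro always_eventually allI)
   fix n
   have "pr (pexp (si (fst (x n))) (v n)) = pr (pexp q (lam b q (et' (snd (x n)))))" using xv(3)[of n] Z'(7)[OF xZ(2)[of n]] by simp
   thus "norm (d (pr (pexp p u)) (pr (pexp (si (fst (x n))) (v n)))) <= norm (lam b q (et' (snd (x n))))"
    using d_pexp_le[OF q lam_in_tan[OF b q qU]] d_nonneg[OF pi_in[OF q] pi_in[OF pexp_in_S[OF q lam_in_tan[OF b q qU]]]]
    by (simp flip: q_def)
  qed
  have vn: "norm (v n) = d (pr (si (fst (x n)))) (pr (pexp (si (fst (x n))) (v n)))" for n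
   using xv(3,4)[of n] si(4)[OF xZ(1)[of n]] by simp
  obtain ph where ph: "strict_mono (ph :: nat => nat)" "(%n. v (ph n)) \<longlonglongrightarrow> u"
   by (rule minimizers_tendsto[OF p u min cut si(2)[OF xZ(1)] sl xv(2) vn d1 d2]) (rule that)
  have oUU: "open (U a \<times> (UNIV :: (real ^ 'i) set))" using open_U[OF a(1)] by (intro open_Times open_UNIV)
  have "smooth_on (U a \<times> UNIV) (%x. DF a (fst x) (snd x))"
   by (intro smooth_on_DF[OF a(1)] smooth_on_fst smooth_on_snd smooth_on_id oUU) auto
  from smooth_on_cont[OF this] have cDF: "continuous_on (U a \<times> UNIV) (%x. DF a (fst x) (snd x))" .
  have sl': "(%n. si (fst (x (ph n)))) \<longlonglongrightarrow> p" using LIMSEQ_subseq_LIMSEQ[OF sl ph(1)] by (simp add: o_def)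
  have zl': "(%n. fst (x (ph n))) \<longlonglongrightarrow> z0" using LIMSEQ_subseq_LIMSEQ[OF zl ph(1)] by (simp add: o_def)
  have "(%n. DF a (si (fst (x (ph n)))) (v (ph n))) \<longlonglongrightarrow> xi0"
   using continuous_on_tendsto_compose[OF cDF tendsto_Pair[OF sl' ph(2)]] a(2) si(1)[OF xZ(1)] by (simp add: xi0_def)
  from topological_tendstoD[OF tendsto_Pair[OF zl' this] IFT(1,3)] obtain n where "(fst (x (ph n)), DF a (si (fst (x (ph n)))) (v (ph n))) : U1"
   using eventually_happens'[OF sequentially_bot] by blast
  thus False using xv(5) by blast
 qed
 then obtain e where e: "0 < e" "!!x. dist x (z0, y0) < e ==> good x" by blast
 define V where "V = V1 \<inter> ball (z0, y0) e"
 have oV: "open V" unfolding V_def using IFT(4) by blast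
 have VV1: "V \<subseteq> V1" by (simp add: V_def)
 have Vgood: "good x" if "x : V" for x using that e(2) by (simp add: V_def dist_commute)
 have V0: "(z0, y0) : V" using IFT(5) e(1) by (simp add: V_def Ph0)
 have smL: "smooth_on V L" unfolding L_def by (intro smooth_on_snd oV smooth_on_subset[OF IFT(7) VV1])
 have key: "DF a (si z) v = L (z, z')"
  if zz: "(z, z') : V" and v: "v : tan (si z)" "pr (pexp (si z) v) = chart_inv b z'" "norm v = d (chart_inv a z) (chart_inv b z')" for z z' v
 proof -
  have zZ: "z : Z" "z' : Z'" and U1: "(z, DF a (si z) v) : U1" using Vgood[OF zz] v unfolding good_def by auto
  have vh: "v : hor (si z)" by (rule minimizer_horizontal[OF si(2)[OF zZ(1)] v(1)]) (simp add: v(2,3) si(4)[OF zZ(1)])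
  have lv: "lam a (si z) (DF a (si z) v) = v" by (rule lam_eqI[OF a(1) si(2)[OF zZ(1)] si(1)[OF zZ(1)] vh])
  have "F b (pexp (si z) v) = z'"
   using F_S[OF pexp_in_S[OF si(2)[OF zZ(1)] v(1)], of b] v(2) chart_chart_inv(2)[of z' b] zZ(2) Z'(3) by auto
  hence "Ph (z, DF a (si z) v) = (z, z')" by (simp add: Ph_def E_def ex_def lv)
  hence "g (z, z') = (z, DF a (si z) v)" using g'(2)[OF U1] by simp
  thus ?thesis by (simp add: L_def)
 qed
 have topb: "chart_inv b z' : topspace (man_top M)" if "z' : Z'" for z'
  using chart_chart_inv(1)[of z' b] chart_subset_topspace[OF b] that Z'(3) by blast
 have ex_min: "EX v:tan (si z). pr (pexp (si z) v) = chart_inv b z' & norm v = d (chart_inv a z) (chart_inv b z') & v = lam a (si z) (L (z, z'))"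
  if zz: "(z, z') : V" for z z'
 proof -
  have zZ: "z : Z" "z' : Z'" using Vgood[OF zz] unfolding good_def by auto
  obtain v where v: "v : tan (si z)" "pr (pexp (si z) v) = chart_inv b z'" "norm v = d (chart_inv a z) (chart_inv b z')"
   using minimizer_exists[OF si(2)[OF zZ(1)] topb[OF zZ(2)]] si(4)[OF zZ(1)] by auto
  have vh: "v : hor (si z)" by (rule minimizer_horizontal[OF si(2)[OF zZ(1)] v(1)]) (simp add: v(2,3) si(4)[OF zZ(1)])
  have "lam a (si z) (DF a (si z) v) = v" by (rule lam_eqI[OF a(1) si(2)[OF zZ(1)] si(1)[OF zZ(1)] vh])
  thus ?thesis using v key[OF zz v] by metis
 qed
 define c where "c = (%x. cost M (chart_inv a (fst x)) (chart_inv b (snd x)))"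
 have cost_eq: "c x = metric M a (fst x) (L x) (L x) / 2" if "x : V" for x
 proof -
  obtain z z' where x: "x = (z, z')" by (cases x)
  have zz: "(z, z') : V" using that x by simp
  have zZ: "z : Z" using Vgood[OF zz] unfolding good_def by auto
  have "(d (chart_inv a z) (chart_inv b z'))\<^sup>2 = metric M a z (L (z, z')) (L (z, z'))"
   using ex_min[OF zz] norm_lam[OF a(1) si(2)[OF zZ] si(1)[OF zZ], of "L (z, z')"] si(3)[OF zZ] by metis
  thus ?thesis by (simp add: x c_def cost_def)
 qed
 have smc: "smooth_on V c"
 proof -
  have "smooth_on V (%x. inverse 2 * metric M a (fst x) (L x) (L x))"
  proof (intro smooth_on_mult smooth_on_const smooth_on_metric[OF a(1)] smL oV smooth_on_fst smooth_on_id)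
   show "fst ` V \<subseteq> chart_image a" using Vgood Z(3) unfolding good_def by blast
  qed
  thus ?thesis using smooth_on_cong[OF oV, of "%x. inverse 2 * metric M a (fst x) (L x) (L x)" c] cost_eq by simp
 qed
 have bij: "bij (FD (%w. L (z, w)) (at z'))" if zz: "(z, z') : V" for z z'
 proof -
  have dP: "((%w. (z, w)) has_derivative (%v. (0, v))) (at z')" by (intro has_derivative_Pair has_derivative_const has_derivative_ident)
  have dL: "((%w. L (z, w)) has_derivative (%v. FD L (at (z, z')) (0, v))) (at z')"
   by (rule has_derivative_compose[OF dP smooth_on_deriv[OF smL oV zz]])
  hence DL: "FD (%w. L (z, w)) (at z') = (%v. FD L (at (z, z')) (0, v))" by (rule frechet_derivative_at[symmetric])
  have "(z, L (z, z')) : Om" using g(1)[of "(z, z')"] gL[of "(z, z')"] zz VV1 IFT(2) by auto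
  note dE = smooth_on_deriv[OF smE oOm this]
  have dPL: "((%w. (z, L (z, w))) has_derivative (%v. (0, FD L (at (z, z')) (0, v)))) (at z')"
   by (intro has_derivative_Pair has_derivative_const dL)
  note dEL = has_derivative_compose[OF dPL dE]
  have "open ((%w. (z, w)) -` V)" by (rule open_vimage[OF oV]) (intro continuous_intros)
  moreover have "z' : (%w. (z, w)) -` V" using zz by simp
  moreover have "E (z, L (z, w)) = w" if "w : (%w. (z, w)) -` V" for w
   using g(2)[of "(z, w)"] gL[of "(z, w)"] that VV1 by (auto simp: Ph_def)
  ultimately have "((%w. w) has_derivative (%v. FD E (at (z, L (z, z'))) (0, FD L (at (z, z')) (0, v)))) (at z')"
   by (rule has_derivative_transform_within_open[OF dEL])
  from has_derivative_unique[OF this has_derivative_ident]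
  have id: "FD E (at (z, L (z, z'))) (0, FD L (at (z, z')) (0, v)) = v" for v by (rule fun_cong)
  have inj: "inj (%v. FD L (at (z, z')) (0, v))" by (rule inj_on_inverseI) (rule id)
  thus ?thesis unfolding DL using linear_injective_imp_surjective[OF has_derivative_linear[OF dL]] by (simp add: bij_def)
 qed
 have grad: "FD (%w. cost M (chart_inv a w) (chart_inv b z')) (at z) ze = - metric M a z (L (z, z')) ze"
  if zz: "(z, z') : V" for z z' ze
 proof -
  have zZ: "z : Z" "z' : Z'" using Vgood[OF zz] unfolding good_def by auto
  let ?s = "si z"
  note s = si[OF zZ(1)]
  obtain v where v: "v : tan ?s" "pr (pexp ?s v) = chart_inv b z'" "norm v = d (chart_inv a z) (chart_inv b z')" "v = lam a ?s (L (z, z'))"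
   using ex_min[OF zz] by blast
  obtain Y th where "normal_coords a ?s Y th" using normal_coordinates[OF a(1) s(2,1)] by blast
  note Y = normal_coordsD[OF this]
  have bl: "bounded_linear (lam a ?s)" using linear_lam[OF a(1) s(2,1)] linear_conv_bounded_linear by blast
  define f where "f = (%w. inverse 2 * ((v - lam a ?s (th w)) *. (v - lam a ?s (th w))))"
  have dth: "((%w. v - lam a ?s (th w)) has_derivative (%h. - lam a ?s h)) (at z)"
   using has_derivative_diff[OF has_derivative_const bounded_linear.has_derivative[OF bl Y(6)], of v] s(3) by simp
  have th0: "v - lam a ?s (th z) = v" using Y(5) s(3) linear_0[OF linear_lam[OF a(1) s(2,1)]] by simp
  have df: "(f has_derivative (%h. - (v *. lam a ?s h))) (at z)"
  proof -
   have "(f has_derivative (%h. inverse 2 * ((v - lam a ?s (th z)) *. (- lam a ?s h) + (- lam a ?s h) *. (v - lam a ?s (th z))))) (at z)"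
    unfolding f_def by (intro has_derivative_mult_right has_derivative_inner dth)
   thus ?thesis by (simp add: th0 inner_commute)
  qed
  let ?c = "%w. cost M (chart_inv a w) (chart_inv b z')"
  have dP: "((%w. (w, z')) has_derivative (%v. (v, 0))) (at z)" by (intro has_derivative_Pair has_derivative_const has_derivative_ident)
  have "((%w. c (w, z')) has_derivative (%v. FD c (at (z, z')) (v, 0))) (at z)"
   by (rule has_derivative_compose[OF dP smooth_on_deriv[OF smc oV zz]])
  hence "?c differentiable (at z)" unfolding c_def differentiable_def by auto
  hence dc: "(?c has_derivative FD ?c (at z)) (at z)" using frechet_derivative_works by blast
  \<comment> \<open>The cost is already known to be differentiable; the hinge comparison places
    \<open>f\<close> above it with equality at \<open>z\<close>, so their difference is maximal
    there.\<close>
  have "(%h. FD ?c (at z) h - - (v *. lam a ?s h)) = (%h. 0)"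
  proof (rule differential_zero_maxmin[OF _ Y(1) has_derivative_diff[OF dc df]])
   show "z : Y" using Y(2) s(3) by simp
   have "?c w <= f w" if w: "w : Y" for w
   proof -
    have "d (pr (pexp ?s v)) (pr (pexp ?s (lam a ?s (th w)))) <= norm (v - lam a ?s (th w))"
     by (rule d_hinge[OF s(2) v(1) lam_in_tan[OF a(1) s(2,1)]])
    hence le: "d (chart_inv b z') (chart_inv a w) <= norm (v - lam a ?s (th w))" using Y(7)[OF w] v(2) by simp
    have ta: "chart_inv a w : topspace (man_top M)" using chart_chart_inv(1)[of w a] chart_subset_topspace[OF a(1)] w Y(3) by blast
    have "(d (chart_inv a w) (chart_inv b z'))\<^sup>2 <= (norm (v - lam a ?s (th w)))\<^sup>2"
     using le d_commute[OF ta topb[OF zZ(2)]] d_nonneg[OF ta topb[OF zZ(2)]] by (intro power_mono) auto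
    thus ?thesis by (simp add: cost_def f_def power2_norm_eq_inner)
   qed
   moreover have "?c z = f z" unfolding f_def th0 using v(3) by (simp add: cost_def flip: power2_norm_eq_inner)
   ultimately show "(ALL y:Y. ?c y - f y <= ?c z - f z) | (ALL y:Y. ?c z - f z <= ?c y - f y)" by auto
  qed
  hence "FD ?c (at z) ze - - (v *. lam a ?s ze) = 0" by (rule fun_cong)
  hence "FD ?c (at z) ze = - (v *. lam a ?s ze)" by linarith
  also have "v *. lam a ?s ze = metric M a z (L (z, z')) ze"
   unfolding v(4) using inner_lam[OF a(1) s(2,1), of "L (z, z')" "lam a ?s ze"] DF_lam[OF a(1) s(2,1)] s(3) by simp
  finally show ?thesis .
 qed
 have VI: "V \<subseteq> chart_image a \<times> chart_image b"
 proof
  fix x assume "x : V"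
  from Vgood[OF this] show "x : chart_image a \<times> chart_image b" using Z(3) Z'(3) unfolding good_def by (auto simp: mem_Times_iff)
 qed
 define X where "X = (%xi. (z0, xi)) -` (U1 \<inter> Ph -` V)"
 have oX: "open X"
 proof -
  have "open (U1 \<inter> Ph -` V)"
   by (rule continuous_open_preimage[OF continuous_on_subset[OF smooth_on_cont[OF smPh] IFT(2)] IFT(1) oV])
  thus ?thesis unfolding X_def by (rule open_vimage) (intro continuous_intros)
 qed
 show ?thesis
 proof (rule that[of V L X])
  show "log_coordinates a b V L" unfolding log_coordinates_def using oV VI smL bij grad cost_eq by (auto simp: c_def)
  show "(F a p, F b (pexp p u)) : V" using V0 by (simp add: z0_def y0_def q_def)
  show "DF a p v = L (F a p, z')" if "(F a p, z') : V" "v : tan p" "pr (pexp p v) = chart_inv b z'" "norm v = d (pr p) (chart_inv b z')" for z' v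
   using key[of z0 z' v] that si0 si(4)[OF z0Z] by (simp add: z0_def)
  show "open X" by (rule oX)
  show "DF a p u : X" using IFT(3) V0 by (simp add: X_def Ph0 flip: xi0_def)
  show "pexp p (lam a p xi) : U b & (F a p, F b (pexp p (lam a p xi))) : V & L (F a p, F b (pexp p (lam a p xi))) = xi" if "xi : X" for xi
  proof -
   have x: "(z0, xi) : U1" "Ph (z0, xi) : V" using that by (auto simp: X_def)
   have Phx: "Ph (z0, xi) = (F a p, F b (pexp p (lam a p xi)))" by (simp add: Ph_def E_def ex0 flip: z0_def)
   have "pexp p (lam a p xi) : U b" using x(1) IFT(2) by (auto simp: Om_def ex0)
   moreover have "L (Ph (z0, xi)) = xi" using g'(2)[OF x(1)] by (simp add: L_def)
   ultimately show ?thesis using x(2) Phx by simp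
  qed
 qed
qed

end

section \<open>Christoffel symbols and curvature of a pseudo-Riemannian metric\<close>

lemma sum_linear_times_inner:
 fixes f :: "'a::euclidean_space => real"
 assumes "linear f"
 shows "(\<Sum>a\<in>Basis. f a * (P *. a)) = f P" using linear_basis_expansion[OF assms, of P] by (simp add: mult.commute)

lemma wedge_contraction:
 fixes h :: "'a::euclidean_space => 'a => real"
 assumes l1: "!!b. linear (%a. h a b)" and l2: "!!a. linear (h a)"
 shows "(\<Sum>a\<in>Basis. \<Sum>b\<in>Basis. h a b * wedge P Q a b) = h P Q - h Q P"
proof -
 have "(\<Sum>b\<in>Basis. h a b * wedge P Q a b) = h a Q * (P *. a) - h a P * (Q *. a)" for a
 proof -
  have "(\<Sum>b\<in>Basis. h a b * wedge P Q a b) = (\<Sum>b\<in>Basis. h a b * (Q *. b)) * (P *. a) - (\<Sum>b\<in>Basis. h a b * (P *. b)) * (Q *. a)"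
   by (simp add: wedge_def sum_distrib_right sum_distrib_left algebra_simps flip: sum_subtractf)
  thus ?thesis using sum_linear_times_inner[OF l2] by simp
 qed
 hence "(\<Sum>a\<in>Basis. \<Sum>b\<in>Basis. h a b * wedge P Q a b) = (\<Sum>a\<in>Basis. h a Q * (P *. a)) - (\<Sum>a\<in>Basis. h a P * (Q *. a))"
  by (simp add: sum_subtractf)
 thus ?thesis using sum_linear_times_inner[OF l1] by simp
qed

locale pseudo_metric =
 fixes G :: "'v::euclidean_space tensor_field" and V :: "'v set"
 assumes open_domain: "open V"
  and smooth_G: "!!u v. smooth_on V (%z. G z u v)"
  and bilinear_G: "!!z. z : V ==> bilinear (G z)"
  and commute_G: "!!z u v. z : V ==> G z u v = G z v u"
  and nondegenerate_G: "!!z u. z : V ==> (!!v. G z u v = 0) ==> u = 0"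
begin

lemma linear_G: "z : V ==> linear (G z u)" "z : V ==> linear (%u. G z u v)" using bilinear_G unfolding bilinear_def by auto

lemmas G_simps = linear_add[OF linear_G(1)] linear_add[OF linear_G(2)] linear_diff[OF linear_G(1)] linear_diff[OF linear_G(2)]
 linear_cmul[OF linear_G(1)] linear_cmul[OF linear_G(2)] linear_0[OF linear_G(1)] linear_0[OF linear_G(2)]

lemma G_eqI:
 assumes z: "z : V" and "!!v. G z u v = G z w v"
 shows "u = w"
proof -
 have "u - w = 0" by (rule nondegenerate_G[OF z]) (simp add: G_simps[OF z] assms(2))
 thus ?thesis by simp
qed

definition "koszul z u v y = (FD (%z'. G z' v y) (at z) u
  + FD (%z'. G z' u y) (at z) v - FD (%z'. G z' u v) (at z) y) / 2"

lemma has_derivative_G: "z : V ==> ((%z. G z u v) has_derivative FD (%z. G z u v) (at z)) (at z)"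
 by (rule smooth_on_deriv[OF smooth_G open_domain])

abbreviation "dG z u v w \<equiv> FD (%z. G z u v) (at z) w"

lemma DG:
 assumes z: "z : V"
 shows "linear (%u. dG z u v w)" "linear (%w. dG z u v w)" "dG z u v w = dG z v u w" "linear (%v. dG z u v w)"
proof -
 note d = differentiableI[OF has_derivative_G[OF z]]
 show "linear (%u. dG z u v w)" by (rule linear_FD_parameter[OF open_domain z d linear_G(2)])
 show "linear (%v. dG z u v w)" by (rule linear_FD_parameter[OF open_domain z d linear_G(1)])
 show "linear (%w. dG z u v w)" by (rule has_derivative_linear[OF has_derivative_G[OF z]])
 have "FD (%z. G z u v) (at z) = FD (%z. G z v u) (at z)" by (rule FD_cong[OF open_domain z]) (rule commute_G)
 thus "dG z u v w = dG z v u w" by simp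
qed

lemma koszul_linear:
 assumes z: "z : V"
 shows "linear (koszul z u v)" "linear (%u. koszul z u v y)" "koszul z u v y = koszul z v u y"
proof -
 note l = DG(1,2,4)[OF z, THEN linear_add] DG(1,2,4)[OF z, THEN linear_cmul]
 show "linear (koszul z u v)"
  by (rule linearI) (simp_all add: koszul_def l algebra_simps add_divide_distrib diff_divide_distrib)
 show "linear (%u. koszul z u v y)"
  by (rule linearI) (simp_all add: koszul_def l algebra_simps add_divide_distrib diff_divide_distrib)
 show "koszul z u v y = koszul z v u y" by (simp add: koszul_def DG(3)[OF z, of u v])
qed

text \<open>The lowering isomorphism. Inverting it exhibits the Christoffel symbols as smooth
  functions of the point, by \<open>smooth_on_inverse_family\<close>.\<close>

definition "flat z u = (\<Sum>e\<in>Basis. G z u e *R e)"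

lemma flat:
 assumes z: "z : V"
 shows "linear (flat z)" "bij (flat z)" "flat z u *. v = G z u v"
proof -
 show lin: "linear (flat z)"
  by (rule linearI) (simp_all add: flat_def G_simps[OF z] scaleR_left_distrib sum.distrib scaleR_sum_right)
 show i: "flat z u *. v = G z u v" for u v using linear_basis_expansion[OF linear_G(1)[OF z], of u v]
  by (simp add: flat_def inner_sum_left inner_sum_right mult.commute inner_commute[of _ v])
 have "u = 0" if "flat z u = 0" for u
 proof (rule nondegenerate_G[OF z])
  show "G z u v = 0" for v using i[of u v] that by simp
 qed
 hence "inj (flat z)" using linear_injective_0[OF lin] by blast
 thus "bij (flat z)" using linear_injective_imp_surjective[OF lin] by (simp add: bij_def)
qed

lemma christoffel_inv:
 assumes z: "z : V"
 shows "christoffel G z u v = inv (flat z) (\<Sum>e\<in>Basis. koszul z u v e *R e)"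
 unfolding christoffel_def koszul_def[symmetric]
proof (rule the_equality)
 let ?w = "inv (flat z) (\<Sum>e\<in>Basis. koszul z u v e *R e)"
 have "flat z ?w = (\<Sum>e\<in>Basis. koszul z u v e *R e)" using flat(2)[OF z] by (simp add: bij_is_surj surj_f_inv_f)
 hence "G z ?w y = (\<Sum>e\<in>Basis. koszul z u v e *R e) *. y" for y using flat(3)[OF z, of ?w y] by simp
 also have "(\<Sum>e\<in>Basis. koszul z u v e *R e) *. y = koszul z u v y" for y
  using linear_basis_expansion[OF koszul_linear(1)[OF z], of u v y] by (simp add: inner_sum_left mult.commute inner_commute[of y])
 finally have eq: "G z ?w y = koszul z u v y" for y .
 thus "ALL y. G z ?w y = koszul z u v y" by blast
 fix w assume "ALL y. G z w y = koszul z u v y"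
 hence "G z w y = G z ?w y" for y unfolding eq by (rule spec)
 thus "w = ?w" by (rule G_eqI[OF z])
qed

lemma G_christoffel:
 assumes z: "z : V"
 shows "G z (christoffel G z u v) y = koszul z u v y"
proof -
 have "flat z (christoffel G z u v) = (\<Sum>e\<in>Basis. koszul z u v e *R e)"
  unfolding christoffel_inv[OF z] using flat(2)[OF z] by (simp add: bij_is_surj surj_f_inv_f)
 hence "G z (christoffel G z u v) y = (\<Sum>e\<in>Basis. koszul z u v e *R e) *. y" using flat(3)[OF z, of "christoffel G z u v" y] by simp
 thus ?thesis
  using linear_basis_expansion[OF koszul_linear(1)[OF z], of u v y] by (simp add: inner_sum_left mult.commute inner_commute[of y])
qed

lemma smooth_christoffel: "smooth_on V (%z. christoffel G z u v)"
proof -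
 have "smooth_on V (%z. inv (flat z) (\<Sum>e\<in>Basis. koszul z u v e *R e))"
 proof (rule smooth_on_inverse_family[OF flat(1) flat(2) open_domain])
  show "smooth_on V (%z. flat z w)" for w
   unfolding flat_def by (intro smooth_on_sum smooth_on_scaleR smooth_G smooth_on_const open_domain)
  have "smooth_on V (%z. koszul z u v e)" for e
  proof -
   have "smooth_on V (%z. inverse 2 * (FD (%z'. G z' v e) (at z) u
    + FD (%z'. G z' u e) (at z) v - FD (%z'. G z' u v) (at z) e))"
    by (intro smooth_on_mult smooth_on_const smooth_on_diff smooth_on_add smooth_on_FD smooth_G open_domain)
   thus ?thesis by (simp add: koszul_def field_simps)
  qed
  thus "smooth_on V (%z. \<Sum>e\<in>Basis. koszul z u v e *R e)"
   by (intro smooth_on_sum smooth_on_scaleR smooth_on_const open_domain)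
 qed
 moreover have "smooth_on V (%z. christoffel G z u v) \<longleftrightarrow> smooth_on V (%z. inv (flat z) (\<Sum>e\<in>Basis. koszul z u v e *R e))"
  by (rule smooth_on_cong[OF open_domain]) (rule christoffel_inv)
 ultimately show ?thesis by blast
qed

lemma christoffel_linear:
 assumes z: "z : V"
 shows "linear (christoffel G z u)" "linear (%u. christoffel G z u v)" "christoffel G z u v = christoffel G z v u"
proof -
 show sym: "christoffel G z u v = christoffel G z v u" for u v
  by (rule G_eqI[OF z]) (simp add: G_christoffel[OF z] koszul_linear(3)[OF z, of u])
 show l: "linear (%u. christoffel G z u v)" for v
 proof (rule linearI)
  show "christoffel G z (x + y) v = christoffel G z x v + christoffel G z y v" for x y
   by (rule G_eqI[OF z]) (simp add: G_christoffel[OF z] G_simps[OF z] linear_add[OF koszul_linear(2)[OF z]])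
  show "christoffel G z (s *R x) v = s *R christoffel G z x v" for s x
   by (rule G_eqI[OF z]) (simp add: G_christoffel[OF z] G_simps[OF z] linear_cmul[OF koszul_linear(2)[OF z]])
 qed
 show "linear (christoffel G z u)"
  using l[of u] by (rule iffD1[OF arg_cong[where f=linear], rotated]) (simp add: fun_eq_iff sym)
qed

lemma has_derivative_christoffel:
 "z : V ==> ((%z. christoffel G z u v) has_derivative FD (%z. christoffel G z u v) (at z)) (at z)"
 by (rule smooth_on_deriv[OF smooth_christoffel open_domain])

lemma D_christoffel_linear:
 assumes z: "z : V"
 shows "linear (%w. FD (%z. christoffel G z u v) (at z) w)"
  "linear (%u. FD (%z. christoffel G z u v) (at z) w)"
  "linear (%v. FD (%z. christoffel G z u v) (at z) w)" by (rule has_derivative_linear[OF has_derivative_christoffel[OF z]],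
  (rule linear_FD_parameter[OF open_domain z differentiableI[OF has_derivative_christoffel[OF z]]], erule christoffel_linear)+)

lemma curvature_tensor_linear:
 assumes z: "z : V"
 shows "linear (%u. curvature_tensor G z u v w)" "linear (%v. curvature_tensor G z u v w)" "linear (curvature_tensor G z u v)"
proof -
 note l = D_christoffel_linear[OF z] christoffel_linear(1,2)[OF z] linear_compose[OF christoffel_linear(1)[OF z] christoffel_linear(1)[OF z], unfolded o_def]
  linear_compose[OF christoffel_linear(2)[OF z] christoffel_linear(1)[OF z], unfolded o_def]
 show "linear (%u. curvature_tensor G z u v w)" "linear (%v. curvature_tensor G z u v w)" "linear (curvature_tensor G z u v)"
  unfolding curvature_tensor_def by (intro linear_compose_add linear_compose_sub l)+
qed

text \<open>The contraction yields four terms; antisymmetry of the curvature tensor in its first two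
  arguments, immediate from its definition, merges them in pairs.\<close>

theorem curvature_operator_wedge:
 assumes z: "z : V"
 shows "curvature_operator G z (wedge P Q) (wedge P Q)
  = 2 * (G z (curvature_tensor G z P Q Q) P - G z (curvature_tensor G z P Q P) Q)"
proof -
 let ?R = "curvature_tensor G z"
 have "(\<Sum>c\<in>Basis. \<Sum>d\<in>Basis. G z (?R a b d) c * wedge P Q a b * wedge P Q c d)
   = (G z (?R a b Q) P - G z (?R a b P) Q) * wedge P Q a b" for a b
 proof -
  have "(\<Sum>c\<in>Basis. \<Sum>d\<in>Basis. G z (?R a b d) c * wedge P Q c d) = G z (?R a b Q) P - G z (?R a b P) Q"
  proof (rule wedge_contraction)
   show "linear (%c. G z (?R a b d) c)" for d by (rule linear_G(1)[OF z])
   show "linear (%d. G z (?R a b d) c)" for c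
    using linear_compose[OF curvature_tensor_linear(3)[OF z] linear_G(2)[OF z]] by (simp add: o_def)
  qed
  moreover have "(\<Sum>c\<in>Basis. \<Sum>d\<in>Basis. G z (?R a b d) c * wedge P Q a b * wedge P Q c d)
   = (\<Sum>c\<in>Basis. \<Sum>d\<in>Basis. G z (?R a b d) c * wedge P Q c d) * wedge P Q a b"
   unfolding sum_distrib_right by (simp only: mult_ac)
  ultimately show ?thesis by simp
 qed
 hence "curvature_operator G z (wedge P Q) (wedge P Q)
  = (\<Sum>a\<in>Basis. \<Sum>b\<in>Basis. (G z (?R a b Q) P - G z (?R a b P) Q) * wedge P Q a b)"
  by (simp add: curvature_operator_def)
 also have "\<dots> = (G z (?R P Q Q) P - G z (?R P Q P) Q) - (G z (?R Q P Q) P - G z (?R Q P P) Q)"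
 proof (rule wedge_contraction)
  show "linear (%a. G z (?R a b Q) P - G z (?R a b P) Q)" for b
   using linear_compose[OF curvature_tensor_linear(1)[OF z] linear_G(2)[OF z]] by (intro linear_compose_sub) (simp_all add: o_def)
  show "linear (%b. G z (?R a b Q) P - G z (?R a b P) Q)" for a
   using linear_compose[OF curvature_tensor_linear(2)[OF z] linear_G(2)[OF z]] by (intro linear_compose_sub) (simp_all add: o_def)
 qed
 also have "?R Q P w = - ?R P Q w" for w by (simp add: curvature_tensor_def)
 hence "G z (?R Q P w) v = - G z (?R P Q w) v" for w v using linear_neg[OF linear_G(2)[OF z]] by simp
 hence "(G z (?R P Q Q) P - G z (?R P Q P) Q) - (G z (?R Q P Q) P - G z (?R Q P P) Q)
  = 2 * (G z (?R P Q Q) P - G z (?R P Q P) Q)" by simp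
 finally show ?thesis .
qed

lemma D_product_G:
 assumes z: "z : V" and f: "smooth_on V f"
 shows "FD (%z. G z (f z) v) (at z) w = FD (%z'. G z' (f z) v) (at z) w + G z (FD f (at z) w) v"
proof -
 have df: "(f has_derivative FD f (at z)) (at z)" by (rule smooth_on_deriv[OF f open_domain z])
 have ex: "G z' u v = (\<Sum>e\<in>Basis. (u *. e) * G z' e v)" if "z' : V" for z' u
  using linear_basis_expansion[OF linear_G(2)[OF that], of u v] by simp
 have "((%z. \<Sum>e\<in>Basis. (f z *. e) * G z e v) has_derivative
  (%w. \<Sum>e\<in>Basis. (f z *. e) * FD (%z. G z e v) (at z) w + (FD f (at z) w *. e) * G z e v)) (at z)"
  by (intro has_derivative_sum has_derivative_mult has_derivative_inner_left df has_derivative_G z)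
 hence "((%z. G z (f z) v) has_derivative
  (%w. \<Sum>e\<in>Basis. (f z *. e) * FD (%z. G z e v) (at z) w + (FD f (at z) w *. e) * G z e v)) (at z)"
  using has_derivative_cong_open[OF open_domain z, of "%z. G z (f z) v" "%z. \<Sum>e\<in>Basis. (f z *. e) * G z e v"] ex by simp
 from frechet_derivative_at[OF this, symmetric]
 have 1: "FD (%z. G z (f z) v) (at z) w
  = (\<Sum>e\<in>Basis. (f z *. e) * FD (%z. G z e v) (at z) w) + (\<Sum>e\<in>Basis. (FD f (at z) w *. e) * G z e v)"
  by (simp add: sum.distrib)
 from linear_basis_expansion[OF DG(1)[OF z], of "f z" v w] show ?thesis
  unfolding 1 using ex[OF z, of "FD f (at z) w"] by simp
qed

end

lemma christoffel_cong:
 assumes V: "open V" "z : V" and eq: "!!z. z : V ==> G z = H z"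
 shows "christoffel G z = christoffel H z"
proof -
 have "FD (%z'. G z' u v) (at z) = FD (%z'. H z' u v) (at z)" for u v by (rule FD_cong[OF V]) (simp add: eq)
 thus ?thesis unfolding christoffel_def by (simp add: eq[OF V(2)] fun_eq_iff)
qed

lemma curvature_operator_cong:
 assumes V: "open V" "z : V" and eq: "!!z. z : V ==> G z = H z"
 shows "curvature_operator G z = curvature_operator H z"
proof -
 have c: "christoffel G z' = christoffel H z'" if "z' : V" for z' by (rule christoffel_cong[OF V(1) that eq])
 have "FD (%z'. christoffel G z' u v) (at z) = FD (%z'. christoffel H z' u v) (at z)" for u v
  by (rule FD_cong[OF V]) (simp add: c)
 hence "curvature_tensor G z = curvature_tensor H z" unfolding curvature_tensor_def by (simp add: c[OF V(2)] fun_eq_iff)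
 thus ?thesis unfolding curvature_operator_def by (simp add: eq[OF V(2)] fun_eq_iff)
qed

section \<open>The pseudo-Riemannian metric of a cost\<close>

lemma FD_scale:
 fixes f :: "'a::euclidean_space => real"
 assumes "open V" "x : V" "smooth_on V f"
 shows "FD (%y. s * f y) (at x) v = s * FD f (at x) v"
proof -
 have "((%y. s * f y) has_derivative (%v. s * FD f (at x) v)) (at x)"
  by (intro has_derivative_mult_right smooth_on_deriv[OF assms(3,1,2)])
 from frechet_derivative_at[OF this, symmetric] show ?thesis by simp
qed

text \<open>With the sign of \<open>h\<close>: the bilinear form \<open>- c_ij\<close>, its first
  vector in the first variable of \<open>c\<close> and its second in the second. The cost is taken
  as one function on the product so that symmetry of full derivatives is at hand.\<close>

definition mixed_hessian :: "('e::euclidean_space \<times> 'e => real) => 'e \<times> 'e => 'e => 'e => real" where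
 "mixed_hessian c x p q = - FD (%y. FD c (at y) (0, q)) (at x) (p, 0)"

definition product_cost_metric :: "('e::euclidean_space \<times> 'e => real) => ('e \<times> 'e) tensor_field" where
 "product_cost_metric c x u v = (mixed_hessian c x (fst u) (snd v) + mixed_hessian c x (fst v) (snd u)) / 2"

locale nondegenerate_cost =
 fixes c :: "'e::euclidean_space \<times> 'e => real" and V
 assumes open_V: "open V" and smooth_c: "smooth_on V c"
  and nondegenerate_left: "!!x p. x : V ==> (!!q. mixed_hessian c x p q = 0) ==> p = 0"
  and nondegenerate_right: "!!x q. x : V ==> (!!p. mixed_hessian c x p q = 0) ==> q = 0"
begin

abbreviation "mu \<equiv> mixed_hessian c"
abbreviation "G \<equiv> product_cost_metric c"
abbreviation "Ga \<equiv> christoffel G"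
abbreviation "dmu x p q v \<equiv> FD (%y. mu y p q) (at x) v"

lemma smooth_Dc: "smooth_on V (%y. FD c (at y) v)" by (rule smooth_on_FD[OF smooth_c])

lemma linear_Dc: "x : V ==> linear (FD c (at x))" using smooth_on_deriv[OF smooth_c open_V] has_derivative_linear by blast

lemma mu_commute:
 assumes "x : V"
 shows "mu x p q = - FD (%y. FD c (at y) (p, 0)) (at x) (0, q)"
 unfolding mixed_hessian_def using FD_commute_real[OF open_V assms smooth_c] by simp

lemma smooth_mu: "smooth_on V (%x. mu x p q)"
 unfolding mixed_hessian_def by (intro smooth_on_minus open_V smooth_on_FD smooth_Dc)

lemma linear_mu:
 assumes x: "x : V"
 shows "linear (mu x p)" "linear (%p. mu x p q)"
proof -
 have i: "linear (%q::'e. (0::'e, q))" "linear (%p::'e. (p, 0::'e))" by (auto intro!: linearI)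
 have "linear (%q. FD (%y. FD c (at y) (0, q)) (at x) (p, 0))"
 proof (rule linear_FD_parameter[OF open_V x smooth_on_diffable[OF smooth_Dc open_V x]])
  show "linear (%q. FD c (at y) (0, q))" if "y : V" for y
   using linear_compose[OF i(1) linear_Dc[OF that]] by (simp add: o_def)
 qed
 thus "linear (mu x p)" unfolding mixed_hessian_def by (rule linear_compose_neg)
 have "linear (FD (%y. FD c (at y) (0, q)) (at x))"
  using smooth_on_deriv[OF smooth_Dc open_V x] has_derivative_linear by blast
 from linear_compose[OF i(2) this] show "linear (%p. mu x p q)"
  unfolding mixed_hessian_def by (intro linear_compose_neg) (simp add: o_def)
qed

lemmas mu_simps = linear_add[OF linear_mu(1)] linear_add[OF linear_mu(2)] linear_diff[OF linear_mu(1)] linear_diff[OF linear_mu(2)]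
 linear_cmul[OF linear_mu(1)] linear_cmul[OF linear_mu(2)] linear_0[OF linear_mu(1)] linear_0[OF linear_mu(2)]

lemma has_derivative_mu: "x : V ==> ((%y. mu y p q) has_derivative FD (%y. mu y p q) (at x)) (at x)"
 by (rule smooth_on_deriv[OF smooth_mu open_V])

lemma dmu_linear:
 assumes x: "x : V"
 shows "dmu x p q (p', q') = dmu x p q (p', 0) + dmu x p q (0, q')"
 using linear_add[OF has_derivative_linear[OF has_derivative_mu[OF x]], of p q "(p', 0)" "(0, q')"] by simp

text \<open>Symmetry of the third derivatives of \<open>c\<close> within each of the two variables.
  It is the analogue of the Kaehler condition and the reason why the mixed Christoffel symbols
  vanish.\<close>

lemma dmu_sym:
 assumes x: "x : V"
 shows "dmu x p q (p', 0) = dmu x p' q (p, 0)" "dmu x p q (0, q') = dmu x p q' (0, q)"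
proof -
 let ?D = FD
 have 1: "dmu x p q v = - ?D (%y. ?D (%y. ?D c (at y) (0, q)) (at y) (p, 0)) (at x) v" for p v unfolding mixed_hessian_def
  using FD_scale[OF open_V x smooth_on_FD[OF smooth_Dc], of "- 1"] by simp
 show "dmu x p q (p', 0) = dmu x p' q (p, 0)" unfolding 1 using FD_commute_real[OF open_V x smooth_Dc] by simp
 have 2: "dmu x p q v = - ?D (%y. ?D (%y. ?D c (at y) (p, 0)) (at y) (0, q)) (at x) v" for q v
 proof -
  have "?D (%y. mu y p q) (at x) = ?D (%y. - 1 * ?D (%y. ?D c (at y) (p, 0)) (at y) (0, q)) (at x)"
   by (rule FD_cong[OF open_V x]) (simp add: mu_commute)
  thus ?thesis using FD_scale[OF open_V x smooth_on_FD[OF smooth_Dc], of "- 1"] by simp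
 qed
 show "dmu x p q (0, q') = dmu x p q' (0, q)" unfolding 2 using FD_commute_real[OF open_V x smooth_Dc] by simp
qed

sublocale pseudo_metric G V
proof
 show "open V" by (rule open_V)
 show "smooth_on V (%z. G z u v)" for u v
 proof -
  have "smooth_on V (%z. inverse 2 * (mu z (fst u) (snd v) + mu z (fst v) (snd u)))"
   by (intro smooth_on_mult smooth_on_add smooth_on_const smooth_mu open_V)
  thus ?thesis by (simp add: product_cost_metric_def field_simps)
 qed
 fix z assume z: "z : V"
 show "bilinear (G z)" unfolding bilinear_def product_cost_metric_def
  by (auto intro!: linearI simp: mu_simps[OF z] algebra_simps add_divide_distrib)
 show "G z u v = G z v u" for u v by (simp add: product_cost_metric_def add.commute)
 show "u = 0" if "!!v. G z u v = 0" for u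
 proof -
  have "mu z (fst u) q = 0" for q using that[of "(0, q)"] by (simp add: product_cost_metric_def mu_simps[OF z])
  hence 1: "fst u = 0" by (rule nondegenerate_left[OF z])
  have "mu z p (snd u) = 0" for p using that[of "(p, 0)"] by (simp add: product_cost_metric_def mu_simps[OF z])
  hence "snd u = 0" by (rule nondegenerate_right[OF z])
  with 1 show ?thesis by (simp add: prod_eq_iff)
 qed
qed

lemma D_G:
 assumes x: "x : V"
 shows "FD (%z. G z (p, 0) (p', q')) (at x) v = dmu x p q' v / 2"
  "FD (%z. G z (0, q) (p', q')) (at x) v = dmu x p' q v / 2"
proof -
 have "FD (%z. G z (p, 0) (p', q')) (at x) = FD (%z. inverse 2 * mu z p q') (at x)"
  by (rule FD_cong[OF open_V x]) (simp add: product_cost_metric_def mu_simps)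
 thus "FD (%z. G z (p, 0) (p', q')) (at x) v = dmu x p q' v / 2"
  using FD_scale[OF open_V x smooth_mu, of "inverse 2"] by simp
 have "FD (%z. G z (0, q) (p', q')) (at x) = FD (%z. inverse 2 * mu z p' q) (at x)"
  by (rule FD_cong[OF open_V x]) (simp add: product_cost_metric_def mu_simps)
 thus "FD (%z. G z (0, q) (p', q')) (at x) v = dmu x p' q v / 2"
  using FD_scale[OF open_V x smooth_mu, of "inverse 2"] by simp
qed

lemma dmu_0: "x : V ==> dmu x 0 q v = 0" "x : V ==> dmu x p 0 v = 0"
proof -
 assume x: "x : V"
 have "FD (%y. mu y 0 q) (at x) = FD (%y. 0) (at x)" "FD (%y. mu y p 0) (at x) = FD (%y. 0) (at x)"
  by (rule FD_cong[OF open_V x]; simp add: mu_simps)+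
 thus "dmu x 0 q v = 0" "dmu x p 0 v = 0" by simp_all
qed

lemma Ga_mixed:
 assumes x: "x : V"
 shows "Ga x (p, 0) (0, q) = 0" "Ga x (0, q) (p, 0) = 0"
proof -
 show 1: "Ga x (p, 0) (0, q) = 0"
 proof (rule G_eqI[OF x])
  fix v :: "'e \<times> 'e" obtain p' q' where v: "v = (p', q')" by (cases v)
  have "koszul x (p, 0) (0, q) v = 0"
   using dmu_sym(1)[OF x, of p' q p] dmu_sym(2)[OF x, of p q' q] dmu_linear[OF x, of p q p' q']
   by (simp add: koszul_def v D_G[OF x])
  thus "G x (Ga x (p, 0) (0, q)) v = G x 0 v" by (simp add: G_christoffel[OF x] G_simps[OF x])
 qed
 show "Ga x (0, q) (p, 0) = 0" using christoffel_linear(3)[OF x, of "(0, q)"] 1 by simp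
qed

lemma Ga_vertical:
 assumes x: "x : V"
 shows "fst (Ga x (0, q) (0, q')) = 0" "mu x p (snd (Ga x (0, q) (0, q'))) = dmu x p q (0, q')"
proof -
 have "mu x (fst (Ga x (0, q) (0, q'))) r = 0" for r using G_christoffel[OF x, of "(0, q)" "(0, q')" "(0, r)"]
  by (simp add: product_cost_metric_def[of c x] mu_simps[OF x] koszul_def D_G[OF x] dmu_0[OF x])
 thus "fst (Ga x (0, q) (0, q')) = 0" by (rule nondegenerate_left[OF x])
 show "mu x p (snd (Ga x (0, q) (0, q'))) = dmu x p q (0, q')"
  using G_christoffel[OF x, of "(0, q)" "(0, q')" "(p, 0)"] dmu_sym(2)[OF x, of p q q']
  by (simp add: product_cost_metric_def[of c x] mu_simps[OF x] koszul_def D_G[OF x] dmu_0[OF x])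
qed

lemma Ga_horizontal:
 assumes x: "x : V"
 shows "snd (Ga x (p, 0) (p', 0)) = 0" "mu x (fst (Ga x (p, 0) (p', 0))) q = dmu x p q (p', 0)"
proof -
 have "mu x r (snd (Ga x (p, 0) (p', 0))) = 0" for r using G_christoffel[OF x, of "(p, 0)" "(p', 0)" "(r, 0)"]
  by (simp add: product_cost_metric_def[of c x] mu_simps[OF x] koszul_def D_G[OF x] dmu_0[OF x])
 thus "snd (Ga x (p, 0) (p', 0)) = 0" by (rule nondegenerate_right[OF x])
 show "mu x (fst (Ga x (p, 0) (p', 0))) q = dmu x p q (p', 0)"
  using G_christoffel[OF x, of "(p, 0)" "(p', 0)" "(0, q)"] dmu_sym(1)[OF x, of p q p']
  by (simp add: product_cost_metric_def[of c x] mu_simps[OF x] koszul_def D_G[OF x] dmu_0[OF x])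
qed

lemma smooth_dmu: "smooth_on V (%x. dmu x p q v)" by (rule smooth_on_FD[OF smooth_mu])

text \<open>As mixed Christoffel symbols vanish, the curvature applied to \<open>(0, q)\<close> is
  the derivative of the vertical symbol in direction \<open>(p, 0)\<close>, and applied to
  \<open>(p, 0)\<close> it is minus the derivative of the horizontal symbol in direction
  \<open>(0, q)\<close>; both come from differentiating the equations that define these symbols. The
  right-hand side is -2 times the second time derivative of \<open>cpp\<close> along the vertical
  geodesic with velocity \<open>q\<close>, whose acceleration is \<open>- g\<close>.\<close>

theorem cross_curvature_formula:
 fixes p q :: 'e
 assumes x: "x : V"
 defines "g \<equiv> snd (Ga x (0, q) (0, q))"
 defines "cpp \<equiv> %y. FD (%y. FD c (at y) (p, 0)) (at y) (p, 0)"
 shows "curvature_operator G x (wedge (p, 0) (0, q)) (wedge (p, 0) (0, q))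
  = - 2 * (FD (%y. FD cpp (at y) (0, q)) (at x) (0, q) - FD cpp (at x) (0, g))"
proof -
 let ?P = "(p, 0) :: 'e \<times> 'e" and ?Q = "(0, q) :: 'e \<times> 'e" and ?D = FD
 let ?R = "curvature_tensor G x ?P ?Q"
 define f where "f = fst (Ga x ?P ?P)"
 have Ga0: "?D (%z. Ga z ?P ?Q) (at x) v = 0" "?D (%z. Ga z ?Q ?P) (at x) v = 0" for v
 proof -
  have "?D (%z. Ga z ?P ?Q) (at x) = ?D (%z. 0) (at x)" "?D (%z. Ga z ?Q ?P) (at x) = ?D (%z. 0) (at x)"
   by (rule FD_cong[OF open_V x]; simp add: Ga_mixed)+
  thus "?D (%z. Ga z ?P ?Q) (at x) v = 0" "?D (%z. Ga z ?Q ?P) (at x) v = 0" by simp_all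
 qed
 have QQ: "Ga x ?Q ?Q = (0, g)" using Ga_vertical(1)[OF x, of q q] by (simp add: g_def prod_eq_iff)
 have PP: "Ga x ?P ?P = (f, 0)" using Ga_horizontal(1)[OF x, of p p] by (simp add: f_def prod_eq_iff)
 have z: "Ga x u 0 = 0" for u by (rule linear_0[OF christoffel_linear(1)[OF x]])
 have RQ: "?R ?Q = ?D (%z. Ga z ?Q ?Q) (at x) ?P" by (simp add: curvature_tensor_def Ga0 QQ Ga_mixed[OF x] z)
 have RP: "?R ?P = - ?D (%z. Ga z ?P ?P) (at x) ?Q" by (simp add: curvature_tensor_def Ga0 PP Ga_mixed[OF x] z)
 have "?D (%z. G z (Ga z ?Q ?Q) ?P) (at x) = ?D (%z. inverse 2 * dmu z p q ?Q) (at x)" by (rule FD_cong[OF open_V x])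
   (simp add: product_cost_metric_def[of c _ "Ga _ _ _"] mu_simps Ga_vertical)
 hence "?D (%z. G z (Ga z ?Q ?Q) ?P) (at x) ?P = ?D (%z. dmu z p q ?Q) (at x) ?P / 2"
  using FD_scale[OF open_V x smooth_dmu, of "inverse 2"] by simp
 moreover have "?D (%z. G z (Ga z ?Q ?Q) ?P) (at x) ?P = ?D (%z. G z (Ga x ?Q ?Q) ?P) (at x) ?P + G x (?D (%z. Ga z ?Q ?Q) (at x) ?P) ?P"
  by (rule D_product_G[OF x smooth_christoffel])
 moreover have "?D (%z. G z (Ga x ?Q ?Q) ?P) (at x) ?P = dmu x p g ?P / 2" unfolding QQ by (rule D_G(2)[OF x])
 ultimately have 1: "G x (?R ?Q) ?P = (?D (%z. dmu z p q ?Q) (at x) ?P - dmu x p g ?P) / 2" by (simp add: RQ field_simps)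
 have "?D (%z. G z (Ga z ?P ?P) ?Q) (at x) = ?D (%z. inverse 2 * dmu z p q ?P) (at x)" by (rule FD_cong[OF open_V x])
   (simp add: product_cost_metric_def[of c _ "Ga _ _ _"] mu_simps Ga_horizontal)
 hence "?D (%z. G z (Ga z ?P ?P) ?Q) (at x) ?Q = ?D (%z. dmu z p q ?P) (at x) ?Q / 2"
  using FD_scale[OF open_V x smooth_dmu, of "inverse 2"] by simp
 moreover have "?D (%z. G z (Ga z ?P ?P) ?Q) (at x) ?Q = ?D (%z. G z (Ga x ?P ?P) ?Q) (at x) ?Q + G x (?D (%z. Ga z ?P ?P) (at x) ?Q) ?Q"
  by (rule D_product_G[OF x smooth_christoffel])
 moreover have "?D (%z. G z (Ga x ?P ?P) ?Q) (at x) ?Q = dmu x f q ?Q / 2" unfolding PP by (rule D_G(1)[OF x])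
 ultimately have 2: "G x (?R ?P) ?Q = - (?D (%z. dmu z p q ?P) (at x) ?Q - dmu x f q ?Q) / 2"
  using linear_neg[OF linear_G(2)[OF x]] by (simp add: RP field_simps)
 have 3: "?D (%z. dmu z p q ?P) (at x) ?Q = ?D (%z. dmu z p q ?Q) (at x) ?P" by (rule FD_commute_real[OF open_V x smooth_mu])
 have 4: "dmu x f q ?Q = dmu x p g ?P"
  using Ga_vertical(2)[OF x, of f q q] Ga_horizontal(2)[OF x, of p p g] by (simp add: g_def f_def)
 have cp: "?D cpp (at y) (0, w) = - dmu y p w ?P" if y: "y : V" for y w
 proof -
  have "?D cpp (at y) (0, w) = ?D (%y. ?D (%y. ?D c (at y) (p, 0)) (at y) (0, w)) (at y) (p, 0)"
   unfolding cpp_def by (rule FD_commute_real[OF open_V y smooth_Dc])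
  also have "?D (%y. ?D (%y. ?D c (at y) (p, 0)) (at y) (0, w)) (at y) = ?D (%y. - 1 * mu y p w) (at y)"
   by (rule FD_cong[OF open_V y]) (simp add: mu_commute)
  finally show ?thesis using FD_scale[OF open_V y smooth_mu, of "- 1"] by simp
 qed
 have "?D (%y. ?D cpp (at y) ?Q) (at x) = ?D (%y. - 1 * dmu y p q ?P) (at x)" by (rule FD_cong[OF open_V x]) (simp add: cp)
 hence 5: "?D (%y. ?D cpp (at y) ?Q) (at x) ?Q = - ?D (%y. dmu y p q ?P) (at x) ?Q"
  using FD_scale[OF open_V x smooth_dmu, of "- 1"] by simp
 have "curvature_operator G x (wedge ?P ?Q) (wedge ?P ?Q) = 2 * (G x (?R ?Q) ?P - G x (?R ?P) ?Q)"
  by (rule curvature_operator_wedge[OF x])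
 also have "\<dots> = 2 * (?D (%z. dmu z p q ?Q) (at x) ?P - dmu x p g ?P)" unfolding 1 2 3 4 by (simp add: field_simps)
 also have "\<dots> = - 2 * (?D (%y. ?D cpp (at y) ?Q) (at x) ?Q - ?D cpp (at x) (0, g))" unfolding 5 3 cp[OF x] by simp
 finally show ?thesis .
qed

end

context submersion_data
begin

definition "coord_cost a b x = cost M (chart_inv a (fst x)) (chart_inv b (snd x))"

text \<open>The gradient formula reduces the mixed Hessian to the derivative of \<open>L\<close> in
  the second variable, and bijectivity of that derivative becomes nondegeneracy of
  \<open>h\<close>.\<close>

lemma coord_cost_log_coordinates:
 assumes a: "a : atlas M" and b: "b : atlas M" and L: "log_coordinates a b V L"
 shows "smooth_on V (coord_cost a b)"
  and "x : V ==> FD (coord_cost a b) (at x) (ze, 0) = - metric M a (fst x) (L x) ze"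
  and "x : V ==> mixed_hessian (coord_cost a b) x p q = metric M a (fst x) (FD (%w. L (fst x, w)) (at (snd x)) q) p"
  and "nondegenerate_cost (coord_cost a b) V"
  and "x : V ==> cost_metric M a b x = product_cost_metric (coord_cost a b) x"
proof -
 let ?c = "coord_cost a b" and ?D = FD
 have V: "open V" "V \<subseteq> chart_image a \<times> chart_image b" "smooth_on V L" using L by (auto simp: log_coordinates_def)
 have fa: "fst ` V \<subseteq> chart_image a" using V(2) by auto
 have ceq: "?c x = metric M a (fst x) (L x) (L x) / 2" if "x : V" for x
  using L that unfolding log_coordinates_def coord_cost_def by (cases x) auto
 show smc: "smooth_on V ?c"
 proof -
  have "smooth_on V (%x. inverse 2 * metric M a (fst x) (L x) (L x))"
   by (intro smooth_on_mult smooth_on_const smooth_on_metric[OF a] V smooth_on_fst smooth_on_id fa)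
  moreover have "smooth_on V ?c \<longleftrightarrow> smooth_on V (%x. inverse 2 * metric M a (fst x) (L x) (L x))"
   by (rule smooth_on_cong[OF V(1)]) (simp add: ceq)
  ultimately show ?thesis by blast
 qed
 show grad: "?D ?c (at x) (ze, 0) = - metric M a (fst x) (L x) ze" if "x : V" for x ze
 proof -
  obtain z z' where x: "x = (z, z')" by (cases x)
  have zz: "(z, z') : V" using that x by simp
  from frechet_derivative_at[OF FD_slice(1)[OF V(1) zz smc]]
  have "?D ?c (at x) (ze, 0) = ?D (%w. ?c (w, z')) (at z) ze" unfolding x by (rule fun_cong)
  also have "\<dots> = - metric M a z (L (z, z')) ze" using L zz unfolding log_coordinates_def coord_cost_def by simp
  finally show ?thesis by (simp add: x)
 qed
 have smD: "smooth_on V (%y. ?D ?c (at y) v)" for v by (rule smooth_on_FD[OF smc])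
 show mix: "mixed_hessian ?c x p q = metric M a (fst x) (?D (%w. L (fst x, w)) (at (snd x)) q) p" if "x : V" for x p q
 proof -
  obtain z z' where x: "x = (z, z')" by (cases x)
  have zz: "(z, z') : V" using that x by simp
  have zc: "z : chart_image a" using fa zz by force
  have "mixed_hessian ?c x p q = - ?D (%y. ?D ?c (at y) (p, 0)) (at x) (0, q)"
   unfolding mixed_hessian_def using FD_commute_real[OF V(1) that smc] by simp
  also have "\<dots> = - ?D (%w. ?D ?c (at (z, w)) (p, 0)) (at z') q"
   unfolding x using fun_cong[OF frechet_derivative_at[OF FD_slice(2)[OF V(1) zz smD]]] by simp
  also have "?D (%w. ?D ?c (at (z, w)) (p, 0)) (at z') = ?D (%w. - metric M a z (L (z, w)) p) (at z')"
  proof (rule FD_cong)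
   show "open ((%w. (z, w)) -` V)" by (rule open_vimage[OF V(1)]) (intro continuous_intros)
   show "z' : (%w. (z, w)) -` V" using zz by simp
   show "?D ?c (at (z, w)) (p, 0) = - metric M a z (L (z, w)) p" if "w : (%w. (z, w)) -` V" for w
    using grad[of "(z, w)"] that by simp
  qed
  also have "\<dots> = (%v. - metric M a z (?D (%w. L (z, w)) (at z') v) p)"
  proof (rule frechet_derivative_at[symmetric])
   have "linear (%u. - metric M a z u p)" by (rule linearI) (simp_all add: metric_simps[OF a zc])
   hence "bounded_linear (%u. - metric M a z u p)" using linear_conv_bounded_linear by blast
   moreover have "((%w. L (z, w)) has_derivative ?D (%w. L (z, w)) (at z')) (at z')"
    using FD_slice(2)[OF V(1) zz V(3)] frechet_derivative_works differentiableI by blast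
   ultimately show "((%w. - metric M a z (L (z, w)) p) has_derivative (%v. - metric M a z (?D (%w. L (z, w)) (at z') v) p)) (at z')"
    by (rule bounded_linear.has_derivative)
  qed
  finally show ?thesis by (simp add: x)
 qed
 have bij: "bij (?D (%w. L (fst x, w)) (at (snd x)))" if "x : V" for x
  using L that unfolding log_coordinates_def by (cases x) simp
 show "nondegenerate_cost ?c V"
 proof
  fix x assume x: "x : V"
  have zc: "fst x : chart_image a" using fa x by blast
  let ?A = "?D (%w. L (fst x, w)) (at (snd x))"
  show "p = 0" if "!!q. mixed_hessian ?c x p q = 0" for p
  proof (rule metric_eqI[OF a zc])
   fix v obtain q where "v = ?A q" using bij_is_surj[OF bij[OF x]] unfolding surj_def by blast
   thus "metric M a (fst x) p v = metric M a (fst x) 0 v"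
    using that[of q] mix[OF x] metric_commute[OF a zc, of p] by (simp add: metric_simps[OF a zc])
  qed
  have linA: "linear ?A"
  proof -
   obtain z z' where xz: "x = (z, z')" by (cases x)
   have "(%w. L (z, w)) differentiable (at z')" using FD_slice(2)[OF V(1) _ V(3)] x xz differentiableI by blast
   thus ?thesis using linear_frechet_derivative xz by auto
  qed
  show "q = 0" if "!!p. mixed_hessian ?c x p q = 0" for q
  proof -
   have "?A q = 0" by (rule metric_eqI[OF a zc]) (use that mix[OF x] in \<open>simp add: metric_simps[OF a zc]\<close>)
   thus ?thesis using linear_injective_0[OF linA] bij_is_inj[OF bij[OF x]] by blast
  qed
 qed (use V smc in auto)
 show "cost_metric M a b x = product_cost_metric ?c x" if "x : V"
 proof -
  obtain z z' where x: "x = (z, z')" by (cases x)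
  have zz: "(z, z') : V" using that x by simp
  have "?D (%w. ?D (%w'. cost M (chart_inv a w) (chart_inv b w')) (at z') v) (at z) u = - mixed_hessian ?c x u v" for u v
  proof -
   have "?D (%w. ?D (%w'. cost M (chart_inv a w) (chart_inv b w')) (at z') v) (at z) = ?D (%w. ?D ?c (at (w, z')) (0, v)) (at z)"
   proof (rule FD_cong)
    show "open ((%w. (w, z')) -` V)" by (rule open_vimage[OF V(1)]) (intro continuous_intros)
    show "z : (%w. (w, z')) -` V" using zz by simp
    show "?D (%w'. cost M (chart_inv a w) (chart_inv b w')) (at z') v = ?D ?c (at (w, z')) (0, v)" if "w : (%w. (w, z')) -` V" for w
     using fun_cong[OF frechet_derivative_at[OF FD_slice(2)[OF V(1) _ smc]], of w z' v] that by (simp add: coord_cost_def)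
   qed
   moreover have "?D (%w. ?D ?c (at (w, z')) (0, v)) (at z) u = ?D (%y. ?D ?c (at y) (0, v)) (at (z, z')) (u, 0)"
    using fun_cong[OF frechet_derivative_at[OF FD_slice(1)[OF V(1) zz smD]]] by simp
   ultimately show ?thesis by (simp add: mixed_hessian_def x)
  qed
  thus ?thesis by (auto simp: fun_eq_iff cost_metric_def product_cost_metric_def x Let_def)
 qed
qed

end

section \<open>Cross-curvature and time-convexity\<close>

text \<open>If \<open>D\<close> were positive, \<open>f t + f (- t)\<close> would increase strictly
  for small positive \<open>t\<close>, because its derivative \<open>f' t - f' (- t)\<close> would
  be positive there.\<close>

lemma second_derivative_nonpos:
 fixes f :: "real => real"
 assumes e: "0 < e" and f: "!!t. \<bar>t\<bar> < e ==> (f has_real_derivative f' t) (at t)" and f': "(f' has_real_derivative D) (at 0)"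
  and le: "!!t. 0 < t ==> t < e ==> f t + f (- t) <= 2 * f 0"
 shows "D <= 0"
proof (rule ccontr)
 assume "\<not> D <= 0"
 have "((%t. f' t - f' (- t)) has_real_derivative D - D * (- 1)) (at 0)"
 proof (rule DERIV_diff[OF f'])
  have "(uminus has_real_derivative - 1) (at 0)" by (auto intro!: derivative_eq_intros)
  thus "((%t. f' (- t)) has_real_derivative D * - 1) (at 0)"
   by (rule DERIV_chain2[where f=f' and g=uminus and x=0 and s=UNIV, rotated]) (use f' in simp)
 qed
 from DERIV_pos_inc_right[OF this] obtain d where d: "0 < d" "!!h. 0 < h ==> h < d ==> 0 < f' h - f' (- h)"
  using \<open>\<not> D <= 0\<close> by auto
 define h where "h = min d e / 2"
 have h: "0 < h" "h < d" "h < e" using d(1) e by (auto simp: h_def)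
 have "f 0 + f (- 0) < f h + f (- h)"
 proof (rule DERIV_pos_imp_increasing_open[where f="%t. f t + f (- t)", OF h(1)])
  have D: "((%t. f t + f (- t)) has_real_derivative f' t - f' (- t)) (at t)" if "\<bar>t\<bar> < e" for t
  proof -
   have "(uminus has_real_derivative - 1) (at t)" by (auto intro!: derivative_eq_intros)
   hence "((%t. f (- t)) has_real_derivative f' (- t) * - 1) (at t)"
    by (rule DERIV_chain2[where f=f and g=uminus and x=t and s=UNIV, rotated]) (use f[of "- t"] that in simp)
   from DERIV_add[OF f[OF that] this] show ?thesis by simp
  qed
  show "EX y. ((%t. f t + f (- t)) has_real_derivative y) (at t) & 0 < y" if "0 < t" "t < h" for t
   using D[of t] d(2)[of t] that h by (intro exI[of _ "f' t - f' (- t)"]) auto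
  show "continuous_on {0..h} (%t. f t + f (- t))"
   using D h by (intro continuous_at_imp_continuous_on ballI DERIV_isCont) force
 qed
 thus False using le[OF h(1,3)] by simp
qed

text \<open>The derivatives given near each time are glued by \<open>vector_derivative\<close>,
  which is unique within the interval, end points included; the glued derivative \<open>g\<close> is
  then constant.\<close>

lemma affine_if_second_derivative_0:
 fixes f :: "real => real"
 assumes f: "!!t. t : {0..1} ==> EX f'. eventually (%s. s : {0..1} --> (f has_vector_derivative f' s) (at s within {0..1})) (nhds t) &
   (f' has_vector_derivative 0) (at t within {0..1})"
  and t: "t : {0..1}"
 shows "f t = (1 - t) * f 0 + t * f 1"
proof -
 let ?J = "{0..1::real}"
 have nb: "at t within ?J ~= bot" if "t : ?J" for t
  using that by (simp add: at_within_Icc_at_right at_within_Icc_at_left trivial_limit_within islimpt_Icc)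
 define g where "g = (%t. vector_derivative f (at t within ?J))"
 have df: "(f has_vector_derivative g t) (at t within ?J)" and dg: "(g has_vector_derivative 0) (at t within ?J)" if t: "t : ?J" for t
 proof -
  obtain f' where f': "eventually (%s. s : ?J --> (f has_vector_derivative f' s) (at s within ?J)) (nhds t)"
   "(f' has_vector_derivative 0) (at t within ?J)" using f[OF t] by blast
  have ev: "eventually (%s. s : ?J --> g s = f' s) (nhds t)" using f'(1)
  proof eventually_elim
   case (elim s)
   show ?case unfolding g_def using vector_derivative_within[OF nb] elim by blast
  qed
  have gt: "g t = f' t" using eventually_nhds_x_imp_x[OF ev] t by simp
  show "(f has_vector_derivative g t) (at t within ?J)" using eventually_nhds_x_imp_x[OF f'(1)] t gt by simp
  have ev': "eventually (%s. f' s = g s) (at t within ?J)" using ev unfolding eventually_at_filter by eventually_elim auto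
  show "(g has_vector_derivative 0) (at t within ?J)"
   using has_derivative_transform_eventually[OF f'(2)[unfolded has_vector_derivative_def] ev' _ t] gt
   by (simp add: has_vector_derivative_def)
 qed
 obtain C where C: "!!t. t : ?J ==> g t = C" using has_vector_derivative_zero_constant[of ?J g] dg by auto
 have "((%t. f t - t * C) has_vector_derivative 0) (at t within ?J)" if t: "t : ?J" for t
 proof -
  have "((%t. f t - t *R C) has_vector_derivative g t - C) (at t within ?J)"
   by (intro has_vector_derivative_diff df t) (auto intro!: derivative_eq_intros)
  thus ?thesis by (simp add: C[OF t])
 qed
 then obtain c where "!!t. t : ?J ==> f t - t * C = c"
  using has_vector_derivative_zero_constant[of ?J "%t. f t - t * C"] by auto
 from this[OF t] this[of 0] this[of 1] show ?thesis by (simp add: algebra_simps)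
qed

text \<open>The chain rule with a moving direction \<open>w s\<close>. The expansion over
  \<open>Basis\<close> is valid while the curve is in \<open>V\<close>, that is for times near
  \<open>t\<close>, hence the transfer by an eventual equality.\<close>

lemma FD_along_curve:
 fixes f :: "'a::euclidean_space => real"
 assumes V: "open V" "ga t : V" and f: "smooth_on V f" and t: "t : J"
  and d: "(ga has_vector_derivative ga') (at t within J)" "(w has_vector_derivative w') (at t within J)"
 shows "((%s. FD f (at (ga s)) (w s)) has_vector_derivative
  FD (%x. FD f (at x) (w t)) (at (ga t)) ga' + FD f (at (ga t)) w') (at t within J)"
proof -
 let ?D = FD
 have lin: "linear (?D f (at x))" if "x : V" for x using smooth_on_deriv[OF f V(1) that] has_derivative_linear by blast
 have sm: "smooth_on V (%x. ?D f (at x) v)" for v by (rule smooth_on_FD[OF f])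
 have dD: "((%s. ?D f (at (ga s)) e) has_real_derivative ?D (%x. ?D f (at x) e) (at (ga t)) ga') (at t within J)" for e
 proof -
  note dx = smooth_on_deriv[OF sm V, of e]
  from has_derivative_compose[OF d(1)[unfolded has_vector_derivative_def] dx]
  show ?thesis using linear_cmul[OF has_derivative_linear[OF dx]]
   by (simp add: has_field_derivative_def mult.commute[of _ "?D (%x. ?D f (at x) e) (at (ga t)) ga'"] fun_eq_iff)
 qed
 have dw: "((%s. w s *. e) has_real_derivative w' *. e) (at t within J)" for e
  unfolding has_real_derivative_iff_has_vector_derivative
  by (rule bounded_linear.has_vector_derivative[OF bounded_linear_inner_left d(2)])
 have "((%s. \<Sum>e\<in>Basis. (w s *. e) * ?D f (at (ga s)) e) has_real_derivative
   (\<Sum>e\<in>Basis. (w' *. e) * ?D f (at (ga t)) e + ?D (%x. ?D f (at x) e) (at (ga t)) ga' * (w t *. e))) (at t within J)"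
  by (intro DERIV_sum DERIV_mult dw dD)
 hence "((%s. \<Sum>e\<in>Basis. (w s *. e) * ?D f (at (ga s)) e) has_vector_derivative
   (\<Sum>e\<in>Basis. (w' *. e) * ?D f (at (ga t)) e + ?D (%x. ?D f (at x) e) (at (ga t)) ga' * (w t *. e))) (at t within J)"
  by (simp only: has_real_derivative_iff_has_vector_derivative)
 moreover have ex: "?D f (at x) v = (\<Sum>e\<in>Basis. (v *. e) * ?D f (at x) e)" if "x : V" for x v
  using linear_basis_expansion[OF lin[OF that], of v] by simp
 have "linear (%v. ?D (%x. ?D f (at x) v) (at (ga t)) ga')"
  by (rule linear_FD_parameter[OF V smooth_on_diffable[OF sm V] lin])
 from linear_basis_expansion[OF this, of "w t"]
 have "?D (%x. ?D f (at x) (w t)) (at (ga t)) ga' = (\<Sum>e\<in>Basis. (w t *. e) * ?D (%x. ?D f (at x) e) (at (ga t)) ga')" by simp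
 hence "(\<Sum>e\<in>Basis. (w' *. e) * ?D f (at (ga t)) e + ?D (%x. ?D f (at x) e) (at (ga t)) ga' * (w t *. e))
  = ?D (%x. ?D f (at x) (w t)) (at (ga t)) ga' + ?D f (at (ga t)) w'"
  using ex[OF V(2), of w'] by (simp add: sum.distrib mult.commute)
 moreover have "eventually (%s. (\<Sum>e\<in>Basis. (w s *. e) * ?D f (at (ga s)) e) = ?D f (at (ga s)) (w s)) (at t within J)"
 proof -
  have "(ga \<longlongrightarrow> ga t) (at t within J)"
   using has_vector_derivative_continuous[OF d(1)] by (simp add: continuous_within)
  from topological_tendstoD[OF this V] show ?thesis by eventually_elim (rule ex[symmetric])
 qed
 ultimately show ?thesis unfolding has_vector_derivative_def
  using has_derivative_transform_eventually[of "%s. \<Sum>e\<in>Basis. (w s *. e) * ?D f (at (ga s)) e" _ t J "%s. ?D f (at (ga s)) (w s)"]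
   ex[OF V(2), of "w t"] t by simp
qed

lemma has_derivative_along_curve:
 fixes f :: "'a::euclidean_space => real"
 assumes V: "open V" "ga t : V" and f: "smooth_on V f" and d: "(ga has_vector_derivative ga') (at t within J)"
 shows "((%s. f (ga s)) has_vector_derivative FD f (at (ga t)) ga') (at t within J)"
proof -
 note df = smooth_on_deriv[OF f V]
 from has_derivative_compose[OF d[unfolded has_vector_derivative_def] df]
 show ?thesis using linear_cmul[OF has_derivative_linear[OF df]] by (simp add: has_vector_derivative_def)
qed

context submersion_data
begin

lemma off_cut_locus_minimizer:
 assumes xy: "(x, y) : off_cut_locus M" and p: "p : S" "pr p = x"
 obtains u where "u : tan p" "u : hor p" "pr (pexp p u) = y" "norm u = d x y" "norm u <= d (pr p) (pr (pexp p u))" "pr (pexp p u) \<notin> cut_locus M (pr p)"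
proof -
 have y: "y : topspace (man_top M)" "y \<notin> cut_locus M x" using xy by (auto simp: off_cut_locus_def)
 obtain u where u: "u : tan p" "pr (pexp p u) = y" "norm u = d (pr p) y" using minimizer_exists[OF p(1) y(1)] by blast
 have "u : hor p" by (rule minimizer_horizontal[OF p(1) u(1)]) (simp add: u)
 thus ?thesis using that[of u] u y p(2) by simp
qed

text \<open>The vertical geodesic is explicit: the targets \<open>et t\<close> of the velocities
  \<open>xi0 + t *R om\<close>. By convexity, the second difference in \<open>t\<close> of the cost
  from a point \<open>z\<close> is largest at \<open>z = z0\<close>. Two derivatives in
  \<open>z\<close> and two in \<open>t\<close> give the sign.\<close>

theorem cross_curvature_nonneg:
 assumes xy: "(x, y) : off_cut_locus M" and a: "a : atlas M" "x : fst a" and b: "b : atlas M" "y : fst b"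
 shows "0 <= cross_curvature M a b x y P Q"
proof -
 have "x : topspace (man_top M)" using xy by (auto simp: off_cut_locus_def)
 then obtain p where p: "p : S" "pr p = x" using ex_fibre by blast
 have pU: "p : U a" using in_U[OF p(1)] p(2) a(2) by simp
 obtain u where u: "u : tan p" "u : hor p" "pr (pexp p u) = y" "norm u = d x y" "norm u <= d (pr p) (pr (pexp p u))"
  "pr (pexp p u) \<notin> cut_locus M (pr p)" by (rule off_cut_locus_minimizer[OF xy p]) (rule that)
 have qS: "pexp p u : S" by (rule pexp_in_S[OF p(1) u(1)])
 have qU: "pexp p u : U b" using in_U[OF qS] u(3) b(2) by simp
 obtain V L X where L: "log_coordinates a b V L" "(F a p, F b (pexp p u)) : V"
  and X: "open X" "DF a p u : X" "!!xi. xi : X ==> pexp p (lam a p xi) : U b & (F a p, F b (pexp p (lam a p xi))) : V & L (F a p, F b (pexp p (lam a p xi))) = xi"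
  by (rule ex_log_coordinates[OF p(1) u(1,5,6) a(1) pU b(1) qU]) (rule that)
 define c where "c = coord_cost a b"
 note cl = coord_cost_log_coordinates[OF a(1) b(1) L(1), folded c_def]
 interpret nondegenerate_cost c V by (rule cl(4))
 let ?D = FD
 define z0 where "z0 = F a p"
 define xi0 where "xi0 = DF a p u"
 have lu: "lam a p xi0 = u" unfolding xi0_def by (rule lam_eqI[OF a(1) p(1) pU u(2)])
 define y0 where "y0 = F b (pexp p u)"
 have x0: "(z0, y0) : V" using L(2) by (simp add: z0_def y0_def)
 have z0c: "z0 : chart_image a" unfolding z0_def by (rule F_in[OF pU])
 have V: "open V" "V \<subseteq> chart_image a \<times> chart_image b" "smooth_on V L" using L(1) by (auto simp: log_coordinates_def)
 define DL where "DL = (%w. ?D (%w. L (z0, w)) (at w))"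
 \<comment> \<open>The image of \<open>Q\<close> under the derivative of \<open>L\<close> in the
   second variable, so that the curve of targets starts with velocity \<open>Q\<close>.\<close>
 define om where "om = DL y0 Q"
 define T where "T = (%t. xi0 + t *R om) -` X"
 have oT: "open T" unfolding T_def by (rule open_vimage[OF X(1)]) (intro continuous_intros)
 have T0: "0 : T" using X(2) by (simp add: T_def xi0_def)
 define et where "et = (%t. F b (pexp p (lam a p (xi0 + t *R om))))"
 have et: "pexp p (lam a p (xi0 + t *R om)) : U b" "(z0, et t) : V" "L (z0, et t) = xi0 + t *R om" if "t : T" for t
  using X(3)[of "xi0 + t *R om"] that by (auto simp: T_def et_def z0_def)
 have et0: "et 0 = y0" by (simp add: et_def lu y0_def)
 have smet: "smooth_on T et"
 proof -
  have "smooth_on T (%t. pexp p (lam a p (xi0 + t *R om)))"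
   by (intro smooth_on_pexp_const smooth_on_lam_const[OF a(1) p(1) pU] smooth_on_add smooth_on_scaleR smooth_on_const smooth_on_id oT)
  from smooth_on_compose[OF oT open_U[OF b(1)] _ this smooth_on_F[OF b(1)]] et(1) show ?thesis unfolding et_def by blast
 qed
 have vd: "(f has_vector_derivative ?D f (at t) 1) (at t)" if "smooth_on T f" "t : T" for f :: "real => 'e" and t
 proof -
  note df = smooth_on_deriv[OF that(1) oT that(2)]
  have "?D f (at t) s = s *R ?D f (at t) 1" for s using linear_cmul[OF has_derivative_linear[OF df], of s 1] by simp
  thus ?thesis unfolding has_vector_derivative_def by (intro has_derivative_eq_rhs[OF df] ext)
 qed
 define et' where "et' = (%t. ?D et (at t) 1)"
 define et'' where "et'' = ?D et' (at 0) 1"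
 have det: "(et has_vector_derivative et' t) (at t)" if "t : T" for t unfolding et'_def by (rule vd[OF smet that])
 have det': "(et' has_vector_derivative et'') (at 0)"
  unfolding et''_def by (rule vd[OF _ T0]) (simp add: et'_def smooth_on_FD[OF smet])
 define ga where "ga = (%t. (z0, et t))"
 have dga: "(ga has_vector_derivative (0, et' t)) (at t)" if "t : T" for t
  unfolding ga_def using det[OF that] by (intro has_vector_derivative_Pair has_vector_derivative_const)
 have gaV: "ga t : V" if "t : T" for t using et(2)[OF that] by (simp add: ga_def)
 have ga0: "ga 0 = (z0, y0)" by (simp add: ga_def et0)
 have DLet: "DL (et t) (et' t) = om" if t: "t : T" for t
 proof (rule vector_derivative_unique_at)
  have "((%w. L (z0, w)) has_derivative DL (et t)) (at (et t))"
   unfolding DL_def using FD_slice(2)[OF V(1) et(2)[OF t] V(3)] frechet_derivative_works differentiableI by blast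
  from has_derivative_compose[OF det[OF t, unfolded has_vector_derivative_def] this]
  show "((%t. L (z0, et t)) has_vector_derivative DL (et t) (et' t)) (at t)"
   using linear_cmul[OF has_derivative_linear[OF \<open>((%w. L (z0, w)) has_derivative DL (et t)) (at (et t))\<close>]]
   by (simp add: has_vector_derivative_def)
  have "((%t. xi0 + t *R om) has_vector_derivative om) (at t)" by (auto intro!: derivative_eq_intros)
  thus "((%t. L (z0, et t)) has_vector_derivative om) (at t)"
   by (rule has_vector_derivative_transform_within_open[OF _ oT t]) (simp add: et(3))
 qed
 have "bij (DL y0)" using L(1) x0 unfolding log_coordinates_def DL_def by blast
 hence et'0: "et' 0 = Q" using DLet[OF T0] injD[OF bij_is_inj, of "DL y0"] by (simp add: om_def et0)
 have muga: "mu (ga t) r (et' t) = metric M a z0 om r" if "t : T" for t r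
  using cl(3)[OF gaV[OF that], of r "et' t"] DLet[OF that] by (simp add: ga_def DL_def)
 define g where "g = snd (Ga (z0, y0) (0, Q) (0, Q))"
 \<comment> \<open>The geodesic equation at time 0. As \<open>L\<close> is affine along the curve,
   the pairing \<open>mu (ga t) r (et' t)\<close> is constant in \<open>t\<close>, and
   differentiating it determines \<open>et''\<close>.\<close>
 have et''g: "et'' = - g"
 proof -
  have "mu (z0, y0) r (et'' + g) = 0" for r
  proof -
   let ?f = "%y. ?D c (at y) (r, 0)"
   have d0: "((%t. (0 :: 'e, et' t)) has_vector_derivative (0, et'')) (at 0)"
    using det' by (intro has_vector_derivative_Pair has_vector_derivative_const)
   have "((%t. ?D ?f (at (ga t)) (0, et' t)) has_vector_derivative
    ?D (%x. ?D ?f (at x) (0, et' 0)) (at (ga 0)) (0, et' 0) + ?D ?f (at (ga 0)) (0, et'')) (at 0)"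
    by (rule FD_along_curve[OF V(1) gaV[OF T0] smooth_Dc UNIV_I dga[OF T0] d0])
   moreover have "((%t. ?D ?f (at (ga t)) (0, et' t)) has_vector_derivative 0) (at 0)"
   proof (rule has_vector_derivative_transform_within_open[OF _ oT T0])
    show "((%t. - metric M a z0 om r) has_vector_derivative 0) (at 0)" by (rule has_vector_derivative_const)
    show "- metric M a z0 om r = ?D ?f (at (ga t)) (0, et' t)" if "t : T" for t
     using muga[OF that, of r] mu_commute[OF gaV[OF that]] by simp
   qed
   ultimately have "?D (%x. ?D ?f (at x) (0, Q)) (at (z0, y0)) (0, Q) + ?D ?f (at (z0, y0)) (0, et'') = 0"
    unfolding ga0 et'0 by (rule vector_derivative_unique_at)
   moreover have "?D (%x. ?D ?f (at x) (0, Q)) (at (z0, y0)) (0, Q) = - dmu (z0, y0) r Q (0, Q)"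
   proof -
    have "?D (%x. ?D ?f (at x) (0, Q)) (at (z0, y0)) = ?D (%x. - 1 * mu x r Q) (at (z0, y0))"
     by (rule FD_cong[OF V(1) x0]) (simp add: mu_commute)
    thus ?thesis using FD_scale[OF V(1) x0 smooth_mu, of "- 1"] by simp
   qed
   ultimately show ?thesis
    using Ga_vertical(2)[OF x0, of r Q Q] mu_commute[OF x0, of r et''] by (simp add: mu_simps[OF x0] g_def)
  qed
  hence "et'' + g = 0" by (rule nondegenerate_right[OF x0])
  thus ?thesis by (simp add: add_eq_0_iff2)
 qed
 define cpp where "cpp = (%y. ?D (%y. ?D c (at y) (P, 0)) (at y) (P, 0))"
 have smcpp: "smooth_on V cpp" unfolding cpp_def by (rule smooth_on_FD[OF smooth_Dc])
 \<comment> \<open>The second difference in time \<open>m s\<close>, taken with the first variable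
   moved by \<open>s *R P\<close>, is largest at \<open>s = 0\<close>; its second derivative there
   is the second difference of \<open>cpp\<close>.\<close>
 have mid: "cpp (ga h) + cpp (ga (- h)) <= 2 * cpp (ga 0)" if h: "h : T" "- h : T" for h
 proof -
  define be where "be = (%t s. (z0 + s *R P, et t))"
  define m where "m = (%s. c (be h s) + c (be (- h) s) - 2 * c (be 0 s))"
  define m' where "m' = (%s. ?D c (at (be h s)) (P, 0) + ?D c (at (be (- h) s)) (P, 0) - 2 * ?D c (at (be 0 s)) (P, 0))"
  have obe: "open (be t -` V)" for t unfolding be_def by (rule open_vimage[OF V(1)]) (intro continuous_intros)
  have be0: "be t 0 = ga t" for t by (simp add: be_def ga_def)
  have "open (be h -` V \<inter> be (- h) -` V \<inter> be 0 -` V)" using obe by (intro open_Int)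
  moreover have "0 : be h -` V \<inter> be (- h) -` V \<inter> be 0 -` V" using be0 gaV h T0 by simp
  ultimately obtain e where e: "0 < e" "!!s. dist s 0 < e ==> s : be h -` V \<inter> be (- h) -` V \<inter> be 0 -` V"
   unfolding open_dist by blast
  have beV: "be h s : V" "be (- h) s : V" "be 0 s : V" if "\<bar>s\<bar> < e" for s using e(2)[of s] that by auto
  have dbe: "(be t has_vector_derivative (P, 0)) (at s)" for t s
   unfolding be_def by (intro has_vector_derivative_Pair has_vector_derivative_const) (auto intro!: derivative_eq_intros)
  have dc: "((%s. c (be t s)) has_real_derivative ?D c (at (be t s)) (P, 0)) (at s)" if "be t s : V" for t s
   unfolding has_real_derivative_iff_has_vector_derivative by (rule has_derivative_along_curve[OF V(1) that smooth_c dbe])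
  have dDc: "((%s. ?D c (at (be t s)) (P, 0)) has_real_derivative cpp (be t s)) (at s)" if "be t s : V" for t s
   unfolding has_real_derivative_iff_has_vector_derivative cpp_def
   by (rule has_derivative_along_curve[OF V(1) that smooth_Dc dbe])
  define v where "v = (%t. lam a p (xi0 + t *R om))"
  have vt: "v t : tan p" for t unfolding v_def by (rule lam_in_tan[OF a(1) p(1) pU])
  have linl: "linear (lam a p)" by (rule linear_lam[OF a(1) p(1) pU])
  have half: "(1 - 1 / 2) *R v h + (1 / 2) *R v (- h) = v 0"
   by (simp add: v_def linear_add[OF linl] linear_cmul[OF linl] linear_diff[OF linl] algebra_simps flip: scaleR_add_left)
  have cz: "c (z, et t) = (d (chart_inv a z) (pr (pexp p (v t))))\<^sup>2 / 2" if "t : T" for z t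
   using chart_inv_F[OF b(1) pexp_in_S[OF p(1) vt] , of t] et(1)[OF that]
   by (simp add: c_def coord_cost_def cost_def et_def v_def)
  have cx: "c (z0, et t) = (norm (v t))\<^sup>2 / 2" if t: "t : T" for t
  proof -
   have "c (z0, et t) = metric M a z0 (L (z0, et t)) (L (z0, et t)) / 2"
    using L(1) et(2)[OF t] unfolding log_coordinates_def c_def coord_cost_def by simp
   thus ?thesis unfolding et(3)[OF t] v_def using norm_lam[OF a(1) p(1) pU] by (simp add: z0_def)
  qed
  have mle: "m s <= m 0" if s: "\<bar>s\<bar> < e" for s
  proof -
   let ?z = "chart_inv a (z0 + s *R P)"
   have "z0 + s *R P : chart_image a" using beV(3)[OF s] V(2) by (auto simp: be_def)
   hence zt: "?z : topspace (man_top M)" by (rule subsetD[OF chart_subset_topspace[OF a(1)] chart_chart_inv(1)])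
   let ?f = "%t. (norm (v t))\<^sup>2 - (d ?z (pr (pexp p (v t))))\<^sup>2"
   have conv: "?f 0 <= (1 - 1 / 2) * ?f h + 1 / 2 * ?f (- h)"
    using d_convexity[OF p(1) zt vt[of h] vt[of "- h"], of "1 / 2"] unfolding half by simp
   have eqs: "c (be t s) = (d ?z (pr (pexp p (v t))))\<^sup>2 / 2" "c (be t 0) = (norm (v t))\<^sup>2 / 2" if "t : T" for t
    using cz[OF that, of "z0 + s *R P"] cx[OF that] by (simp_all add: be_def)
   show ?thesis unfolding m_def eqs(1)[OF h(1)] eqs(1)[OF h(2)] eqs(1)[OF T0] eqs(2)[OF h(1)] eqs(2)[OF h(2)] eqs(2)[OF T0]
    using conv by (simp add: field_simps)
  qed
  have "cpp (be h 0) + cpp (be (- h) 0) - 2 * cpp (be 0 0) <= 0"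
  proof (rule second_derivative_nonpos[OF e(1)])
   show "(m has_real_derivative m' s) (at s)" if "\<bar>s\<bar> < e" for s
    unfolding m_def m'_def by (intro DERIV_add DERIV_diff DERIV_cmult dc beV that)
   show "(m' has_real_derivative cpp (be h 0) + cpp (be (- h) 0) - 2 * cpp (be 0 0)) (at 0)"
    unfolding m'_def by (intro DERIV_add DERIV_diff DERIV_cmult dDc beV) (use e in auto)
   show "m s + m (- s) <= 2 * m 0" if "0 < s" "s < e" for s using mle[of s] mle[of "- s"] that by simp
  qed
  thus ?thesis by (simp add: be0)
 qed
 define k2 where "k2 = ?D (%x. ?D cpp (at x) (0, Q)) (at (z0, y0)) (0, Q) + ?D cpp (at (z0, y0)) (0, - g)"
 have "k2 <= 0"
 proof -
  have "open (T \<inter> uminus -` T)" using oT by (intro open_Int open_vimage continuous_intros)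
  moreover have "0 : T \<inter> uminus -` T" using T0 by simp
  ultimately obtain e where e: "0 < e" "!!t. dist t 0 < e ==> t : T \<inter> uminus -` T" unfolding open_dist by blast
  show ?thesis
  proof (rule second_derivative_nonpos[OF e(1)])
   show "((%t. cpp (ga t)) has_real_derivative ?D cpp (at (ga t)) (0, et' t)) (at t)" if "\<bar>t\<bar> < e" for t
   proof -
    have tT: "t : T" using e(2)[of t] that by simp
    show ?thesis
     unfolding has_real_derivative_iff_has_vector_derivative by (rule has_derivative_along_curve[OF V(1) gaV[OF tT] smcpp dga[OF tT]])
   qed
   have d0: "((%t. (0 :: 'e, et' t)) has_vector_derivative (0, - g)) (at 0)"
    using det' unfolding et''g by (intro has_vector_derivative_Pair has_vector_derivative_const)
   show "((%t. ?D cpp (at (ga t)) (0, et' t)) has_real_derivative k2) (at 0)"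
    unfolding has_real_derivative_iff_has_vector_derivative k2_def
    using FD_along_curve[OF V(1) gaV[OF T0] smcpp UNIV_I dga[OF T0] d0] by (simp only: ga0 et'0)
   show "cpp (ga t) + cpp (ga (- t)) <= 2 * cpp (ga 0)" if "0 < t" "t < e" for t using mid[of t] e(2)[of t] that by simp
  qed
 qed
 have lin: "linear (?D cpp (at (z0, y0)))" using smooth_on_deriv[OF smcpp V(1) x0] has_derivative_linear by blast
 have "?D cpp (at (z0, y0)) (0, - g) = - ?D cpp (at (z0, y0)) (0, g)" using linear_neg[OF lin, of "(0, g)"] by simp
 hence k2: "?D (%x. ?D cpp (at x) (0, Q)) (at (z0, y0)) (0, Q) - ?D cpp (at (z0, y0)) (0, g) <= 0"
  using \<open>k2 <= 0\<close> by (simp add: k2_def)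
 have xy0: "(snd a x, snd b y) = (z0, y0)" using F_S[OF p(1), of a] F_S[OF qS, of b] p(2) u(3) by (simp add: z0_def y0_def)
 have "cross_curvature M a b x y P Q = curvature_operator G (z0, y0) (wedge (P, 0) (0, Q)) (wedge (P, 0) (0, Q))"
  unfolding cross_curvature_def xy0 using curvature_operator_cong[OF V(1) x0 cl(5)] by simp
 also have "\<dots> = - 2 * (?D (%x. ?D cpp (at x) (0, Q)) (at (z0, y0)) (0, Q) - ?D cpp (at (z0, y0)) (0, g))"
  unfolding cpp_def g_def by (rule cross_curvature_formula[OF x0])
 finally show ?thesis using k2 by simp
qed

text \<open>Pairing the initial velocity of the minimizer to \<open>ze t\<close> with
  \<open>r\<close> gives minus the derivative of the cost in direction \<open>(r, 0)\<close>, and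
  the geodesic equation says that its second time derivative is 0. So the vectors \<open>u t\<close>
  are affine in time, and \<open>d_convexity\<close> applies to them.\<close>

theorem vertical_cost_geodesic_convexity:
 assumes geo: "vertical_cost_geodesic M x ze" and y: "y : topspace (man_top M)" and t: "t : {0..1}"
 shows "sliding_mountain M x ze t y <= (1 - t) * sliding_mountain M x ze 0 y + t * sliding_mountain M x ze 1 y"
proof -
 let ?D = FD and ?J = "{0..1::real}"
 have cont: "continuous_map (top_of_set ?J) (man_top M) ze" and off: "!!t. t : ?J ==> (x, ze t) : off_cut_locus M"
  and eq: "!!a b t. t : ?J ==> a : atlas M ==> b : atlas M ==> x : fst a ==> ze t : fst b ==>
   geodesic_equation_at (cost_metric M a b) ?J (%s. (snd a x, snd b (ze s))) t"
  using geo unfolding vertical_cost_geodesic_def by blast+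
 have "x : topspace (man_top M)" using off[of 0] by (auto simp: off_cut_locus_def)
 then obtain p where p: "p : S" "pr p = x" using ex_fibre by blast
 obtain a where a: "a : atlas M" "pr p : fst a" using ex_chart[OF p(1)] by blast
 have ax: "x : fst a" using a(2) p(2) by simp
 have pU: "p : U a" by (rule in_U[OF p(1) a(2)])
 have "EX u. t : ?J --> u : tan p & u : hor p & pr (pexp p u) = ze t & norm u = d x (ze t)" for t
 proof (cases "t : ?J")
  case True
  obtain u where "u : tan p" "u : hor p" "pr (pexp p u) = ze t" "norm u = d x (ze t)"
   by (rule off_cut_locus_minimizer[OF off[OF True] p]) (rule that)
  thus ?thesis by blast
 qed blast
 then obtain u where u: "!!t. t : ?J ==> u t : tan p" "!!t. t : ?J ==> u t : hor p" "!!t. t : ?J ==> pr (pexp p (u t)) = ze t"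
  "!!t. t : ?J ==> norm (u t) = d x (ze t)" by metis
 define z0 where "z0 = F a p"
 have z0: "snd a x = z0" using F_S[OF p(1), of a] p(2) by (simp add: z0_def)
 have z0c: "z0 : chart_image a" unfolding z0_def by (rule F_in[OF pU])
 have affine: "metric M a z0 (DF a p (u t)) r = (1 - t) * metric M a z0 (DF a p (u 0)) r + t * metric M a z0 (DF a p (u 1)) r" if t: "t : ?J" for t r
 proof (rule affine_if_second_derivative_0[where f="%t. metric M a z0 (DF a p (u t)) r", OF _ t])
  fix t assume t: "t : ?J"
  let ?K = "%t. metric M a z0 (DF a p (u t)) r"
  have qS: "pexp p (u t) : S" by (rule pexp_in_S[OF p(1) u(1)[OF t]])
  obtain b where b: "b : atlas M" "pr (pexp p (u t)) : fst b" using ex_chart[OF qS] by blast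
  have qU: "pexp p (u t) : U b" by (rule in_U[OF qS b(2)])
  have bze: "ze t : fst b" using b(2) u(3)[OF t] by simp
  have min: "norm (u t) <= d (pr p) (pr (pexp p (u t)))" using u(3,4)[OF t] p(2) by simp
  have cut: "pr (pexp p (u t)) \<notin> cut_locus M (pr p)" using off[OF t] u(3)[OF t] p(2) by (simp add: off_cut_locus_def)
  \<comment> \<open>Such coordinates exist only near each time and may use a different chart
    \<open>b\<close> each time; \<open>Lu\<close> ties them to the minimizers \<open>u\<close>,
    which were chosen once for all times.\<close>
  obtain V L where L: "log_coordinates a b V L" "(F a p, F b (pexp p (u t))) : V"
   and Lu: "!!z' v. (F a p, z') : V ==> v : tan p ==> pr (pexp p v) = chart_inv b z' ==> norm v = d (pr p) (chart_inv b z') ==> DF a p v = L (F a p, z')"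
   by (rule ex_log_coordinates[OF p(1) u(1)[OF t] min cut a(1) pU b(1) qU]) (rule that)
  define c where "c = coord_cost a b"
  note cl = coord_cost_log_coordinates[OF a(1) b(1) L(1), folded c_def]
  interpret nondegenerate_cost c V by (rule cl(4))
  have V: "open V" using L(1) by (simp add: log_coordinates_def)
  define ga where "ga = (%s. (z0, snd b (ze s)))"
  have "geodesic_equation_at (cost_metric M a b) ?J ga t" unfolding ga_def using eq[OF t a(1) b(1) ax bze] z0 by simp
  then obtain w where w: "eventually (%s. s : ?J --> (ga has_vector_derivative w s) (at s within ?J)) (nhds t)"
   "(w has_vector_derivative - christoffel (cost_metric M a b) (ga t) (w t) (w t)) (at t within ?J)"
   unfolding geodesic_equation_at_def by blast
  have gat: "ga t : V" using L(2) F_S[OF qS, of b] u(3)[OF t] by (simp add: ga_def z0_def)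
  have dgat: "(ga has_vector_derivative w t) (at t within ?J)" using eventually_nhds_x_imp_x[OF w(1)] t by simp
  have evV: "eventually (%s. s : ?J --> ga s : V) (nhds t)"
  proof -
   have "(ga \<longlongrightarrow> ga t) (at t within ?J)" using has_vector_derivative_continuous[OF dgat] by (simp add: continuous_within)
   from topological_tendstoD[OF this V gat] have "eventually (%s. s ~= t --> s : ?J --> ga s : V) (nhds t)"
    by (simp add: eventually_at_filter)
   thus ?thesis by eventually_elim (use gat in auto)
  qed
  have evb: "eventually (%s. s : ?J --> ze s : fst b) (nhds t)" by (rule eventually_in_chart[OF cont t bze b(1)])
  have nb: "at s within ?J ~= bot" if "s : ?J" for s by (rule at_within_Icc_not_bot[OF that])
  have w1: "fst (w s) = 0" if "s : ?J" "(ga has_vector_derivative w s) (at s within ?J)" for s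
  proof -
   have "((%s. fst (ga s)) has_vector_derivative fst (w s)) (at s within ?J)"
    by (rule bounded_linear.has_vector_derivative[OF bounded_linear_fst that(2)])
   hence "((%s. z0) has_vector_derivative fst (w s)) (at s within ?J)" by (simp add: ga_def)
   thus ?thesis using vector_derivative_within[OF nb[OF that(1)]] has_vector_derivative_const by metis
  qed
  have Kga: "?K s = - ?D c (at (ga s)) (r, 0)" if "s : ?J" "ga s : V" "ze s : fst b" for s
  proof -
   have "DF a p (u s) = L (ga s)"
    using Lu[of "snd b (ze s)" "u s"] that u[OF that(1)] chart_inv_chart[OF b(1) that(3)] p(2) by (simp add: ga_def z0_def)
   thus ?thesis using cl(2)[OF that(2), of r] by (simp add: ga_def)
  qed
  let ?f = "%y. ?D c (at y) (r, 0)"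
  define K' where "K' = (%s. - ?D ?f (at (ga s)) (w s))"
  have ev3: "eventually (%s. s : ?J --> ?K s = - ?f (ga s)) (nhds t)" using evV evb by eventually_elim (use Kga in auto)
  show "EX f'. eventually (%s. s : ?J --> (?K has_vector_derivative f' s) (at s within ?J)) (nhds t) &
   (f' has_vector_derivative 0) (at t within ?J)"
  proof (intro exI[of _ K'] conjI)
   show "eventually (%s. s : ?J --> (?K has_vector_derivative K' s) (at s within ?J)) (nhds t)"
    using eventually_eventually[THEN iffD2, OF ev3] evV w(1)
   proof eventually_elim
    case (elim s)
    show ?case
    proof
     assume s: "s : ?J"
     have "((%s. - ?f (ga s)) has_vector_derivative K' s) (at s within ?J)" unfolding K'_def using elim(2,3) s
      by (intro has_vector_derivative_minus has_derivative_along_curve[OF V _ smooth_Dc]) auto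
     moreover have "eventually (%s. - ?f (ga s) = ?K s) (at s within ?J)"
      using elim(1) unfolding eventually_at_filter by eventually_elim auto
     moreover have "- ?f (ga s) = ?K s" using eventually_nhds_x_imp_x[OF elim(1)] s by simp
     ultimately show "(?K has_vector_derivative K' s) (at s within ?J)"
      unfolding has_vector_derivative_def by (rule has_derivative_transform_eventually[OF _ _ _ s])
    qed
   qed
   define q where "q = snd (w t)"
   have wt: "w t = (0, q)" using w1[OF t dgat] by (simp add: q_def prod_eq_iff)
   define g where "g = snd (Ga (ga t) (0, q) (0, q))"
   have "christoffel (cost_metric M a b) (ga t) = Ga (ga t)" by (rule christoffel_cong[OF V gat cl(5)])
   moreover have "Ga (ga t) (w t) (w t) = (0, g)"
    unfolding wt using Ga_vertical(1)[OF gat, of q q] by (simp add: g_def prod_eq_iff)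
   ultimately have w': "(w has_vector_derivative (0, - g)) (at t within ?J)" using w(2) by simp
   have "(K' has_vector_derivative - (?D (%x. ?D ?f (at x) (w t)) (at (ga t)) (w t) + ?D ?f (at (ga t)) (0, - g))) (at t within ?J)"
    unfolding K'_def by (rule has_vector_derivative_minus[OF FD_along_curve[OF V gat smooth_Dc t dgat w']])
   moreover have "?D (%x. ?D ?f (at x) (w t)) (at (ga t)) (w t) = - dmu (ga t) r q (0, q)"
   proof -
    have "?D (%x. ?D ?f (at x) (0, q)) (at (ga t)) = ?D (%x. - 1 * mu x r q) (at (ga t))"
     by (rule FD_cong[OF V gat]) (simp add: mu_commute)
    thus ?thesis using FD_scale[OF V gat smooth_mu, of "- 1"] wt by simp
   qed
   \<comment> \<open>The defining equation of the vertical Christoffel symbol; the two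
     third-derivative terms cancel.\<close>
   moreover have "?D ?f (at (ga t)) (0, - g) = dmu (ga t) r q (0, q)"
    using mu_commute[OF gat, of r "- g"] Ga_vertical(2)[OF gat, of r q q] linear_neg[OF linear_mu(1)[OF gat], of r g]
    by (simp add: g_def)
   ultimately show "(K' has_vector_derivative 0) (at t within ?J)" by simp
  qed
 qed
 have "DF a p (u t) = (1 - t) *R DF a p (u 0) + t *R DF a p (u 1)"
  by (rule metric_eqI[OF a(1) z0c]) (simp add: affine[OF t] metric_simps[OF a(1) z0c])
 moreover have lu: "lam a p (DF a p (u s)) = u s" if "s : ?J" for s by (rule lam_eqI[OF a(1) p(1) pU u(2)[OF that]])
 ultimately have "u t = (1 - t) *R u 0 + t *R u 1"
  using lu[OF t] lu[of 0] lu[of 1] linear_add[OF linear_lam[OF a(1) p(1) pU]] linear_cmul[OF linear_lam[OF a(1) p(1) pU]] by simp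
 with d_convexity[OF p(1) y u(1)[of 0] u(1)[of 1], of t] t
 have "(norm (u t))\<^sup>2 - (d y (pr (pexp p (u t))))\<^sup>2 <= (1 - t) * ((norm (u 0))\<^sup>2 - (d y (pr (pexp p (u 0))))\<^sup>2)
  + t * ((norm (u 1))\<^sup>2 - (d y (pr (pexp p (u 1))))\<^sup>2)" by simp
 moreover have "(norm (u s))\<^sup>2 - (d y (pr (pexp p (u s))))\<^sup>2 = 2 * sliding_mountain M x ze s y" if "s : ?J" for s
  using u(3,4)[OF that] by (simp add: sliding_mountain_def cost_def)
 ultimately show ?thesis using t by simp
qed

theorem nonneg_cross_curved_time_convex: "nonneg_cross_curved M & time_convex_sliding_mountain M"
proof
 show "nonneg_cross_curved M" unfolding nonneg_cross_curved_def using cross_curvature_nonneg by blast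
 show "time_convex_sliding_mountain M" unfolding time_convex_sliding_mountain_def Let_def
 proof (intro allI impI ballI conjI)
  fix x ze y t assume a: "vertical_cost_geodesic M x ze" "y : topspace (man_top M)" "t : {0..1::real}"
  let ?f = "%t. sliding_mountain M x ze t y"
  show le: "?f t <= (1 - t) * ?f 0 + t * ?f 1" by (rule vertical_cost_geodesic_convexity[OF a])
  have "(1 - t) * ?f 0 + t * ?f 1 <= (1 - t) * max (?f 0) (?f 1) + t * max (?f 0) (?f 1)"
   using a(3) by (intro add_mono mult_left_mono) auto
  thus "?f t <= max (?f 0) (?f 1)" using le by (simp add: algebra_simps)
 qed
qed

end

theorem mainTheorem3:
  fixes B :: "'i::finite \<Rightarrow> nat" and k l :: nat and n :: "nat \<Rightarrow> nat" and r :: "nat \<Rightarrow> real"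
    and P :: "(real ^ 'i, 'd::euclidean_space) riemannian"
  assumes spheres: "\<And>j. j < k \<Longrightarrow> 1 \<le> n j \<and> card {i. B i = j} = n j + 1 \<and> 0 < r j"
    and euclidean: "card {i. k \<le> B i} = l"
    and dimension: "DIM('d) = (\<Sum>j<k. n j) + l"
    and P: "P = submanifold (spheres_times_euclidean B k r)"
  shows "(nonneg_cross_curved P \<and> time_convex_sliding_mountain P) \<and>
    (\<forall>(M :: ('m, 'e::euclidean_space) riemannian) \<pi>.
       riemannian_manifold M \<and> riemannian_submersion P M \<pi> \<longrightarrow>
       nonneg_cross_curved M \<and> time_convex_sliding_mountain M)"
proof -
  \<comment> \<open>The sphere of index \<open>j\<close> occupies \<open>n j + 1\<close>
    coordinates, so the dimension falls short of the number of coordinates by one for each sphere,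
    \<open>k\<close> in all.\<close>
  have "(UNIV :: 'i set) = (\<Union>j<k. {i. B i = j}) \<union> {i. k \<le> B i}" by (auto simp: not_less)
  then have "CARD('i) = card (\<Union>j<k. {i. B i = j}) + card {i. k \<le> B i}"
    by (subst card_Un_disjoint[symmetric]) auto
  also have "card (\<Union>j<k. {i. B i = j}) = (\<Sum>j<k. card {i. B i = j})"
    by (rule card_UN_disjoint) auto
  also have "\<dots> = (\<Sum>j<k. n j + 1)" using spheres by (intro sum.cong) auto
  finally have card: "CARD('i) = (\<Sum>j<k. n j + 1) + card {i. k \<le> B i}" .
  interpret sphere_product_dim B k r "TYPE('d)"
  proof
    show "0 < r j" "2 \<le> card {i. B i = j}" if "j < k" for j using spheres[OF that] by auto
    show "DIM('d) + k = CARD('i)" unfolding card dimension euclidean sum.distrib by simp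
  qed
  show ?thesis
    \<comment> \<open>The first claim is the second one for the identity submersion of the
      product.\<close>
    using submersion_data.nonneg_cross_curved_time_convex[OF submersion_data[OF riemannian_manifold_P riemannian_submersion_id]]
      submersion_data.nonneg_cross_curved_time_convex[OF submersion_data]
    unfolding P by blast
qed

end
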